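(* Let $n\ge 2$, let $K\subset \mathbb{R}^n$ be a compact subset, and let $B\subset \mathbb{R}^n$ be a closed ball of positive radius such that $\operatorname{fav}_{n-1}K=\operatorname{fav}_{n-1}B$. Then $\mathcal H^n (K)\le \mathcal H^n (B)$. Moreover, if $\mathcal H^n (K)=\mathcal H^n (B)$, then there is a subset $B'\subset K$ congruent to $B$ such that $\mathcal H^n(K\setminus B')=0$.
   Context: $\mathcal H^k$ denotes the $k$-dimensional Hausdorff measure, normalized so that the $k$-dimensional unit cube has $\mathcal H^k$-measure $1$. For a Borel set $K\subset\mathbb{R}^n$ and an integer $1\le k\le n$, the $k$-dimensional mean shadow area $\operatorname{fav}_k K\in[0,+\infty]$ is the average of $\mathcal H^k(\pi_V(K))$ over all $k$-dimensional linear subspaces $V\subset\mathbb{R}^n$, where $\pi_V$ is the orthogonal projection onto $V$ and the average is taken with respect to the $\mathrm{O}(n)$-invariant probability measure on the Grassmannian of $k$-dimensional linear subspaces of $\mathbb{R}^n$. *)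

theory Defs
  imports "HOL-Probability.Probability"
begin

section \<open>Hausdorff measure\<close>

text \<open>
  The Hausdorff (outer) measure without a normalizing constant, as the supremum over
  \<open>\<delta> > 0\<close> of the infima over countable covers by arbitrary sets of diameter at most \<open>\<delta>\<close>.
  Boundedness has to be required separately, since \<^const>\<open>diameter\<close> has no meaning on
  unbounded sets. Finite covers are covers padded with the empty set, which has diameter
  \<open>0\<close>; hence only \<open>k \<ge> 1\<close> is meaningful (\<open>0 ^ 0 = 1\<close>).
\<close>

definition raw_hausdorff_content :: "nat \<Rightarrow> real \<Rightarrow> 'a::euclidean_space set \<Rightarrow> ennreal" where
  "raw_hausdorff_content k \<delta> A =
     (INF C\<in>{C :: nat \<Rightarrow> 'a set. A \<subseteq> (\<Union>i. C i) \<and> (\<forall>i. bounded (C i) \<and> diameter (C i) \<le> \<delta>)}.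
        (\<Sum>i. ennreal (diameter (C i) ^ k)))"

definition raw_hausdorff :: "nat \<Rightarrow> 'a::euclidean_space set \<Rightarrow> ennreal" where
  "raw_hausdorff k A = (SUP \<delta>\<in>{0<..}. raw_hausdorff_content k \<delta> A)"

text \<open>
  A \<open>k\<close>-dimensional unit cube spanned by \<open>k\<close> of the standard basis vectors, for
  \<open>k \<le> DIM('a)\<close>. All such cubes are congruent, so the choice of basis vectors is immaterial.
\<close>

definition unit_cube :: "nat \<Rightarrow> 'a::euclidean_space set" where
  "unit_cube k = cbox 0 (\<Sum>(SOME S. S \<subseteq> Basis \<and> card S = k))"

definition hausdorff_measure :: "nat \<Rightarrow> 'a::euclidean_space set \<Rightarrow> ennreal" where
  "hausdorff_measure k A = raw_hausdorff k A / raw_hausdorff k (unit_cube k :: 'a set)"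


section \<open>Orthogonal projections and the Grassmannian\<close>

definition orth_proj :: "'a::euclidean_space set \<Rightarrow> 'a \<Rightarrow> 'a" where
  "orth_proj V x = (THE y. y \<in> V \<and> x - y \<in> V\<^sup>\<bottom>)"

lemma orth_proj_unique:
  assumes "subspace V" "y \<in> V" "x - y \<in> V\<^sup>\<bottom>" "z \<in> V" "x - z \<in> V\<^sup>\<bottom>"
  shows "y = z"
proof -
  have "y - z \<in> V"
    using assms by (simp add: subspace_diff)
  moreover have "y - z \<in> V\<^sup>\<bottom>"
    using subspace_diff[OF subspace_orthogonal_comp assms(5) assms(3)] by simp
  ultimately have "orthogonal (y - z) (y - z)"
    by (simp add: orthogonal_comp_def)
  then show ?thesis
    by (simp add: orthogonal_self)
qed

lemma orth_proj_eqI: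
  assumes "subspace V" "y \<in> V" "x - y \<in> V\<^sup>\<bottom>"
  shows "orth_proj V x = y"
  unfolding orth_proj_def using assms by (blast intro: orth_proj_unique)

lemma orth_proj_works:
  assumes "subspace V"
  shows "orth_proj V x \<in> V" "x - orth_proj V x \<in> V\<^sup>\<bottom>"
proof -
  obtain y z where "y \<in> span V" and z: "\<And>w. w \<in> span V \<Longrightarrow> orthogonal z w" and x: "x = y + z"
    using orthogonal_subspace_decomp_exists[of V x] by blast
  then have "y \<in> V"
    using assms by (metis span_eq_iff)
  moreover have "x - y \<in> V\<^sup>\<bottom>"
    using z x by (simp add: orthogonal_comp_def orthogonal_commute span_base)
  ultimately show "orth_proj V x \<in> V" "x - orth_proj V x \<in> V\<^sup>\<bottom>"
    using orth_proj_eqI[OF assms] by auto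
qed

lemma bounded_linear_orth_proj:
  assumes "subspace V"
  shows "bounded_linear (orth_proj V)"
proof -
  have "linear (orth_proj V)"
  proof (rule linearI)
    fix x y
    have "(x - orth_proj V x) + (y - orth_proj V y) \<in> V\<^sup>\<bottom>"
      by (intro subspace_add subspace_orthogonal_comp orth_proj_works assms)
    then have "(x + y) - (orth_proj V x + orth_proj V y) \<in> V\<^sup>\<bottom>"
      by (simp add: algebra_simps)
    then show "orth_proj V (x + y) = orth_proj V x + orth_proj V y"
      by (intro orth_proj_eqI subspace_add orth_proj_works assms)
  next
    fix c x
    have "c *\<^sub>R (x - orth_proj V x) \<in> V\<^sup>\<bottom>"
      by (intro subspace_scale subspace_orthogonal_comp orth_proj_works assms)
    then have "c *\<^sub>R x - c *\<^sub>R orth_proj V x \<in> V\<^sup>\<bottom>"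
      by (simp add: algebra_simps)
    then show "orth_proj V (c *\<^sub>R x) = c *\<^sub>R orth_proj V x"
      by (intro orth_proj_eqI subspace_scale orth_proj_works assms)
  qed
  then show ?thesis
    by (rule linear_linear[THEN iffD2])
qed

text \<open>
  The Grassmannian of \<open>k\<close>-dimensional linear subspaces with its Borel \<open>\<sigma>\<close>-algebra. Its topology
  is the usual one, obtained by embedding it into the normed space of linear operators via
  \<open>V \<mapsto> \<pi>\<^sub>V\<close>. Only the measurable space matters here; the measure of
  \<^const>\<open>vimage_algebra\<close> is a dummy.
\<close>

definition grassmannian_borel :: "nat \<Rightarrow> 'a::euclidean_space set measure" where
  "grassmannian_borel k =
     vimage_algebra {V. subspace V \<and> dim V = k} (\<lambda>V. Blinfun (orth_proj V)) borel"

definition invariant_grassmannian_prob :: "nat \<Rightarrow> 'a::euclidean_space set measure \<Rightarrow> bool" where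
  "invariant_grassmannian_prob k \<mu> \<longleftrightarrow>
     prob_space \<mu> \<and> sets \<mu> = sets (grassmannian_borel k) \<and>
     (\<forall>g. orthogonal_transformation g \<longrightarrow> distr \<mu> \<mu> (\<lambda>V. g ` V) = \<mu>)"

text \<open>For \<open>k \<le> DIM('a)\<close> there is exactly one such measure.\<close>

definition grassmannian_measure :: "nat \<Rightarrow> 'a::euclidean_space set measure" where
  "grassmannian_measure k = (SOME \<mu>. invariant_grassmannian_prob k \<mu>)"


section \<open>Mean shadow area and congruence\<close>

definition fav :: "nat \<Rightarrow> 'a::euclidean_space set \<Rightarrow> ennreal" where
  "fav k K = (\<integral>\<^sup>+ V. hausdorff_measure k (orth_proj V ` K) \<partial>grassmannian_measure k)"

definition congruent_sets :: "'a::euclidean_space set \<Rightarrow> 'a set \<Rightarrow> bool" where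
  "congruent_sets A B \<longleftrightarrow> (\<exists>f :: 'a \<Rightarrow> 'a. (\<forall>x y. dist (f x) (f y) = dist x y) \<and> f ` A = B)"

end

(* The mean shadow of K is the average, over random rank one projections Q onto lines, of the volume of a cylinder over the
shadow of K along Q. Let S0(p) be the average of s(Qp), with s an odd bounded increasing function applied along the line of Q;
S0 is the gradient of a convex function, its Jacobian DS is positive definite and its image is a ball. Optimal transport of the
measure det(DS) dp to Lebesgue measure on K gives a convex potential, whose subdifferential is described by the Lipschitz
functions P and X with X + P = id and X(z) in the subdifferential at P(z). The map with the components of X orthogonal to u and
s(u . P) along u is injective up to null sets and takes its values in the cylinder over the shadow in direction u. Averaging its
Jacobian determinant over u, the AM-GM inequality for the eigenvalues of DS^(1/2) slope DS^(1/2) yields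
n (mass / vol K)^(1/n) vol K <= average cylinder volume, which is sharp for balls.
In the case of equality AM-GM forces DS (1 - DX) = k DX on the preimage of K, and DX = 1 almost everywhere else, because no
volume of the cylinders may be wasted. Hence S0(P) - k X has derivative 0 or -k id almost everywhere, which makes it constant,
and X takes its values in a ball of the radius of B. *)
theory Submission
 imports Defs "HOL-Library.Diagonal_Subsequence" "HOL-Real_Asymp.Real_Asymp"
begin

text \<open>The function s is bounded so that everything stays finite: the image of S0, hence the
  mass to be transported, and the height 2 of the cylinders, whose volume is twice the shadow. The
  weight det(DS) is dictated by the extremal case: for a ball the transport map is S0 up to dilation
  and translation, and every estimate becomes sharp. Mass and shadow of the ball are both bounded
  through S0, so the mean shadow of a ball never has to be computed explicitly. The potential is
  merely convex and Lipschitz. The sum z of a point and a subgradient serves as parameter because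
  both are 1-Lipschitz in z; Rademacher's theorem then replaces second order differentiability of
  convex functions. The transport enters only as an inequality for compact sets, a form that
  survives limits of discrete problems. The obstacle in the equality case is the set where X leaves
  K, since the Monge-Ampere relation says nothing there. Strong monotonicity excludes a degenerate
  DX, and lines through X(z) that meet K would add volume to the cylinders.\<close>

abbreviation "hcontent == raw_hausdorff_content"
lemmas idr = inner_diff_right
and idl = inner_diff_left
and iar = inner_add_right
and ial = inner_add_left
and icomm = inner_commute
and cont_borel = borel_measurable_continuous_onI
and mv_assoc = matrix_vector_mul_assoc
and mv_diff = matrix_vector_mult_diff_rdistrib
and mv_add = matrix_vector_mult_add_rdistrib
and mv_scale = scaleR_matrix_vector_assoc
and mv_scaleR = matrix_vector_mult_scaleR
and neg_null = negligible_iff_null_sets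
and orth_linear = orthogonal_transformation_linear
and der_within = has_derivative_at_withinI
and sq_eq = power2_eq_square
and mcomp = measurable_compose
and alg = algebra_simps
and lip_cont = lipschitz_on_continuous_on
and orth_matrix = orthogonal_transformation_matrix
and CS_ineq = Cauchy_Schwarz_ineq2
and norm_sq = power2_norm_eq_inner

notation inner (infixl ".*" 70) and scaleR (infixr "*:" 75)

abbreviation "vol == emeasure lborel"
abbreviation "lvol == emeasure lebesgue"

section \<open>Change of variables for arbitrary finite index types\<close>

(* The change of variables theorems of HOL-Analysis require a well-ordered index type. They are
 transferred to an arbitrary finite one along a bijection with an initial segment of the
 naturals. *)
typedef ('n::finite) enumerated = "{..<CARD('n)}" by (rule exI[of _ 0]) simp

setup_lifting type_definition_enumerated

instantiation enumerated :: (finite) linorder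
begin

lift_definition less_eq_enumerated :: "'a enumerated => 'a enumerated => bool" is "(\<le>)" .
lift_definition less_enumerated :: "'a enumerated => 'a enumerated => bool" is "(<)" .

instance by standard (transfer; auto)+

end

lemma bij_betw_Rep_enumerated: "bij_betw Rep_enumerated (UNIV :: 'n::finite enumerated set) {..<CARD('n)}"
 using Rep_enumerated_inject type_definition.Rep_range[OF type_definition_enumerated] by (auto simp: bij_betw_def inj_on_def)

instance enumerated :: (finite) finite by standard (use bij_betw_finite[OF bij_betw_Rep_enumerated] in auto)

instance enumerated :: (finite) wellorder
proof
 fix P :: "'a enumerated => bool" and a :: "'a enumerated"
 assume step: "!!x. (!!y. y < x ==> P y) ==> P x"
 show "P a"
 proof (induction "Rep_enumerated a" arbitrary: a rule: less_induct)
  case less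
  show ?case by (rule step, rule less) (simp add: less_enumerated.rep_eq)
 qed
qed

lemma enumeration_exists:
 obtains \<pi> :: "'n::finite enumerated => 'n" where "bij \<pi>"
proof -
 have "card (UNIV :: 'n enumerated set) = card (UNIV :: 'n set)" using bij_betw_same_card[OF bij_betw_Rep_enumerated] by simp
 thus thesis using that finite_same_card_bij[of "UNIV :: 'n enumerated set" "UNIV :: 'n set"] by auto
qed

lemma sign_conjugate:
 fixes \<pi> :: "'m::finite => 'n::finite"
 assumes "bij \<pi>" "p permutes (UNIV :: 'm set)"
 shows "sign (\<pi> \<circ> p \<circ> inv \<pi>) = sign p" using assms(2) finite
proof (induction p rule: permutes_induct)
 case id
 thus ?case using assms(1) surj_iff[of \<pi>] by (simp add: bij_is_surj)
next
 case (swap a b p)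
 have "\<pi> \<circ> (Transposition.transpose a b \<circ> p) \<circ> inv \<pi> = Transposition.transpose (\<pi> a) (\<pi> b) \<circ> (\<pi> \<circ> p \<circ> inv \<pi>)"
  using assms(1) by (auto simp: fun_eq_iff Transposition.transpose_def bij_def inj_eq inv_f_f)
 moreover have "permutation p" using swap by (auto simp: permutation_permutes)
 moreover have "permutation (\<pi> \<circ> p \<circ> inv \<pi>)"
 proof -
  have "bij (\<pi> \<circ> p \<circ> inv \<pi>)" using swap assms(1) by (auto intro!: bij_comp bij_imp_bij_inv dest: permutes_bij)
  hence "(\<pi> \<circ> p \<circ> inv \<pi>) permutes UNIV" by (rule bij_imp_permutes) auto
  thus ?thesis by (auto simp: permutation_permutes)
 qed
 moreover have "\<pi> a ~= \<pi> b" using swap(3) assms(1) by (simp add: bij_is_inj inj_eq)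
 ultimately show ?case using swap(3) swap.IH by (simp only: sign_compose permutation_swap_id sign_swap_id if_False)
qed

lemma det_reindex:
 fixes A :: "real^'n^'n" and \<pi> :: "'m::finite => 'n"
 assumes \<pi>: "bij \<pi>"
 shows "det (\<chi> i j. A $ \<pi> i $ \<pi> j) = det A"
proof -
 have bb: "bij_betw (%p. \<pi> \<circ> p \<circ> inv \<pi>) {p. p permutes (UNIV::'m set)} {p. p permutes (UNIV::'n set)}"
 proof (rule bij_betw_byWitness[where f' = "%q. inv \<pi> \<circ> q \<circ> \<pi>"])
  show "\<forall>p\<in>{p. p permutes UNIV}. inv \<pi> \<circ> (\<pi> \<circ> p \<circ> inv \<pi>) \<circ> \<pi> = p"
   "\<forall>p\<in>{p. p permutes UNIV}. \<pi> \<circ> (inv \<pi> \<circ> p \<circ> \<pi>) \<circ> inv \<pi> = p"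
   using \<pi> by (auto simp: fun_eq_iff bij_is_inj bij_is_surj surj_f_inv_f)
  show "(%p. \<pi> \<circ> p \<circ> inv \<pi>) ` {p. p permutes UNIV} <= {p. p permutes UNIV}"
   "(%q. inv \<pi> \<circ> q \<circ> \<pi>) ` {p. p permutes UNIV} <= {p. p permutes UNIV}"
   using \<pi> by (auto intro!: bij_imp_permutes bij_comp bij_imp_bij_inv dest: permutes_bij)
 qed
 have "det A = (\<Sum>p | p permutes (UNIV::'m set). of_int (sign (\<pi> \<circ> p \<circ> inv \<pi>)) * (\<Prod>i\<in>UNIV. A $ i $ ((\<pi> \<circ> p \<circ> inv \<pi>) i)))"
  unfolding det_def by (rule sum.reindex_bij_betw[OF bb, symmetric])
 also have "... = (\<Sum>p | p permutes (UNIV::'m set). of_int (sign p) * (\<Prod>i\<in>UNIV. A $ \<pi> i $ \<pi> (p i)))"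
 proof (rule sum.cong[OF refl])
  fix p assume "p : {p. p permutes (UNIV::'m set)}"
  moreover have "(\<Prod>i\<in>UNIV. A $ i $ ((\<pi> \<circ> p \<circ> inv \<pi>) i)) = (\<Prod>i\<in>UNIV. A $ \<pi> i $ \<pi> (p i))"
   using prod.reindex_bij_betw[OF \<pi>, of "%i. A $ i $ ((\<pi> \<circ> p \<circ> inv \<pi>) i)"] \<pi> by (simp add: bij_is_inj)
  ultimately show "of_int (sign (\<pi> \<circ> p \<circ> inv \<pi>)) * (\<Prod>i\<in>UNIV. A $ i $ ((\<pi> \<circ> p \<circ> inv \<pi>) i)) = of_int (sign p) * (\<Prod>i\<in>UNIV. A $ \<pi> i $ \<pi> (p i))"
   using sign_conjugate[OF \<pi>] by simp
 qed
 also have "... = det (\<chi> i j. A $ \<pi> i $ \<pi> j)" by (simp add: det_def)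
 finally show ?thesis ..
qed

definition reindex :: "('m::finite => 'n::finite) => real^'n => real^'m" where
 "reindex \<pi> x = (\<chi> i. x $ \<pi> i)"

lemma linear_reindex: "linear (reindex \<pi>)" by (rule linearI) (simp_all add: reindex_def vec_eq_iff)

lemma reindex_reindex: "bij \<pi> ==> reindex \<pi> (reindex (inv \<pi>) x) = x" "bij \<pi> ==> reindex (inv \<pi>) (reindex \<pi> y) = y"
 by (simp_all add: reindex_def vec_eq_iff bij_is_inj bij_is_surj surj_f_inv_f)

lemma distr_reindex:
 fixes \<pi> :: "'m::finite => 'n::finite"
 assumes \<pi>: "bij \<pi>"
 shows "distr lborel borel (reindex \<pi>) = lborel"
proof (rule lborel_eqI[symmetric])
 fix l u :: "real^'m"
 assume lu: "!!b. b : Basis ==> l .* b <= u .* b"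
 have m: "reindex \<pi> : borel_measurable borel"
  using linear_reindex by (intro cont_borel linear_continuous_on) (simp add: linear_conv_bounded_linear)
 have le: "l $ i <= u $ i" for i using lu[of "axis i 1"] by (simp add: inner_axis axis_in_Basis_iff)
 have "reindex \<pi> -` box l u = box (reindex (inv \<pi>) l) (reindex (inv \<pi>) u)"
  using \<pi> by (auto simp: mem_box_cart reindex_def) (metis bij_inv_eq_iff)+
 hence "emeasure (distr lborel borel (reindex \<pi>)) (box l u) = vol (box (reindex (inv \<pi>) l) (reindex (inv \<pi>) u))"
  using m by (simp add: emeasure_distr)
 also have "... = ennreal (\<Prod>i\<in>UNIV. (u - l) $ inv \<pi> i)"
  using le by (subst emeasure_lborel_box) (auto simp: reindex_def Basis_vec_def inner_axis UNION_singleton_eq_range prod.reindex inj_on_def axis_eq_axis intro!: arg_cong[where f=ennreal])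
 also have "(\<Prod>i\<in>UNIV. (u - l) $ inv \<pi> i) = (\<Prod>i\<in>UNIV. (u - l) $ i)"
  using prod.reindex_bij_betw[OF bij_imp_bij_inv[OF \<pi>], of "%i. (u - l) $ i"] by simp
 also have "... = (\<Prod>b\<in>Basis. (u - l) .* b)"
  by (auto simp: Basis_vec_def inner_axis UNION_singleton_eq_range prod.reindex inj_on_def axis_eq_axis)
 finally show "emeasure (distr lborel borel (reindex \<pi>)) (box l u) = (\<Prod>b\<in>Basis. (u - l) .* b)" .
qed simp

text \<open>\<open>has_measure_differentiable_image\<close> speaks about images of finite measure.
  If the image has infinite measure, a finite integral would by the same equivalence make it
  \<open>lmeasurable\<close>; so both sides are infinite.\<close>

lemma
 fixes g :: "real^'n::{finite,wellorder} => real^'n::_"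
 assumes S: "S : sets lebesgue"
  and der: "!!x. x : S ==> (g has_derivative g' x) (at x within S)"
  and inj: "inj_on g S"
 shows image_sets_lebesgue_wo: "g ` S : sets lebesgue"
  and emeasure_image_wo: "lvol (g ` S) = (\<integral>\<^sup>+x. ennreal \<bar>det (matrix (g' x))\<bar> * indicator S x \<partial>lebesgue)"
proof -
 have "g differentiable_on S" using der by (auto simp: differentiable_on_def differentiable_def)
 thus sets: "g ` S : sets lebesgue" using S by (intro differentiable_image_in_sets_lebesgue) auto
 let ?D = "%x. \<bar>det (matrix (g' x))\<bar> * indicator S x"
 have meas: "?D : borel_measurable lebesgue"
 proof -
  have "(%x. \<bar>det (matrix (g' x))\<bar>) : borel_measurable (lebesgue_on S)" using borel_measurable_det_Jacobian[OF S der] by measurable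
  thus ?thesis using S by (subst (asm) borel_measurable_restrict_space_iff) (auto simp: mult.commute)
 qed
 have eq: "(\<integral>\<^sup>+x. ennreal \<bar>det (matrix (g' x))\<bar> * indicator S x \<partial>lebesgue) = (\<integral>\<^sup>+x. ennreal (?D x) \<partial>lebesgue)"
  by (intro nn_integral_cong) (auto simp: indicator_def)
 have iff: "g ` S : lmeasurable & measure lebesgue (g ` S) = m \<longleftrightarrow> integral\<^sup>N lebesgue ?D = m & 0 <= m" for m
 proof -
  have "((%x. \<bar>det (matrix (g' x))\<bar>) has_integral m) S \<longleftrightarrow> (?D has_integral m) UNIV"
   unfolding has_integral_restrict_UNIV[of S, symmetric] by (intro arg_cong[where f="%f. (f has_integral m) UNIV"]) (auto simp: fun_eq_iff)
  thus ?thesis using has_measure_differentiable_image[OF S der inj, of m] meas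
    has_integral_iff_nn_integral_lebesgue[of ?D m] by auto
 qed
 show "lvol (g ` S) = (\<integral>\<^sup>+x. ennreal \<bar>det (matrix (g' x))\<bar> * indicator S x \<partial>lebesgue)" unfolding eq
 proof (cases "lvol (g ` S) = \<infinity>")
  case False
  hence "g ` S : lmeasurable" using sets by (auto simp: fmeasurable_def less_top[symmetric])
  thus "lvol (g ` S) = (\<integral>\<^sup>+x. ennreal (?D x) \<partial>lebesgue)"
   using iff[of "measure lebesgue (g ` S)"] by (simp add: emeasure_eq_measure2)
 next
  case True
  show "lvol (g ` S) = (\<integral>\<^sup>+x. ennreal (?D x) \<partial>lebesgue)"
  proof (rule ccontr)
   assume "~ ?thesis"
   then obtain m where "0 <= m" "integral\<^sup>N lebesgue ?D = ennreal m" using True by (cases "integral\<^sup>N lebesgue ?D") auto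
   hence "g ` S : lmeasurable" using iff[of m] by simp
   thus False using True by (auto simp: fmeasurable_def)
  qed
 qed
qed

lemma completion_distr_image:
 fixes L :: "'a::euclidean_space => 'b::euclidean_space"
 assumes d: "distr lborel borel L = lborel" "distr lborel borel L' = lborel"
  and L: "L : borel_measurable borel" "L' : borel_measurable borel"
  and inv: "!!x. L' (L x) = x" "!!y. L (L' y) = y"
 shows "L : lebesgue \<rightarrow>\<^sub>M lebesgue" "distr lebesgue lebesgue L = lebesgue"
proof -
 have null: "L -` N Int space lebesgue : null_sets lebesgue" if N: "N : null_sets lebesgue" for N
 proof -
  obtain N' where N': "N' : null_sets lborel" "N <= N'" using N unfolding null_sets_completion_iff2 by auto
  from N'(1) have "N' : null_sets (distr lborel borel L)" by (simp add: d(1))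
  hence "L -` N' : null_sets lborel" using L(1) by (simp add: null_sets_distr_iff)
  thus ?thesis using N'(2) unfolding null_sets_completion_iff2 by (auto intro!: bexI[of _ "L -` N'"])
 qed
 show m: "L : lebesgue \<rightarrow>\<^sub>M lebesgue"
 proof (rule measurableI)
  fix A :: "'b set" assume "A : sets lebesgue"
  from sets_lebesgue_almost_borel[OF this]
  obtain B N where A: "A = B Un N" "B : sets borel" "N : null_sets lebesgue" unfolding neg_null by blast
  have "L -` B Int space lebesgue : sets lebesgue" using measurable_sets[OF L(1) A(2)] by simp
  thus "L -` A Int space lebesgue : sets lebesgue" using null[OF A(3)] A(1) by (auto simp: vimage_Un)
 qed auto
 show "distr lebesgue lebesgue L = lebesgue"
 proof (rule measure_eqI)
  fix A assume "A : sets (distr lebesgue lebesgue L)"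
  hence "A : sets lebesgue" by simp
  from sets_lebesgue_almost_borel[OF this]
  obtain B N where A: "A = B Un N" "B : sets borel" "N : null_sets lebesgue" unfolding neg_null by blast
  have "emeasure (distr lebesgue lebesgue L) A = lvol (L -` A)" using m \<open>A : sets lebesgue\<close> by (simp add: emeasure_distr)
  also have "... = lvol (L -` B)" using null[OF A(3)] A(1) measurable_sets[OF L(1) A(2)] by (simp add: vimage_Un emeasure_Un_null_set)
  also have "... = vol B" using A(2) L(1) d(1) measurable_sets[OF L(1) A(2)] by (subst d(1)[symmetric], subst emeasure_distr) auto
  also have "... = lvol A" using A by (simp add: emeasure_Un_null_set)
  finally show "emeasure (distr lebesgue lebesgue L) A = lvol A" .
 qed simp
qed

context
 fixes \<pi> :: "'n::finite enumerated => 'n" and L L'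
 assumes \<pi>: "bij \<pi>"
 defines "L \<equiv> reindex \<pi>" and "L' \<equiv> reindex (inv \<pi>)"
begin

lemma reindex_facts:
 "linear L" "linear L'" "bounded_linear L" "bounded_linear L'" "L' (L x) = x" "L (L' y) = y"
 "L : borel_measurable borel" "L' : borel_measurable borel" unfolding L_def L'_def
 using linear_reindex[of \<pi>] linear_reindex[of "inv \<pi>"] reindex_reindex[OF \<pi>]
 by (auto simp: linear_conv_bounded_linear intro!: cont_borel linear_continuous_on)

lemma reindex_lebesgue:
 "L : lebesgue \<rightarrow>\<^sub>M lebesgue" "distr lebesgue lebesgue L = lebesgue"
 "L' : lebesgue \<rightarrow>\<^sub>M lebesgue" "distr lebesgue lebesgue L' = lebesgue"
 using completion_distr_image[of L L'] completion_distr_image[of L' L] reindex_facts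
  distr_reindex[OF \<pi>] distr_reindex[OF bij_imp_bij_inv[OF \<pi>]] by (auto simp: L_def L'_def)

lemma reindex_image: "L ` S = L' -` S" "L' ` T = L -` T" using reindex_facts(5,6) by (auto simp: image_iff) metis+

lemma det_matrix_reindex:
 assumes "linear f"
 shows "det (matrix (L \<circ> f \<circ> L')) = det (matrix f)"
proof -
 have "L' (axis j 1) = axis (\<pi> j) 1" for j
  using \<pi> by (auto simp: L'_def reindex_def vec_eq_iff axis_def bij_is_surj surj_f_inv_f bij_is_inj)
 hence "matrix (L \<circ> f \<circ> L') = (\<chi> i j. matrix f $ \<pi> i $ \<pi> j)" by (simp add: matrix_def L_def reindex_def)
 thus ?thesis using det_reindex[OF \<pi>, of "matrix f"] by simp
qed

end

lemma
 fixes g :: "real^'n => real^'n"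
 assumes S: "S : sets lebesgue"
  and der: "!!x. x : S ==> (g has_derivative g' x) (at x within S)"
 shows borel_measurable_det_derivative:
   "(%x. ennreal \<bar>det (matrix (g' x))\<bar> * indicator S x) : borel_measurable lebesgue"
  and negligible_image_singular:
   "(!!x. x : S ==> det (matrix (g' x)) = 0) ==> negligible (g ` S)"
  and image_sets_lebesgue: "inj_on g S ==> g ` S : sets lebesgue"
  and emeasure_image: "inj_on g S ==>
   lvol (g ` S) = (\<integral>\<^sup>+x. ennreal \<bar>det (matrix (g' x))\<bar> * indicator S x \<partial>lebesgue)"
proof -
 obtain \<pi> :: "'n enumerated => 'n" where \<pi>: "bij \<pi>" by (rule enumeration_exists)
 define L where "L = reindex \<pi>"
 define L' where "L' = reindex (inv \<pi>)"
 note facts = reindex_facts[OF \<pi>, folded L_def L'_def]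
 note leb = reindex_lebesgue[OF \<pi>, folded L_def L'_def]
 note img = reindex_image[OF \<pi>, folded L_def L'_def]
 let ?h = "L \<circ> g \<circ> L'" and ?h' = "%y. L \<circ> g' (L' y) \<circ> L'"
 have S': "L ` S : sets lebesgue" using measurable_sets[OF leb(3) S] by (simp add: img)
 have der': "(?h has_derivative ?h' y) (at y within L ` S)" if "y : L ` S" for y
 proof -
  have y: "L' y : S" using that by (auto simp: facts(5))
  have "L' ` (L ` S) = S" by (simp add: image_image facts(5))
  with y show ?thesis using der[OF y] facts(3,4)
   by (intro diff_chain_within) (auto simp: image_comp[symmetric] simp del: image_comp intro: bounded_linear_imp_has_derivative)
 qed
 have him: "?h ` (L ` S) = L ` (g ` S)" using facts(5) by (auto simp: image_image)
 have "(%y. \<bar>det (matrix (?h' y))\<bar>) : borel_measurable (lebesgue_on (L ` S))"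
  using borel_measurable_det_Jacobian[OF S' der'] by measurable
 hence "(%y. \<bar>det (matrix (?h' y))\<bar> * indicator (L ` S) y) : borel_measurable lebesgue"
  using S' by (subst (asm) borel_measurable_restrict_space_iff) (auto simp: mult.commute)
 hence "(%y. ennreal (\<bar>det (matrix (?h' y))\<bar> * indicator (L ` S) y)) : borel_measurable lebesgue" by measurable
 hence m: "(%y. ennreal \<bar>det (matrix (?h' y))\<bar> * indicator (L ` S) y) : borel_measurable lebesgue"
  by (simp add: ennreal_mult'' ennreal_indicator)
 have det: "det (matrix (?h' (L x))) = det (matrix (g' x))" if "x : S" for x
 proof -
  have "linear (g' x)" using der[OF that] has_derivative_bounded_linear linear_linear by blast
  thus ?thesis using det_matrix_reindex[OF \<pi>, of "g' x"] by (simp add: L_def[symmetric] L'_def[symmetric] facts(5))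
 qed
 have eq: "ennreal \<bar>det (matrix (?h' (L x)))\<bar> * indicator (L ` S) (L x) = ennreal \<bar>det (matrix (g' x))\<bar> * indicator S x" for x
  using det[of x] by (auto simp: img facts(5) indicator_def)
 show "(%x. ennreal \<bar>det (matrix (g' x))\<bar> * indicator S x) : borel_measurable lebesgue" using mcomp[OF leb(1) m] unfolding eq .
 {
  assume "!!x. x : S ==> det (matrix (g' x)) = 0"
  hence "det (matrix (?h' y)) = 0" if "y : L ` S" for y using that det by auto
  hence "negligible (?h ` (L ` S))" by (intro baby_Sard[where f'="?h'"] der') (auto simp: det_eq_0_rank)
  hence "L ` (g ` S) : null_sets (distr lebesgue lebesgue L)" unfolding him neg_null leb .
  hence "L -` (L ` (g ` S)) Int space lebesgue : null_sets lebesgue" unfolding null_sets_distr_iff[OF leb(1)] by blast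
  moreover have "L -` (L ` (g ` S)) Int space lebesgue = g ` S"
   using inj_vimage_image_eq[OF inj_on_inverseI[of UNIV L' L], of "g ` S"] facts(5) by simp
  ultimately show "negligible (g ` S)" by (simp add: neg_null)
 }
 assume inj: "inj_on g S"
 have inj': "inj_on ?h (L ` S)" using inj facts(5) by (auto simp: inj_on_def) metis
 have "L ` (g ` S) : sets lebesgue" using image_sets_lebesgue_wo[OF S' der' inj'] unfolding him .
 from measurable_sets[OF leb(1) this] show sets: "g ` S : sets lebesgue" by (simp add: img(2)[symmetric] image_image facts(5))
 have "lvol (g ` S) = emeasure (distr lebesgue lebesgue L') (g ` S)" by (simp add: leb)
 also have "... = lvol (L ` (g ` S))"
  unfolding emeasure_distr[OF leb(3) sets] by (simp only: img(1) space_completion space_lborel space_borel Int_UNIV_right)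
 also have "... = (\<integral>\<^sup>+y. ennreal \<bar>det (matrix (?h' y))\<bar> * indicator (L ` S) y \<partial>distr lebesgue lebesgue L)"
  using emeasure_image_wo[OF S' der' inj'] unfolding him leb .
 also have "... = (\<integral>\<^sup>+x. ennreal \<bar>det (matrix (?h' (L x)))\<bar> * indicator (L ` S) (L x) \<partial>lebesgue)"
  by (rule nn_integral_distr[OF leb(1)]) (use m in auto)
 also have "... = (\<integral>\<^sup>+x. ennreal \<bar>det (matrix (g' x))\<bar> * indicator S x \<partial>lebesgue)" unfolding eq ..
 finally show "lvol (g ` S) = (\<integral>\<^sup>+x. ennreal \<bar>det (matrix (g' x))\<bar> * indicator S x \<partial>lebesgue)" .
qed

text \<open>Both sides are integrals of \<open>f\<close> against image measures on the Borel sets.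
  These measures agree on every Borel set by \<open>emeasure_image\<close>, so no approximation by
  simple functions occurs.\<close>

lemma nn_integral_image:
 fixes g :: "real^'n => real^'n"
 assumes S: "S : sets lebesgue"
  and der: "!!x. x : S ==> (g has_derivative g' x) (at x within S)"
  and inj: "inj_on g S" and f: "f : borel_measurable borel"
 shows "(\<integral>\<^sup>+y. f y * indicator (g ` S) y \<partial>lebesgue)
   = (\<integral>\<^sup>+x. f (g x) * (ennreal \<bar>det (matrix (g' x))\<bar> * indicator S x) \<partial>lebesgue)"
proof -
 let ?d = "%x. ennreal \<bar>det (matrix (g' x))\<bar> * indicator S x"
 note d = borel_measurable_det_derivative[OF S der]
 note img = image_sets_lebesgue[OF S der inj]
 \<comment> \<open>\<open>h\<close> extends \<open>g\<close> by 0 to a globally measurable map. The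
   value off \<open>S\<close> is harmless because the density vanishes there.\<close>
 define h where "h = (%x. if x : S then g x else 0)"
 have "continuous_on S g" using der by (auto simp: continuous_on_eq_continuous_within intro: has_derivative_continuous)
 hence "g : borel_measurable (lebesgue_on S)" using S by (rule continuous_imp_measurable_on_sets_lebesgue)
 hence h: "h : borel_measurable lebesgue" unfolding h_def using S by (simp add: borel_measurable_if)
 have id: "(%x. x :: real^'n) : borel_measurable lebesgue" by (rule measurable_completion) simp
 have eq: "distr (density lebesgue ?d) borel h = distr (density lebesgue (indicator (g ` S))) borel (%x. x)"
 proof (rule measure_eqI)
  fix B :: "(real^'n) set" assume "B : sets (distr (density lebesgue ?d) borel h)"
  hence B: "B : sets borel" by simp
  have T: "S Int h -` B : sets lebesgue" using measurable_sets[OF h B] S by auto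
  have im: "g ` (S Int h -` B) = g ` S Int B" by (auto simp: h_def)
  have "emeasure (distr (density lebesgue ?d) borel h) B = (\<integral>\<^sup>+x. ?d x * indicator (h -` B) x \<partial>lebesgue)"
   using B h d measurable_sets[OF h B] by (simp add: emeasure_distr emeasure_density)
  also have "... = (\<integral>\<^sup>+x. ennreal \<bar>det (matrix (g' x))\<bar> * indicator (S Int h -` B) x \<partial>lebesgue)"
   by (intro nn_integral_cong) (auto simp: indicator_def)
  also have "... = lvol (g ` S Int B)" unfolding im[symmetric]
  proof (rule emeasure_image[OF T, symmetric])
   show "(g has_derivative g' x) (at x within S Int h -` B)" if "x : S Int h -` B" for x
    using der[of x] that by (auto intro: has_derivative_subset)
   show "inj_on g (S Int h -` B)" using inj by (rule inj_on_subset) auto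
  qed
  also have "... = emeasure (distr (density lebesgue (indicator (g ` S))) borel (%x. x)) B"
  proof -
   have "(%x. x) : measurable (density lebesgue (indicator (g ` S))) borel" using id by simp
   from emeasure_distr[OF this B]
   have "emeasure (distr (density lebesgue (indicator (g ` S))) borel (%x. x)) B = emeasure (density lebesgue (indicator (g ` S))) B" by simp
   also have "... = (\<integral>\<^sup>+x. indicator (g ` S) x * indicator B x \<partial>lebesgue)"
    using B img by (intro emeasure_density) auto
   also have "... = (\<integral>\<^sup>+x. indicator (g ` S Int B) x \<partial>lebesgue)"
    by (intro nn_integral_cong) (auto simp: indicator_def)
   also have "... = lvol (g ` S Int B)" using B img by (intro nn_integral_indicator) auto
   finally show ?thesis ..
  qed
  finally show "emeasure (distr (density lebesgue ?d) borel h) B = emeasure (distr (density lebesgue (indicator (g ` S))) borel (%x. x)) B" .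
 qed simp
 have f': "f : borel_measurable lebesgue" using f by (intro measurable_completion) simp
 have "(\<integral>\<^sup>+y. f y * indicator (g ` S) y \<partial>lebesgue) = (\<integral>\<^sup>+y. f y \<partial>distr (density lebesgue (indicator (g ` S))) borel (%x. x))"
  using f f' img id by (subst nn_integral_distr) (auto simp: nn_integral_density mult.commute)
 also have "... = (\<integral>\<^sup>+x. ?d x * f (h x) \<partial>lebesgue)"
  unfolding eq[symmetric] using f h d by (subst nn_integral_distr) (auto simp: nn_integral_density)
 also have "... = (\<integral>\<^sup>+x. f (g x) * ?d x \<partial>lebesgue)"
  by (intro nn_integral_cong) (auto simp: indicator_def h_def mult.commute)
 finally show ?thesis .
qed

section \<open>Symmetric matrices\<close>

declare transpose_matrix_vector [simp del]

definition outer :: "real^'n => real^'m => real^'m^'n" where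
 "outer u v = (\<chi> i j. u $ i * v $ j)"

lemma outer_mult_vec [simp]: "outer u v *v x = (v .* x) *: u"
 by (simp add: outer_def matrix_vector_mult_def vec_eq_iff inner_vec_def sum_distrib_left sum_distrib_right mult_ac)

lemma transpose_outer [simp]: "transpose (outer u v) = outer v u" by (simp add: outer_def transpose_def vec_eq_iff)

lemma matrix_eqI: "(!!x. A *v x = B *v x) ==> A = (B :: real^'n^'m)" by (simp add: matrix_eq)

lemma inner_transpose: "(A *v x) .* y = x .* (transpose A *v y)" for A :: "real^'n^'m"
 by (metis dot_lmul_matrix icomm vector_transpose_matrix transpose_transpose)

text \<open>The matrix determinant lemma. After a rotation taking \<open>v\<close> to a multiple of
  an axis, the matrix differs from the identity in a single column, and Cramer's rule reads off the
  determinant.\<close>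

lemma det_mat1_plus_outer:
 fixes u v :: "real^'n"
 shows "det (mat 1 + outer u v) = 1 + u .* v"
proof (cases "v = 0")
 case True
 hence "outer u v = 0" by (simp add: outer_def vec_eq_iff)
 with True show ?thesis by (simp add: det_I)
next
 case False
 obtain k :: 'n where True by simp
 obtain R :: "real^'n => real^'n" where R: "orthogonal_transformation R" "R v = norm v *: axis k 1"
  by (rule orthogonal_transformation_exists[of v "norm v *: axis k 1"]) auto
 define O1 where "O1 = matrix R"
 have O1: "orthogonal_matrix O1" and R_eq: "R x = O1 *v x" for x using R(1) by (auto simp: O1_def orth_matrix matrix_works orth_linear)
 have "O1 ** (mat 1 + outer u v) ** transpose O1 = mat 1 + outer (O1 *v u) (O1 *v v)"
 proof (rule matrix_eqI)
  fix x
  have O1x: "O1 *v (transpose O1 *v x) = x" using O1 by (simp add: mv_assoc orthogonal_matrix_def)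
  have "O1 ** (mat 1 + outer u v) ** transpose O1 *v x = O1 *v ((mat 1 + outer u v) *v (transpose O1 *v x))"
   by (simp only: mv_assoc matrix_mul_assoc)
  also have "... = x + (v .* (transpose O1 *v x)) *: (O1 *v u)" by (simp add: mv_add matrix_vector_right_distrib mv_scaleR O1x)
  also have "... = (mat 1 + outer (O1 *v u) (O1 *v v)) *v x" by (simp add: mv_add inner_transpose)
  finally show "O1 ** (mat 1 + outer u v) ** transpose O1 *v x = (mat 1 + outer (O1 *v u) (O1 *v v)) *v x" .
 qed
 hence "det (O1 ** (mat 1 + outer u v) ** transpose O1) = det (mat 1 + outer (O1 *v u) (O1 *v v))" by simp
 hence "det O1 * det O1 * det (mat 1 + outer u v) = det (mat 1 + outer (O1 *v u) (O1 *v v))" by (simp add: det_mul det_transpose mult_ac)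
 moreover have "det O1 * det O1 = 1" using det_orthogonal_matrix[OF O1] by auto
 moreover have "det (mat 1 + outer (O1 *v u) (O1 *v v)) = 1 + u .* v"
 proof -
  define w where "w = norm v *: (O1 *v u) + axis k 1"
  have "mat 1 + outer (O1 *v u) (O1 *v v) = (\<chi> i j. if j = k then w $ i else mat 1 $ i $ j)" using R(2) unfolding R_eq w_def
   by (auto simp: vec_eq_iff outer_def axis_def mat_def)
  hence "det (mat 1 + outer (O1 *v u) (O1 *v v)) = w $ k"
   using cramer_lemma[of k "mat 1" w] by (simp only: matrix_vector_mul_lid det_I mult_1_right)
  also have "... = 1 + (O1 *v u) .* (O1 *v v)" using R(2) unfolding R_eq w_def by (simp add: inner_axis)
  also have "(O1 *v u) .* (O1 *v v) = u .* v" using R(1) unfolding R_eq[symmetric] by (simp add: orthogonal_transformation_def)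
  finally show ?thesis .
 qed
 ultimately show ?thesis by simp
qed

section \<open>Spectral theorem and the determinant-trace inequality for positive definite
  matrices\<close>

definition symmetric_matrix :: "real^'n^'n => bool" where
 "symmetric_matrix A \<longleftrightarrow> transpose A = A"

definition positive_matrix :: "real^'n^'n => bool" where
 "positive_matrix A \<longleftrightarrow> symmetric_matrix A & (\<forall>x. x ~= 0 --> 0 < x .* (A *v x))"

definition nonneg_matrix :: "real^'n^'n => bool" where
 "nonneg_matrix A \<longleftrightarrow> symmetric_matrix A & (\<forall>x. 0 <= x .* (A *v x))"

lemma symmetric_matrix_inner: "symmetric_matrix A ==> (A *v x) .* y = x .* (A *v y)" by (simp add: symmetric_matrix_def inner_transpose)

text \<open>Moving from \<open>x\<close> by a small multiple of \<open>- A *v x\<close> lowers the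
  quadratic form to first order unless \<open>A *v x = 0\<close>, and the form cannot become
  negative.\<close>

lemma nonneg_matrix_kernel:
 assumes A: "nonneg_matrix A" and x: "x .* (A *v x) = 0"
 shows "A *v x = 0"
proof -
 define y where "y = A *v x"
 define c where "c = y .* (A *v y)"
 have "0 <= (x - t *: y) .* (A *v (x - t *: y))" for t using A by (simp add: nonneg_matrix_def)
 moreover have "(x - t *: y) .* (A *v (x - t *: y)) = t * (t * c - 2 * (y .* y))" for t using A x symmetric_matrix_inner[of A x y]
  by (simp add: nonneg_matrix_def matrix_vector_mult_diff_distrib mv_scaleR inner_diff icomm y_def[symmetric] c_def alg)
 ultimately have *: "0 <= t * (t * c - 2 * (y .* y))" for t by metis
 have "0 <= c" using A by (simp add: nonneg_matrix_def c_def)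
 have "y .* y = 0"
 proof (rule ccontr)
  assume "y .* y ~= 0"
  hence "0 < y .* y" by simp
  \<comment> \<open>A step short enough that the linear term dominates; the \<open>+ 1\<close>
    covers the case \<open>c = 0\<close>.\<close>
  define t where "t = (y .* y) / (c + 1)"
  have "t > 0" "t * c < y .* y * 1" using \<open>0 < y .* y\<close> \<open>0 <= c\<close> by (auto simp: t_def field_simps)
  hence "t * (t * c - 2 * (y .* y)) < 0" using \<open>0 < y .* y\<close> by (intro mult_pos_neg) linarith+
  thus False using *[of t] by simp
 qed
 thus ?thesis by (simp add: y_def)
qed

text \<open>The eigenvector maximizes the quadratic form on the unit sphere of \<open>S\<close>. The
  invariant subspace \<open>S\<close> is carried along so that eigenvectors can be split off one
  after another.\<close>

lemma symmetric_eigenvector_exists: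
 fixes A :: "real^'n^'n"
 assumes A: "symmetric_matrix A" and S: "subspace S" "S ~= {0}" and inv: "!!x. x : S ==> A *v x : S"
 obtains v c where "v : S" "norm v = 1" "A *v v = c *: v"
proof -
 let ?q = "%x. x .* (A *v x)"
 have "compact (S Int sphere 0 1)" using closed_subspace[OF S(1)] by (simp add: closed_Int_compact)
 moreover have "S Int sphere 0 1 ~= {}"
 proof -
  obtain x where "x : S" "x ~= 0" using S subspace_0 by blast
  hence "x /\<^sub>R norm x : S Int sphere 0 1" using S(1) by (simp add: subspace_scale)
  thus ?thesis by blast
 qed
 moreover have "continuous_on (S Int sphere 0 1) ?q"
  by (intro continuous_on_inner continuous_on_id linear_continuous_on matrix_vector_mul_bounded_linear)
 ultimately obtain v where v': "v : S Int sphere 0 1" "\<forall>y\<in>S Int sphere 0 1. ?q y <= ?q v" using continuous_attains_sup by blast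
 hence v: "v : S" "norm v = 1" and max: "!!y. y : S ==> norm y = 1 ==> ?q y <= ?q v" by auto
 define c where "c = ?q v"
 have le: "?q y <= c * (y .* y)" if "y : S" for y
 proof (cases "y = 0")
  case False
  define u where "u = y /\<^sub>R norm y"
  have y: "y = norm y *: u" using False by (simp add: u_def)
  have u: "u : S" "norm u = 1" using False that S(1) by (auto simp: u_def subspace_scale)
  have "?q y = ?q (norm y *: u)" using y by simp
  also have "... = norm y * norm y * ?q u" by (simp add: mv_scaleR)
  also have "... <= norm y * norm y * c" unfolding c_def using max[OF u] by (rule mult_left_mono) simp
  also have "... = c * (y .* y)" by (simp add: dot_square_norm sq_eq)
  finally show ?thesis .
 qed simp
 \<comment> \<open>\<open>v\<close> minimizes \<open>c |y|\<^sup>2 - \<langle>y, A y\<rangle> >= 0\<close> on \<open>S\<close>, so the residual \<open>w\<close> vanishes.\<close>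
 define w where "w = c *: v - A *v v"
 have wS: "w : S" unfolding w_def using v inv S(1) by (simp add: subspace_diff subspace_scale)
 define d where "d = c * (w .* w) - ?q w"
 have "0 <= c * ((v - t *: w) .* (v - t *: w)) - ?q (v - t *: w)" for t
  using le[of "v - t *: w"] v wS S(1) by (simp add: subspace_diff subspace_scale)
 moreover have "c * ((v - t *: w) .* (v - t *: w)) - ?q (v - t *: w) = t * (t * d - 2 * (w .* w))" for t
 proof -
  have "v .* v = 1" using v(2) by (simp add: norm_eq_1)
  moreover have "w .* w = (c *: v - A *v v) .* w" by (simp only: w_def)
  hence "(A *v v) .* w = c * (v .* w) - w .* w" by (simp add: idl)
  moreover have "w .* (A *v v) = (A *v v) .* w" "v .* (A *v w) = (A *v v) .* w" "(A *v v) .* v = c" "v .* (A *v v) = c"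
   using symmetric_matrix_inner[OF A] by (simp_all add: icomm c_def)
  ultimately show ?thesis unfolding d_def
   apply (simp add: matrix_vector_mult_diff_distrib mv_scaleR inner_diff icomm[of w v] alg) by algebra
 qed
 ultimately have *: "0 <= t * (t * d - 2 * (w .* w))" for t by metis
 have "0 <= d" using le[OF wS] by (simp add: d_def)
 have "w = 0"
 proof (rule ccontr)
  assume "w ~= 0"
  hence "0 < w .* w" by simp
  define t where "t = (w .* w) / (d + 1)"
  have "t > 0" "t * d < w .* w * 1" using \<open>0 < w .* w\<close> \<open>0 <= d\<close> by (auto simp: t_def field_simps)
  hence "t * (t * d - 2 * (w .* w)) < 0" using \<open>0 < w .* w\<close> by (intro mult_pos_neg) linarith+
  thus False using *[of t] by simp
 qed
 thus thesis using v that[of v c] by (simp add: w_def)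
qed

lemma symmetric_eigenbasis_subspace:
 fixes A :: "real^'n^'n"
 assumes A: "symmetric_matrix A" and "subspace S" and "!!x. x : S ==> A *v x : S"
 shows "\<exists>B. B <= S & pairwise orthogonal B & (\<forall>v\<in>B. norm v = 1 & (\<exists>c. A *v v = c *: v)) & finite B & card B = dim S"
 using assms(2,3)
proof (induction "dim S" arbitrary: S)
 case 0
 thus ?case by (intro exI[of _ "{}"]) auto
next
 case (Suc k)
 hence "S ~= {0}" by auto
 from symmetric_eigenvector_exists[OF A Suc.prems(1) this Suc.prems(2)]
 obtain v c where v: "v : S" "norm v = 1" "A *v v = c *: v" by blast
 define T where "T = {x : S. orthogonal v x}"
 have T: "subspace T" using Suc.prems(1) subspace_orthogonal_to_vector[of v] unfolding T_def by (simp add: subspace_def orthogonal_clauses)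
 have dimT: "dim T = k"
 proof -
  have "span {v} <= S" using v(1) Suc.prems(1) by (simp add: span_minimal)
  from dim_subspace_orthogonal_to_vectors[OF subspace_span Suc.prems(1) this]
  have "dim {y : S. \<forall>x\<in>span {v}. orthogonal x y} + dim (span {v}) = dim S" .
  moreover have "{y : S. \<forall>x\<in>span {v}. orthogonal x y} = T" by (auto simp: T_def span_singleton orthogonal_def)
  moreover have "dim {v} = 1" using v(2) dim_eq_card_independent[of "{v}"] by auto
  ultimately show ?thesis using Suc.hyps(2) by simp
 qed
 have invT: "A *v x : T" if "x : T" for x using that Suc.prems(2) symmetric_matrix_inner[OF A, of v x] v(3)
  by (simp add: T_def orthogonal_def)
 obtain B where B: "B <= T" "pairwise orthogonal B" "\<forall>v\<in>B. norm v = 1 & (\<exists>c. A *v v = c *: v)" "finite B" "card B = dim T"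
  using Suc.hyps(1)[OF dimT[symmetric] T invT] by blast
 have "v ~: B" using B(1) v(2) by (auto simp: T_def orthogonal_self)
 thus ?case using B v dimT Suc.hyps(2) by (intro exI[of _ "insert v B"]) (auto simp: T_def pairwise_insert orthogonal_commute)
qed

theorem symmetric_matrix_diagonalization:
 fixes A :: "real^'n^'n"
 assumes A: "symmetric_matrix A"
 obtains U d where "orthogonal_matrix U" "A = transpose U ** (\<chi> i j. if i = j then d i else 0) ** U"
proof -
 obtain B where B: "pairwise orthogonal B" "\<forall>v\<in>B. norm v = 1 & (\<exists>c. A *v v = c *: v)" "finite B" "card B = CARD('n)"
  using symmetric_eigenbasis_subspace[OF A subspace_UNIV] by (auto simp: dim_UNIV)
 have "\<exists>b. bij_betw b (UNIV :: 'n set) B" by (rule finite_same_card_bij) (simp_all add: B)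
 then obtain b where b: "bij_betw b (UNIV :: 'n set) B" by blast
 have "\<exists>c. A *v b i = c *: b i" for i using B(2) bij_betwE[OF b] by blast
 then obtain d where d: "!!i. A *v b i = d i *: b i" by metis
 define U :: "real^'n^'n" where "U = (\<chi> i. b i)"
 have orth: "b i .* b j = (if i = j then 1 else 0)" for i j
 proof (cases "i = j")
  case True
  thus ?thesis using B(2) bij_betwE[OF b] by (simp add: norm_eq_1)
 next
  case False
  hence "b i ~= b j" using b by (auto simp: bij_betw_def inj_on_def)
  thus ?thesis using False B(1) bij_betwE[OF b] by (auto simp: pairwise_def orthogonal_def)
 qed
 have U: "orthogonal_matrix U" unfolding orthogonal_matrix_orthonormal_rows using orth by (auto simp: U_def row_def norm_eq_1 orthogonal_def)
 have Ui: "(U *v x) $ i = b i .* x" for x i by (simp add: U_def matrix_vector_mul_component)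
 have "A = transpose U ** (\<chi> i j. if i = j then d i else 0) ** U"
 proof -
  have *: "U ** A = (\<chi> i j. if i = j then d i else 0) ** U"
  proof (rule matrix_eqI)
   fix x
   have "(U *v (A *v x)) $ i = d i * (U *v x) $ i" for i using symmetric_matrix_inner[OF A, of "b i" x] d by (simp add: Ui)
   moreover have "((\<chi> i j. if i = j then d i else 0) *v y) $ i = d i * y $ i" for y :: "real^'n" and i
    by (simp add: matrix_vector_mult_def if_distrib if_distribR cong: if_cong)
   ultimately show "U ** A *v x = (\<chi> i j. if i = j then d i else 0) ** U *v x" by (simp add: mv_assoc[symmetric] vec_eq_iff)
  qed
  have "transpose U ** (U ** A) = A" using U by (simp add: matrix_mul_assoc orthogonal_matrix)
  thus ?thesis by (simp add: * matrix_mul_assoc)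
 qed
 thus thesis by (rule that[OF U])
qed

text \<open>The inequality of the means together with its equality case. Both come from
  \<open>ln x <= x - 1\<close>, applied to the ratios \<open>d i / m\<close>, because the numbers
  \<open>d i / m - 1\<close> add up to 0.\<close>

lemma prod_le_mean_power:
 fixes d :: "'n::finite => real"
 assumes pos: "!!i. 0 < d i"
 defines "m \<equiv> (\<Sum>i\<in>UNIV. d i) / CARD('n)"
 shows "(\<Prod>i\<in>UNIV. d i) <= m ^ CARD('n)"
  and "(\<Prod>i\<in>UNIV. d i) = m ^ CARD('n) ==> d i = m"
proof -
 have "(\<Sum>i\<in>UNIV. d i) > 0" using pos by (intro sum_pos) auto
 hence m: "m > 0" and "(\<Sum>i\<in>UNIV. d i) ~= 0" unfolding m_def by auto
 hence sum: "(\<Sum>i\<in>UNIV. d i / m - 1) = 0" by (simp add: sum_subtractf sum_divide_distrib[symmetric]) (simp add: m_def)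
 have le: "ln (d i / m) <= d i / m - 1" for i using pos m by (intro ln_le_minus_one) auto
 have ln: "ln ((\<Prod>i\<in>UNIV. d i) / m ^ CARD('n)) = (\<Sum>i\<in>UNIV. ln (d i / m))"
  using pos m by (subst ln_prod[symmetric]) (auto simp: prod_dividef less_imp_neq[symmetric])
 have P: "(\<Prod>i\<in>UNIV. d i) / m ^ CARD('n) > 0" using pos m by (auto intro!: divide_pos_pos prod_pos)
 have "(\<Sum>i\<in>UNIV. ln (d i / m)) <= 0" using sum_mono[of UNIV "%i. ln (d i / m)" "%i. d i / m - 1"] le sum by simp
 hence "(\<Prod>i\<in>UNIV. d i) / m ^ CARD('n) <= 1" using ln ln_le_zero_iff[OF P] by simp
 thus "(\<Prod>i\<in>UNIV. d i) <= m ^ CARD('n)" using m by (simp add: field_simps)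
 assume "(\<Prod>i\<in>UNIV. d i) = m ^ CARD('n)"
 hence "(\<Sum>i\<in>UNIV. ln (d i / m)) = (\<Sum>i\<in>UNIV. d i / m - 1)" using ln sum m by simp
 hence "ln (d i / m) = d i / m - 1" using sum_mono_inv[of "%i. ln (d i / m)" UNIV "%i. d i / m - 1" i] le by auto
 thus "d i = m" using ln_eq_minus_one[of "d i / m"] pos[of i] m by simp
qed

lemma trace_mult_commute: "trace (A ** B) = trace (B ** (A :: real^'n^'n))" by (rule trace_mul_sym)

definition diagonal_matrix :: "('n => real) => real^'n^'n" where
 "diagonal_matrix d = (\<chi> i j. if i = j then d i else 0)"

lemma positive_matrix_diagonalization:
 fixes C :: "real^'n^'n"
 assumes C: "positive_matrix C"
 obtains U d where "orthogonal_matrix U" "C = transpose U ** diagonal_matrix d ** U" "\<forall>i. 0 < d i"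
proof -
 obtain U d where U: "orthogonal_matrix U" and eq: "C = transpose U ** diagonal_matrix d ** U"
  using symmetric_matrix_diagonalization[of C] C unfolding positive_matrix_def diagonal_matrix_def by blast
 have UT: "U ** transpose U = mat 1" "transpose U ** U = mat 1" using U by (auto simp: orthogonal_matrix_def)
 have "0 < d i" for i
 proof -
  define w where "w = transpose U *v axis i 1"
  have Uw: "U *v w = axis i 1" unfolding w_def by (simp add: mv_assoc UT)
  have "w .* (C *v w) = w .* (transpose U *v (diagonal_matrix d *v (U *v w)))" unfolding eq by (simp only: mv_assoc matrix_mul_assoc)
  also have "... = (U *v w) .* (diagonal_matrix d *v (U *v w))" by (rule inner_transpose[symmetric])
  also have "... = d i" unfolding Uw by (simp add: matrix_vector_mult_basis column_def inner_axis' diagonal_matrix_def)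
  finally have "w .* (C *v w) = d i" .
  moreover have "w ~= 0" using Uw by auto
  ultimately show ?thesis using C by (auto simp: positive_matrix_def)
 qed
 thus thesis using that U eq by blast
qed

lemma positive_matrix_det_trace:
 fixes C :: "real^'n^'n"
 assumes C: "positive_matrix C"
 shows "0 < det C"
  and "det C <= (trace C / CARD('n)) ^ CARD('n)"
  and "det C = (trace C / CARD('n)) ^ CARD('n) ==> C = mat (trace C / CARD('n))"
  and "0 < trace C"
proof -
 obtain U d where U: "orthogonal_matrix U" and eq: "C = transpose U ** diagonal_matrix d ** U"
  and dpos': "\<forall>i. 0 < d i" by (rule positive_matrix_diagonalization[OF C])
 have dpos: "0 < d i" for i using dpos' by blast
 let ?D = "diagonal_matrix d"
 have UT: "U ** transpose U = mat 1" "transpose U ** U = mat 1" using U by (auto simp: orthogonal_matrix_def)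
 have det: "det C = (\<Prod>i\<in>UNIV. d i)"
 proof -
  have "det C = det (transpose U) * det ?D * det U" unfolding eq by (simp add: det_mul)
  also have "... = det ?D" using det_orthogonal_matrix[OF U] by (auto simp: det_transpose)
  also have "... = (\<Prod>i\<in>UNIV. d i)" by (subst det_diagonal) (auto simp: diagonal_matrix_def)
  finally show ?thesis .
 qed
 have tr: "trace C = (\<Sum>i\<in>UNIV. d i)"
 proof -
  have "trace C = trace (U ** (transpose U ** ?D))" unfolding eq by (rule trace_mult_commute)
  also have "... = trace ?D" by (simp add: matrix_mul_assoc UT)
  finally show ?thesis by (simp add: trace_def diagonal_matrix_def)
 qed
 show "0 < det C" unfolding det using dpos by (simp add: prod_pos)
 show "0 < trace C" unfolding tr using dpos by (simp add: sum_pos)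
 show "det C <= (trace C / CARD('n)) ^ CARD('n)" unfolding det tr by (rule prod_le_mean_power(1)[OF dpos])
 assume "det C = (trace C / CARD('n)) ^ CARD('n)"
 hence "d i = trace C / CARD('n)" for i unfolding det tr using prod_le_mean_power(2)[of d i, OF dpos] by simp
 hence "?D = (trace C / CARD('n)) *: mat 1" by (simp add: vec_eq_iff mat_def diagonal_matrix_def)
 hence "C = (trace C / CARD('n)) *: (transpose U ** U)" by (subst eq) (simp add: scalar_matrix_assoc matrix_scalar_ac)
 hence "C = (trace C / CARD('n)) *: mat 1" by (simp only: UT)
 thus "C = mat (trace C / CARD('n))" by (simp add: vec_eq_iff mat_def)
qed

lemma positive_matrix_sqrt:
 fixes M :: "real^'n^'n"
 assumes M: "positive_matrix M"
 obtains L :: "real^'n^'n" where "M = transpose L ** L" "invertible L"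
proof -
 obtain U d where U: "orthogonal_matrix U" and eq: "M = transpose U ** diagonal_matrix d ** U"
  and dpos: "\<forall>i. 0 < d i" by (rule positive_matrix_diagonalization[OF M])
 define L where "L = diagonal_matrix (%i. sqrt (d i)) ** U"
 have diag: "diagonal_matrix a *v x = (\<chi> i. a i * x $ i)" for a and x :: "real^'n"
  by (simp add: matrix_vector_mult_def if_distrib if_distribR diagonal_matrix_def cong: if_cong)
 have "diagonal_matrix d = diagonal_matrix (%i. sqrt (d i)) ** diagonal_matrix (%i. sqrt (d i))"
  using dpos by (intro matrix_eqI) (simp add: mv_assoc[symmetric] diag vec_eq_iff mult.assoc[symmetric] less_imp_le)
 moreover have "transpose (diagonal_matrix (%i. sqrt (d i))) = diagonal_matrix (%i. sqrt (d i))"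
  by (auto simp: diagonal_matrix_def transpose_def vec_eq_iff)
 ultimately have "M = transpose L ** L" by (simp add: eq L_def matrix_transpose_mul matrix_mul_assoc)
 moreover from this have "det L ~= 0" using positive_matrix_det_trace(1)[OF M] by (auto simp: det_mul det_transpose)
 ultimately show thesis by (intro that[of L]) (simp_all add: invertible_det_nz)
qed

text \<open>The product of two symmetric matrices need not be symmetric. With
  \<open>M = transpose L ** L\<close> the matrix \<open>L ** A ** transpose L\<close> is positive
  and has the determinant and the trace of \<open>M ** A\<close>. In the equality case it is scalar,
  and conjugating back shows the same for \<open>M ** A\<close>.\<close>

theorem det_mult_le_trace:
 fixes M A :: "real^'n^'n"
 assumes M: "positive_matrix M" and A: "positive_matrix A"
 shows "det M * det A <= (trace (M ** A) / CARD('n)) ^ CARD('n)"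
  and "det M * det A = (trace (M ** A) / CARD('n)) ^ CARD('n) ==> M ** A = mat (trace (M ** A) / CARD('n))"
proof -
 obtain L :: "real^'n^'n" where L: "M = transpose L ** L" "invertible L" using positive_matrix_sqrt[OF M] .
 define C where "C = L ** A ** transpose L"
 have "positive_matrix C" unfolding positive_matrix_def
 proof (intro conjI allI impI)
  have "transpose A = A" using A by (simp add: symmetric_matrix_def positive_matrix_def)
  thus "symmetric_matrix C" unfolding symmetric_matrix_def C_def by (simp only: matrix_transpose_mul transpose_transpose matrix_mul_assoc)
  fix x :: "real^'n" assume "x ~= 0"
  have "invertible (transpose L)" using L(2) by (simp add: transpose_invertible)
  hence "transpose L *v x ~= 0" using \<open>x ~= 0\<close> by (metis invertible_def matrix_left_invertible_ker)
  moreover have "x .* (C *v x) = x .* (transpose (transpose L) *v (A *v (transpose L *v x)))"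
   unfolding C_def by (simp only: mv_assoc matrix_mul_assoc transpose_transpose)
  hence "x .* (C *v x) = (transpose L *v x) .* (A *v (transpose L *v x))" by (simp only: inner_transpose[symmetric])
  ultimately show "0 < x .* (C *v x)" using A by (simp add: positive_matrix_def)
 qed
 note * = positive_matrix_det_trace[OF this]
 have "trace C = trace (transpose L ** (L ** A))" unfolding C_def by (rule trace_mul_sym)
 hence tr: "trace C = trace (M ** A)" by (simp only: L(1) matrix_mul_assoc)
 have det: "det C = det M * det A" by (simp add: C_def L(1) det_mul det_transpose mult_ac)
 show "det M * det A <= (trace (M ** A) / CARD('n)) ^ CARD('n)" using *(2) by (simp add: tr det)
 assume "det M * det A = (trace (M ** A) / CARD('n)) ^ CARD('n)"
 hence "C = mat (trace (M ** A) / CARD('n))" using *(3) by (simp add: tr det)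
 hence C: "C = mat k" if "k = trace (M ** A) / CARD('n)" for k using that by simp
 define k where "k = trace (M ** A) / CARD('n)"
 obtain T where T: "transpose L ** T = mat 1" using transpose_invertible[OF L(2)] unfolding invertible_def by blast
 have "M ** A = transpose L ** C ** T"
 proof -
  have "transpose L ** C ** T = M ** A ** (transpose L ** T)" unfolding C_def L(1) by (simp only: matrix_mul_assoc)
  thus ?thesis by (simp add: T)
 qed
 also have "C = k *: mat 1" using C[OF k_def] by (simp add: vec_eq_iff mat_def)
 also have "transpose L ** (k *: mat 1) ** T = k *: (transpose L ** T)"
  by (simp only: matrix_scalar_ac scalar_matrix_assoc[symmetric] matrix_mul_rid)
 finally have "M ** A = k *: mat 1" by (simp only: T)
 thus "M ** A = mat (trace (M ** A) / CARD('n))" unfolding k_def by (simp add: vec_eq_iff mat_def)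
qed

section \<open>Rademacher's theorem\<close>

declare emeasure_completion [simp del]

lemma lebesgue_lborel: "B : sets borel ==> lvol B = vol B" by (simp add: emeasure_completion)

text \<open>Let \<open>e\<close> be the outer measure of \<open>N\<close>. Covering a nearly optimal
  open set once more gives \<open>e <= \<theta> * (e + eps) + eps\<close> for every positive
  \<open>eps\<close>, hence \<open>e = 0\<close>. Arguing with outer measure makes this applicable
  to sets whose measurability is not known.\<close>

lemma negligible_outer_contraction:
 fixes N :: "'a::euclidean_space set"
 assumes "bounded N" and \<theta>: "0 <= \<theta>" "\<theta> < 1"
  and contr: "!!U. open U ==> bounded U ==> N <= U ==>
   \<exists>T\<in>sets lebesgue. N <= T & lvol T <= ennreal (\<theta> * measure lebesgue U)"
 shows "negligible N"
proof -
 obtain R where R: "N <= ball 0 R" using \<open>bounded N\<close> bounded_subset_ballD by blast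
 define \<U> where "\<U> = {U. open U & bounded U & N <= U}"
 have "ball 0 R : \<U>" using R by (simp add: \<U>_def)
 define e where "e = (INF U\<in>\<U>. measure lebesgue U)"
 have bdd: "bdd_below (measure lebesgue ` \<U>)" by (auto intro!: bdd_belowI[of _ 0])
 have e0: "0 <= e" unfolding e_def using \<open>ball 0 R : \<U>\<close> by (intro cINF_greatest) auto
 have step: "e <= \<theta> * (e + eps) + eps" if eps: "eps > 0" for eps
 proof -
  obtain U where U: "U : \<U>" "measure lebesgue U < e + eps"
   using cINF_less_iff[OF _ bdd, of "e + eps"] \<open>ball 0 R : \<U>\<close> eps by (auto simp: e_def[symmetric])
  then obtain T where T: "T : sets lebesgue" "N <= T" "lvol T <= ennreal (\<theta> * measure lebesgue U)"
   using contr[of U] by (auto simp: \<U>_def)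
  have "T Int U : sets lebesgue" using T(1) U(1) by (auto simp: \<U>_def)
  then obtain V where V: "open V" "T Int U <= V" "V - T Int U : lmeasurable" "lvol (V - T Int U) < ennreal eps"
   using sets_lebesgue_outer_open eps by blast
  have "V Int U : \<U>" using V U(1) T(2) by (auto simp: \<U>_def)
  hence "e <= measure lebesgue (V Int U)" unfolding e_def by (rule cINF_lower[OF bdd])
  also have "ennreal (measure lebesgue (V Int U)) <= ennreal (\<theta> * measure lebesgue U + eps)"
  proof -
   have "V Int U : lmeasurable" using V U(1) by (auto simp: \<U>_def intro!: lmeasurable_open)
   hence "ennreal (measure lebesgue (V Int U)) = lvol (V Int U)" by (simp add: emeasure_eq_measure2)
   also have "... <= lvol (T Un (V - T Int U))" using T(1) V(3) by (intro emeasure_mono) auto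
   also have "... <= lvol T + lvol (V - T Int U)" using T(1) V(3) by (intro emeasure_subadditive) auto
   also have "... <= ennreal (\<theta> * measure lebesgue U) + ennreal eps" using T(3) V(4) by (intro add_mono) auto
   finally show ?thesis using \<theta> eps by simp
  qed
  hence "measure lebesgue (V Int U) <= \<theta> * measure lebesgue U + eps" using \<theta> eps by (simp del: ennreal_plus)
  also have "... <= \<theta> * (e + eps) + eps" using U(2) \<theta> by (intro add_right_mono mult_left_mono) auto
  finally show ?thesis .
 qed
 have "e = 0"
 proof (rule ccontr)
  assume "e ~= 0"
  hence "e > 0" using e0 by simp
  define eps where "eps = (1 - \<theta>) * e / 4"
  have "eps > 0" using \<open>e > 0\<close> \<theta> by (simp add: eps_def)
  from step[OF this] have "(1 - \<theta>) * e <= \<theta> * eps + eps" by (simp add: alg)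
  also have "... <= 1 * eps + eps" using \<theta> \<open>eps > 0\<close> by (intro add_right_mono mult_right_mono) auto
  finally have "4 * eps <= 2 * eps" by (simp add: eps_def)
  thus False using \<open>eps > 0\<close> by simp
 qed
 show ?thesis unfolding negligible_outer_le
 proof (intro allI impI)
  fix eps :: real assume "eps > 0"
  then obtain U where "U : \<U>" "measure lebesgue U < eps"
   using cINF_less_iff[OF _ bdd, of eps] \<open>ball 0 R : \<U>\<close> \<open>e = 0\<close> by (auto simp: e_def[symmetric])
  thus "\<exists>T. N <= T & T : lmeasurable & measure lebesgue T <= eps" by (intro exI[of _ U]) (auto simp: \<U>_def lmeasurable_open)
 qed
qed

section \<open>Differentiability of Lipschitz functions of one variable\<close>

lemma real_cball_closed_segment:
 fixes s t :: real
 assumes "s < t"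
 shows "cball ((s + t) / 2) ((t - s) / 2) = {s..t}" using assms by (auto simp: cball_eq_atLeastAtMost field_simps)

lemma image_interval_strict_mono:
 fixes f :: "real => real"
 assumes "strict_mono f" "continuous_on UNIV f" "s <= t"
 shows "f ` {s..t} = {f s..f t}"
proof
 show "f ` {s..t} <= {f s..f t}" using assms by (auto simp: strict_mono_less_eq)
 show "{f s..f t} <= f ` {s..t}"
 proof
  fix y assume "y : {f s..f t}"
  then obtain x where "s <= x" "x <= t" "f x = y" using IVT'[of f s y t] assms continuous_on_subset by fastforce
  thus "y : f ` {s..t}" by auto
 qed
qed

text \<open>The short intervals of slope at most \<open>p\<close> form a Vitali cover of
  \<open>E\<close>. A disjoint subfamily has disjoint images of total length at most
  \<open>p\<close> times the measure of \<open>U\<close>, and the null set left over has a null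
  image because \<open>f\<close> is Lipschitz.\<close>

lemma strict_mono_image_slope_bound:
 fixes f :: "real => real"
 assumes mono: "strict_mono f" and lip: "C-lipschitz_on UNIV f"
  and U: "open U" "bounded U" "E <= U" and p: "p > 0"
  and slope: "!!x d. x : E ==> d > 0 ==> \<exists>s t. s < t & x : {s..t} & t - s < d & f t - f s <= p * (t - s)"
 shows "\<exists>T\<in>sets lebesgue. f ` E <= T & lvol T <= ennreal (p * measure lebesgue U)"
proof -
 have cont: "continuous_on UNIV f" using lip by (rule lip_cont)
 define K where "K = {(s, t). s < t & {s..t} <= U & f t - f s <= p * (t - s)}"
 let ?a = "%(s, t). (s + t) / 2 :: real" and ?r = "%(s, t). (t - s) / 2 :: real"
 have cb: "cball (?a i) (?r i) = {fst i..snd i}" if "i : K" for i using that by (auto simp: K_def real_cball_closed_segment)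
 have fine: "\<exists>i. i : K & x : cball (?a i) (?r i) & ?r i < d" if x: "x : E" and "d > 0" for x d
 proof -
  obtain \<delta> where \<delta>: "\<delta> > 0" "cball x \<delta> <= U" using U x by (meson open_contains_cball subsetD)
  obtain s t where st: "s < t" "x : {s..t}" "t - s < min d \<delta>" "f t - f s <= p * (t - s)"
   using slope[OF x, of "min d \<delta>"] \<open>d > 0\<close> \<delta>(1) by auto
  have "{s..t} <= cball x \<delta>" using st by (auto simp: dist_real_def)
  hence "(s, t) : K" using st \<delta> by (auto simp: K_def)
  thus ?thesis using st cb[of "(s, t)"] by (intro exI[of _ "(s, t)"]) auto
 qed
 have "0 < ?r i" if "i : K" for i using that by (auto simp: K_def)
 from this fine obtain D where D: "countable D" "D <= K"
  "pairwise (%i j. disjnt (cball (?a i) (?r i)) (cball (?a j) (?r j))) D"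
  "negligible (E - (\<Union>i\<in>D. cball (?a i) (?r i)))" by (rule Vitali_covering_theorem_cballs[of K ?r E ?a])
 define I where "I i = {fst i..snd i}" for i :: "real \<times> real"
 have eq: "(\<Union>i\<in>D. cball (?a i) (?r i)) = (\<Union>i\<in>D. I i)" unfolding I_def using cb D(2) by (intro SUP_cong) auto
 have disj: "disjoint_family_on I D" unfolding disjoint_family_on_def
 proof (intro ballI impI)
  fix i j assume ij: "i : D" "j : D" "i ~= j"
  hence "cball (?a i) (?r i) = I i" "cball (?a j) (?r j) = I j" using cb[of i] cb[of j] D(2) unfolding I_def by blast+
  thus "I i Int I j = {}" using pairwiseD[OF D(3) ij] by (simp only: disjnt_def)
 qed
 have I_sets: "I i : sets lebesgue" for i by (simp add: I_def)
 have fI: "f ` I i = {f (fst i)..f (snd i)}" if "i : D" for i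
  unfolding I_def using that D(2) by (intro image_interval_strict_mono[OF mono cont]) (auto simp: K_def)
 have disj': "disjoint_family_on (%i. f ` I i) D" unfolding disjoint_family_on_def
 proof (intro ballI impI)
  fix i j assume "i : D" "j : D" "i ~= j"
  hence "I i Int I j = {}" using disj by (auto simp: disjoint_family_on_def)
  thus "f ` I i Int f ` I j = {}" using strict_mono_imp_inj_on[OF mono, of UNIV] by (simp add: image_Int[symmetric])
 qed
 define Z where "Z = E - (\<Union>i\<in>D. I i)"
 have Z: "negligible Z" using D(4) by (simp add: Z_def eq)
 have fZ: "negligible (f ` Z)"
 proof (rule negligible_locally_Lipschitz_image[OF _ Z])
  fix x assume "x : Z"
  show "\<exists>T B. open T & x : T & (\<forall>y\<in>Z Int T. norm (f y - f x) <= B * norm (y - x))"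
   using lip by (intro exI[of _ UNIV] exI[of _ C]) (auto simp: lipschitz_on_def dist_norm)
 qed simp
 define T where "T = (\<Union>i\<in>D. f ` I i) Un f ` Z"
 have meas: "(\<Union>i\<in>D. f ` I i) : sets lebesgue" using D(1) fI by (intro sets.countable_UN') auto
 show ?thesis
 proof (intro bexI[of _ T] conjI)
  show "T : sets lebesgue" unfolding T_def using meas fZ by (auto dest: negligible_imp_sets)
  have "E <= (\<Union>i\<in>D. I i) Un Z" by (auto simp: Z_def)
  from image_mono[OF this, of f] show "f ` E <= T" by (simp only: T_def image_Un image_UN)
  have "lvol T = lvol (\<Union>i\<in>D. f ` I i)" unfolding T_def using meas fZ by (intro emeasure_Un_null_set) (auto simp: neg_null)
  also have "... = (\<integral>\<^sup>+i. lvol (f ` I i) \<partial>count_space D)" using D(1) disj' fI by (intro emeasure_UN_countable) auto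
  also have "... <= (\<integral>\<^sup>+i. ennreal p * lvol (I i) \<partial>count_space D)"
  proof (intro nn_integral_mono)
   fix i assume "i : space (count_space D)"
   hence i: "i : D" "fst i < snd i" "f (snd i) - f (fst i) <= p * (snd i - fst i)" using D(2) by (auto simp: K_def)
   have "f (fst i) <= f (snd i)" using i mono by (simp add: strict_mono_less_eq)
   thus "lvol (f ` I i) <= ennreal p * lvol (I i)" unfolding fI[OF i(1)] using i p by (simp add: I_def ennreal_mult[symmetric] lebesgue_lborel)
  qed
  also have "... = ennreal p * (\<integral>\<^sup>+i. lvol (I i) \<partial>count_space D)" by (rule nn_integral_cmult) simp
  also have "(\<integral>\<^sup>+i. lvol (I i) \<partial>count_space D) = lvol (\<Union>i\<in>D. I i)"
   using D(1) disj I_sets by (intro emeasure_UN_countable[symmetric]) auto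
  also have "... <= lvol U"
  proof (intro emeasure_mono UN_least)
   show "I i <= U" if "i : D" for i using subsetD[OF D(2) that] by (auto simp: I_def K_def)
  qed (use U(1) in auto)
  also have "... = ennreal (measure lebesgue U)" using U by (intro emeasure_eq_measure2 lmeasurable_open)
  finally show "lvol T <= ennreal (p * measure lebesgue U)" using p by (simp add: ennreal_mult mult_left_mono)
 qed
qed

lemma slope_segment_at:
 fixes f :: "real => real"
 assumes "t ~= x" "\<bar>t - x\<bar> < d" "(f t - f x) / (t - x) <= p"
 shows "\<exists>s t. s < t & x : {s..t} & t - s < d & f t - f s <= p * (t - s)"
proof (cases "x < t")
 case True
 thus ?thesis using assms by (intro exI[of _ x] exI[of _ t]) (auto simp: field_simps)
next
 case False
 hence "t < x" using assms by simp
 thus ?thesis using assms by (intro exI[of _ t] exI[of _ x]) (auto simp: field_simps)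
qed

text \<open>The slope bound is used twice: \<open>f\<close> shrinks \<open>E\<close> by the factor
  \<open>p\<close>, and the inverse function, which exists and is 1-Lipschitz by
  \<open>growth\<close>, shrinks the image by \<open>1 / q\<close>. Together the outer measure
  contracts by \<open>p / q\<close>, up to a slack that still leaves a factor below 1.\<close>

lemma negligible_Dini_gap:
 fixes f g :: "real => real"
 assumes lip: "C-lipschitz_on UNIV f" and growth: "!!s t. s <= t ==> t - s <= f t - f s"
  and pq: "0 < p" "p < q" and "bounded E"
  and low: "!!x d. x : E ==> d > 0 ==> \<exists>t. t ~= x & \<bar>t - x\<bar> < d & (f t - f x) / (t - x) <= p"
  and high: "!!x d. x : E ==> d > 0 ==> \<exists>t. t ~= x & \<bar>t - x\<bar> < d & (f t - f x) / (t - x) >= q"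
 shows "negligible E"
proof (rule negligible_outer_contraction[OF \<open>bounded E\<close>, of "(p + q) / (2 * q)"])
 show "0 <= (p + q) / (2 * q)" "(p + q) / (2 * q) < 1" using pq by (auto simp: field_simps)
 have mono: "strict_mono f" using growth by (auto intro!: strict_monoI) (metis diff_gt_0_iff_gt less_imp_le order_less_le_trans)
 have cont: "continuous_on UNIV f" using lip by (rule lip_cont)
 have "\<exists>x. f x = y" for y
 proof -
  define b where "b = \<bar>y - f 0\<bar>"
  have "f (-b) <= y" "y <= f b" using growth[of "-b" 0] growth[of 0 b] by (auto simp: b_def)
  thus ?thesis using IVT'[of f "-b" y b] continuous_on_subset[OF cont subset_UNIV, of "{-b..b}"] by (auto simp: b_def)
 qed
 then obtain g where g: "!!y. f (g y) = y" by metis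
 have gf: "g (f x) = x" for x using g mono by (metis strict_mono_eq)
 have gmono: "strict_mono g" using mono g by (auto intro!: strict_monoI) (metis strict_mono_less)
 have glip: "1-lipschitz_on UNIV g"
 proof (rule lipschitz_onI)
  fix x y
  have "\<bar>s - t\<bar> <= \<bar>f s - f t\<bar>" for s t using growth[of s t] growth[of t s] by (cases "s <= t") auto
  from this[of "g x" "g y"] show "dist (g x) (g y) <= 1 * dist x y" by (simp add: dist_real_def g)
 qed simp
 fix U assume U: "open U" "bounded U" "E <= U"
 show "\<exists>T\<in>sets lebesgue. E <= T & lvol T <= ennreal ((p + q) / (2 * q) * measure lebesgue U)"
 proof (cases "E = {}")
  case True
  thus ?thesis by (intro bexI[of _ "{}"]) auto
 next
  case False
  hence "U ~= {}" using U by auto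
  hence mU: "measure lebesgue U > 0"
   using U by (metis lmeasurable_open measure_nonneg negligible_iff_measure open_not_negligible order_le_less)
  have "\<exists>T\<in>sets lebesgue. f ` E <= T & lvol T <= ennreal (p * measure lebesgue U)"
  proof (rule strict_mono_image_slope_bound[OF mono lip U pq(1)])
   fix x d :: real assume "x : E" "d > 0"
   thus "\<exists>s t. s < t & x : {s..t} & t - s < d & f t - f s <= p * (t - s)" using low[of x d] slope_segment_at[of _ x d f p] by blast
  qed
  then obtain T where T: "T : sets lebesgue" "f ` E <= T" "lvol T <= ennreal (p * measure lebesgue U)" by blast
  have bfU: "bounded (f ` U)"
  proof (rule bounded_subset)
   show "bounded (f ` closure U)" using U(2) cont by (intro compact_imp_bounded compact_continuous_image) (auto intro: continuous_on_subset)
  qed (use closure_subset in auto)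
  \<comment> \<open>This tolerance turns \<open>p\<close> into the mean \<open>(p + q) / 2\<close>;
    dividing by \<open>q\<close> afterwards gives the announced factor.\<close>
  define eps where "eps = (q - p) / 2 * measure lebesgue U"
  have eps: "eps > 0" using mU pq by (simp add: eps_def)
  obtain R where R: "f ` U <= ball 0 R" using bfU bounded_subset_ballD by blast
  obtain V0 where V0: "open V0" "T <= V0" "V0 - T : lmeasurable" "lvol (V0 - T) < ennreal eps"
   using sets_lebesgue_outer_open[OF T(1) eps] by blast
  define V where "V = V0 Int ball 0 R"
  have V: "open V" "bounded V" "f ` E <= V" using V0 T(2) subset_trans[OF image_mono[OF U(3)] R] by (auto simp: V_def)
  have "ennreal (measure lebesgue V) = lvol V" using V by (intro emeasure_eq_measure2[symmetric] lmeasurable_open)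
  also have "... <= lvol (T Un (V0 - T))" using T(1) fmeasurableD[OF V0(3)] by (intro emeasure_mono sets.Un) (auto simp: V_def)
  also have "... <= lvol T + lvol (V0 - T)" using T(1) V0(3) by (intro emeasure_subadditive) auto
  also have "... <= ennreal (p * measure lebesgue U) + ennreal eps" using T(3) V0(4) by (intro add_mono) auto
  also have "... = ennreal ((p + q) / 2 * measure lebesgue U)"
  proof -
   have "(p + q) / 2 * measure lebesgue U = p * measure lebesgue U + eps" by (simp add: eps_def field_simps)
   thus ?thesis using pq mU eps by (simp only: ennreal_plus mult_nonneg_nonneg less_imp_le)
  qed
  finally have mV: "measure lebesgue V <= (p + q) / 2 * measure lebesgue U" using pq by simp
  have "\<exists>T'\<in>sets lebesgue. g ` (f ` E) <= T' & lvol T' <= ennreal (1 / q * measure lebesgue V)"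
  proof (rule strict_mono_image_slope_bound[OF gmono glip V])
   show "1 / q > 0" using pq by simp
   fix y d :: real assume "y : f ` E" "d > 0"
   then obtain x where x: "x : E" "y = f x" by blast
   have C: "0 <= C" "\<bar>f s - f t\<bar> <= C * \<bar>s - t\<bar>" for s t using lip by (auto simp: lipschitz_on_def dist_real_def)
   obtain t where t: "t ~= x" "\<bar>t - x\<bar> < d / (C + 1)" "(f t - f x) / (t - x) >= q"
    using high[OF x(1), of "d / (C + 1)"] \<open>d > 0\<close> C(1) by auto
   have "\<bar>f t - f x\<bar> < d"
   proof -
    have "\<bar>f t - f x\<bar> <= C * \<bar>t - x\<bar>" by (rule C)
    also have "... <= (C + 1) * \<bar>t - x\<bar>" by (intro mult_right_mono) auto
    also have "... < d" using t(2) C(1) by (simp add: field_simps)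
    finally show ?thesis .
   qed
   moreover have "f t ~= f x" using t(1) mono by (simp add: strict_mono_eq)
   moreover have "(g (f t) - g (f x)) / (f t - f x) <= 1 / q"
    using t(3) pq by (metis gf frac_le inverse_divide inverse_eq_divide less_le_trans le_imp_inverse_le order_less_trans)
   ultimately show "\<exists>s t. s < t & y : {s..t} & t - s < d & g t - g s <= 1 / q * (t - s)"
    unfolding x(2) by (intro slope_segment_at[of "f t"]) auto
  qed
  then obtain T' where T': "T' : sets lebesgue" "E <= T'" "lvol T' <= ennreal (1 / q * measure lebesgue V)" by (auto simp: image_image gf)
  moreover have "1 / q * measure lebesgue V <= (p + q) / (2 * q) * measure lebesgue U" using mV pq by (simp add: field_simps)
  ultimately show ?thesis by (meson ennreal_leI order_trans)
 qed
qed

text \<open>Adding \<open>(L + 1) * t\<close> puts all difference quotients between 1 and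
  \<open>2 * L + 1\<close>, so the function becomes strictly increasing with controlled inverse.
  Where the derivative fails to exist, two rationals separate the lower from the upper derivative,
  and \<open>negligible_Dini_gap\<close> applies to each such pair.\<close>

theorem Lipschitz_real_differentiable_AE:
 fixes g :: "real => real"
 assumes lip: "L-lipschitz_on UNIV g"
 shows "negligible {x. ~ g differentiable (at x)}"
proof -
 define f where "f = (%t. g t + (L + 1) * t)"
 have L: "0 <= L" "\<bar>g s - g t\<bar> <= L * \<bar>s - t\<bar>" for s t using lip by (auto simp: lipschitz_on_def dist_real_def)
 have growth: "t - s <= f t - f s" if "s <= t" for s t using L(2)[of s t] that by (simp add: f_def alg abs_if split: if_splits)
 have lipf: "(2 * L + 1)-lipschitz_on UNIV f"
 proof (rule lipschitz_onI)
  fix s t :: real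
  have "\<bar>f s - f t\<bar> <= \<bar>g s - g t\<bar> + \<bar>(L + 1) * (s - t)\<bar>" by (simp add: f_def alg)
  also have "... <= L * \<bar>s - t\<bar> + (L + 1) * \<bar>s - t\<bar>" using L by (intro add_mono) (auto simp: abs_mult)
  finally show "dist (f s) (f t) <= (2 * L + 1) * dist s t" by (simp add: dist_real_def alg)
 qed (use L in simp)
 define Q where "Q x t = (f t - f x) / (t - x)" for x t
 have Q: "1 <= Q x t" "Q x t <= 2 * L + 1" if "t ~= x" for x t
 proof -
  have "\<bar>f t - f x\<bar> <= (2 * L + 1) * \<bar>t - x\<bar>" using lipf by (auto simp: lipschitz_on_def dist_real_def)
  thus "1 <= Q x t" "Q x t <= 2 * L + 1" using growth[of x t] growth[of t x] that unfolding Q_def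
   by (cases "x < t"; simp add: field_simps abs_if split: if_splits; fail)+
 qed
 define E where "E p q m = {x. \<bar>x\<bar> <= real m & (\<forall>d>0. \<exists>t. t ~= x & \<bar>t - x\<bar> < d & Q x t <= p) &
   (\<forall>d>0. \<exists>t. t ~= x & \<bar>t - x\<bar> < d & Q x t >= q)}" for p q m
 have negE: "negligible (E p q m)" if "0 < p" "p < q" for p q m
 proof (rule negligible_Dini_gap[OF lipf growth that])
  show "bounded (E p q m)" by (auto simp: E_def bounded_iff)
 qed (auto simp: E_def Q_def)
 define PQ where "PQ = {(p, q). p : \<rat> & q : \<rat> & 0 < p & p < (q::real)}"
 have "countable PQ" by (rule countable_subset[of _ "\<rat> \<times> \<rat>"]) (auto simp: PQ_def countable_rat)
 hence "negligible (\<Union>(p, q)\<in>PQ. \<Union>m. E p q m)"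
  using negE by (intro negligible_countable_Union countable_image) (auto simp: PQ_def intro!: negligible_countable_Union)
 moreover have "{x. ~ g differentiable (at x)} <= (\<Union>(p, q)\<in>PQ. \<Union>m. E p q m)"
 proof (rule subsetI, rule ccontr)
  fix x assume x: "x : {x. ~ g differentiable (at x)}" and no: "x ~: (\<Union>(p, q)\<in>PQ. \<Union>m. E p q m)"
  obtain m where m: "\<bar>x\<bar> <= real m" using real_arch_simple by blast
  \<comment> \<open>The supremum \<open>c\<close> of \<open>A\<close> is the lower derivative of
    \<open>f\<close> at \<open>x\<close>.\<close>
  define A where "A = {p. \<exists>d>0. \<forall>t. t ~= x & \<bar>t - x\<bar> < d --> p <= Q x t}"
  define c where "c = Sup A"
  have "1 : A" using Q by (auto simp: A_def intro: exI[of _ 1])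
  have ub: "p <= 2 * L + 1" if pA: "p : A" for p
  proof -
   obtain d where "d > 0" "\<forall>t. t ~= x & \<bar>t - x\<bar> < d --> p <= Q x t" using pA by (auto simp: A_def)
   hence "p <= Q x (x + d / 2)" by simp
   also have "... <= 2 * L + 1" using \<open>d > 0\<close> by (intro Q) simp
   finally show ?thesis .
  qed
  hence bdd: "bdd_above A" by (auto simp: bdd_above_def)
  have "c >= 1" unfolding c_def using \<open>1 : A\<close> bdd by (rule cSup_upper)
  have "\<exists>d>0. \<forall>t. t ~= x & \<bar>t - x\<bar> < d --> \<bar>Q x t - c\<bar> < e" if "e > 0" for e
  proof -
   obtain p0 where p0: "p0 : A" "c - e < p0"
    using less_cSup_iff[OF _ bdd, of "c - e"] \<open>1 : A\<close> \<open>e > 0\<close> by (auto simp: c_def)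
   then obtain d0 where d0: "d0 > 0" "\<forall>t. t ~= x & \<bar>t - x\<bar> < d0 --> p0 <= Q x t" by (auto simp: A_def)
   \<comment> \<open>Quotients at most \<open>p\<close> occur arbitrarily close to \<open>x\<close>
     because \<open>p\<close> exceeds the supremum of \<open>A\<close>. As \<open>x\<close> lies in
     no \<open>E p q m\<close>, quotients of size \<open>q\<close> or more cannot do so as well;
     thus \<open>c + e\<close> bounds the quotients near \<open>x\<close>.\<close>
   obtain p where p: "p : \<rat>" "c < p" "p < c + e / 2" using Rats_dense_in_real[of c "c + e / 2"] \<open>e > 0\<close> by auto
   obtain q where q: "q : \<rat>" "c + e / 2 < q" "q < c + e" using Rats_dense_in_real[of "c + e / 2" "c + e"] \<open>e > 0\<close> by auto
   have "p ~: A" using cSup_upper[OF _ bdd, of p] p(2) by (auto simp: c_def)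
   hence "\<forall>d>0. \<exists>t. t ~= x & \<bar>t - x\<bar> < d & Q x t <= p" unfolding A_def by (force simp: not_le)
   moreover have "x ~: E p q m" using no p q \<open>c >= 1\<close> by (auto simp: PQ_def)
   ultimately obtain d1 where "d1 > 0" "\<forall>t. t ~= x & \<bar>t - x\<bar> < d1 --> Q x t < q" using m by (auto simp: E_def not_le)
   thus ?thesis using d0 p0 q by (intro exI[of _ "min d0 d1"]) force
  qed
  hence "(Q x \<longlongrightarrow> c) (at x)" by (auto simp: tendsto_iff eventually_at dist_real_def)
  hence "(f has_real_derivative c) (at x)" by (simp add: has_field_derivative_iff Q_def[abs_def])
  hence "((%t. f t - (L + 1) * t) has_real_derivative c - (L + 1)) (at x)" by (auto intro!: derivative_eq_intros)
  thus False using x by (auto simp: f_def real_differentiable_def)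
 qed
 ultimately show ?thesis by (rule negligible_subset)
qed

text \<open>The critical values of \<open>g\<close> and the image of \<open>N\<close> are null sets, but an interval is not.\<close>

lemma Lipschitz_zero_derivative_constant:
 fixes g :: "real => real"
 assumes lip: "L-lipschitz_on UNIV g" and N: "negligible N"
  and zero: "!!x. x ~: N ==> (g has_real_derivative 0) (at x)"
 shows "g a = g b"
proof (rule ccontr)
 assume ne: "g a ~= g b"
 have gN: "negligible (g ` N)"
 proof (rule negligible_locally_Lipschitz_image[OF _ N])
  show "\<exists>T B. open T & x : T & (\<forall>y\<in>N Int T. norm (g y - g x) <= B * norm (y - x))" for x
   using lip by (intro exI[of _ UNIV] exI[of _ L]) (auto simp: lipschitz_on_def dist_norm)
 qed simp
 \<comment> \<open>The lemma on singular values concerns maps of \<open>real^'n\<close>, so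
   \<open>g\<close> is lifted to \<open>real^1\<close>.\<close>
 let ?f = "%x :: real^1. vec (g (x $ 1)) :: real^1"
 have "negligible (vec ` N :: (real^1) set)" by (rule negligible_differentiable_image_negligible[OF _ N])
   (auto intro!: linear_imp_differentiable_on simp: linear_iff vec_eq_iff)
 hence sets: "- vec ` N : sets (lebesgue :: (real^1) measure)"
  using negligible_imp_sets by (metis sets.compl_sets space_borel space_completion space_lborel Compl_eq_Diff_UNIV)
 have "negligible (?f ` (- vec ` N))"
 proof (rule negligible_image_singular[OF sets])
  fix x :: "real^1" assume "x : - vec ` N"
  moreover have "x = vec (x $ 1)" by (simp add: vec_eq_iff)
  ultimately have "x $ 1 ~: N" by blast
  hence "(g has_derivative (%h. 0)) (at (x $ 1))" using zero by (simp add: has_field_derivative_def lambda_zero)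
  moreover have "((%x. x $ 1) has_derivative (%h. h $ 1)) (at x within - vec ` N)"
   by (intro bounded_linear_imp_has_derivative bounded_linear_vec_nth)
  ultimately have "((%x. g (x $ 1)) has_derivative (%h. 0)) (at x within - vec ` N)" using has_derivative_compose by fastforce
  hence "((%x. g (x $ 1) *: (vec 1 :: real^1)) has_derivative (%h. 0 *: vec 1)) (at x within - vec ` N)" by (rule has_derivative_scaleR_left)
  moreover have "r *: (vec 1 :: real^1) = vec r" for r by (simp add: vec_eq_iff)
  ultimately show "(?f has_derivative (%h. 0)) (at x within - vec ` N)" by simp
  show "det (matrix (%h :: real^1. 0 :: real^1)) = 0" by (simp add: matrix_def det_1)
 qed
 hence "negligible ((%x. x $ 1) ` ?f ` (- vec ` N))" by (rule negligible_differentiable_image_negligible[rotated])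
   (auto intro!: linear_imp_differentiable_on bounded_linear.linear bounded_linear_vec_nth)
 moreover have "range g <= (%x. x $ 1) ` ?f ` (- vec ` N) Un g ` N"
 proof (rule image_subsetI)
  fix t show "g t : (%x. x $ 1) ` ?f ` (- vec ` N) Un g ` N"
  proof (cases "t : N")
   case False
   hence "(vec t :: real^1) : - vec ` N" by (auto simp: vec_eq_iff)
   hence "(?f (vec t)) $ 1 : (%x. x $ 1) ` ?f ` (- vec ` N)" by (intro imageI)
   thus ?thesis by simp
  qed simp
 qed
 ultimately have "negligible (range g)" using gN by (meson negligible_Un negligible_subset)
 moreover have "connected (range g)" by (intro connected_continuous_image connected_UNIV lip_cont[OF lip])
 hence "{min (g a) (g b)<..<max (g a) (g b)} <= range g" by (intro connected_contains_Ioo) (auto simp: min_def max_def)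
 ultimately have "negligible {min (g a) (g b)<..<max (g a) (g b)}" by (rule negligible_subset)
 thus False using open_not_negligible[of "{min (g a) (g b)<..<max (g a) (g b)}"] ne by (auto simp: min_def max_def split: if_splits)
qed

text \<open>The volume of \<open>N\<close> equals its average over the translates by
  \<open>s *: v\<close> with \<open>s\<close> in the unit interval. Exchanging the integrals leaves
  the null sections along \<open>v\<close>; no coordinates adapted to \<open>v\<close> have to be
  introduced.\<close>

lemma negligible_if_lines_negligible:
 fixes N :: "'a::euclidean_space set"
 assumes N: "N : sets borel" and lines: "!!z. negligible {s. z + s *: v : N}"
 shows "negligible N"
proof -
 note N [measurable]
 have "vol N = (\<integral>\<^sup>+s. indicator {0..1::real} s * vol N \<partial>lborel)" by (simp add: nn_integral_multc)
 also have "... = (\<integral>\<^sup>+s. (\<integral>\<^sup>+z. indicator {0..1} s * indicator N (z + s *: v) \<partial>lborel) \<partial>lborel)"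
 proof (intro nn_integral_cong)
  fix s :: real
  have "vol N = (\<integral>\<^sup>+z. indicator N z \<partial>lborel)" using N by simp
  also have "... = (\<integral>\<^sup>+z. indicator N z \<partial>distr lborel borel ((+) (s *: v)))" by (simp add: lborel_distr_plus)
  also have "... = (\<integral>\<^sup>+z. indicator N (z + s *: v) \<partial>lborel)"
   using N by (subst nn_integral_distr) (auto simp: add.commute)
  finally show "indicator {0..1::real} s * vol N = (\<integral>\<^sup>+z. indicator {0..1} s * indicator N (z + s *: v) \<partial>lborel)"
   using N by (simp add: nn_integral_cmult)
 qed
 also have "... = (\<integral>\<^sup>+z. (\<integral>\<^sup>+s. indicator {0..1} s * indicator N (z + s *: v) \<partial>lborel) \<partial>lborel)"
 proof (rule lborel_pair.Fubini')
  have "(%p. fst p + snd p *: v) : borel_measurable (borel \<Otimes>\<^sub>M borel)"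
   unfolding borel_prod by (intro cont_borel continuous_intros)
  from mcomp[OF this borel_measurable_indicator[OF N]]
  have "(%p. indicator N (fst p + snd p *: v) :: ennreal) : borel_measurable (borel \<Otimes>\<^sub>M borel)" .
  moreover have "(%p. indicator {0..1::real} (snd p) :: ennreal) : borel_measurable ((borel :: 'a measure) \<Otimes>\<^sub>M borel)"
   by (intro mcomp[OF measurable_snd] borel_measurable_indicator) simp
  ultimately have "(%p. indicator {0..1::real} (snd p) * indicator N (fst p + snd p *: v) :: ennreal) : borel_measurable (borel \<Otimes>\<^sub>M borel)"
   by (rule borel_measurable_times_ennreal[rotated])
  thus "(%(z, s). indicator {0..1::real} s * indicator N (z + s *: v) :: ennreal) : borel_measurable (lborel \<Otimes>\<^sub>M lborel)"
   by (simp add: split_beta' measurable_cong_sets[OF sets_pair_measure_cong[OF sets_lborel sets_lborel] refl])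
 qed
 also have "... = (\<integral>\<^sup>+z. 0 \<partial>(lborel :: 'a measure))"
 proof (intro nn_integral_cong)
  fix z
  have "{s. z + s *: v : N} : null_sets lborel" using lines[of z] N by (auto simp: neg_null null_sets_def lebesgue_lborel)
  hence "AE s in lborel. s ~: {s. z + s *: v : N}" by (rule AE_not_in)
  hence "(\<integral>\<^sup>+s. indicator {0..1} s * indicator N (z + s *: v) \<partial>lborel) = (\<integral>\<^sup>+s. 0 \<partial>(lborel::real measure))"
   by (intro nn_integral_cong_AE) (auto elim!: eventually_mono)
  thus "(\<integral>\<^sup>+s. indicator {0..1} s * indicator N (z + s *: v) \<partial>lborel) = 0" by simp
 qed
 finally show ?thesis using N by (simp add: neg_null null_sets_def lebesgue_lborel)
qed

text \<open>Around a point of \<open>N\<close>, the ball of radius \<open>2 * dist y z\<close>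
  contains a hole of radius \<open>eps * dist y z\<close>, which is the fraction
  \<open>(eps / 2) ^ DIM('a)\<close> of its volume. Removing the holes from a disjoint Vitali family
  of such balls contracts the outer measure.\<close>

lemma negligible_porous_bounded:
 fixes E :: "'a::euclidean_space set"
 assumes eps: "0 < eps" "eps <= 1" and "bounded N" "N <= E"
  and porous: "!!z r. z : N ==> r > 0 ==> \<exists>y. dist y z < r & ball y (eps * dist y z) Int E = {} & y ~= z"
 shows "negligible N"
proof (rule negligible_outer_contraction[OF \<open>bounded N\<close>, of "1 - (eps / 2) ^ DIM('a)"])
 have "(eps / 2) ^ DIM('a) <= 1" using eps by (intro power_le_one) auto
 moreover have "0 < (eps / 2) ^ DIM('a)" using eps by simp
 ultimately show "0 <= 1 - (eps / 2) ^ DIM('a)" "1 - (eps / 2) ^ DIM('a) < 1" by simp_all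
 note \<theta>0 = this(1)
 fix U :: "'a set" assume U: "open U" "bounded U" "N <= U"
 define K where "K = {(z, y). z : N & y ~= z & cball z (2 * dist y z) <= U & ball y (eps * dist y z) Int E = {}}"
 let ?r = "%i. 2 * dist (snd i) (fst i)"
 have fine: "\<exists>i. i : K & z : cball (fst i) (?r i) & ?r i < d" if z: "z : N" and "d > 0" for z d
 proof -
  obtain \<delta> where \<delta>: "\<delta> > 0" "cball z \<delta> <= U" using U z by (meson open_contains_cball subsetD)
  obtain y where y: "dist y z < min (d / 2) (\<delta> / 2)" "ball y (eps * dist y z) Int E = {}" "y ~= z"
   using porous[OF z, of "min (d / 2) (\<delta> / 2)"] \<open>d > 0\<close> \<delta>(1) by auto
  have "cball z (2 * dist y z) <= U" using y(1) \<delta>(2) by (auto intro: subset_trans[OF subset_cball])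
  thus ?thesis using y z by (intro exI[of _ "(z, y)"]) (auto simp: K_def)
 qed
 have "0 < ?r i" if "i : K" for i using that by (auto simp: K_def)
 from this fine obtain D where D: "countable D" "D <= K"
  "pairwise (%i j. disjnt (cball (fst i) (?r i)) (cball (fst j) (?r j))) D"
  "negligible (N - (\<Union>i\<in>D. cball (fst i) (?r i)))" by (rule Vitali_covering_theorem_cballs[of K ?r N fst])
 define I where "I i = cball (fst i) (?r i)" for i :: "'a \<times> 'a"
 define H where "H i = I i - ball (snd i) (eps * dist (snd i) (fst i))" for i :: "'a \<times> 'a"
 have sets: "I i : sets lebesgue" "H i : sets lebesgue" for i by (auto simp: I_def H_def)
 have disj: "disjoint_family_on I D" unfolding disjoint_family_on_def
 proof (intro ballI impI)
  fix i j assume ij: "i : D" "j : D" "i ~= j"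
  show "I i Int I j = {}" using pairwiseD[OF D(3) ij] by (simp only: disjnt_def I_def)
 qed
 have disj': "disjoint_family_on H D" unfolding disjoint_family_on_def
 proof (intro ballI impI)
  fix i j assume "i : D" "j : D" "i ~= j"
  hence "I i Int I j = {}" using disj by (auto simp: disjoint_family_on_def)
  thus "H i Int H j = {}" by (auto simp: H_def)
 qed
 define Z where "Z = N - (\<Union>i\<in>D. I i)"
 have Z: "negligible Z" using D(4) by (simp add: Z_def I_def)
 have meas: "(\<Union>i\<in>D. H i) : sets lebesgue" using D(1) sets by (intro sets.countable_UN') auto
 define \<theta> where "\<theta> = 1 - (eps / 2) ^ DIM('a)"
 have HI: "lvol (H i) <= ennreal \<theta> * lvol (I i)" if "i : D" for i
 proof -
  let ?d = "dist (snd i) (fst i)"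
  have d: "?d > 0" using that D(2) by (auto simp: K_def)
  have sub: "ball (snd i) (eps * ?d) <= I i"
  proof
   fix x assume "x : ball (snd i) (eps * ?d)"
   hence "dist (snd i) x < eps * ?d" by simp
   also have "... <= 1 * ?d" using eps by (intro mult_right_mono) auto
   finally have "dist (fst i) x < 2 * ?d" using dist_triangle[of "fst i" x "snd i"] by (simp add: dist_commute)
   thus "x : I i" by (simp add: I_def)
  qed
  let ?c = "unit_ball_vol (real DIM('a))"
  have "lvol (H i) = lvol (I i) - lvol (ball (snd i) (eps * ?d))"
   unfolding H_def using sub by (intro emeasure_Diff) (auto simp: I_def lebesgue_lborel emeasure_ball d less_imp_le eps)
  also have "... = ennreal (?c * (2 * ?d) ^ DIM('a)) - ennreal (?c * (eps * ?d) ^ DIM('a))"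
   using d eps by (simp add: I_def lebesgue_lborel emeasure_ball emeasure_cball less_imp_le)
  also have "... = ennreal (?c * (2 * ?d) ^ DIM('a) - ?c * (eps * ?d) ^ DIM('a))" using d eps by (intro ennreal_minus) auto
  also have "?c * (2 * ?d) ^ DIM('a) - ?c * (eps * ?d) ^ DIM('a) = \<theta> * (?c * (2 * ?d) ^ DIM('a))"
   by (simp add: \<theta>_def power_mult_distrib power_divide field_simps)
  also have "ennreal ... = ennreal \<theta> * lvol (I i)"
   using d \<theta>0 by (simp add: \<theta>_def I_def lebesgue_lborel emeasure_cball ennreal_mult)
  finally show ?thesis by simp
 qed
 show "\<exists>T\<in>sets lebesgue. N <= T & lvol T <= ennreal ((1 - (eps / 2) ^ DIM('a)) * measure lebesgue U)"
  unfolding \<theta>_def[symmetric]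
 proof (intro bexI[of _ "(\<Union>i\<in>D. H i) Un Z"] conjI)
  show "(\<Union>i\<in>D. H i) Un Z : sets lebesgue" using meas negligible_imp_sets[OF Z] by (rule sets.Un)
  show "N <= (\<Union>i\<in>D. H i) Un Z"
  proof
   fix x assume "x : N"
   show "x : (\<Union>i\<in>D. H i) Un Z"
   proof (cases "x : Z")
    case False
    then obtain i where "i : D" "x : I i" using \<open>x : N\<close> by (auto simp: Z_def)
    moreover have "x ~: ball (snd i) (eps * dist (snd i) (fst i))"
     using subsetD[OF D(2) \<open>i : D\<close>] \<open>x : N\<close> \<open>N <= E\<close> by (auto simp: K_def)
    ultimately show ?thesis by (auto simp: H_def)
   qed simp
  qed
  have "lvol ((\<Union>i\<in>D. H i) Un Z) = lvol (\<Union>i\<in>D. H i)" using meas Z by (intro emeasure_Un_null_set) (auto simp: neg_null)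
  also have "... = (\<integral>\<^sup>+i. lvol (H i) \<partial>count_space D)" using D(1) disj' sets by (intro emeasure_UN_countable) auto
  also have "... <= (\<integral>\<^sup>+i. ennreal \<theta> * lvol (I i) \<partial>count_space D)" using HI by (intro nn_integral_mono) auto
  also have "... = ennreal \<theta> * (\<integral>\<^sup>+i. lvol (I i) \<partial>count_space D)" by (rule nn_integral_cmult) simp
  also have "(\<integral>\<^sup>+i. lvol (I i) \<partial>count_space D) = lvol (\<Union>i\<in>D. I i)"
   using D(1) disj sets by (intro emeasure_UN_countable[symmetric]) auto
  also have "... <= lvol U"
  proof (intro emeasure_mono UN_least)
   show "I i <= U" if "i : D" for i using subsetD[OF D(2) that] by (auto simp: I_def K_def)
  qed (use U(1) in auto)
  also have "... = ennreal (measure lebesgue U)" using U by (intro emeasure_eq_measure2 lmeasurable_open)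
  finally show "lvol ((\<Union>i\<in>D. H i) Un Z) <= ennreal (\<theta> * measure lebesgue U)"
   using \<theta>0 by (simp add: ennreal_mult mult_left_mono \<theta>_def)
 qed
qed

text \<open>A substitute for density points: at every other point of \<open>E\<close>, each
  sufficiently close \<open>y\<close> has a point of \<open>E\<close> within
  \<open>eps * dist y z\<close>.\<close>

lemma negligible_porous_points:
 fixes E :: "'a::euclidean_space set"
 assumes eps: "0 < eps" "eps <= 1"
 shows "negligible {z\<in>E. \<forall>r>0. \<exists>y. dist y z < r & (\<forall>b\<in>E. eps * dist y z < dist y b)}"
  (is "negligible ?N")
proof -
 have "negligible (?N Int ball 0 (real k))" for k
 proof (rule negligible_porous_bounded[OF eps, of _ E])
  fix z r assume z: "z : ?N Int ball 0 (real k)" and "(r::real) > 0"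
  then obtain y where y: "dist y z < r" "\<forall>b\<in>E. eps * dist y z < dist y b" by blast
  hence "y ~= z" using z by auto
  thus "\<exists>y. dist y z < r & ball y (eps * dist y z) Int E = {} & y ~= z"
   using y by (intro exI[of _ y]) (meson disjoint_iff less_asym mem_ball)
 qed auto
 hence "negligible (\<Union>k. ?N Int ball 0 (real k))" by (intro negligible_countable_Union) auto
 moreover have "?N <= (\<Union>k. ?N Int ball 0 (real k))" using reals_Archimedean2 by fastforce
 ultimately show ?thesis by (rule negligible_subset)
qed

text \<open>The approximate gradients for tolerances tending to 0 stay in a fixed ball; any limit
  point of them is the gradient.\<close>

lemma derivative_from_approximations:
 fixes g :: "'a::euclidean_space => real"
 assumes approx: "!!e. e > 0 ==> \<exists>q r. 0 < r & norm q <= B & (\<forall>h. norm h < r --> \<bar>g (z + h) - g z - q .* h\<bar> <= e * norm h)"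
 shows "\<exists>q. (g has_derivative (%h. q .* h)) (at z)"
proof -
 obtain q r where qr: "!!k::nat. 0 < r k" "!!k. norm (q k) <= B"
  "!!k h. norm h < r k ==> \<bar>g (z + h) - g z - q k .* h\<bar> <= inverse (real (Suc k)) * norm h"
  using approx[of "inverse (real (Suc _))"] by (metis inverse_positive_iff_positive of_nat_0_less_iff zero_less_Suc)
 have "compact (cball 0 B :: 'a set)" "\<forall>k. q k : cball 0 B" using qr(2) by auto
 then obtain p \<sigma> where p: "strict_mono (\<sigma> :: nat => nat)" "(q \<circ> \<sigma>) \<longlonglongrightarrow> p"
  by (meson compact_def)
 have "(g has_derivative (%h. p .* h)) (at z)" unfolding has_derivative_at_alt
 proof (intro conjI allI impI)
  show "bounded_linear (%h. p .* h)" by (rule bounded_linear_inner_right)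
  fix e :: real assume "e > 0"
  obtain k1 where k1: "!!k. k >= k1 ==> dist ((q \<circ> \<sigma>) k) p < e / 2"
   using p(2) \<open>e > 0\<close> by (meson half_gt_zero lim_sequentially)
  obtain k2 where k2: "inverse (real (Suc k2)) < e / 2" using reals_Archimedean[of "e / 2"] \<open>e > 0\<close> by auto
  define k where "k = max k1 k2"
  have "k2 <= \<sigma> k" using seq_suble[OF p(1), of k] by (simp add: k_def)
  hence s2: "inverse (real (Suc (\<sigma> k))) <= e / 2"
   using k2 by (smt (verit) inverse_le_iff_le of_nat_0_less_iff of_nat_le_iff Suc_le_mono zero_less_Suc)
  show "\<exists>d>0. \<forall>y. norm (y - z) < d --> norm (g y - g z - p .* (y - z)) <= e * norm (y - z)"
  proof (intro exI[of _ "r (\<sigma> k)"] conjI allI impI qr(1))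
   fix y assume y: "norm (y - z) < r (\<sigma> k)"
   have "\<bar>g y - g z - p .* (y - z)\<bar> <= \<bar>g y - g z - q (\<sigma> k) .* (y - z)\<bar> + \<bar>(q (\<sigma> k) - p) .* (y - z)\<bar>"
    by (simp add: idl)
   also have "... <= e / 2 * norm (y - z) + e / 2 * norm (y - z)"
   proof (rule add_mono)
    have "\<bar>g y - g z - q (\<sigma> k) .* (y - z)\<bar> <= inverse (real (Suc (\<sigma> k))) * norm (y - z)" using qr(3)[OF y] by simp
    also have "... <= e / 2 * norm (y - z)" using s2 by (rule mult_right_mono) simp
    finally show "\<bar>g y - g z - q (\<sigma> k) .* (y - z)\<bar> <= e / 2 * norm (y - z)" .
    have "\<bar>(q (\<sigma> k) - p) .* (y - z)\<bar> <= norm (q (\<sigma> k) - p) * norm (y - z)" by (rule CS_ineq)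
    also have "... <= e / 2 * norm (y - z)" using k1[of k] by (intro mult_right_mono) (auto simp: k_def dist_norm)
    finally show "\<bar>(q (\<sigma> k) - p) .* (y - z)\<bar> <= e / 2 * norm (y - z)" .
   qed
   finally show "norm (g y - g z - p .* (y - z)) <= e * norm (y - z)" by simp
  qed
 qed
 thus ?thesis by blast
qed

text \<open>On the closed set \<open>C i eps q m\<close> the quotients in direction \<open>i\<close>
  are within \<open>eps\<close> of \<open>q\<close> at all scales below \<open>1 / (m + 1)\<close>.
  By the one-dimensional theorem on lines, rational \<open>q\<close> and all \<open>m\<close>
  together give almost every point. At a nonporous point of an intersection over all
  \<open>i\<close>, an increment is split into its coordinates, and every intermediate corner is
  replaced by a nearby point of the same set, where the directional slope is under control.\<close>

theorem Rademacher_real: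
 fixes g :: "real^'n => real"
 assumes lip: "L-lipschitz_on UNIV g"
 shows "negligible {z. ~ g differentiable (at z)}"
proof -
 have L: "0 <= L" "\<bar>g x - g y\<bar> <= L * norm (x - y)" for x y using lip by (auto simp: lipschitz_on_def dist_real_def dist_norm)
 have cont: "continuous_on UNIV g" using lip by (rule lip_cont)
 define e where "e i = (axis i 1 :: real^'n)" for i
 define C where "C i eps q m = {z. \<forall>t. \<bar>t\<bar> < inverse (real (Suc m)) --> \<bar>g (z + t *: e i) - g z - q * t\<bar> <= eps * \<bar>t\<bar>}" for i eps q m
 have closedC: "closed (C i eps q m)" for i eps q m
 proof -
  have "C i eps q m = (\<Inter>t\<in>{t. \<bar>t\<bar> < inverse (real (Suc m))}. {z. \<bar>g (z + t *: e i) - g z - q * t\<bar> <= eps * \<bar>t\<bar>})"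
   by (auto simp: C_def)
  also have "closed ..." by (intro closed_INT ballI closed_Collect_le continuous_intros continuous_on_compose2[OF cont]) auto
  finally show ?thesis .
 qed
 have negC: "negligible (- (\<Union>q\<in>\<rat>. \<Union>m. C i eps q m))" if "eps > 0" for i eps
 proof (rule negligible_if_lines_negligible[where v="e i"])
  show "- (\<Union>q\<in>\<rat>. \<Union>m. C i eps q m) : sets borel"
   using closedC by (intro borel_comp sets.countable_UN' countable_rat) auto
  fix z
  define h where "h = (%s. g (z + s *: e i))"
  have "L-lipschitz_on UNIV h"
  proof (rule lipschitz_onI)
   fix s t :: real
   show "dist (h s) (h t) <= L * dist s t" using L(2)[of "z + s *: e i" "z + t *: e i"]
    by (simp add: h_def dist_real_def scaleR_diff_left[symmetric] e_def)
  qed (rule L)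
  hence "negligible {s. ~ h differentiable (at s)}" by (rule Lipschitz_real_differentiable_AE)
  moreover have "{s. z + s *: e i : - (\<Union>q\<in>\<rat>. \<Union>m. C i eps q m)} <= {s. ~ h differentiable (at s)}"
  proof (rule subsetI, rule ccontr)
   fix s assume s: "s : {s. z + s *: e i : - (\<Union>q\<in>\<rat>. \<Union>m. C i eps q m)}"
    and "s ~: {s. ~ h differentiable (at s)}"
   then obtain c where "(h has_real_derivative c) (at s)" by (auto simp: real_differentiable_def)
   hence "(h has_derivative (%t. c * t)) (at s)" by (simp add: has_field_derivative_def mult_commute_abs)
   then obtain d where d: "d > 0" "!!y. norm (y - s) < d ==> norm (h y - h s - c * (y - s)) <= eps / 2 * norm (y - s)"
    using \<open>eps > 0\<close> unfolding has_derivative_at_alt by (meson half_gt_zero)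
   obtain q where q: "q : \<rat>" "c < q" "q < c + eps / 2"
    using Rats_dense_in_real[of c "c + eps / 2"] \<open>eps > 0\<close> by auto
   obtain m where m: "inverse (real (Suc m)) < d" using reals_Archimedean[OF d(1)] by auto
   have "z + s *: e i : C i eps q m" unfolding C_def mem_Collect_eq
   proof (intro allI impI)
    fix t assume "\<bar>t\<bar> < inverse (real (Suc m))"
    hence "\<bar>h (s + t) - h s - c * t\<bar> <= eps / 2 * \<bar>t\<bar>" using d(2)[of "s + t"] m by simp
    moreover have "\<bar>(q - c) * t\<bar> <= eps / 2 * \<bar>t\<bar>" unfolding abs_mult using q by (intro mult_right_mono) auto
    moreover have "h (s + t) = g (z + s *: e i + t *: e i)" "h s = g (z + s *: e i)" by (simp_all add: h_def scaleR_add_left add.assoc)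
    moreover have "(h (s + t) - h s - c * t) - (q - c) * t = h (s + t) - h s - q * t" by (simp add: alg)
    ultimately show "\<bar>g (z + s *: e i + t *: e i) - g (z + s *: e i) - q * t\<bar> <= eps * \<bar>t\<bar>"
     using abs_triangle_ineq4[of "h (s + t) - h s - c * t" "(q - c) * t"] by linarith
   qed
   thus False using s q(1) by auto
  qed
  ultimately show "negligible {s. z + s *: e i : - (\<Union>q\<in>\<rat>. \<Union>m. C i eps q m)}" by (rule negligible_subset)
 qed
 define E where "E eps q m = (\<Inter>i. C i eps (real_of_rat (q i)) m)" for eps and q :: "'n => rat" and m
 define Bad where "Bad eps q m = {z\<in>E eps q m. \<forall>r>0. \<exists>y. dist y z < r & (\<forall>b\<in>E eps q m. eps * dist y z < dist y b)}" for eps q m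
 have negBad: "negligible (Bad eps q m)" if "0 < eps" "eps <= 1" for eps q m
  unfolding Bad_def by (rule negligible_porous_points[OF that])
 define G where "G i eps = - (\<Union>q\<in>\<rat>. \<Union>m. C i eps q m)" for i eps
 define N where "N = (\<Union>k. \<Union>i. G i (inverse (real (Suc k)))) \<union>
  (\<Union>k. \<Union>q. \<Union>m. Bad (inverse (real (Suc k))) q m)"
 have "negligible (G i (inverse (real (Suc k))))" for i k unfolding G_def by (rule negC) simp
 moreover have "negligible (Bad (inverse (real (Suc k))) q m)" for k q m by (rule negBad) (auto simp: inverse_le_1_iff)
 ultimately have "negligible N"
  unfolding N_def by (intro negligible_Un negligible_countable_Union countable_image) (auto intro!: negligible_countable_Union)
 moreover have "{z. ~ g differentiable (at z)} <= N"
 proof (rule subsetI, rule ccontr)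
  fix z assume "z : {z. ~ g differentiable (at z)}" and z: "z ~: N"
  have "\<exists>q. (g has_derivative (%h. q .* h)) (at z)"
  proof (rule derivative_from_approximations)
   fix e0 :: real assume "e0 > 0"
   \<comment> \<open>One coordinate step costs \<open>eps\<close> for the slope at the replacement
     point and twice \<open>L * eps\<close> for moving there and back; \<open>c\<close> adds this up
     over all coordinates.\<close>
   define c where "c = real CARD('n) * (2 * L + 1)"
   have "c >= 1" using L(1) mult_mono[of 1 "real CARD('n)" 1 "2 * L + 1"] by (simp add: c_def)
   obtain k where k: "inverse (real (Suc k)) < e0 / c" using reals_Archimedean[of "e0 / c"] \<open>e0 > 0\<close> \<open>c >= 1\<close> by auto
   define eps where "eps = inverse (real (Suc k))"
   have eps: "eps > 0" "eps <= 1" "c * eps <= e0"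
    using k \<open>c >= 1\<close> by (auto simp: eps_def inverse_le_1_iff field_simps)
   have "\<exists>q m. z : C i eps (real_of_rat q) m" for i
   proof -
    have "z : (\<Union>q\<in>\<rat>. \<Union>m. C i eps q m)" using z unfolding N_def G_def eps_def by blast
    thus ?thesis by (auto elim!: Rats_cases)
   qed
   then obtain q m where qm: "!!i. z : C i eps (real_of_rat (q i)) (m i)" by metis
   \<comment> \<open>The largest index gives a scale that works for all directions at once.\<close>
   define M where "M = Max (range m)"
   have "m i <= M" for i by (simp add: M_def)
   hence "inverse (real (Suc M)) <= inverse (real (Suc (m i)))" for i by (intro le_imp_inverse_le) auto
   hence "C i eps q' (m i) <= C i eps q' M" for i q' unfolding C_def using order_less_le_trans by blast
   hence zE: "z : E eps q M" using qm unfolding E_def by blast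
   moreover have "z ~: Bad eps q M" using z by (auto simp: N_def eps_def)
   ultimately obtain r where r: "r > 0" "!!y. dist y z < r ==> \<exists>b\<in>E eps q M. dist y b <= eps * dist y z"
    unfolding Bad_def by (smt (verit) mem_Collect_eq)
   define Q where "Q = (\<chi> i. real_of_rat (q i))"
   have Q: "\<bar>g (b + t *: e i) - g b - Q $ i * t\<bar> <= eps * \<bar>t\<bar>"
    if "b : E eps q M" "\<bar>t\<bar> < inverse (real (Suc M))" for b i t using that by (simp add: E_def C_def Q_def del: of_nat_Suc)
   show "\<exists>q r. 0 < r & norm q <= real CARD('n) * (L + 1) & (\<forall>h. norm h < r --> \<bar>g (z + h) - g z - q .* h\<bar> <= e0 * norm h)"
   proof (intro exI[of _ Q] exI[of _ "min r (inverse (real (Suc M)))"] conjI allI impI)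
    show "0 < min r (inverse (real (Suc M)))" using r(1) by simp
    show "norm Q <= real CARD('n) * (L + 1)"
    proof -
     have "\<bar>Q $ i\<bar> <= L + 1" for i
     proof -
      define t where "t = inverse (real (Suc M)) / 2"
      have t: "t > 0" "t < inverse (real (Suc M))" by (simp_all add: t_def)
      have "\<bar>g (z + t *: e i) - g z - Q $ i * t\<bar> <= eps * t" using Q[OF zE, of t i] t by simp
      moreover have "\<bar>g (z + t *: e i) - g z\<bar> <= L * t" using L(2)[of "z + t *: e i" z] t by (simp add: e_def)
      moreover have "eps * t <= 1 * t" using eps t by (intro mult_right_mono) auto
      ultimately have "\<bar>Q $ i * t\<bar> <= (L + 1) * t" by (simp add: alg)
      thus ?thesis using t by (simp add: abs_mult)
     qed
     hence "(\<Sum>i\<in>UNIV. \<bar>Q $ i\<bar>) <= real CARD('n) * (L + 1)" by (intro sum_bounded_above[of UNIV, simplified])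
     thus ?thesis using norm_le_l1_cart[of Q] by linarith
    qed
    fix h :: "real^'n" assume h: "norm h < min r (inverse (real (Suc M)))"
    \<comment> \<open>The corner reached after applying the coordinates of \<open>h\<close> with
      index in \<open>S\<close>.\<close>
    define y where "y S = z + (\<Sum>i\<in>S. h $ i *: e i)" for S
    have hi: "\<bar>h $ i\<bar> <= norm h" for i by (rule component_le_norm_cart)
    have "\<bar>g (y S) - g z - (\<Sum>i\<in>S. Q $ i * h $ i)\<bar> <= real (card S) * ((2 * L + 1) * (eps * norm h))" if "finite S" for S
     using that
    proof (induction S rule: finite_induct)
     case empty
     thus ?case by (simp add: y_def)
    next
     case (insert i S)
     have "norm (y S - z) <= norm h"
     proof (rule norm_le_componentwise_cart)
      fix j
      have "(y S - z) $ j = (if j : S then h $ j else 0)"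
       using insert.hyps(1) by (simp add: y_def e_def axis_def if_distrib sum.delta cong: if_cong)
      thus "norm ((y S - z) $ j) <= norm (h $ j)" by simp
     qed
     hence ySz: "dist (y S) z <= norm h" by (simp add: dist_norm)
     then obtain b where b: "b : E eps q M" "dist (y S) b <= eps * dist (y S) z" using r(2)[of "y S"] h by auto
     have yb: "norm (y S - b) <= eps * norm h" using b(2) ySz eps by (auto simp: dist_norm intro: order_trans mult_left_mono)
     have y': "y (insert i S) = y S + h $ i *: e i" using insert.hyps by (simp add: y_def)
     have "\<bar>g (b + h $ i *: e i) - g b - Q $ i * h $ i\<bar> <= eps * \<bar>h $ i\<bar>" using hi[of i] h by (intro Q b(1)) simp
     also have "... <= eps * norm h" using hi eps by (intro mult_left_mono) auto
     finally have 1: "\<bar>g (b + h $ i *: e i) - g b - Q $ i * h $ i\<bar> <= eps * norm h" .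
     have Lyb: "L * norm (y S - b) <= L * (eps * norm h)" using yb L(1) by (rule mult_left_mono)
     have 2: "\<bar>g (y S + h $ i *: e i) - g (b + h $ i *: e i)\<bar> <= L * (eps * norm h)"
      using L(2)[of "y S + h $ i *: e i" "b + h $ i *: e i"] Lyb by simp
     have 3: "\<bar>g b - g (y S)\<bar> <= L * (eps * norm h)" using L(2)[of b "y S"] Lyb by (simp add: norm_minus_commute)
     have "\<bar>g (y (insert i S)) - g (y S) - Q $ i * h $ i\<bar> <= (2 * L + 1) * (eps * norm h)"
      using 1 2 3 unfolding y' by (simp add: alg abs_le_iff)
     thus ?case using insert by (simp add: alg abs_le_iff)
    qed
    from this[of UNIV] have "\<bar>g (y UNIV) - g z - Q .* h\<bar> <= (c * eps) * norm h" by (simp add: inner_vec_def c_def mult_ac)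
    also have "... <= e0 * norm h" using eps(3) by (intro mult_right_mono) auto
    finally show "\<bar>g (z + h) - g z - Q .* h\<bar> <= e0 * norm h"
     using basis_expansion[of h] by (simp add: y_def e_def scalar_mult_eq_scaleR)
   qed
  qed
  with \<open>z : _\<close> show False by (auto simp: differentiable_def)
 qed
 ultimately show ?thesis by (rule negligible_subset)
qed

theorem Rademacher:
 fixes g :: "real^'n => real^'m"
 assumes lip: "L-lipschitz_on UNIV g"
 shows "negligible {z. ~ g differentiable (at z)}"
proof -
 have "negligible {z. ~ (%z. g z $ i) differentiable (at z)}" for i
 proof (rule Rademacher_real)
  show "L-lipschitz_on UNIV (%z. g z $ i)"
  proof (rule lipschitz_onI)
   fix x y
   have "dist (g x $ i) (g y $ i) <= dist (g x) (g y)" by (rule dist_vec_nth_le)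
   also have "... <= L * dist x y" using lip by (auto simp: lipschitz_on_def)
   finally show "dist (g x $ i) (g y $ i) <= L * dist x y" .
  qed (use lip in \<open>simp add: lipschitz_on_def\<close>)
 qed
 hence "negligible (\<Union>i. {z. ~ (%z. g z $ i) differentiable (at z)})" by (intro negligible_countable_Union) auto
 moreover have "{z. ~ g differentiable (at z)} <= (\<Union>i. {z. ~ (%z. g z $ i) differentiable (at z)})"
 proof (rule subsetI, rule ccontr)
  fix z assume z: "z : {z. ~ g differentiable (at z)}" "z ~: (\<Union>i. {z. ~ (%z. g z $ i) differentiable (at z)})"
  then obtain g' where "!!i. ((%z. g z $ i) has_derivative g' i) (at z)" unfolding differentiable_def by (auto simp: choice_iff)
  hence "(g has_derivative (%h. \<chi> i. g' i h)) (at z)"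
   by (subst has_derivative_componentwise_within) (auto simp: Basis_vec_def inner_axis)
  thus False using z(1) by (auto simp: differentiable_def)
 qed
 ultimately show ?thesis by (rule negligible_subset)
qed

section \<open>Optimal transport onto a compact set\<close>

definition subdiff :: "('a::real_inner => real) => 'a => 'a set" where
 "subdiff \<psi> p = {x. \<forall>r. \<psi> p + x .* (r - p) <= \<psi> r}"

text \<open>A cell of a Laguerre (power) diagram: the region where the affine function with slope
  \<open>x\<close> and offset \<open>- a x\<close> is maximal in the family.\<close>

definition power_cell :: "'a::real_inner set => ('a => real) => 'a => 'a set" where
 "power_cell F a x = {p. \<forall>y\<in>F. y .* p - a y <= x .* p - a x}"

lemma closed_power_cell: "closed (power_cell F a (x::'a::euclidean_space))"
proof -
 have "power_cell F a x = (\<Inter>y\<in>F. {p. y .* p - a y <= x .* p - a x})" by (auto simp: power_cell_def)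
 also have "closed ..." by (intro closed_INT ballI closed_Collect_le continuous_intros)
 finally show ?thesis .
qed

lemma power_cell_sets: "power_cell F a (x::'a::euclidean_space) : sets borel" by (rule borel_closed[OF closed_power_cell])

lemma power_cells_cover:
 assumes "finite F" "F ~= {}"
 shows "(\<Union>x\<in>F. power_cell F a x) = UNIV"
proof -
 have "p : (\<Union>x\<in>F. power_cell F a x)" for p
 proof -
  define M where "M = Max ((%x. x .* p - a x) ` F)"
  have "M : (%x. x .* p - a x) ` F" unfolding M_def using assms by (intro Max_in) auto
  then obtain x where "x : F" "M = x .* p - a x" by auto
  moreover have "y .* p - a y <= M" if "y : F" for y unfolding M_def using assms that by (intro Max_ge) auto
  ultimately show ?thesis by (auto simp: power_cell_def)
 qed
 thus ?thesis by auto
qed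

section \<open>Power cells of prescribed measure\<close>

locale transport_source = finite_measure \<omega> for \<omega> :: "'a::euclidean_space measure" +
 assumes sets_\<omega> [measurable_cong, simp]: "sets \<omega> = sets borel"
  and null_\<omega>: "!!N. N : null_sets lborel ==> N : null_sets \<omega>"
begin

lemma space_\<omega> [simp]: "space \<omega> = UNIV" using sets_eq_imp_space_eq[OF sets_\<omega>] by simp

lemma hyperplane_null:
 assumes "v ~= 0"
 shows "{p. v .* p = c} : null_sets \<omega>"
proof (rule null_\<omega>)
 have "negligible {p. v .* p = c}" using assms by (intro negligible_hyperplane) auto
 moreover have "closed {p. v .* p = c}" by (rule closed_hyperplane)
 ultimately show "{p. v .* p = c} : null_sets lborel" by (auto simp: neg_null null_sets_def lebesgue_lborel)
qed

lemma halfspace_small: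
 assumes "v ~= 0" "eps > 0"
 obtains t where "measure \<omega> {p. v .* p >= t} < eps"
proof -
 have "(%k. measure \<omega> {p. v .* p >= real k}) \<longlonglongrightarrow> measure \<omega> (\<Inter>k. {p. v .* p >= real k})"
  by (intro finite_Lim_measure_decseq) (auto simp: decseq_def intro!: borel_closed closed_halfspace_ge)
 also have "(\<Inter>k. {p. v .* p >= real k}) = {}"
 proof -
  have "p ~: (\<Inter>k. {p. v .* p >= real k})" for p using reals_Archimedean2[of "v .* p"] by (meson INT_D UNIV_I mem_Collect_eq not_le)
  thus ?thesis by blast
 qed
 finally have "\<forall>\<^sub>F k in sequentially. measure \<omega> {p. v .* p >= real k} < eps"
  using \<open>eps > 0\<close> by (intro order_tendstoD(2)) auto
 thus thesis using that by (auto simp: eventually_sequentially)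
qed

text \<open>Distinct strict cells are disjoint, which the closed cells are not; the two versions
  differ by finitely many hyperplanes, which are null.\<close>

definition strict_cell :: "'a set => ('a => real) => 'a => 'a set" where
 "strict_cell F a x = {p. \<forall>y\<in>F - {x}. y .* p - a y < x .* p - a x}"

lemma strict_cell_subset: "strict_cell F a x <= power_cell F a x"
proof
 fix p assume p: "p : strict_cell F a x"
 have "y .* p - a y <= x .* p - a x" if "y : F" for y using p that by (cases "y = x") (auto simp: strict_cell_def intro: less_imp_le)
 thus "p : power_cell F a x" by (auto simp: power_cell_def)
qed

lemma strict_cell_sets:
 assumes "finite F"
 shows "strict_cell F a x : sets borel"
proof -
 have "open (strict_cell F a x)"
 proof -
  have "strict_cell F a x = (\<Inter>y\<in>F - {x}. {p. y .* p - a y < x .* p - a x})" by (auto simp: strict_cell_def)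
  also have "open ..." using assms by (intro open_INT ballI open_Collect_less continuous_intros) auto
  finally show ?thesis .
 qed
 thus ?thesis by simp
qed

lemma measure_strict_cell:
 assumes "finite F"
 shows "measure \<omega> (strict_cell F a x) = measure \<omega> (power_cell F a x)"
proof -
 let ?N = "\<Union>y\<in>F - {x}. {p. (x - y) .* p = a x - a y}"
 have N: "?N : null_sets \<omega>" using assms by (intro null_sets_UN' hyperplane_null) (auto simp: countable_finite)
 have c: "power_cell F a x : sets \<omega>" "strict_cell F a x : sets \<omega>" using power_cell_sets strict_cell_sets[OF assms] by auto
 have "AE p in \<omega>. p ~: ?N" using N by (rule AE_not_in)
 hence "AE p in \<omega>. p : strict_cell F a x \<longleftrightarrow> p : power_cell F a x"
 proof (rule eventually_mono)
  fix p assume p: "p ~: ?N"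
  show "p : strict_cell F a x \<longleftrightarrow> p : power_cell F a x"
  proof
   assume "p : strict_cell F a x"
   thus "p : power_cell F a x" using strict_cell_subset by blast
  next
   assume c: "p : power_cell F a x"
   show "p : strict_cell F a x" unfolding strict_cell_def
   proof (intro CollectI ballI)
    fix y assume y: "y : F - {x}"
    hence "(x - y) .* p ~= a x - a y" using p by auto
    hence "y .* p - a y ~= x .* p - a x" by (auto simp: idl)
    thus "y .* p - a y < x .* p - a x" using c y by (force simp: power_cell_def)
   qed
  qed
 qed
 thus ?thesis using c by (intro finite_measure_eq_AE) auto
qed

lemma measure_UN_power_cells:
 assumes "finite F" "G <= F"
 shows "(\<Sum>x\<in>G. measure \<omega> (power_cell F a x)) <= measure \<omega> (\<Union>x\<in>G. power_cell F a x)"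
proof -
 have fin: "finite G" using assms finite_subset by blast
 have "(\<Sum>x\<in>G. measure \<omega> (power_cell F a x)) = (\<Sum>x\<in>G. measure \<omega> (strict_cell F a x))"
  using measure_strict_cell[OF assms(1)] by simp
 also have "... = measure \<omega> (\<Union>x\<in>G. strict_cell F a x)"
 proof (intro finite_measure_finite_Union[symmetric] fin)
  show "strict_cell F a ` G <= sets \<omega>" using strict_cell_sets[OF assms(1)] by auto
  show "disjoint_family_on (strict_cell F a) G" using assms(2) unfolding disjoint_family_on_def strict_cell_def by (force dest: bspec)
 qed
 also have "... <= measure \<omega> (\<Union>x\<in>G. power_cell F a x)" using fin power_cell_sets strict_cell_subset
  by (intro finite_measure_mono UN_mono) (auto intro: sets.finite_UN)
 finally show ?thesis .
qed

text \<open>Alexandrov's theorem by Perron's method: lower the heights as long as no cell other than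
 the one of the reference point \<open>x\<^sub>1\<close> exceeds its prescribed mass.\<close>

theorem power_cells_prescribed_measure:
 assumes F: "finite F" "F ~= {}" and m: "!!x. x : F ==> 0 < m x" and sum: "(\<Sum>x\<in>F. m x) = measure \<omega> UNIV"
 shows "\<exists>a. \<forall>x\<in>F. m x <= measure \<omega> (power_cell F a x)"
proof -
 obtain x1 where x1: "x1 : F" using F by blast
 define \<A> where "\<A> = {a. a x1 = 0 & (\<forall>x\<in>F - {x1}. measure \<omega> (power_cell F a x) <= m x)}"
 have sets: "power_cell F a x : sets \<omega>" for a x using power_cell_sets by auto
 have total: "measure \<omega> UNIV <= (\<Sum>x\<in>F. measure \<omega> (power_cell F a x))" for a
  using finite_measure_subadditive_finite[OF F(1), of "power_cell F a"] sets power_cells_cover[OF F] by auto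
 \<comment> \<open>The cells cover the space, so the cell of \<open>x1\<close> receives what the
   others leave.\<close>
 have x1_ge: "m x1 <= measure \<omega> (power_cell F a x1)" if a: "a : \<A>" for a
 proof -
  have "(\<Sum>x\<in>F - {x1}. measure \<omega> (power_cell F a x)) <= (\<Sum>x\<in>F - {x1}. m x)"
   using a by (intro sum_mono) (auto simp: \<A>_def)
  thus ?thesis using total[of a] sum F(1) x1 by (simp add: sum.remove)
 qed
 \<comment> \<open>\<open>\<A>\<close> is not empty\<close>
 have "\<exists>t. measure \<omega> {p. (x - x1) .* p >= t} < m x" if x: "x : F - {x1}" for x
  using halfspace_small[of "x - x1" "m x"] m[of x] x by (metis Diff_iff insertI1 right_minus_eq)
 then obtain t where t: "!!x. x : F - {x1} ==> measure \<omega> {p. (x - x1) .* p >= t x} < m x" by metis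
 have start: "(%x. if x = x1 then 0 else t x) : \<A>" unfolding \<A>_def
 proof (intro CollectI conjI ballI)
  fix x assume x: "x : F - {x1}"
  have "measure \<omega> (power_cell F (%x. if x = x1 then 0 else t x) x) <= measure \<omega> {p. (x - x1) .* p >= t x}"
   using x x1 by (intro finite_measure_mono) (auto simp: power_cell_def idl closed_halfspace_ge dest!: bspec[OF _ x1])
  thus "measure \<omega> (power_cell F (%x. if x = x1 then 0 else t x) x) <= m x" using t[OF x] by simp
 qed simp
 \<comment> \<open>heights in \<open>\<A>\<close> are bounded below\<close>
 have "\<exists>l. \<forall>a\<in>\<A>. l <= a x" if x: "x : F" for x
 proof (cases "x = x1")
  case True
  thus ?thesis by (auto simp: \<A>_def)
 next
  case False
  obtain s where s: "measure \<omega> {p. (x1 - x) .* p >= s} < m x1" using halfspace_small[of "x1 - x" "m x1"] m[OF x1] False by auto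
  have "- s <= a x" if a: "a : \<A>" for a
  proof (rule ccontr)
   assume "~ - s <= a x"
   hence "power_cell F a x1 <= {p. (x1 - x) .* p >= s}" using a x by (auto simp: power_cell_def \<A>_def idl dest!: bspec[OF _ x])
   hence "measure \<omega> (power_cell F a x1) <= measure \<omega> {p. (x1 - x) .* p >= s}"
    by (intro finite_measure_mono) (auto simp: closed_halfspace_ge)
   thus False using x1_ge[OF a] s by simp
  qed
  thus ?thesis by blast
 qed
 hence bdd: "bdd_below ((%a. a x) ` \<A>)" if "x : F" for x using that by (auto simp: bdd_below_def)
 define b where "b x = (if x : F then Inf ((%a. a x) ` \<A>) else 0)" for x
 have b_le: "b x <= a x" if "a : \<A>" "x : F" for a x using that bdd by (auto simp: b_def intro: cINF_lower)
 have bx1: "b x1 = 0"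
 proof -
  have "(%a. a x1) ` \<A> <= {0}" by (auto simp: \<A>_def)
  hence "(%a. a x1) ` \<A> = {0}" using start by (simp add: subset_singleton_iff) blast
  thus ?thesis using x1 by (simp add: b_def)
 qed
 \<comment> \<open>Stability under pointwise minima lets a single member of the family approach
   finitely many infima simultaneously.\<close>
 have min: "(%x. min (a x) (a' x)) : \<A>" if a: "a : \<A>" "a' : \<A>" for a a' unfolding \<A>_def
 proof (intro CollectI conjI ballI)
  show "min (a x1) (a' x1) = 0" using a by (simp add: \<A>_def)
  fix x assume x: "x : F - {x1}"
  have "power_cell F (%x. min (a x) (a' x)) x <= (if a x <= a' x then power_cell F a x else power_cell F a' x)"
   unfolding power_cell_def by (auto dest!: bspec simp: min_def split: if_splits)
  hence "measure \<omega> (power_cell F (%x. min (a x) (a' x)) x) <= measure \<omega> (if a x <= a' x then power_cell F a x else power_cell F a' x)"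
   using sets by (intro finite_measure_mono) auto
  also have "... <= m x" using a x by (auto simp: \<A>_def)
  finally show "measure \<omega> (power_cell F (%x. min (a x) (a' x)) x) <= m x" .
 qed
 have approx: "\<exists>a\<in>\<A>. \<forall>x\<in>H. a x < b x + e" if "e > 0" "finite H" "H <= F" for e H using that(2,3)
 proof (induction H rule: finite_induct)
  case empty
  thus ?case using start by blast
 next
  case (insert x H)
  then obtain a where a: "a : \<A>" "\<forall>x\<in>H. a x < b x + e" by auto
  obtain a' where a': "a' : \<A>" "a' x < b x + e"
   using cINF_less_iff[OF _ bdd, of x "b x + e"] insert.prems \<open>e > 0\<close> start by (auto simp: b_def)
  show ?case using min[OF a(1) a'(1)] a(2) a'(2) by (intro bexI[of _ "%x. min (a x) (a' x)"]) (auto simp: min_less_iff_disj)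
 qed
 obtain A where A: "!!k. A k : \<A>" "!!k x. x : F ==> A k x < b x + inverse (real (Suc k))"
  using approx[OF _ F(1) order_refl, of "inverse (real (Suc _))"] by (metis inverse_positive_iff_positive of_nat_0_less_iff zero_less_Suc)
 have b_in: "b : \<A>" unfolding \<A>_def
 proof (intro CollectI conjI ballI bx1)
  fix x assume x: "x : F - {x1}"
  \<comment> \<open>The increasing union of the \<open>B k\<close> is the limit inferior of the
    cells of the approximating heights. It contains the strict cell of \<open>b\<close>, which
    carries the measure of the whole cell.\<close>
  define B where "B k = (\<Inter>j\<in>{k..}. power_cell F (A j) x)" for k
  have B: "B k : sets \<omega>" "measure \<omega> (B k) <= m x" for k
  proof -
   have "closed (B k)" unfolding B_def by (intro closed_INT ballI closed_power_cell)
   thus "B k : sets \<omega>" by simp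
   have "measure \<omega> (B k) <= measure \<omega> (power_cell F (A k) x)" using sets by (intro finite_measure_mono) (auto simp: B_def)
   also have "... <= m x" using A(1)[of k] x by (auto simp: \<A>_def)
   finally show "measure \<omega> (B k) <= m x" .
  qed
  have "incseq B" by (auto simp: incseq_def B_def)
  hence "(%k. measure \<omega> (B k)) \<longlonglongrightarrow> measure \<omega> (\<Union>k. B k)"
   using B by (intro finite_Lim_measure_incseq) auto
  hence UB: "measure \<omega> (\<Union>k. B k) <= m x" using B(2) by (intro LIMSEQ_le_const2) auto
  have "strict_cell F b x <= (\<Union>k. B k)"
  proof
   fix p assume p: "p : strict_cell F b x"
   define e where "e = Min (insert 1 ((%y. (x .* p - b x) - (y .* p - b y)) ` (F - {x})))"
   have "e > 0" unfolding e_def using F(1) p by (subst Min_gr_iff) (auto simp: strict_cell_def)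
   have e: "y .* p - b y + e <= x .* p - b x" if "y : F - {x}" for y
   proof -
    have "e <= (x .* p - b x) - (y .* p - b y)" unfolding e_def using F(1) that by (intro Min_le) auto
    thus ?thesis by simp
   qed
   obtain k where k: "inverse (real (Suc k)) < e" using reals_Archimedean[OF \<open>e > 0\<close>] by auto
   have "p : power_cell F (A j) x" if "k <= j" for j unfolding power_cell_def
   proof (intro CollectI ballI)
    fix y assume y: "y : F"
    show "y .* p - A j y <= x .* p - A j x"
    proof (cases "y = x")
     case False
     have "inverse (real (Suc j)) <= inverse (real (Suc k))" using that by (intro le_imp_inverse_le) auto
     moreover have "A j x < b x + inverse (real (Suc j))" using A(2) x by blast
     ultimately have "A j x < b x + e" using k by linarith
     moreover have "b y <= A j y" using b_le[OF A(1) y] .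
     ultimately show ?thesis using e[of y] y False by simp
    qed simp
   qed
   thus "p : (\<Union>k. B k)" by (auto simp: B_def)
  qed
  hence "measure \<omega> (strict_cell F b x) <= measure \<omega> (\<Union>k. B k)"
   using B(1) by (intro finite_measure_mono sets.countable_UN) auto
  thus "measure \<omega> (power_cell F b x) <= m x" using UB measure_strict_cell[OF F(1)] by simp
 qed
 have "m x <= measure \<omega> (power_cell F b x)" if x: "x : F" for x
 proof (cases "x = x1")
  case True
  thus ?thesis using x1_ge[OF b_in] by simp
 next
  case False
  show ?thesis
  proof (rule ccontr)
   assume "~ ?thesis"
   hence less: "measure \<omega> (power_cell F b x) < m x" by simp
   \<comment> \<open>Lowering the height of \<open>x\<close> enlarges no cell but its own, and by
     continuity from above that cell stays below its prescribed mass if the decrease is small. This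
     would contradict the minimality of \<open>b\<close>.\<close>
   define b' where "b' k = b(x := b x - inverse (real (Suc k)))" for k
   have dec: "decseq (%k. power_cell F (b' k) x)" unfolding decseq_def
   proof (intro allI impI)
    fix k l :: nat assume "k <= l"
    hence "inverse (real (Suc l)) <= inverse (real (Suc k))" by (intro le_imp_inverse_le) auto
    hence le: "x .* p - b' l x <= x .* p - b' k x" for p by (simp add: b'_def)
    show "power_cell F (b' l) x <= power_cell F (b' k) x"
    proof
     fix p assume p: "p : power_cell F (b' l) x"
     have "y .* p - b' k y <= x .* p - b' k x" if "y : F" for y
     proof (cases "y = x")
      case False
      hence "y .* p - b' k y = y .* p - b' l y" by (simp add: b'_def)
      also have "... <= x .* p - b' l x" using p that by (auto simp: power_cell_def)
      finally show ?thesis using le by (rule order_trans)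
     qed simp
     thus "p : power_cell F (b' k) x" by (auto simp: power_cell_def)
    qed
   qed
   have "(\<Inter>k. power_cell F (b' k) x) <= power_cell F b x"
   proof
    fix p assume p: "p : (\<Inter>k. power_cell F (b' k) x)"
    have "y .* p - b y <= x .* p - b x" if y: "y : F" for y
    proof (cases "y = x")
     case False
     have "y .* p - b y <= x .* p - b x + inverse (real (Suc k))" for k
     proof -
      have "p : power_cell F (b' k) x" using p by blast
      thus ?thesis using y False by (auto simp: power_cell_def b'_def)
     qed
     moreover have "(%k. x .* p - b x + inverse (real (Suc k))) \<longlonglongrightarrow> x .* p - b x + 0"
      by (intro tendsto_add tendsto_const LIMSEQ_inverse_real_of_nat)
     ultimately show ?thesis by (intro LIMSEQ_le_const[of _ "x .* p - b x"]) auto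
    qed simp
    thus "p : power_cell F b x" by (auto simp: power_cell_def)
   qed
   hence "measure \<omega> (\<Inter>k. power_cell F (b' k) x) < m x"
    using less finite_measure_mono[OF _ sets, of "\<Inter>k. power_cell F (b' k) x" b x] by simp
   moreover have "(%k. measure \<omega> (power_cell F (b' k) x)) \<longlonglongrightarrow> measure \<omega> (\<Inter>k. power_cell F (b' k) x)"
    using sets dec by (intro finite_Lim_measure_decseq) auto
   ultimately have "\<forall>\<^sub>F k in sequentially. measure \<omega> (power_cell F (b' k) x) < m x" by (intro order_tendstoD(2))
   then obtain k where k: "measure \<omega> (power_cell F (b' k) x) < m x" by (auto simp: eventually_sequentially)
   have "b' k : \<A>" unfolding \<A>_def
   proof (intro CollectI conjI ballI)
    show "b' k x1 = 0" using bx1 False by (simp add: b'_def)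
    fix y assume y: "y : F - {x1}"
    show "measure \<omega> (power_cell F (b' k) y) <= m y"
    proof (cases "y = x")
     case True
     thus ?thesis using k by simp
    next
     case False
     have "power_cell F (b' k) y <= power_cell F b y"
     proof
      fix p assume p: "p : power_cell F (b' k) y"
      have "z .* p - b z <= y .* p - b y" if "z : F" for z
      proof -
       have "z .* p - b' k z <= y .* p - b' k y" using p that by (auto simp: power_cell_def)
       moreover have "b' k z <= b z" "b' k y = b y" using False by (auto simp: b'_def)
       ultimately show ?thesis by simp
      qed
      thus "p : power_cell F b y" by (auto simp: power_cell_def)
     qed
     hence "measure \<omega> (power_cell F (b' k) y) <= measure \<omega> (power_cell F b y)" using sets by (intro finite_measure_mono)
     also have "... <= m y" using b_in y by (auto simp: \<A>_def)
     finally show ?thesis .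
    qed
   qed
   hence "b x <= b' k x" using b_le x by blast
   thus False by (simp add: b'_def)
  qed
 qed
 thus ?thesis by blast
qed

end

text \<open>A diagonal sequence converges on a countable dense set, and the common Lipschitz
  constant carries convergence over to every point.\<close>

lemma Lipschitz_convergent_subsequence:
 fixes f :: "nat => 'a::euclidean_space => real"
 assumes lip: "!!k. R-lipschitz_on UNIV (f k)" and zero: "!!k. f k 0 = 0"
 obtains \<sigma> g where "strict_mono \<sigma>" "!!p. (%k. f (\<sigma> k) p) \<longlonglongrightarrow> g p"
proof -
 obtain D :: "'a set" where D: "countable D" "closure D = UNIV"
  using separable[of UNIV] by (metis UNIV_eq_I closure_UNIV subset_UNIV top.extremum_unique)
 have "D ~= {}" using D(2) by auto
 define d where "d = from_nat_into D"
 have R: "\<bar>f k x - f k y\<bar> <= R * norm (x - y)" "0 <= R" for k x y using lip by (auto simp: lipschitz_on_def dist_norm)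
 interpret subseqs "%n s. convergent (%k. f (s k) (d n))"
 proof
  fix n and s :: "nat => nat"
  have "\<bar>f (s k) (d n)\<bar> <= R * norm (d n)" for k using R(1)[of "s k" "d n" 0] zero by simp
  hence "bounded (range (%k. f (s k) (d n)))" by (auto simp: bounded_iff)
  then obtain l r where "strict_mono (r :: nat => nat)" "((%k. f (s k) (d n)) \<circ> r) \<longlonglongrightarrow> l"
   using bounded_imp_convergent_subsequence by blast
  thus "\<exists>r'. strict_mono r' & convergent (%k. f ((s \<circ> r') k) (d n))" by (auto simp: convergent_def o_def)
 qed
 have conv_d: "convergent (%k. f (diagseq k) (d n))" for n
 proof -
  have "convergent (%k. f ((diagseq \<circ> (+) (Suc n)) k) (d n))"
  proof (rule diagseq_holds)
   fix r s :: "nat => nat" and m assume "strict_mono r" "convergent (%k. f (s k) (d m))"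
   thus "convergent (%k. f ((s \<circ> r) k) (d m))" using convergent_subseq_convergent[of "%k. f (s k) (d m)" r] by (simp add: o_def)
  qed
  hence "convergent (%k. f (diagseq (k + Suc n)) (d n))" by (simp add: add.commute)
  thus ?thesis using convergent_ignore_initial_segment[of "%k. f (diagseq k) (d n)" "Suc n"] by simp
 qed
 have "convergent (%k. f (diagseq k) p)" for p
 proof -
  have "Cauchy (%k. f (diagseq k) p)"
  proof (rule metric_CauchyI)
   fix e :: real assume "e > 0"
   have "p : closure D" using D(2) by simp
   then obtain y where y: "y : D" "dist y p < e / (3 * (R + 1))"
    using \<open>e > 0\<close> R(2) unfolding closure_approachable by (meson divide_pos_pos add_nonneg_pos zero_less_one mult_pos_pos zero_less_numeral)
   then obtain n where n: "y = d n" using D(1) \<open>D ~= {}\<close> by (metis d_def from_nat_into_surj)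
   have Ry: "R * norm (p - y) <= e / 3"
   proof -
    have "R * norm (p - y) <= (R + 1) * norm (p - y)" by (intro mult_right_mono) auto
    also have "... <= e / 3" using y(2) R(2) by (simp add: dist_norm norm_minus_commute field_simps)
    finally show ?thesis .
   qed
   obtain M where M: "!!j k. j >= M ==> k >= M ==> dist (f (diagseq j) y) (f (diagseq k) y) < e / 3"
    using convergent_Cauchy[OF conv_d[of n]] \<open>e > 0\<close> unfolding n Cauchy_def by (meson divide_pos_pos zero_less_numeral)
   show "\<exists>M. \<forall>m\<ge>M. \<forall>k\<ge>M. dist (f (diagseq m) p) (f (diagseq k) p) < e"
   proof (intro exI[of _ M] allI impI)
    fix m k assume "M <= m" "M <= k"
    thus "dist (f (diagseq m) p) (f (diagseq k) p) < e" using M[of m k] R(1)[of "diagseq m" p y] R(1)[of "diagseq k" p y] Ry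
     unfolding dist_real_def by linarith
   qed
  qed
  thus ?thesis by (rule Cauchy_convergent)
 qed
 hence "(%k. f (diagseq k) p) \<longlonglongrightarrow> lim (%k. f (diagseq k) p)" for p by (rule convergent_LIMSEQ_iff[THEN iffD1])
 thus thesis by (intro that[of diagseq "%p. lim (%k. f (diagseq k) p)"] subseq_diagseq allI)
qed

lemma compact_fine_partition:
 fixes K :: "'a::euclidean_space set"
 assumes K: "compact K" and \<delta>: "\<delta> > 0"
 obtains T D where "finite T" "T <= K" "!!x. x : T ==> D x : sets borel" "disjoint_family_on D T"
  "(\<Union>x\<in>T. D x) = K" "!!x y. x : T ==> y : D x ==> dist x y < \<delta>"
proof -
 have "K <= (\<Union>x\<in>K. ball x \<delta>)" using \<delta> by auto
 then obtain T where T: "T <= K" "finite T" "K <= (\<Union>x\<in>T. ball x \<delta>)"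
  using compactE_image[OF K, of K "%x. ball x \<delta>"] by auto
 obtain e where e: "bij_betw e {0..<card T} T" using ex_bij_betw_nat_finite[OF T(2)] by blast
 define B where "B i = K Int ball (e i) \<delta>" for i
 define D where "D x = disjointed B (the_inv_into {0..<card T} e x)" for x
 have inv: "the_inv_into {0..<card T} e (e i) = i" if "i < card T" for i using e that by (intro the_inv_into_f_f) (auto simp: bij_betw_def)
 have De: "D (e i) = disjointed B i" if "i < card T" for i using inv[OF that] by (simp add: D_def)
 have Te: "\<exists>i<card T. x = e i" if "x : T" for x
 proof -
  have "x : e ` {0..<card T}" using that bij_betw_imp_surj_on[OF e] by simp
  thus ?thesis by auto
 qed
 have eT: "e i : T" if "i < card T" for i using that bij_betwE[OF e] by auto
 have Bs: "B i : sets borel" for i using K by (auto simp: B_def compact_imp_closed)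
 show thesis
 proof
  show "finite T" "T <= K" by fact+
  show "D x : sets borel" if "x : T" for x
  proof -
   have "range (disjointed B) <= sets borel" by (rule sets.range_disjointed_sets) (use Bs in auto)
   thus ?thesis by (auto simp: D_def)
  qed
  show "disjoint_family_on D T" unfolding disjoint_family_on_def
  proof (intro ballI impI)
   fix x y assume "x : T" "y : T" "x ~= y"
   then obtain i j where ij: "x = e i" "y = e j" "i < card T" "j < card T" "i ~= j" using Te by metis
   thus "D x Int D y = {}" using disjoint_family_disjointed[of B] by (simp add: De disjoint_family_on_def)
  qed
  show "(\<Union>x\<in>T. D x) = K"
  proof
   show "(\<Union>x\<in>T. D x) <= K" using disjointed_subset[of B] by (auto simp: D_def B_def)
   show "K <= (\<Union>x\<in>T. D x)"
   proof
    fix y assume "y : K"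
    then obtain i0 where i0: "i0 < card T" "y : B i0" using T(3) Te unfolding B_def by blast
    define i where "i = (LEAST i. y : B i)"
    have "y : B i" "i <= i0" unfolding i_def using i0(2) by (auto intro: LeastI Least_le)
    moreover have "y ~: B j" if "j < i" for j using that not_less_Least unfolding i_def by blast
    ultimately have "y : disjointed B i" by (auto simp: disjointed_def)
    thus "y : (\<Union>x\<in>T. D x)" using De[of i] eT[of i] i0 \<open>i <= i0\<close> by auto
   qed
  qed
  show "dist x y < \<delta>" if xy: "x : T" "y : D x" for x y
  proof -
   obtain i where i: "x = e i" "i < card T" using Te[OF xy(1)] by blast
   hence "y : B i" using that(2) De disjointed_subset[of B i] by auto
   thus ?thesis by (simp add: B_def i(1))
  qed
 qed
qed

section \<open>From finite targets to compact targets\<close>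

context transport_source
begin

text \<open>The target is cut into small pieces whose masses are placed at points \<open>F\<close>.
  The prescribed power cells then define \<open>\<psi>\<close> as a maximum of affine functions, and
  \<open>H E\<close> collects the cells of the points close to \<open>E\<close>. The slope condition
  keeps the Lipschitz constant under control independently of \<open>\<delta>\<close>.\<close>

theorem semidiscrete_transport:
 assumes K: "compact K" and c: "c > 0" "c * measure lborel K = measure \<omega> UNIV" and pos: "measure lborel K > 0" and \<delta>: "\<delta> > 0"
 obtains F \<psi> H where "finite F" "F ~= {}" "F <= K" "convex_on UNIV \<psi>" "\<psi> 0 = (0::real)"
  "!!p q. \<exists>x\<in>F. \<psi> p - \<psi> q <= x .* (p - q)"
  "!!E. H E : sets borel"
  "!!E. compact E ==> E <= K ==> c * measure lborel E <= measure \<omega> (H E)"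
  "!!E p. p : H E ==> \<exists>x\<in>F. (\<exists>y\<in>E. dist x y < \<delta>) & x : subdiff \<psi> p"
proof -
 obtain T D where TD: "finite T" "T <= K" "!!x. x : T ==> D x : sets borel" "disjoint_family_on D T"
  "(\<Union>x\<in>T. D x) = K" "!!x y. x : T ==> y : D x ==> dist x y < \<delta>" using compact_fine_partition[OF K \<delta>] by metis
 have DK: "D x <= K" if "x : T" for x using TD(5) that by auto
 have fm: "K : fmeasurable lborel" using K by (rule fmeasurable_compact)
 have fmD: "D x : fmeasurable lborel" if "x : T" for x using fm DK[OF that] TD(3)[OF that] by (intro fmeasurableI2[OF fm]) auto
 define m where "m x = c * measure lborel (D x)" for x
 \<comment> \<open>Null pieces are dropped because the power cell theorem prescribes positive masses
   only.\<close>
 define F where "F = {x\<in>T. m x > 0}"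
 have m0: "m x >= 0" for x using c(1) by (simp add: m_def)
 have sumD: "(\<Sum>x\<in>G. measure lborel (D x)) = measure lborel (\<Union>x\<in>G. D x)" if "G <= T" for G
 proof (rule measure_finite_Union[symmetric])
  show "finite G" using that TD(1) finite_subset by blast
  show "D ` G <= sets lborel" using that TD(3) by auto
  show "disjoint_family_on D G" using TD(4) that by (rule disjoint_family_on_mono[rotated])
  show "vol (D x) ~= \<infinity>" if "x : G" for x using fmD[of x] \<open>G <= T\<close> that by (auto simp: fmeasurable_def)
 qed
 have FT: "(\<Sum>x\<in>F Int G. m x) = (\<Sum>x\<in>G. m x)" if "G <= T" for G
 proof (rule sum.mono_neutral_left)
  show "finite G" using that TD(1) finite_subset by blast
  show "\<forall>x\<in>G - F Int G. m x = 0" using that m0 by (force simp: F_def not_less intro: antisym)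
 qed auto
 have "(\<Sum>x\<in>F. m x) = (\<Sum>x\<in>T. m x)" using FT[of T] by (simp add: F_def Int_absorb2)
 also have "... = c * measure lborel K" using sumD[of T] TD(5) by (simp add: m_def sum_distrib_left[symmetric])
 finally have sumF: "(\<Sum>x\<in>F. m x) = measure \<omega> UNIV" using c(2) by simp
 have F: "finite F" "F <= K" using TD by (auto simp: F_def)
 have "F ~= {}"
 proof
  assume "F = {}"
  hence "measure \<omega> UNIV = 0" using sumF by simp
  thus False using c pos by simp
 qed
 obtain a where a: "\<forall>x\<in>F. m x <= measure \<omega> (power_cell F a x)"
  using power_cells_prescribed_measure[OF F(1) \<open>F ~= {}\<close> _ sumF] by (auto simp: F_def)
 define \<psi>0 where "\<psi>0 p = Max ((%x. x .* p - a x) ` F)" for p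
 define \<psi> where "\<psi> p = \<psi>0 p - \<psi>0 0" for p
 have ge: "x .* p - a x <= \<psi>0 p" if "x : F" for x p unfolding \<psi>0_def using F(1) that by (intro Max_ge) auto
 have ex: "\<exists>x\<in>F. \<psi>0 p = x .* p - a x" for p
 proof -
  have "\<psi>0 p : (%x. x .* p - a x) ` F" unfolding \<psi>0_def using F(1) \<open>F ~= {}\<close> by (intro Max_in) auto
  thus ?thesis by auto
 qed
 have slope: "\<exists>x\<in>F. \<psi> p - \<psi> q <= x .* (p - q)" for p q
 proof -
  obtain x where x: "x : F" "\<psi>0 p = x .* p - a x" using ex by blast
  thus ?thesis using ge[OF x(1), of q] by (intro bexI[of _ x]) (auto simp: \<psi>_def idr)
 qed
 have conv: "convex_on UNIV \<psi>"
 proof (rule convex_onI)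
  fix t p q assume t: "0 < t" "t < (1::real)"
  obtain x where x: "x : F" "\<psi>0 ((1 - t) *: p + t *: q) = x .* ((1 - t) *: p + t *: q) - a x" using ex by blast
  have "\<psi>0 ((1 - t) *: p + t *: q) = (1 - t) * (x .* p - a x) + t * (x .* q - a x)" unfolding x(2) by (simp add: iar alg)
  also have "... <= (1 - t) * \<psi>0 p + t * \<psi>0 q" using ge[OF x(1)] t by (intro add_mono mult_left_mono) auto
  finally show "\<psi> ((1 - t) *: p + t *: q) <= (1 - t) * \<psi> p + t * \<psi> q" by (simp add: \<psi>_def alg)
 qed simp
 have cell: "x : subdiff \<psi> p" if "x : F" "p : power_cell F a x" for x p
 proof -
  have "\<psi>0 p = x .* p - a x"
  proof (rule antisym)
   obtain y where "y : F" "\<psi>0 p = y .* p - a y" using ex by blast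
   thus "\<psi>0 p <= x .* p - a x" using that(2) by (auto simp: power_cell_def)
  qed (rule ge[OF that(1)])
  hence "\<psi>0 p + x .* (r - p) <= \<psi>0 r" for r using ge[OF that(1), of r] by (simp add: idr)
  thus ?thesis by (simp add: subdiff_def \<psi>_def)
 qed
 define near where "near E = {x\<in>F. \<exists>y\<in>E. dist x y < \<delta>}" for E
 define H where "H E = (\<Union>x\<in>near E. power_cell F a x)" for E
 show thesis
 proof (rule that[of F \<psi> H])
  show "\<psi> 0 = 0" by (simp add: \<psi>_def)
  show "H E : sets borel" for E unfolding H_def near_def using F(1) power_cell_sets by (intro sets.finite_UN) auto
  show "\<exists>x\<in>F. (\<exists>y\<in>E. dist x y < \<delta>) & x : subdiff \<psi> p" if "p : H E" for E p
   using that cell by (auto simp: H_def near_def)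
  fix E assume E: "compact E" "E <= K"
  define G where "G = {x\<in>T. D x Int E ~= {}}"
  have "E <= (\<Union>x\<in>G. D x)"
  proof
   fix y assume y: "y : E"
   then obtain x where "x : T" "y : D x" using E(2) TD(5) by blast
   thus "y : (\<Union>x\<in>G. D x)" using y by (auto simp: G_def)
  qed
  moreover have "(\<Union>x\<in>G. D x) : fmeasurable lborel" using TD(1) fmD by (intro fmeasurable.finite_UN) (auto simp: G_def)
  ultimately have "measure lborel E <= measure lborel (\<Union>x\<in>G. D x)"
   using E(1) by (intro measure_mono_fmeasurable) (auto simp: compact_imp_closed)
  hence "c * measure lborel E <= (\<Sum>x\<in>G. m x)" using sumD[of G] c(1) by (auto simp: m_def sum_distrib_left[symmetric] G_def)
  also have "... = (\<Sum>x\<in>F Int G. m x)" by (rule FT[symmetric]) (auto simp: G_def)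
  also have "... <= (\<Sum>x\<in>near E. m x)"
  proof (rule sum_mono2)
   show "F Int G <= near E" using TD(6) by (auto simp: G_def near_def F_def)
  qed (use F(1) m0 in \<open>auto simp: near_def\<close>)
  also have "... <= (\<Sum>x\<in>near E. measure \<omega> (power_cell F a x))" using a by (intro sum_mono) (auto simp: near_def)
  also have "... <= measure \<omega> (H E)" unfolding H_def using F(1) by (intro measure_UN_power_cells) (auto simp: near_def)
  finally show "c * measure lborel E <= measure \<omega> (H E)" .
 qed (use F \<open>F ~= {}\<close> slope conv in auto)
qed

text \<open>No transport map is constructed in the limit. What passes to the limit is the bound for
  the set of points having a subgradient in a compact \<open>E\<close>, and this form is the one
  used later.\<close>

theorem transport_potential_exists:
 assumes K: "compact K" and c: "c > 0" "c * measure lborel K = measure \<omega> UNIV" and pos: "measure lborel K > 0"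
 obtains \<psi> R where "convex_on UNIV \<psi>" "R-lipschitz_on UNIV (\<psi> :: 'a => real)"
  "!!E. compact E ==> E <= K ==> {p. E Int subdiff \<psi> p ~= {}} : sets borel &
   c * measure lborel E <= measure \<omega> {p. E Int subdiff \<psi> p ~= {}}"
proof -
 have "\<forall>k::nat. \<exists>F \<psi> H. finite F & F ~= {} & F <= K & convex_on UNIV \<psi> & \<psi> 0 = (0::real) &
  (\<forall>p q. \<exists>x\<in>F. \<psi> p - \<psi> q <= x .* (p - q)) & (\<forall>E. H E : sets borel) &
  (\<forall>E. compact E --> E <= K --> c * measure lborel E <= measure \<omega> (H E)) &
  (\<forall>E p. p : H E --> (\<exists>x\<in>F. (\<exists>y\<in>E. dist x y < inverse (real (Suc k))) & x : subdiff \<psi> p))"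
 proof
  fix k :: nat
  show "\<exists>F \<psi> H. finite F & F ~= {} & F <= K & convex_on UNIV \<psi> & \<psi> 0 = (0::real) &
   (\<forall>p q. \<exists>x\<in>F. \<psi> p - \<psi> q <= x .* (p - q)) & (\<forall>E. H E : sets borel) &
   (\<forall>E. compact E --> E <= K --> c * measure lborel E <= measure \<omega> (H E)) &
   (\<forall>E p. p : H E --> (\<exists>x\<in>F. (\<exists>y\<in>E. dist x y < inverse (real (Suc k))) & x : subdiff \<psi> p))"
   by (rule semidiscrete_transport[OF K c pos, of "inverse (real (Suc k))"]) (simp, blast)
 qed
 then obtain F \<psi> H where *: "!!k. F k <= K" "!!k. convex_on UNIV (\<psi> k)" "!!k. \<psi> k 0 = 0"
  "!!k p q. \<exists>x\<in>F k. \<psi> k p - \<psi> k q <= x .* (p - q)" "!!k E. H k E : sets borel"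
  "!!k E. compact E ==> E <= K ==> c * measure lborel E <= measure \<omega> (H k E)"
  "!!k E p. p : H k E ==> \<exists>x\<in>F k. (\<exists>y\<in>E. dist x y < inverse (real (Suc k))) & x : subdiff (\<psi> k) p" by metis
 obtain R0 where R0: "!!x. x : K ==> norm x <= R0" using compact_imp_bounded[OF K] by (auto simp: bounded_iff)
 define R where "R = max R0 0"
 have R: "!!x. x : K ==> norm x <= R" "0 <= R" using R0 by (force simp: R_def)+
 have lip1: "\<psi> k p - \<psi> k q <= R * norm (p - q)" for k p q
 proof -
  obtain x where x: "x : F k" "\<psi> k p - \<psi> k q <= x .* (p - q)" using *(4) by blast
  have "x .* (p - q) <= norm x * norm (p - q)" by (rule norm_cauchy_schwarz)
  also have "... <= R * norm (p - q)" using R(1)[of x] x(1) *(1) by (intro mult_right_mono) auto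
  finally show ?thesis using x(2) by simp
 qed
 have lip: "R-lipschitz_on UNIV (\<psi> k)" for k
 proof (rule lipschitz_onI)
  fix p q
  show "dist (\<psi> k p) (\<psi> k q) <= R * dist p q" using lip1[of k p q] lip1[of k q p, unfolded norm_minus_commute[of q p]]
   unfolding dist_real_def dist_norm by linarith
 qed (rule R)
 have "\<exists>\<sigma> \<phi>. strict_mono (\<sigma> :: nat => nat) & (\<forall>p. (%k. \<psi> (\<sigma> k) p) \<longlonglongrightarrow> \<phi> p)"
 proof (rule Lipschitz_convergent_subsequence[of R \<psi>])
  show "R-lipschitz_on UNIV (\<psi> k)" "\<psi> k 0 = 0" for k by (fact lip *(3))+
 qed blast
 then obtain \<sigma> \<phi> where \<sigma>: "strict_mono (\<sigma> :: nat => nat)" and lim': "\<forall>p. (%k. \<psi> (\<sigma> k) p) \<longlonglongrightarrow> \<phi> p"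
  by blast
 from lim' have lim: "(%k. \<psi> (\<sigma> k) p) \<longlonglongrightarrow> \<phi> p" for p by blast
 show thesis
 proof
  show "convex_on UNIV \<phi>"
  proof (rule convex_onI)
   fix t p q assume t: "0 < t" "t < (1::real)"
   show "\<phi> ((1 - t) *: p + t *: q) <= (1 - t) * \<phi> p + t * \<phi> q"
   proof (rule LIMSEQ_le[OF lim tendsto_add[OF tendsto_mult[OF tendsto_const lim] tendsto_mult[OF tendsto_const lim]]])
    have "\<psi> (\<sigma> k) ((1 - t) *: p + t *: q) <= (1 - t) * \<psi> (\<sigma> k) p + t * \<psi> (\<sigma> k) q" for k
     using t by (intro convex_onD[OF *(2)]) auto
    thus "\<exists>N. \<forall>k\<ge>N. \<psi> (\<sigma> k) ((1 - t) *: p + t *: q) <= (1 - t) * \<psi> (\<sigma> k) p + t * \<psi> (\<sigma> k) q"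
     by blast
   qed
  qed simp
  show "R-lipschitz_on UNIV \<phi>"
  proof (rule lipschitz_onI)
   fix p q
   have "(%k. dist (\<psi> (\<sigma> k) p) (\<psi> (\<sigma> k) q)) \<longlonglongrightarrow> dist (\<phi> p) (\<phi> q)"
    by (intro tendsto_dist lim)
   thus "dist (\<phi> p) (\<phi> q) <= R * dist p q" using lip by (intro LIMSEQ_le_const2) (auto simp: lipschitz_on_def)
  qed (rule R)
  hence cont: "continuous_on UNIV \<phi>" by (rule lip_cont)
  fix E assume E: "compact E" "E <= K"
  let ?S = "{p. E Int subdiff \<phi> p ~= {}}"
  have "closed ?S"
  proof -
   have "closed {z :: 'a \<times> 'a. \<forall>r. \<phi> (snd z) + fst z .* (r - snd z) <= \<phi> r}"
    by (intro closed_Collect_all closed_Collect_le continuous_intros continuous_on_compose2[OF cont]) auto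
   hence "closed {p. \<exists>x. x : E & (x, p) : {z. \<forall>r. \<phi> (snd z) + fst z .* (r - snd z) <= \<phi> r}}"
    using E(1) by (intro closed_compact_projection)
   moreover have "?S = {p. \<exists>x. x : E & (x, p) : {z. \<forall>r. \<phi> (snd z) + fst z .* (r - snd z) <= \<phi> r}}"
    by (auto simp: subdiff_def)
   ultimately show ?thesis by simp
  qed
  hence S: "?S : sets borel" by simp
  \<comment> \<open>A point in all \<open>B j\<close> has, for infinitely many of the approximating
    potentials, a subgradient whose distance from \<open>E\<close> tends to 0. A limit point of
    these subgradients lies in \<open>E\<close> and is a subgradient of the limit potential.\<close>
  define B where "B j = (\<Union>k\<in>{j..}. H (\<sigma> k) E)" for j
  have B: "B j : sets \<omega>" for j unfolding B_def using *(5) by (intro sets.countable_UN') auto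
  have "decseq B" unfolding decseq_def B_def by (intro allI impI UN_mono) auto
  have "c * measure lborel E <= measure \<omega> (B j)" for j
  proof -
   have "measure \<omega> (H (\<sigma> j) E) <= measure \<omega> (B j)" using B by (intro finite_measure_mono) (auto simp: B_def)
   thus ?thesis using *(6)[OF E, of "\<sigma> j"] by simp
  qed
  moreover have "(%j. measure \<omega> (B j)) \<longlonglongrightarrow> measure \<omega> (\<Inter>j. B j)"
   using B \<open>decseq B\<close> by (intro finite_Lim_measure_decseq) auto
  ultimately have "c * measure lborel E <= measure \<omega> (\<Inter>j. B j)" by (intro LIMSEQ_le_const) auto
  also have "... <= measure \<omega> ?S"
  proof (rule finite_measure_mono)
   show "(\<Inter>j. B j) <= ?S"
   proof
    fix p assume "p : (\<Inter>j. B j)"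
    hence "\<forall>j. \<exists>k\<ge>j. p : H (\<sigma> k) E" by (auto simp: B_def)
    then obtain \<tau> where \<tau>: "!!j. \<tau> j >= j" "!!j. p : H (\<sigma> (\<tau> j)) E" by metis
    have "\<forall>j. \<exists>x y. x : F (\<sigma> (\<tau> j)) & y : E & dist x y < inverse (real (Suc (\<sigma> (\<tau> j)))) & x : subdiff (\<psi> (\<sigma> (\<tau> j))) p"
     using *(7)[OF \<tau>(2)] by blast
    then obtain x y where xy: "!!j. y j : E" "!!j. dist (x j) (y j) < inverse (real (Suc (\<sigma> (\<tau> j))))"
     "!!j. x j : subdiff (\<psi> (\<sigma> (\<tau> j))) p" by metis
    obtain l \<rho> where l: "l : E" "strict_mono (\<rho> :: nat => nat)" "(y \<circ> \<rho>) \<longlonglongrightarrow> l"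
     using E(1) xy(1) unfolding compact_def by metis
    have far: "\<sigma> (\<tau> (\<rho> j)) >= j" for j
     using \<tau>(1)[of "\<rho> j"] seq_suble[OF l(2), of j] seq_suble[OF \<sigma>, of "\<tau> (\<rho> j)"] by linarith
    have "(%j. dist (x (\<rho> j)) (y (\<rho> j))) \<longlonglongrightarrow> 0"
    proof (rule tendsto_sandwich[OF _ _ tendsto_const LIMSEQ_inverse_real_of_nat])
     show "\<forall>\<^sub>F j in sequentially. dist (x (\<rho> j)) (y (\<rho> j)) <= inverse (real (Suc j))"
     proof (intro always_eventually allI)
      fix j
      have "inverse (real (Suc (\<sigma> (\<tau> (\<rho> j))))) <= inverse (real (Suc j))" using far[of j] by (intro le_imp_inverse_le) auto
      thus "dist (x (\<rho> j)) (y (\<rho> j)) <= inverse (real (Suc j))" using xy(2)[of "\<rho> j"] by linarith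
     qed
    qed auto
    hence xl0: "(%j. dist (x (\<rho> j)) (y (\<rho> j)) + dist (y (\<rho> j)) l) \<longlonglongrightarrow> 0 + 0"
     using l(3)[unfolded tendsto_dist_iff[of _ l] o_def] by (rule tendsto_add)
    have "(%j. dist (x (\<rho> j)) l) \<longlonglongrightarrow> 0"
    proof (rule tendsto_sandwich[OF _ _ tendsto_const])
     show "(%j. dist (x (\<rho> j)) (y (\<rho> j)) + dist (y (\<rho> j)) l) \<longlonglongrightarrow> 0" using xl0 by simp
    qed (simp_all add: dist_triangle)
    hence xl: "(%j. x (\<rho> j)) \<longlonglongrightarrow> l" by (rule iffD2[OF tendsto_dist_iff])
    have flt: "filterlim (%j. \<tau> (\<rho> j)) sequentially sequentially"
    proof (rule filterlim_at_top_mono[OF filterlim_ident])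
     show "\<forall>\<^sub>F j in sequentially. j <= \<tau> (\<rho> j)"
      using \<tau>(1) seq_suble[OF l(2)] by (intro always_eventually allI) (rule order_trans)
    qed
    have lim_sub: "(%j. \<psi> (\<sigma> (\<tau> (\<rho> j))) q) \<longlonglongrightarrow> \<phi> q" for q
     by (rule filterlim_compose[OF lim flt])
    have "\<phi> p + l .* (r - p) <= \<phi> r" for r
    proof (rule LIMSEQ_le[OF tendsto_add[OF lim_sub[of p] tendsto_inner[OF xl tendsto_const]] lim_sub[of r]])
     show "\<exists>N. \<forall>n\<ge>N. \<psi> (\<sigma> (\<tau> (\<rho> n))) p + x (\<rho> n) .* (r - p) <= \<psi> (\<sigma> (\<tau> (\<rho> n))) r"
      using xy(3) unfolding subdiff_def by blast
    qed
    hence "l : subdiff \<phi> p" unfolding subdiff_def by blast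
    thus "p : ?S" using l(1) by blast
   qed
   show "?S : sets \<omega>" using S by (simp only: sets_\<omega>)
  qed
  finally show "?S : sets borel & c * measure lborel E <= measure \<omega> ?S" by (rule conjI[OF S])
 qed
qed

end

section \<open>Hausdorff measure of compact subsets of coordinate subspaces\<close>

lemma content_le_cover:
 assumes "A <= (\<Union>i. C i)" "!!i. bounded (C i) & diameter (C i) <= \<delta>"
 shows "hcontent k \<delta> A <= (\<Sum>i. ennreal (diameter (C i) ^ k))"
 unfolding raw_hausdorff_content_def using assms by (intro INF_lower) auto

lemma content_approx:
 assumes "hcontent k \<delta> A < top" "e > 0"
 obtains C where "A <= (\<Union>i. C i)" "\<forall>i::nat. bounded (C i) & diameter (C i) <= \<delta>"
  "(\<Sum>i. ennreal (diameter (C i) ^ k)) <= hcontent k \<delta> A + ennreal e"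
proof -
 have "hcontent k \<delta> A < hcontent k \<delta> A + ennreal e"
  using assms by (cases "hcontent k \<delta> A" rule: ennreal_cases) (auto simp: ennreal_less_iff simp flip: ennreal_plus)
 then obtain C where "C : {C :: nat => 'a set. A <= (\<Union>i. C i) & (\<forall>i. bounded (C i) & diameter (C i) <= \<delta>)}"
  "(\<Sum>i. ennreal (diameter (C i) ^ k)) < hcontent k \<delta> A + ennreal e"
  unfolding raw_hausdorff_content_def[of k \<delta> A] INF_less_iff by blast
 thus thesis by (intro that[of C]) auto
qed

lemma content_mono: "A <= B ==> hcontent k \<delta> A <= hcontent k \<delta> B"
 unfolding raw_hausdorff_content_def by (intro INF_superset_mono) auto

lemma content_antimono: "\<delta> <= \<delta>' ==> hcontent k \<delta>' A <= hcontent k \<delta> A"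
 unfolding raw_hausdorff_content_def by (intro INF_superset_mono) (auto intro: order_trans)

lemma content_le_raw: "\<delta> > 0 ==> hcontent k \<delta> A <= raw_hausdorff k A" unfolding raw_hausdorff_def by (intro SUP_upper) auto

lemma raw_hausdorff_le: "(!!\<delta>. \<delta> > 0 ==> hcontent k \<delta> A <= c) ==> raw_hausdorff k A <= c"
 unfolding raw_hausdorff_def by (intro SUP_least) auto

lemma raw_hausdorff_mono: "A <= B ==> raw_hausdorff k A <= raw_hausdorff k B"
 by (intro raw_hausdorff_le order_trans[OF content_mono content_le_raw])

lemma content_empty:
 assumes "k >= 1" "\<delta> > 0"
 shows "hcontent k \<delta> ({}::'a::euclidean_space set) = 0"
 using content_le_cover[of "{} :: 'a set" "%_. {}" \<delta> k] assms by (simp add: zero_power)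

lemma content_countably_subadditive:
 "hcontent k \<delta> (\<Union>i. A i) <= (\<Sum>i. hcontent k \<delta> (A i))"
proof (rule ennreal_le_epsilon)
 fix e :: real assume "0 < e" and fin: "(\<Sum>i. hcontent k \<delta> (A i)) < top"
 have "hcontent k \<delta> (A i) < top" for i
  using sum_le_suminf[of "%i. hcontent k \<delta> (A i)" "{i}"] fin by (auto intro: le_less_trans)
 hence "\<exists>C. A i <= (\<Union>j. C j) & (\<forall>j::nat. bounded (C j) & diameter (C j) <= \<delta>) &
  (\<Sum>j. ennreal (diameter (C j) ^ k)) <= hcontent k \<delta> (A i) + ennreal (e * (1/2)^Suc i)" for i
  using content_approx[of k \<delta> "A i" "e * (1/2)^Suc i"] \<open>0 < e\<close> by (metis half_gt_zero mult_pos_pos zero_less_one zero_less_power)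
 then obtain C :: "nat => nat => 'a set" where C: "!!i. A i <= (\<Union>j. C i j)"
  "!!i j. bounded (C i j) & diameter (C i j) <= \<delta>"
  "!!i. (\<Sum>j. ennreal (diameter (C i j) ^ k)) <= hcontent k \<delta> (A i) + ennreal (e * (1/2)^Suc i)" by metis
 define D where "D m = (case prod_decode m of (i, j) => C i j)" for m
 have "(\<Union>i. A i) <= (\<Union>m. D m)"
 proof (rule subsetI, elim UN_E)
  fix x i assume "x : A i"
  then obtain j where "x : C i j" using C(1)[of i] by blast
  hence "x : D (prod_encode (i, j))" by (simp add: D_def)
  thus "x : (\<Union>m. D m)" by (rule UN_I[OF UNIV_I])
 qed
 hence "hcontent k \<delta> (\<Union>i. A i) <= (\<Sum>m. ennreal (diameter (D m) ^ k))"
  using C(2) by (intro content_le_cover) (auto simp: D_def split: prod.split)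
 also have "... = (\<Sum>i. \<Sum>j. ennreal (diameter (C i j) ^ k))"
  using suminf_ennreal_2dimen[of _ "%(i, j). ennreal (diameter (C i j) ^ k)"] by (simp add: D_def case_prod_beta)
 also have "... <= (\<Sum>i. hcontent k \<delta> (A i) + ennreal (e * (1/2)^Suc i))" using C(3) by (intro suminf_le) auto
 also have "... = (\<Sum>i. hcontent k \<delta> (A i)) + (\<Sum>i. ennreal (e * (1/2)^Suc i))" by (intro suminf_add[symmetric]) auto
 also have "(\<Sum>i. ennreal (e * (1/2)^Suc i)) = ennreal e"
  using \<open>0 < e\<close> sums_mult[OF power_half_series, of e] by (intro suminf_ennreal_eq) auto
 finally show "hcontent k \<delta> (\<Union>i. A i) <= (\<Sum>i. hcontent k \<delta> (A i)) + ennreal e" .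
qed

lemma raw_hausdorff_countably_subadditive:
 "raw_hausdorff k (\<Union>i. A i) <= (\<Sum>i. raw_hausdorff k (A i))"
 by (intro raw_hausdorff_le order_trans[OF content_countably_subadditive] suminf_le content_le_raw) auto

lemma content_Un:
 assumes "k >= 1" "\<delta> > 0"
 shows "hcontent k \<delta> (A Un B) <= hcontent k \<delta> A + hcontent k \<delta> (B::'a::euclidean_space set)"
proof -
 define F where "F i = (if i = 0 then A else if i = (1::nat) then B else {})" for i
 have "(\<Sum>i. hcontent k \<delta> (F i)) = (\<Sum>i\<in>{0,1}. hcontent k \<delta> (F i))"
  using assms by (intro suminf_finite) (auto simp: F_def content_empty)
 moreover have "(\<Union>i. F i) = A Un B" by (auto simp: F_def split: if_splits)
 ultimately show ?thesis using content_countably_subadditive[of k \<delta> F] by (simp add: F_def)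
qed

lemma content_finite_UN:
 assumes "finite I" "k >= 1" "\<delta> > 0"
 shows "hcontent k \<delta> (\<Union>i\<in>I. A i) <= (\<Sum>i\<in>I. hcontent k \<delta> (A i :: 'a::euclidean_space set))" using assms(1)
proof (induction rule: finite_induct)
 case (insert i I)
 thus ?case using order_trans[OF content_Un[OF assms(2,3), of "A i" "\<Union>i\<in>I. A i"] add_left_mono] by simp
qed (use content_empty[OF assms(2,3)] in simp)

lemma raw_hausdorff_Un: "k >= 1 ==> raw_hausdorff k (A Un B) <= raw_hausdorff k A + raw_hausdorff k B"
 by (intro raw_hausdorff_le order_trans[OF content_Un] add_mono content_le_raw)

lemma raw_hausdorff_countable_UN:
 fixes A :: "'i => 'a::euclidean_space set"
 assumes "countable I" "k >= 1"
 shows "raw_hausdorff k (\<Union>i\<in>I. A i) <= (\<integral>\<^sup>+i. raw_hausdorff k (A i) \<partial>count_space I)"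
proof -
 let ?N = "to_nat_on I ` I" and ?a = "from_nat_into I"
 have ha: "?a (to_nat_on I i) = i" if "i : I" for i using assms(1) that by simp
 have bij: "bij_betw (to_nat_on I) I ?N" by (simp add: bij_betw_def inj_on_to_nat_on assms(1))
 have e: "raw_hausdorff k ({} :: 'a set) = 0" using raw_hausdorff_le[of k "{} :: 'a set" 0] content_empty assms(2) by force
 have "(\<Union>i\<in>I. A i) <= (\<Union>n. if n : ?N then A (?a n) else {})" using ha by fastforce
 hence "raw_hausdorff k (\<Union>i\<in>I. A i) <= (\<Sum>n. raw_hausdorff k (if n : ?N then A (?a n) else {}))"
  by (rule order_trans[OF raw_hausdorff_mono raw_hausdorff_countably_subadditive])
 also have "... = (\<integral>\<^sup>+n. raw_hausdorff k (A (?a n)) * indicator ?N n \<partial>count_space UNIV)"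
  unfolding nn_integral_count_space_nat by (intro suminf_cong) (simp add: e indicator_def)
 also have "... = (\<integral>\<^sup>+i. raw_hausdorff k (A (?a (to_nat_on I i))) \<partial>count_space I)"
  unfolding nn_integral_bij_count_space[OF bij, of "%n. raw_hausdorff k (A (?a n))"] by (simp add: nn_integral_count_space_indicator)
 also have "... = (\<integral>\<^sup>+i. raw_hausdorff k (A i) \<partial>count_space I)" by (intro nn_integral_cong) (simp add: ha)
 finally show ?thesis .
qed

lemma content_similar_le:
 fixes f :: "'a::euclidean_space => 'b::euclidean_space"
 assumes f: "!!x y. dist (f x) (f y) = s * dist x y" and s: "s > 0"
 shows "hcontent k (s * \<delta>) (f ` A) <= ennreal (s ^ k) * hcontent k \<delta> A"
proof -
 have "hcontent k (s * \<delta>) (f ` A) / ennreal (s ^ k) <= hcontent k \<delta> A" unfolding raw_hausdorff_content_def[of k \<delta>]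
 proof (rule INF_greatest, elim CollectE conjE)
  fix C :: "nat => 'a set" assume C: "A <= (\<Union>i. C i)" "\<forall>i. bounded (C i) & diameter (C i) <= \<delta>"
  have d: "dist (f x) (f y) <= s * diameter (C i)" if "x : C i" "y : C i" for x y i
   using diameter_bounded_bound[of "C i"] C(2) that s by (simp add: f)
  have im: "bounded (f ` C i)" "diameter (f ` C i) <= s * diameter (C i)" for i
  proof -
   show "bounded (f ` C i)" unfolding bounded_two_points using d by blast
   show "diameter (f ` C i) <= s * diameter (C i)" using d s C(2) by (intro diameter_le) (auto simp: dist_norm diameter_ge_0)
  qed
  have "f ` A <= (\<Union>i. f ` C i)" using C(1) by blast
  moreover have "bounded (f ` C i) & diameter (f ` C i) <= s * \<delta>" for i
   using im[of i] s C(2) by (auto intro: order_trans[OF im(2) mult_left_mono])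
  ultimately have "hcontent k (s * \<delta>) (f ` A) <= (\<Sum>i. ennreal (diameter (f ` C i) ^ k))" by (rule content_le_cover)
  also have "... <= (\<Sum>i. ennreal (s ^ k) * ennreal (diameter (C i) ^ k))"
  proof (intro suminf_le allI)
   fix i
   have "diameter (f ` C i) ^ k <= (s * diameter (C i)) ^ k" using im[of i] by (intro power_mono diameter_ge_0)
   thus "ennreal (diameter (f ` C i) ^ k) <= ennreal (s ^ k) * ennreal (diameter (C i) ^ k)"
    using s C(2) by (simp add: power_mult_distrib diameter_ge_0 flip: ennreal_mult)
  qed auto
  finally show "hcontent k (s * \<delta>) (f ` A) / ennreal (s ^ k) <= (\<Sum>i. ennreal (diameter (C i) ^ k))"
   using s by (intro divide_le_posI_ennreal) auto
 qed
 hence "ennreal (s ^ k) * (hcontent k (s * \<delta>) (f ` A) / ennreal (s ^ k)) <= ennreal (s ^ k) * hcontent k \<delta> A"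
  by (rule mult_left_mono) simp
 thus ?thesis using s by (simp add: ennreal_times_divide mult_divide_eq_ennreal mult.commute[of _ "hcontent k (s * \<delta>) (f ` A)"])
qed

lemma raw_hausdorff_similar_le:
 fixes f :: "'a::euclidean_space => 'b::euclidean_space"
 assumes f: "!!x y. dist (f x) (f y) = s * dist x y" and s: "s > 0"
 shows "raw_hausdorff k (f ` A) <= ennreal (s ^ k) * raw_hausdorff k A"
proof (rule raw_hausdorff_le)
 fix \<delta> :: real assume "\<delta> > 0"
 thus "hcontent k \<delta> (f ` A) <= ennreal (s ^ k) * raw_hausdorff k A"
  using order_trans[OF content_similar_le[OF f s, of k "\<delta> / s"] mult_left_mono[OF content_le_raw]] s by simp
qed

lemma raw_hausdorff_isometric:
 fixes f :: "'a::euclidean_space => 'b::euclidean_space"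
 assumes f: "!!x y. dist (f x) (f y) = dist x y" and g: "!!x y. dist (g x) (g y) = dist x y" and inv: "!!x. g (f x) = x"
 shows "raw_hausdorff k (f ` A) = raw_hausdorff k A"
 using raw_hausdorff_similar_le[of f 1 k A] raw_hausdorff_similar_le[of g 1 k "f ` A"] f g by (intro antisym) (simp_all add: image_image inv)

section \<open>Hausdorff measure as volume of a thickened set\<close>

locale coordinate_subspace =
 fixes S :: "'a::euclidean_space set"
 assumes S: "S <= Basis" "S ~= {}"
begin

definition coord_proj :: "'a => 'a" where
 "coord_proj x = (\<Sum>b\<in>S. (x .* b) *: b)"

text \<open>Thickening by an open cube of side 2 in the transversal directions turns measure inside
  the span of \<open>S\<close> into volume; \<open>2 ^ codim\<close> is the volume of the
  fibre.\<close>

definition slab :: "'a set => 'a set" where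
 "slab E = {x. coord_proj x : E & (\<forall>b\<in>Basis - S. -1 < x .* b & x .* b < 1)}"

definition cube :: "'a => real => 'a set" where
 "cube z s = cbox z (z + s *: \<Sum>S)"

abbreviation "codim \<equiv> DIM('a) - card S"
abbreviation "unit_vol \<equiv> raw_hausdorff (card S) (cbox 0 (\<Sum>S))"

lemma finite_S: "finite S" and card_S: "card S >= 1" and card_codim: "card (Basis - S) = codim"
proof -
 show fin: "finite S" using S finite_subset finite_Basis by blast
 show "card S >= 1" using S fin by (simp add: Suc_le_eq card_gt_0_iff)
 show "card (Basis - S) = codim" using S fin by (simp add: card_Diff_subset)
qed

lemma sum_inner: "T <= Basis ==> b : Basis ==> (\<Sum>c\<in>T. f c *: c) .* b = (if b : T then f b else 0)"
proof -
 assume T: "T <= Basis" "b : Basis"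
 hence "(\<Sum>c\<in>T. f c *: c) .* b = (\<Sum>c\<in>T. if c = b then f b else 0)"
  unfolding inner_sum_left by (intro sum.cong) (auto simp: inner_Basis subset_iff)
 thus ?thesis using finite_subset[OF T(1)] by simp
qed

lemma coord_proj_inner: "b : Basis ==> coord_proj x .* b = (if b : S then x .* b else 0)"
 unfolding coord_proj_def by (rule sum_inner[OF S(1)])

lemma sum_S_inner: "b : Basis ==> \<Sum>S .* b = (if b : S then 1 else 0)" using sum_inner[OF S(1), of b "%_. 1"] by simp

lemma span_S_iff: "x : span S \<longleftrightarrow> (\<forall>b\<in>Basis - S. x .* b = 0)" using S span_substd_basis[of S] by auto

lemma slab_borel: "E : sets borel ==> slab E : sets borel"
proof -
 assume E: "E : sets borel"
 have "coord_proj : borel_measurable borel" unfolding coord_proj_def[abs_def] by (intro cont_borel continuous_intros)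
 from measurable_sets[OF this E] have "{x. coord_proj x : E} : sets borel" by (simp add: vimage_def)
 moreover have "open (\<Inter>b\<in>Basis - S. {x::'a. -1 < x .* b & x .* b < 1})"
  by (intro open_INT ballI open_Collect_conj open_Collect_less continuous_intros) auto
 ultimately have "{x. coord_proj x : E} Int (\<Inter>b\<in>Basis - S. {x. -1 < x .* b & x .* b < 1}) : sets borel" by auto
 thus ?thesis by (rule back_subst[of "%A. A : sets borel"]) (auto simp: slab_def)
qed

lemma emeasure_coordinate_box:
 assumes w: "!!b. b : Basis ==> q .* b - p .* b = (if b : S then s else t)" and st: "0 <= s" "0 <= t"
 shows "vol (cbox p q) = ennreal (s ^ card S * t ^ codim)" "vol (box p q) = ennreal (s ^ card S * t ^ codim)"
proof -
 have "(\<Prod>b\<in>Basis. (q - p) .* b) = (\<Prod>b\<in>Basis. if b : S then s else t)" using w by (intro prod.cong) (auto simp: idl)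
 also have "... = s ^ card S * t ^ codim" using S by (simp add: prod.If_cases Int_absorb1 flip: card_codim) (simp add: Diff_eq)
 finally have *: "(\<Prod>b\<in>Basis. (q - p) .* b) = s ^ card S * t ^ codim" .
 have "p .* b <= q .* b" if "b : Basis" for b using w[OF that] st by (simp split: if_splits)
 thus "vol (cbox p q) = ennreal (s ^ card S * t ^ codim)" "vol (box p q) = ennreal (s ^ card S * t ^ codim)"
  by (simp_all add: emeasure_lborel_cbox emeasure_lborel_box *)
qed

lemma raw_hausdorff_cube:
 assumes s: "s > 0"
 shows "raw_hausdorff k (cube z s) = ennreal (s ^ k) * raw_hausdorff k (cbox 0 (\<Sum>S))"
proof (rule antisym)
 have ne: "cbox 0 (\<Sum>S) ~= {}" "cube z s ~= {}" using s by (auto simp: cube_def box_ne_empty sum_S_inner ial)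
 have "cube z s = (%x. z + s *: x) ` cbox 0 (\<Sum>S)" using s ne image_affinity_cbox[of s z 0 "\<Sum>S"] by (simp add: cube_def add.commute)
 thus "raw_hausdorff k (cube z s) <= ennreal (s ^ k) * raw_hausdorff k (cbox 0 (\<Sum>S))"
  using raw_hausdorff_similar_le[of "%x. z + s *: x" s k "cbox 0 (\<Sum>S)"] s by (simp add: dist_norm flip: scaleR_diff_right)
 have "cbox 0 (\<Sum>S) = (%x. - (1/s) *: z + (1/s) *: x) ` cube z s"
  using s ne image_affinity_cbox[of "1/s" "- (1/s) *: z" z "z + s *: \<Sum>S"] by (simp add: cube_def add.commute scaleR_add_right)
 hence "raw_hausdorff k (cbox 0 (\<Sum>S)) <= ennreal ((1/s) ^ k) * raw_hausdorff k (cube z s)"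
  using raw_hausdorff_similar_le[of "%x. - (1/s) *: z + (1/s) *: x" "1/s" k "cube z s"] s by (simp add: dist_norm flip: scaleR_diff_right)
 hence "ennreal (s ^ k) * raw_hausdorff k (cbox 0 (\<Sum>S)) <= ennreal (s ^ k) * (ennreal ((1/s) ^ k) * raw_hausdorff k (cube z s))"
  by (rule mult_left_mono) simp
 also have "... = raw_hausdorff k (cube z s)" using s by (simp add: power_one_over flip: mult.assoc ennreal_mult)
 finally show "ennreal (s ^ k) * raw_hausdorff k (cbox 0 (\<Sum>S)) <= raw_hausdorff k (cube z s)" .
qed

text \<open>The unit cube consists of \<open>2 ^ card S\<close> copies scaled by \<open>1/2\<close>, so the content at scale \<open>\<delta> / 2\<close> is at most the one at scale \<open>\<delta>\<close>.\<close>

lemma unit_vol_finite: "unit_vol < top"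
proof -
 let ?C = "cbox 0 (\<Sum>S)" and ?k = "card S"
 define d where "d = diameter ?C + 1"
 have d: "0 < d" using diameter_ge_0[of ?C] by (simp add: d_def add_nonneg_pos)
 have half: "hcontent ?k (1/2 * \<delta>) ?C <= hcontent ?k \<delta> ?C" if \<delta>: "\<delta> > 0" for \<delta>
 proof -
  let ?f = "%T x. (1/2) *: (\<Sum>T + x)"
  have "?C <= (\<Union>T\<in>Pow S. ?f T ` ?C)"
  proof
   fix x assume x: "x : ?C"
   define T where "T = {b : S. 1/2 <= x .* b}"
   have T: "T <= S" by (auto simp: T_def)
   have "2 *: x - \<Sum>T : ?C" unfolding mem_box
   proof
    fix b :: 'a assume b: "b : Basis"
    have "\<Sum>T .* b = (if b : T then 1 else 0)" using sum_inner[OF order_trans[OF T S(1)] b, of "%_. 1"] by simp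
    thus "0 .* b <= (2 *: x - \<Sum>T) .* b & (2 *: x - \<Sum>T) .* b <= \<Sum>S .* b"
     using x b sum_S_inner[OF b] by (auto simp: mem_box T_def idl split: if_splits)
   qed
   thus "x : (\<Union>T\<in>Pow S. ?f T ` ?C)" using T by (intro UN_I[of T] image_eqI[of _ _ "2 *: x - \<Sum>T"]) auto
  qed
  hence "hcontent ?k (1/2 * \<delta>) ?C <= (\<Sum>T\<in>Pow S. hcontent ?k (1/2 * \<delta>) (?f T ` ?C))"
   using \<delta> finite_S card_S by (intro order_trans[OF content_mono content_finite_UN]) auto
  also have "... <= (\<Sum>T\<in>Pow S. ennreal ((1/2) ^ ?k) * hcontent ?k \<delta> ?C)"
   by (intro sum_mono content_similar_le) (auto simp: dist_norm simp flip: scaleR_diff_right)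
  also have "... = (2 ^ ?k * ennreal ((1/2) ^ ?k)) * hcontent ?k \<delta> ?C" using finite_S by (simp add: card_Pow mult.assoc)
  also have "2 ^ ?k * ennreal ((1/2) ^ ?k) = 1"
   by (simp add: power_one_over ennreal_numeral[symmetric] ennreal_power del: ennreal_numeral flip: ennreal_mult)
  finally show ?thesis by simp
 qed
 have small: "hcontent ?k (d / 2 ^ j) ?C <= hcontent ?k d ?C" for j
 proof (induction j)
  case (Suc j)
  thus ?case using order_trans[OF half[of "d / 2 ^ j"]] d by simp
 qed simp
 have "raw_hausdorff ?k ?C <= hcontent ?k d ?C"
 proof (rule raw_hausdorff_le)
  fix \<delta> :: real assume "\<delta> > 0"
  then obtain j where "(1/2) ^ j < \<delta> / d" using real_arch_pow_inv[of "\<delta> / d" "1/2"] d by auto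
  hence "d / 2 ^ j <= \<delta>" using d by (simp add: field_simps power_one_over)
  thus "hcontent ?k \<delta> ?C <= hcontent ?k d ?C" using order_trans[OF content_antimono small] by blast
 qed
 also have "... <= (\<Sum>i::nat. ennreal (diameter (if i = 0 then ?C else {}) ^ ?k))" using d by (intro content_le_cover) (auto simp: d_def)
 also have "... = (\<Sum>i\<in>{0::nat}. ennreal (diameter (if i = 0 then ?C else {}) ^ ?k))"
  using card_S by (intro suminf_finite) (auto simp: zero_power)
 also have "... < top" by simp
 finally show ?thesis .
qed

text \<open>A set of diameter \<open>d\<close> lies over a box with sides \<open>2 * d\<close> along
  \<open>S\<close>. The slabs over these boxes cover the slab over the unit cube, so their total
  volume, and with it the sum of the powers of the diameters, is bounded below.\<close>

lemma unit_vol_pos: "0 < unit_vol"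
proof -
 let ?C = "cbox 0 (\<Sum>S)" and ?k = "card S"
 have "ennreal ((1/2) ^ ?k) <= (\<Sum>i. ennreal (diameter (D i) ^ ?k))"
  if D: "?C <= (\<Union>i. D i)" "\<forall>i. bounded (D i) & diameter (D i) <= 1" for D :: "nat => 'a set"
 proof -
  \<comment> \<open>The centre of an empty \<open>D i\<close> is arbitrary, but it is used only for
    sets that contain a point.\<close>
  define c d where "c i = (SOME c. c : D i)" and "d i = diameter (D i)" for i
  define F where "F i = cbox (\<Sum>b\<in>Basis. (if b : S then c i .* b - d i else -1) *: b) (\<Sum>b\<in>Basis. (if b : S then c i .* b + d i else 1) *: b)" for i
  have d: "0 <= d i" for i using D(2) by (simp add: d_def diameter_ge_0)
  have F: "vol (F i) = ennreal ((2 * d i) ^ ?k * 2 ^ codim)" for i unfolding F_def using d[of i] by (intro emeasure_coordinate_box) auto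
  let ?W = "box (\<Sum>b\<in>Basis. (if b : S then 0 else -1) *: b) (\<Sum>b\<in>Basis. 1 *: b :: 'a)"
  have "ennreal (1 ^ ?k * 2 ^ codim) = vol ?W" by (intro emeasure_coordinate_box(2)[symmetric]) auto
  also have "... <= vol (\<Union>i. F i)"
  proof (rule emeasure_mono)
   show "?W <= (\<Union>i. F i)"
   proof
    fix x assume x: "x : ?W"
    hence "coord_proj x : ?C" by (force simp: mem_box coord_proj_inner sum_S_inner)
    then obtain i where i: "coord_proj x : D i" using D(1) by blast
    hence "c i : D i" unfolding c_def by (rule someI)
    hence "dist (coord_proj x) (c i) <= d i" using D(2) i unfolding d_def by (intro diameter_bounded_bound) auto
    hence "\<bar>(coord_proj x - c i) .* b\<bar> <= d i" if "b : Basis" for b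
     using Basis_le_norm[OF that, of "coord_proj x - c i"] by (simp add: dist_norm)
    hence "x : F i" using x unfolding F_def by (fastforce simp: mem_box coord_proj_inner idl abs_le_iff)
    thus "x : (\<Union>i. F i)" by blast
   qed
  qed (auto simp: F_def)
  also have "... <= (\<Sum>i. vol (F i))" by (intro emeasure_subadditive_countably) (auto simp: F_def)
  also have "... = (\<Sum>i. ennreal (2 ^ ?k * 2 ^ codim) * ennreal (d i ^ ?k))"
   unfolding F using d by (simp add: power_mult_distrib ennreal_mult[symmetric] mult_ac)
  finally have "ennreal (2 ^ codim) <= ennreal (2 ^ ?k * 2 ^ codim) * (\<Sum>i. ennreal (d i ^ ?k))" by simp
  hence "ennreal ((1/2) ^ ?k / 2 ^ codim) * ennreal (2 ^ codim)
   <= ennreal ((1/2) ^ ?k / 2 ^ codim) * (ennreal (2 ^ ?k * 2 ^ codim) * (\<Sum>i. ennreal (d i ^ ?k)))" by (rule mult_left_mono) simp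
  thus ?thesis by (simp add: d_def power_one_over flip: mult.assoc ennreal_mult)
 qed
 hence "ennreal ((1/2) ^ ?k) <= hcontent ?k 1 ?C" unfolding raw_hausdorff_content_def by (intro INF_greatest) auto
 also have "... <= raw_hausdorff ?k ?C" by (intro content_le_raw) auto
 finally show ?thesis by (rule less_le_trans[rotated]) simp
qed

end

context coordinate_subspace
begin

lemma bounded_subset_coordinate_box:
 assumes E: "bounded E"
 obtains M where "M > 0" "!!x b. x : E ==> b : Basis ==> \<bar>x .* b\<bar> <= M"
proof -
 obtain M where "M > 0" "!!x. x : E ==> norm x <= M" using E unfolding bounded_pos by blast
 thus thesis using that Basis_le_norm order_trans by metis
qed

text \<open>A slab is covered by boxes, with side lengths \<open>s\<close> along \<open>S\<close> and \<open>t\<close> otherwise, of almost minimal total volume. On average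
 over the position \<open>y\<close> in the directions transversal to \<open>S\<close>, the sections of the boxes have total volume at most that of the slab.\<close>

lemma raw_hausdorff_le_vol:
 assumes E: "bounded E" "E <= span S" "E : sets borel"
 shows "2 ^ codim * raw_hausdorff (card S) E <= unit_vol * vol (slab E)"
proof -
 obtain M where M: "M > 0" "!!x b. x : E ==> b : Basis ==> \<bar>x .* b\<bar> <= M"
  by (rule bounded_subset_coordinate_box[OF E(1)]) (rule that)
 define w where "w = (\<Sum>b\<in>Basis. (if b : S then M else 1) *: b)"
 have w: "w .* b = (if b : S then M else 1)" if "b : Basis" for b using that by (simp add: w_def)
 have sl: "slab E <= cbox (- w) w"
 proof
  fix x assume x: "x : slab E"
  show "x : cbox (- w) w" unfolding mem_box
  proof
   fix b :: 'a assume b: "b : Basis"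
   thus "- w .* b <= x .* b & x .* b <= w .* b"
    using x M(2)[of "coord_proj x" b] by (cases "b : S") (auto simp: slab_def coord_proj_inner w abs_le_iff dest!: bspec[of "Basis - S" _ b])
  qed
 qed
 define v where "v = measure lebesgue (slab E)"
 have slL: "slab E : lmeasurable" using slab_borel[OF E(3)] bounded_subset[OF bounded_cbox sl] by (intro bounded_set_imp_lmeasurable) auto
 have v: "vol (slab E) = ennreal v" using lebesgue_lborel[OF slab_borel[OF E(3)]] emeasure_eq_measure2[OF slL] by (simp only: v_def)
 have bound: "2 ^ codim * raw_hausdorff (card S) E <= unit_vol * ennreal (v + 2 * e)" if e: "e > 0" for e
 proof -
  obtain D where D: "countable D" "!!K. K : D ==> K <= cbox (- w) w & K ~= {} & (\<exists>c d. K = cbox c d)"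
   "pairwise (%A B. interior A Int interior B = {}) D"
   "!!u v. cbox u v : D ==> \<exists>n. \<forall>i\<in>Basis. v .* i - u .* i = (w .* i - (- w) .* i)/2^n"
   "slab E <= \<Union>D" "\<Union>D : lmeasurable" "measure lebesgue (\<Union>D) <= v + e"
   unfolding v_def by (rule measurable_outer_intervals_bounded[OF slL sl e]) blast
  have "\<exists>p q n. K = cbox p q & (\<forall>i\<in>Basis. q .* i - p .* i = (if i : S then 2 * M / 2 ^ n else 2 / 2 ^ n))" if K: "K : D" for K
  proof -
   obtain p q where pq: "K = cbox p q" using D(2)[OF K] by blast
   then obtain n :: nat where "\<forall>i\<in>Basis. q .* i - p .* i = (w .* i - (- w) .* i)/2^n" using D(4) K by blast
   thus ?thesis using pq w by (intro exI[of _ p] exI[of _ q] exI[of _ n]) auto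
  qed
  then obtain p q n where K: "!!K. K : D ==> K = cbox (p K) (q K)"
   "!!K i. K : D ==> i : Basis ==> q K .* i - p K .* i = (if i : S then 2 * M / 2 ^ n K else 2 / 2 ^ n K)" by metis
  define s t where "s K = 2 * M / 2 ^ n K" and "t K = (2::real) / 2 ^ n K" for K :: "'a set"
  have st: "0 < s K" "0 < t K" for K using M(1) by (auto simp: s_def t_def)
  define T where "T K = cbox (\<Sum>b\<in>Basis. (if b : S then 0 else p K .* b) *: b) (\<Sum>b\<in>Basis. (if b : S then 1 else q K .* b) *: b)" for K
  have T: "vol (T K) = ennreal (t K ^ codim)" if "K : D" for K
   unfolding T_def using emeasure_coordinate_box(1)[of _ _ 1 "t K"] K(2)[OF that] st[of K] by (auto simp: t_def)
  define f where "f y = (\<integral>\<^sup>+K. ennreal (s K ^ card S) * indicator (T K) y \<partial>count_space D)" for y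
  have "(\<integral>\<^sup>+y. f y \<partial>lborel) = (\<integral>\<^sup>+K. \<integral>\<^sup>+y. ennreal (s K ^ card S) * indicator (T K) y \<partial>lborel \<partial>count_space D)"
   unfolding f_def by (rule nn_integral_count_space_nn_integral[OF D(1)]) (simp add: T_def)
  \<comment> \<open>The boxes may share boundary points; their interiors are disjoint, so the
    volumes can be added.\<close>
  also have "... = (\<integral>\<^sup>+K. vol (interior K) \<partial>count_space D)"
  proof (intro nn_integral_cong, simp)
   fix k assume k: "k : D"
   have "interior k = box (p k) (q k)" by (subst K(1)[OF k]) (rule interior_cbox)
   hence "vol (interior k) = ennreal (s k ^ card S * t k ^ codim)"
    using emeasure_coordinate_box(2)[of "q k" "p k" "s k" "t k"] K(2)[OF k] st[of k] by (simp add: s_def t_def)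
   thus "(\<integral>\<^sup>+y. ennreal (s k ^ card S) * indicator (T k) y \<partial>lborel) = vol (interior k)"
    using T[OF k] st[of k] by (subst nn_integral_cmult_indicator) (auto simp: T_def ennreal_mult)
  qed
  also have "... = vol (\<Union>k\<in>D. interior k)"
   using D(1,3) by (intro emeasure_UN_countable[symmetric]) (auto simp: pairwise_def disjoint_family_on_def)
  also have "... = lvol (\<Union>k\<in>D. interior k)" by (intro lebesgue_lborel[symmetric] borel_open) auto
  also have "... <= lvol (\<Union>D)"
  proof (rule emeasure_mono)
   show "(\<Union>k\<in>D. interior k) <= \<Union>D" using interior_subset by (intro UN_least) blast
   show "\<Union>D : sets lebesgue" using D(6) by (rule fmeasurableD)
  qed
  also have "... <= ennreal (v + e)" unfolding emeasure_eq_measure2[OF D(6)] by (rule ennreal_leI[OF D(7)])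
  finally have If: "(\<integral>\<^sup>+y. f y \<partial>lborel) <= ennreal (v + e)" .
  \<comment> \<open>\<open>W\<close> has volume \<open>2 ^ codim\<close>. If \<open>f\<close> were
    at least \<open>X\<close> on all of \<open>W\<close>, its integral would be at least
    \<open>v + 2 * e\<close>, but it is at most \<open>v + e\<close>.\<close>
  define X where "X = (v + 2 * e) / 2 ^ codim"
  have v0: "0 <= v" by (simp add: v_def)
  define W where "W = box (\<Sum>b\<in>Basis. (if b : S then 0 else -1) *: b) (\<Sum>b\<in>Basis. 1 *: b :: 'a)"
  have WB: "W : sets lborel" by (simp add: W_def)
  have Wm: "vol W = ennreal (1 ^ card S * 2 ^ codim)" unfolding W_def by (intro emeasure_coordinate_box(2)) auto
  have Wb: "(if b : S then 0 else -1) < y .* b & y .* b < 1" if "y : W" "b : Basis" for y b using that by (simp add: W_def mem_box)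
  have "\<exists>y\<in>W. f y <= ennreal X"
  proof (rule ccontr)
   assume "~ (\<exists>y\<in>W. f y <= ennreal X)"
   hence "ennreal X <= f y" if "y : W" for y using that by (meson linear)
   hence le: "ennreal X * indicator W y <= f y" for y by (cases "y : W") auto
   have "ennreal X * ennreal (2 ^ codim) <= ennreal (v + e)"
    using order_trans[OF nn_integral_mono[OF le] If] unfolding nn_integral_cmult_indicator[OF WB] Wm by simp
   hence "ennreal (v + 2 * e) <= ennreal (v + e)" using v0 e by (simp add: X_def flip: ennreal_mult)
   thus False using v0 e by (subst (asm) ennreal_le_iff) auto
  qed
  then obtain y where y: "y : W" "f y <= ennreal X" by blast
  let ?D = "{K : D. y : T K}"
  have "E <= (\<Union>K\<in>?D. cube (coord_proj (p K)) (s K))"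
  proof
   fix x assume x: "x : E"
   hence x0: "x .* b = 0" if "b : Basis - S" for b using E(2) that span_S_iff by blast
   let ?x = "x + (y - coord_proj y)"
   have in': "?x .* b = (if b : S then x .* b else y .* b)" if "b : Basis" for b using x0[of b] that by (simp add: ial idl coord_proj_inner)
   have "coord_proj ?x = x" by (rule euclidean_eqI) (use in' x0 in \<open>auto simp: coord_proj_inner\<close>)
   moreover have "-1 < ?x .* b & ?x .* b < 1" if "b : Basis - S" for b using in'[of b] Wb[OF y(1), of b] that by simp
   ultimately have "?x : slab E" using x by (simp add: slab_def)
   then obtain k where k: "k : D" "?x : cbox (p k) (q k)" using D(5) K(1) by blast
   have kb: "p k .* b <= ?x .* b & ?x .* b <= q k .* b" if "b : Basis" for b using k(2) that by (simp add: mem_box)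
   have "y : T k" unfolding T_def mem_box
   proof
    fix b :: 'a assume b: "b : Basis"
    show "(\<Sum>b\<in>Basis. (if b : S then 0 else p k .* b) *: b) .* b <= y .* b & y .* b <= (\<Sum>b\<in>Basis. (if b : S then 1 else q k .* b) *: b) .* b"
     using b kb[OF b] in'[OF b] Wb[OF y(1) b] by (auto split: if_splits)
   qed
   moreover have "x : cube (coord_proj (p k)) (s k)" unfolding cube_def mem_box
   proof
    fix b :: 'a assume b: "b : Basis"
    show "coord_proj (p k) .* b <= x .* b & x .* b <= (coord_proj (p k) + s k *: \<Sum>S) .* b"
     using kb[OF b] in'[OF b] K(2)[OF k(1) b] x0[of b] b by (cases "b : S") (auto simp: coord_proj_inner ial sum_S_inner s_def)
   qed
   ultimately show "x : (\<Union>K\<in>?D. cube (coord_proj (p K)) (s K))" using k(1) by blast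
  qed
  hence "raw_hausdorff (card S) E <= (\<integral>\<^sup>+K. raw_hausdorff (card S) (cube (coord_proj (p K)) (s K)) \<partial>count_space ?D)"
   using D(1) card_S by (intro order_trans[OF raw_hausdorff_mono raw_hausdorff_countable_UN]) auto
  also have "... = (\<integral>\<^sup>+K. unit_vol * (ennreal (s K ^ card S) * indicator (T K) y) \<partial>count_space D)"
   unfolding raw_hausdorff_cube[OF st(1)]
   by (subst (1 2) nn_integral_count_space_indicator) (auto simp: indicator_def mult.commute intro!: nn_integral_cong)
  also have "... = unit_vol * f y" unfolding f_def by (rule nn_integral_cmult) simp
  also have "... <= unit_vol * ennreal X" using y(2) by (rule mult_left_mono) simp
  finally have "2 ^ codim * raw_hausdorff (card S) E <= ennreal (2 ^ codim) * (unit_vol * ennreal X)"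
   by (simp add: mult_left_mono ennreal_power[symmetric])
  also have "... = unit_vol * ennreal (v + 2 * e)" using v0 e by (simp add: X_def mult.left_commute flip: ennreal_mult)
  finally show ?thesis .
 qed
 show ?thesis
 proof (rule LIMSEQ_le_const)
  have "(%m. ennreal (v + 2 * inverse (real (Suc m)))) \<longlonglongrightarrow> ennreal (v + 2 * 0)"
   by (intro tendsto_ennrealI tendsto_intros LIMSEQ_inverse_real_of_nat)
  thus "(%m. unit_vol * ennreal (v + 2 * inverse (real (Suc m)))) \<longlonglongrightarrow> unit_vol * vol (slab E)"
   using unit_vol_finite by (intro ennreal_tendsto_cmult) (simp_all add: v)
 qed (use bound in auto)
qed

text \<open>The lower bound comes from the upper bound for the complement of \<open>E\<close> in an
  enclosing cube \<open>D\<close>, because for the cube the Hausdorff measure is known exactly.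
  Finiteness of the complementary term allows it to be cancelled.\<close>

theorem raw_hausdorff_eq_vol:
 assumes E: "compact E" "E <= span S"
 shows "2 ^ codim * raw_hausdorff (card S) E = unit_vol * vol (slab E)"
proof (rule antisym)
 have EB: "E : sets borel" using E(1) by (rule borel_compact)
 show "2 ^ codim * raw_hausdorff (card S) E <= unit_vol * vol (slab E)" using E EB by (intro raw_hausdorff_le_vol compact_imp_bounded)
 obtain M where M: "M > 0" "!!x b. x : E ==> b : Basis ==> \<bar>x .* b\<bar> <= M"
  by (rule bounded_subset_coordinate_box[OF compact_imp_bounded[OF E(1)]]) (rule that)
 define D where "D = cube (- M *: \<Sum>S) (2 * M)"
 have D: "x : D \<longleftrightarrow> (\<forall>b\<in>Basis. if b : S then \<bar>x .* b\<bar> <= M else x .* b = 0)" for x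
  unfolding D_def cube_def mem_box by (intro ball_cong refl) (auto simp: ial idl sum_S_inner abs_le_iff)
 have DS: "D <= span S" "E <= D"
 proof -
  show "D <= span S" by (rule subsetI) (simp add: span_S_iff D)
  show "E <= D"
  proof
   fix x assume x: "x : E"
   hence "x : span S" using E(2) by blast
   thus "x : D" using M(2)[OF x] by (simp add: D span_S_iff)
  qed
 qed
 have DB: "D : sets borel" "bounded D" by (auto simp: D_def cube_def)
 let ?a = "vol (slab E)" and ?b = "vol (slab (D - E))" and ?r = "raw_hausdorff (card S)"
 have "?a + ?b = vol (slab E Un slab (D - E))"
 proof (rule plus_emeasure)
  show "slab E : sets lborel" "slab (D - E) : sets lborel" using slab_borel[OF EB] slab_borel[OF sets.Diff[OF DB(1) EB]] by simp_all
  show "slab E Int slab (D - E) = {}" by (auto simp: slab_def)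
 qed
 also have "... <= vol (cbox (\<Sum>b\<in>Basis. (if b : S then - M else - 1) *: b) (\<Sum>b\<in>Basis. (if b : S then M else 1) *: b :: 'a))"
 proof (rule emeasure_mono)
  have "slab E Un slab (D - E) <= slab D" using DS(2) by (auto simp: slab_def)
  also have "slab D <= cbox (\<Sum>b\<in>Basis. (if b : S then - M else - 1) *: b) (\<Sum>b\<in>Basis. (if b : S then M else 1) *: b)"
   by (force simp: slab_def D mem_box coord_proj_inner abs_le_iff)
  finally show "slab E Un slab (D - E) <= ..." .
 qed simp
 also have "... = ennreal ((2 * M) ^ card S * 2 ^ codim)" using M(1) by (intro emeasure_coordinate_box) auto
 finally have ab: "?a + ?b <= 2 ^ codim * ennreal ((2 * M) ^ card S)"
  using M(1) by (simp add: ennreal_mult mult.commute ennreal_power[symmetric])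
 have fin: "unit_vol * ?b < top"
 proof -
  have "?b <= 2 ^ codim * ennreal ((2 * M) ^ card S)" using ab by (rule order_trans[rotated]) simp
  also have "... < top" by (simp add: ennreal_mult_less_top power_less_top_ennreal)
  finally show ?thesis using unit_vol_finite by (simp add: ennreal_mult_less_top)
 qed
 have "unit_vol * ?a + unit_vol * ?b <= unit_vol * (2 ^ codim * ennreal ((2 * M) ^ card S))"
  unfolding distrib_left[symmetric] using ab by (rule mult_left_mono) simp
 also have "... = 2 ^ codim * ?r D" using M(1) by (simp add: D_def raw_hausdorff_cube mult_ac)
 also have "?r D <= ?r E + ?r (D - E)" using raw_hausdorff_Un[OF card_S, of E "D - E"] DS(2) by (simp add: Un_absorb1)
 also have "2 ^ codim * (?r E + ?r (D - E)) <= 2 ^ codim * ?r E + unit_vol * ?b"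
  unfolding distrib_left using DS(1) DB EB by (intro add_left_mono raw_hausdorff_le_vol) auto
 finally show "unit_vol * ?a <= 2 ^ codim * ?r E"
  using fin by (auto simp: add.commute[of _ "unit_vol * ?b"] ennreal_add_left_cancel_le mult_left_mono)
qed

lemma hausdorff_measure_coordinate:
 assumes E: "compact E" "E <= span S" and uc: "unit_cube (card S) = cbox 0 (\<Sum>S)"
 shows "2 ^ codim * hausdorff_measure (card S) E = vol (slab E)" unfolding hausdorff_measure_def uc
 using raw_hausdorff_eq_vol[OF E] unit_vol_finite unit_vol_pos by (simp add: ennreal_times_divide mult_divide_eq_ennreal mult.commute)

end

lemma unit_cube_obtains:
 fixes S :: "'a::euclidean_space set"
 assumes "S <= Basis" "card S = k"
 obtains S' where "S' <= Basis" "card S' = k" "unit_cube k = cbox 0 (\<Sum>S' :: 'a)"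
 using someI_ex[of "%S. S <= (Basis :: 'a set) & card S = k"] assms unfolding unit_cube_def by blast

lemma hausdorff_measure_compact:
 fixes E :: "'a::euclidean_space set"
 assumes E: "compact E"
 shows "hausdorff_measure DIM('a) E = vol E"
proof -
 interpret coordinate_subspace "Basis :: 'a set" by unfold_locales auto
 obtain S' :: "'a set" where S': "S' <= Basis" "card S' = DIM('a)" "unit_cube DIM('a) = cbox 0 (\<Sum>S' :: 'a)"
  by (rule unit_cube_obtains[of Basis "DIM('a)"]) auto
 hence "S' = Basis" by (intro card_subset_eq) auto
 thus ?thesis using hausdorff_measure_coordinate[OF E] S'(3) by (simp add: slab_def coord_proj_def euclidean_representation)
qed

lemma hausdorff_measure_diff_null:
 fixes K B :: "'a::euclidean_space set"
 assumes K: "compact K" and B: "closed B" and null: "vol (K - B) = 0"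
 shows "hausdorff_measure DIM('a) (K - B) = 0"
proof -
 interpret coordinate_subspace "Basis :: 'a set" by unfold_locales auto
 have "K - B : sets borel" using B borel_compact[OF K] by auto
 moreover have "slab (K - B) = K - B" by (auto simp: slab_def coord_proj_def euclidean_representation)
 ultimately show ?thesis using raw_hausdorff_le_vol[of "K - B"] bounded_diff[OF compact_imp_bounded[OF K]] null
  by (simp add: hausdorff_measure_def)
qed

section \<open>Rotations and sets in arbitrary hyperplanes\<close>

lemma orthogonal_inverse_exists:
 fixes g :: "'a::euclidean_space => 'a"
 assumes g: "orthogonal_transformation g"
 shows "\<exists>g'. orthogonal_transformation g' & (\<forall>x. g (g' x) = x) & (\<forall>x. g' (g x) = x)"
proof -
 have b: "bij g" by (rule orthogonal_transformation_bij[OF g])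
 show ?thesis by (intro exI[of _ "inv g"] conjI allI orthogonal_transformation_inv[OF g]
   surj_f_inv_f[OF bij_is_surj[OF b]] inv_f_f[OF bij_is_inj[OF b]])
qed

lemma emeasure_orthogonal_image:
 fixes f :: "real^'n => real^'n"
 assumes f: "orthogonal_transformation f" and A: "A : sets borel"
 shows "vol (f ` A) = vol A" "f ` A : sets borel"
proof -
 have lin: "linear f" using f by (rule orth_linear)
 obtain g where g: "orthogonal_transformation g" "!!x. g (f x) = x" "!!x. f (g x) = x" using orthogonal_inverse_exists[OF f] by blast
 have "f ` A = g -` A" using g(2,3) by (auto simp: image_iff) metis
 moreover have "g : borel_measurable borel" using orth_linear[OF g(1)] by (intro cont_borel linear_continuous_on) (simp add: linear_linear)
 ultimately show fA: "f ` A : sets borel" using measurable_sets[of g borel borel A] A by simp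
 have "lvol (f ` A) = (\<integral>\<^sup>+x. ennreal \<bar>det (matrix f)\<bar> * indicator A x \<partial>lebesgue)"
 proof (rule emeasure_image)
  show "A : sets lebesgue" using A by simp
  show "(f has_derivative f) (at x within A)" for x
   using lin by (simp add: has_derivative_linear linear_linear bounded_linear_imp_has_derivative)
  show "inj_on f A" using orthogonal_transformation_inj[OF f] by (rule inj_on_subset) simp
 qed
 thus "vol (f ` A) = vol A" using A fA by (simp add: orthogonal_transformation_det[OF f] lebesgue_lborel)
qed

text \<open>The hyperplane is rotated onto the coordinate hyperplane of precisely that set
  \<open>S\<close> which \<open>unit_cube\<close> has chosen, so that the normalizing constant of
  \<open>hausdorff_measure\<close> cancels literally.\<close>

theorem hausdorff_measure_hyperplane:
 fixes E :: "(real^'n) set"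
 assumes n: "CARD('n) >= 2" and u: "norm u = 1" and E: "compact E" "!!x. x : E ==> u .* x = 0"
 shows "2 * hausdorff_measure (CARD('n) - 1) E = vol {y. y - (u .* y) *: u : E & \<bar>u .* y\<bar> < 1}"
  (is "_ = vol ?T")
proof -
 obtain b :: "real^'n" where b: "b : Basis" using nonempty_Basis by blast
 obtain S :: "(real^'n) set" where SB: "S <= Basis" "card S = CARD('n) - 1" "unit_cube (CARD('n) - 1) = cbox 0 (\<Sum>S :: real^'n)"
  by (rule unit_cube_obtains[of "Basis - {b}" "CARD('n) - 1"]) (use b in auto)
 have "card (Basis - S) = 1" using SB n by (simp add: card_Diff_subset finite_subset[OF SB(1)])
 then obtain c where c: "Basis - S = {c}" by (auto simp: card_1_singleton_iff)
 hence c': "c : Basis" "S = Basis - {c}" using SB(1) by auto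
 have "S ~= {}" using SB(2) n by auto
 then interpret coordinate_subspace S by unfold_locales (use SB(1) in auto)
 obtain f where f: "orthogonal_transformation f" "f u = c" using orthogonal_transformation_exists_1[OF u, of c] c'(1) by auto
 obtain g where g: "orthogonal_transformation g" "!!x. g (f x) = x" "!!x. f (g x) = x" using orthogonal_inverse_exists[OF f(1)] by blast
 have lin: "linear f" using f(1) by (rule orth_linear)
 have fu: "c .* f x = u .* x" for x unfolding f(2)[symmetric] using f(1) by (simp add: orthogonal_transformation_def)
 have cp: "coord_proj x = x - (c .* x) *: c" for x
 proof -
  have "(\<Sum>b\<in>Basis. (x .* b) *: b) = (x .* c) *: c + (\<Sum>b\<in>S. (x .* b) *: b)"
   unfolding c'(2) using c'(1) by (intro sum.remove) auto
  hence "(c .* x) *: c + coord_proj x = x" unfolding coord_proj_def euclidean_representation by (simp only: icomm)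
  thus ?thesis by (simp only: eq_diff_eq add.commute)
 qed
 have cf: "coord_proj (f y) = f (y - (u .* y) *: u)" for y using lin f(2) by (simp add: cp fu linear_diff linear_scale)
 have fE: "compact (f ` E)" "f ` E <= span S"
 proof -
  show "compact (f ` E)" using lin E(1) by (intro compact_continuous_image linear_continuous_on) (auto simp: linear_linear)
  show "f ` E <= span S" using E(2) by (auto simp: span_S_iff c fu icomm[of _ c])
 qed
 have im: "x : f ` A \<longleftrightarrow> g x : A" for x A using g(2,3) by (auto simp: image_iff) metis
 have fT: "slab (f ` E) = f ` ?T"
 proof (rule set_eqI)
  fix x
  have "coord_proj x = f (g x - (u .* g x) *: u)" "c .* x = u .* g x" using cf[of "g x"] fu[of "g x"] g(3) by simp_all
  thus "x : slab (f ` E) \<longleftrightarrow> x : f ` ?T" unfolding im slab_def c by (auto simp: im g(2) icomm[of _ c] abs_less_iff)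
 qed
 have iso: "raw_hausdorff k (f ` E) = raw_hausdorff k E" for k
  by (rule raw_hausdorff_isometric[of f g]) (use f(1) g in \<open>auto simp: orthogonal_transformation_isometry\<close>)
 have "2 ^ codim * hausdorff_measure (card S) (f ` E) = vol (f ` ?T)"
  unfolding fT[symmetric] by (rule hausdorff_measure_coordinate[OF fE]) (simp only: SB(2,3))
 moreover have "codim = 1" using SB(2) n by simp
 ultimately have "2 * hausdorff_measure (CARD('n) - 1) E = vol (f ` ?T)" by (simp only: hausdorff_measure_def iso SB(2) power_one_right)
 moreover have "?T : sets borel"
 proof -
  have "continuous_on UNIV (%y. y - (u .* y) *: u)" by (intro continuous_intros)
  from closed_vimage[OF compact_imp_closed[OF E(1)] this]
  have "closed {y. y - (u .* y) *: u : E}" by (simp add: vimage_def)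
  moreover have "open {y. \<bar>u .* y\<bar> < 1}" by (intro open_Collect_less continuous_intros)
  ultimately show ?thesis by (simp add: Collect_conj_eq sets.Int)
 qed
 ultimately show ?thesis using emeasure_orthogonal_image(1)[OF f(1)] by simp
qed

section \<open>The rotation invariant distribution of hyperplanes\<close>

lemma orth_proj_hyperplane:
 assumes "x ~= 0"
 shows "orth_proj {y. x .* y = 0} z = z - ((x .* z) / (x .* x)) *: x"
proof (rule orth_proj_eqI[OF subspace_hyperplane])
 show "z - ((x .* z) / (x .* x)) *: x : {y. x .* y = 0}" using assms by (simp add: idr)
 show "z - (z - ((x .* z) / (x .* x)) *: x) : {y. x .* y = 0}\<^sup>\<bottom>" by (auto simp: orthogonal_comp_def orthogonal_def icomm)
qed

lemma subspace_image_orthogonal: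
 fixes g :: "'a::euclidean_space => 'a"
 assumes g: "orthogonal_transformation g" and V: "subspace V"
 shows "subspace (g ` V)" "dim (g ` V) = dim V"
proof -
 have lin: "linear g" by (rule orth_linear[OF g])
 show "subspace (g ` V)" by (rule linear_subspace_image[OF lin V])
 show "dim (g ` V) = dim V" by (rule dim_image_eq[OF lin inj_on_subset[OF orthogonal_transformation_inj[OF g] subset_UNIV]])
qed

lemma orth_proj_image:
 fixes g :: "'a::euclidean_space => 'a"
 assumes g: "orthogonal_transformation g" "orthogonal_transformation g'" "!!x. g (g' x) = x" and V: "subspace V"
 shows "orth_proj (g ` V) x = g (orth_proj V (g' x))"
proof (rule orth_proj_eqI)
 show "subspace (g ` V)" by (rule subspace_image_orthogonal[OF g(1) V])
 show "g (orth_proj V (g' x)) : g ` V" using orth_proj_works(1)[OF V] by blast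
 have "orthogonal y (g' x - orth_proj V (g' x))" if "y : V" for y
  using orth_proj_works(2)[OF V, of "g' x"] that by (simp add: orthogonal_comp_def)
 moreover have "x - g (orth_proj V (g' x)) = g (g' x - orth_proj V (g' x))" using g by (simp add: linear_diff orth_linear)
 ultimately show "x - g (orth_proj V (g' x)) : (g ` V)\<^sup>\<bottom>"
  using g(1) by (auto simp: orthogonal_comp_def orthogonal_def orthogonal_transformation_def)
qed

lemma matrix_works_real: "linear f ==> matrix f *v x = f (x :: real^'n)" by (rule matrix_works) (simp add: linear_def scalar_mult_eq_scaleR)

lemma hyperplane_eq:
 fixes V :: "'a::euclidean_space set"
 assumes V: "subspace V" "dim V = DIM('a) - 1"
 obtains u where "norm u = 1" "V = {y. u .* y = 0}"
proof -
 have "dim V < DIM('a)" using V(2) DIM_positive[where 'a='a] by linarith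
 then obtain x where x: "x ~= 0" "!!y. y : span V ==> orthogonal x y" using orthogonal_to_subspace_exists[of V] by blast
 have "V = {y. x .* y = 0}"
 proof (rule subspace_dim_equal[OF V(1) subspace_hyperplane])
  show "V <= {y. x .* y = 0}" using x(2) by (auto simp: orthogonal_def intro: span_base)
  show "dim {y. x .* y = 0} <= dim V" using dim_hyperplane[OF x(1)] V(2) by simp
 qed
 also have "... = {y. (x /\<^sub>R norm x) .* y = 0}" using x(1) by auto
 finally show thesis using x(1) by (intro that[of "x /\<^sub>R norm x"]) auto
qed

lemma measurable_grassmannian_iff:
 assumes "!!x. x : space M ==> subspace (f x) & dim (f x) = k" "(%x. Blinfun (orth_proj (f x))) : borel_measurable M"
 shows "f : M \<rightarrow>\<^sub>M grassmannian_borel k"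
 unfolding grassmannian_borel_def by (rule measurable_vimage_algebra2) (use assms in auto)

lemma space_grassmannian: "space (grassmannian_borel k) = {V. subspace V & dim V = k}" by (simp add: grassmannian_borel_def)

lemma measurable_orth_proj: "(%V. Blinfun (orth_proj V)) : borel_measurable (grassmannian_borel k)"
 unfolding grassmannian_borel_def by (rule measurable_vimage_algebra1) simp

lemma measurable_image_grassmannian:
 fixes g :: "'a::euclidean_space => 'a"
 assumes g: "orthogonal_transformation g"
 shows "(%V. g ` V) : grassmannian_borel k \<rightarrow>\<^sub>M grassmannian_borel k"
proof (rule measurable_grassmannian_iff)
 obtain g' where g': "orthogonal_transformation g'" "!!x. g (g' x) = x" "!!x. g' (g x) = x" using orthogonal_inverse_exists[OF g] by blast
 have bl: "bounded_linear g" "bounded_linear g'" using g g' by (auto simp: linear_linear orth_linear)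
 fix V :: "'a set" assume "V : space (grassmannian_borel k)"
 thus "subspace (g ` V) & dim (g ` V) = k" using subspace_image_orthogonal[OF g, of V] by (simp add: space_grassmannian)
next
 obtain g' where g': "orthogonal_transformation g'" "!!x. g (g' x) = x" "!!x. g' (g x) = x" using orthogonal_inverse_exists[OF g] by blast
 have bl: "bounded_linear g" "bounded_linear g'" using g g' by (auto simp: linear_linear orth_linear)
 have "(%P. Blinfun g o\<^sub>L (P o\<^sub>L Blinfun g')) : borel_measurable borel" by (intro cont_borel continuous_intros)
 from mcomp[OF measurable_orth_proj this]
 have "(%V. Blinfun g o\<^sub>L (Blinfun (orth_proj V) o\<^sub>L Blinfun g')) : borel_measurable (grassmannian_borel k)" .
 also have "?this \<longleftrightarrow> (%V. Blinfun (orth_proj (g ` V))) : borel_measurable (grassmannian_borel k)"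
 proof (rule measurable_cong)
  fix V :: "'a set" assume "V : space (grassmannian_borel k)"
  hence V: "subspace V" "subspace (g ` V)" using subspace_image_orthogonal[OF g, of V] by (auto simp: space_grassmannian)
  show "Blinfun g o\<^sub>L (Blinfun (orth_proj V) o\<^sub>L Blinfun g') = Blinfun (orth_proj (g ` V))"
   by (rule blinfun_eqI) (simp add: bounded_linear_Blinfun_apply bl bounded_linear_orth_proj V orth_proj_image[OF g g'(1,2) V(1)])
 qed
 finally show "(%V. Blinfun (orth_proj (g ` V))) : borel_measurable (grassmannian_borel k)" .
qed

text \<open>Guarantees that the choice in \<open>grassmannian_measure\<close> is meaningful. The
  uniform distribution on the unit ball is pushed forward by taking a vector to its orthogonal
  hyperplane; at the null point 0 the vector \<open>e\<close> is substituted. Invariance is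
  inherited from Lebesgue measure.\<close>

theorem invariant_grassmannian_exists:
 "\<exists>\<mu>. invariant_grassmannian_prob (CARD('n) - 1) (\<mu> :: (real^'n) set measure)"
proof -
 define m0 where "m0 = uniform_measure lborel (ball (0::real^'n) 1)"
 have pos: "vol (ball (0::real^'n) 1) ~= 0" "vol (ball (0::real^'n) 1) ~= \<infinity>"
  using emeasure_bounded_finite[of "ball (0::real^'n) 1"] content_ball_pos[of 1 "0::real^'n"] by (auto simp: measure_def)
 interpret m0: prob_space m0 unfolding m0_def by (rule prob_space_uniform_measure[OF pos])
 have sets_m0: "sets m0 = sets borel" by (simp add: m0_def)
 obtain e :: "real^'n" where e: "e : Basis" using nonempty_Basis by blast
 hence e0: "e ~= 0" by auto
 define V where "V x = {y. (if x = 0 then e else x) .* y = 0}" for x :: "real^'n"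
 let ?G = "grassmannian_borel (CARD('n) - 1) :: (real^'n) set measure"
 have V: "V : borel \<rightarrow>\<^sub>M ?G"
 proof (rule measurable_grassmannian_iff)
  fix x :: "real^'n"
  show "subspace (V x) & dim (V x) = CARD('n) - 1"
   using e0 dim_hyperplane[of "if x = 0 then e else x"] subspace_hyperplane[of "if x = 0 then e else x"] by (simp add: V_def)
 next
  have "continuous_on {0} (%x. Blinfun (orth_proj (V x)))" by simp
  moreover have "continuous_on (- {0}) (%x. Blinfun (orth_proj (V x)))"
  proof (rule continuous_on_blinfun_componentwise)
   fix i :: "real^'n"
   have "continuous_on (- {0}) (%x. i - ((x .* i) / (x .* x)) *: x)" by (intro continuous_intros) auto
   moreover have "i - ((x .* i) / (x .* x)) *: x = blinfun_apply (Blinfun (orth_proj (V x))) i" if "x : - {0}" for x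
    using that by (simp add: V_def bounded_linear_Blinfun_apply bounded_linear_orth_proj subspace_hyperplane orth_proj_hyperplane)
   ultimately show "continuous_on (- {0}) (%x. blinfun_apply (Blinfun (orth_proj (V x))) i)"
    using continuous_on_cong[OF refl, of "- {0}"] by (metis (no_types, lifting))
  qed
  ultimately have "(%x. if x : {0} then Blinfun (orth_proj (V x)) else Blinfun (orth_proj (V x))) : borel_measurable borel"
   by (intro borel_measurable_continuous_on_if) auto
  thus "(%x. Blinfun (orth_proj (V x))) : borel_measurable borel" by simp
 qed
 hence Vm0: "V : m0 \<rightarrow>\<^sub>M ?G" using measurable_cong_sets[OF sets_m0 refl, of ?G] by simp
 have inv: "distr (distr m0 ?G V) ?G ((`) g) = distr m0 ?G V" if g: "orthogonal_transformation g" for g :: "real^'n => real^'n"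
 proof -
  obtain g' where g': "orthogonal_transformation g'" "!!x. g (g' x) = x" "!!x. g' (g x) = x" using orthogonal_inverse_exists[OF g] by blast
  have gm: "g : borel_measurable borel" "linear g"
   using orth_linear[OF g] by (auto intro!: cont_borel linear_continuous_on simp: linear_linear)
  have gm': "g : m0 \<rightarrow>\<^sub>M borel" using gm(1) measurable_cong_sets[OF sets_m0 refl] by blast
  have dg: "distr m0 borel g = m0"
  proof (rule measure_eqI)
   fix A assume "A : sets (distr m0 borel g)"
   hence A: "A : sets borel" by simp
   have im: "g -` A = g' ` A" using g'(2,3) by (auto simp: image_iff) metis
   have ball: "g' ` ball 0 1 = ball 0 1"
   proof
    show "g' ` ball 0 1 <= ball 0 1" using orthogonal_transformation_norm[OF g'(1)] by auto
    show "ball 0 1 <= g' ` ball 0 1"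
    proof
     fix x :: "real^'n" assume "x : ball 0 1"
     thus "x : g' ` ball 0 1" using orthogonal_transformation_norm[OF g] g'(3) by (intro image_eqI[of _ _ "g x"]) auto
    qed
   qed
   have "inj g'" using g'(2) by (metis injI)
   have "emeasure (distr m0 borel g) A = emeasure m0 (g' ` A)"
    using A gm' by (subst emeasure_distr) (auto simp: im space_uniform_measure m0_def)
   also have "... = vol (ball 0 1 Int g' ` A) / vol (ball (0::real^'n) 1)" using emeasure_orthogonal_image(2)[OF g'(1) A] by (simp add: m0_def)
   also have "ball 0 1 Int g' ` A = g' ` (ball 0 1 Int A)" using ball image_Int[OF \<open>inj g'\<close>, of "ball 0 1" A] by simp
   also have "vol (g' ` (ball 0 1 Int A)) = vol (ball 0 1 Int A)" using A by (intro emeasure_orthogonal_image g') auto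
   finally show "emeasure (distr m0 borel g) A = emeasure m0 A" using A by (simp add: m0_def)
  qed (simp add: sets_m0)
  have "distr (distr m0 ?G V) ?G ((`) g) = distr m0 ?G ((`) g \<circ> V)" by (rule distr_distr[OF measurable_image_grassmannian[OF g] Vm0])
  also have "... = distr m0 ?G (V \<circ> g)"
  proof (rule distr_cong_AE)
   have "AE x in lborel. x ~= (0::real^'n)" by (rule AE_lborel_singleton)
   hence "AE x in m0. x ~= 0" unfolding m0_def by (intro AE_uniform_measureI) (auto elim: eventually_mono)
   thus "AE x in m0. ((`) g \<circ> V) x = (V \<circ> g) x"
   proof eventually_elim
    fix x :: "real^'n" assume x: "x ~= 0"
    hence "g x ~= 0" using orthogonal_transformation_norm[OF g, of x] by auto
    have "g ` {y. x .* y = 0} = {y. g x .* y = 0}"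
    proof (intro set_eqI iffI)
     fix y assume "y : {y. g x .* y = 0}"
     moreover have "g x .* g (g' y) = x .* g' y" using g unfolding orthogonal_transformation_def by blast
     ultimately have "x .* g' y = 0" using g'(2)[of y] by simp
     thus "y : g ` {y. x .* y = 0}" by (intro image_eqI[of _ _ "g' y"]) (auto simp: g')
    qed (use g in \<open>auto simp: orthogonal_transformation_def\<close>)
    thus "((`) g \<circ> V) x = (V \<circ> g) x" using x \<open>g x ~= 0\<close> by (simp add: V_def)
   qed
   show "(`) g \<circ> V : m0 \<rightarrow>\<^sub>M ?G" by (rule measurable_comp[OF Vm0 measurable_image_grassmannian[OF g]])
   show "V \<circ> g : m0 \<rightarrow>\<^sub>M ?G" by (rule measurable_comp[OF gm' V])
  qed (rule refl)+
  also have "... = distr (distr m0 borel g) ?G V" by (rule distr_distr[OF V gm', symmetric])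
  finally show ?thesis unfolding dg .
 qed
 have "prob_space (distr m0 ?G V)" by (rule m0.prob_space_distr[OF Vm0])
 moreover have "distr (distr m0 ?G V) (distr m0 ?G V) ((`) g) = distr m0 ?G V" if g: "orthogonal_transformation g" for g :: "real^'n => real^'n"
  using inv[OF g] distr_cong[of "distr m0 ?G V" "distr m0 ?G V" "distr m0 ?G V" ?G "(`) g" "(`) g"] by simp
 ultimately show ?thesis unfolding invariant_grassmannian_prob_def by (intro exI[of _ "distr m0 ?G V"]) auto
qed

text \<open>\<open>cyl Q K\<close> is the cylinder of height \<open>2\<close> over the shadow of \<open>K\<close> in the direction spanned by the range of \<open>Q\<close>.\<close>

definition cyl :: "real^'n^'n => (real^'n) set => (real^'n) set" where
 "cyl Q K = {y. norm (Q *v y) < 1 & (\<exists>k\<in>K. y - k = Q *v (y - k))}"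

lemma cyl_measurable:
 fixes K :: "(real^'n) set"
 assumes K: "compact K"
 shows "cyl Q K : sets borel" "(%Q. vol (cyl Q K)) : borel_measurable borel"
proof -
 let ?T = "{z :: (real^'n) \<times> (real^'n^'n) \<times> (real^'n). snd (snd z) - fst z = fst (snd z) *v (snd (snd z) - fst z)}"
 have "closed ?T" unfolding matrix_vector_mult_def by (intro closed_Collect_eq continuous_intros)
 from closed_compact_projection[OF K this]
 have "closed {(Q, y). \<exists>k\<in>K. y - k = Q *v (y - k)}" by (rule back_subst[of closed]) auto
 moreover have "open {z :: (real^'n^'n) \<times> (real^'n). norm (fst z *v snd z) < 1}"
  unfolding matrix_vector_mult_def by (intro open_Collect_less continuous_intros)
 ultimately have "{z :: (real^'n^'n) \<times> (real^'n). norm (fst z *v snd z) < 1} Int {(Q, y). \<exists>k\<in>K. y - k = Q *v (y - k)} : sets borel"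
  by (intro sets.Int) auto
 hence *: "{z. snd z : cyl (fst z) K} : sets borel" by (rule back_subst[of "%A. A : sets borel"]) (auto simp: cyl_def)
 hence **: "{z. snd z : cyl (fst z) K} : sets (borel \<Otimes>\<^sub>M lborel)"
  unfolding sets_pair_measure_cong[OF refl sets_lborel] borel_prod .
 from sets_Pair1[OF **, of Q] show "cyl Q K : sets borel" by (simp add: vimage_def)
 have "(%Q. vol (Pair Q -` {z. snd z : cyl (fst z) K})) : borel_measurable borel" by (rule lborel.measurable_emeasure_Pair[OF **])
 thus "(%Q. vol (cyl Q K)) : borel_measurable borel" by (simp add: vimage_def)
qed

lemma mult_outer_transpose: "A ** outer u v ** transpose B = outer (A *v u) (B *v v)"
 by (rule matrix_eqI) (simp add: mv_assoc[symmetric] inner_transpose mv_scaleR)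

text \<open>A hyperplane is encoded by the projection \<open>outer u u\<close> onto its normal line,
  which does not depend on the sign of \<open>u\<close>. In these matrices all later integrands are
  explicit formulas, which makes joint measurability accessible. The listed properties are all that
  is used about the distribution from here on.\<close>

theorem fav_cylinders:
 assumes n: "CARD('n) >= 2"
 obtains \<nu> :: "(real^'n^'n) measure" where "prob_space \<nu>" "sets \<nu> = sets borel"
  "AE Q in \<nu>. \<exists>u. norm u = 1 & Q = outer u u"
  "!!A. orthogonal_matrix A ==> distr \<nu> borel (%Q. A ** Q ** transpose A) = \<nu>"
  "!!K. compact K ==> 2 * fav (CARD('n) - 1) K = (\<integral>\<^sup>+Q. vol (cyl Q K) \<partial>\<nu>)"
proof -
 let ?G = "grassmannian_borel (CARD('n) - 1) :: (real^'n) set measure"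
 define \<mu> :: "(real^'n) set measure" where "\<mu> = grassmannian_measure (CARD('n) - 1)"
 have "invariant_grassmannian_prob (CARD('n) - 1) \<mu>"
  unfolding \<mu>_def grassmannian_measure_def by (rule someI_ex[OF invariant_grassmannian_exists])
 hence \<mu>: "prob_space \<mu>" "sets \<mu> = sets ?G" "!!g. orthogonal_transformation g ==> distr \<mu> \<mu> ((`) g) = \<mu>"
  by (auto simp: invariant_grassmannian_prob_def)
 interpret \<mu>: prob_space \<mu> by fact
 define q :: "((real^'n) \<Rightarrow>\<^sub>L (real^'n)) => real^'n^'n" where "q P = (\<chi> i j. axis j 1 $ i - blinfun_apply P (axis j 1) $ i)" for P
 define Q where "Q V = q (Blinfun (orth_proj V))" for V
 have space: "space \<mu> = {V. subspace V & dim V = CARD('n) - 1}" using sets_eq_imp_space_eq[OF \<mu>(2)] by (simp add: space_grassmannian)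
 have Q: "Q : \<mu> \<rightarrow>\<^sub>M borel"
 proof -
  have "q : borel_measurable borel" unfolding q_def by (intro cont_borel continuous_intros)
  from mcomp[OF measurable_orth_proj this]
  show ?thesis unfolding Q_def measurable_cong_sets[OF \<mu>(2) refl] .
 qed
 have Q_mult: "Q V *v x = x - orth_proj V x" if "subspace V" for V x
 proof -
  have bl: "bounded_linear (orth_proj V)" by (rule bounded_linear_orth_proj[OF that])
  hence lin: "linear (%x. x - orth_proj V x)" by (intro linear_compose_sub linear_id[unfolded id_def] bounded_linear.linear)
  have "Q V = matrix (%x. x - orth_proj V x)" by (simp add: Q_def q_def matrix_def bounded_linear_Blinfun_apply bl)
  thus ?thesis using matrix_works_real[OF lin] by simp
 qed
 have Q_outer: "\<exists>u. norm u = 1 & Q V = outer u u & V = {y. u .* y = 0}" if V: "V : space \<mu>" for V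
 proof -
  have V': "subspace V" "dim V = DIM(real^'n) - 1" using V by (auto simp: space)
  obtain u where u: "norm u = 1" "V = {y. u .* y = 0}" by (rule hyperplane_eq[OF V'])
  have "u ~= 0" "u .* u = 1" using u(1) by (auto simp: norm_eq_1)
  have "Q V *v x = outer u u *v x" for x
   unfolding Q_mult[OF V'(1)] unfolding u(2) orth_proj_hyperplane[OF \<open>u ~= 0\<close>] using \<open>u .* u = 1\<close> by simp
  hence "Q V = outer u u" by (rule matrix_eqI)
  thus ?thesis using u by blast
 qed
 define \<nu> where "\<nu> = distr \<mu> borel Q"
 show thesis
 proof
  show "prob_space \<nu>" unfolding \<nu>_def by (rule \<mu>.prob_space_distr[OF Q])
  show "sets \<nu> = sets borel" by (simp add: \<nu>_def)
  show "AE Q in \<nu>. \<exists>u. norm u = 1 & Q = outer u u"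
  proof -
   have "closed {Q :: real^'n^'n. \<exists>u. u : sphere 0 1 & (u, Q) : {z. snd z = outer (fst z) (fst z)}}" unfolding outer_def
    by (intro closed_compact_projection compact_sphere closed_Collect_eq continuous_intros)
   hence "{Q :: real^'n^'n. \<exists>u. norm u = 1 & Q = outer u u} : sets borel"
    by (intro borel_closed) (rule back_subst[of closed], auto simp: dist_norm)
   thus ?thesis unfolding \<nu>_def by (subst AE_distr_iff[OF Q]) (auto simp: Q_outer intro!: AE_I2 dest: Q_outer)
  qed
  show "distr \<nu> borel (%Q. A ** Q ** transpose A) = \<nu>" if A: "orthogonal_matrix A" for A :: "real^'n^'n"
  proof -
   have g: "orthogonal_transformation ((*v) A)" using A by (simp add: orth_matrix)
   have "(%Q. A ** Q ** transpose A) : borel_measurable borel" unfolding matrix_matrix_mult_def by (intro cont_borel continuous_intros)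
   hence "distr \<nu> borel (%Q. A ** Q ** transpose A) = distr \<mu> borel ((%Q. A ** Q ** transpose A) \<circ> Q)"
    unfolding \<nu>_def by (rule distr_distr[OF _ Q])
   also have "... = distr \<mu> borel (Q \<circ> (`) ((*v) A))"
   proof (rule distr_cong[OF refl refl])
    fix V assume V: "V : space \<mu>"
    hence gV: "(*v) A ` V : space \<mu>" using subspace_image_orthogonal[OF g, of V] by (simp add: space)
    obtain u where u: "norm u = 1" "Q V = outer u u" "V = {y. u .* y = 0}" using Q_outer[OF V] by blast
    have "u .* u = 1" "u ~= 0" using u(1) by (auto simp: norm_eq_1)
    have AA: "A *v (transpose A *v x) = x" "transpose A *v (A *v x) = x" for x
     using A by (simp_all add: mv_assoc orthogonal_matrix_def del: transpose_matrix_vector)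
    have g': "orthogonal_transformation ((*v) (transpose A))" using A by (simp add: orth_matrix)
    have V': "subspace V" using V by (simp add: space)
    have "Q ((*v) A ` V) = outer (A *v u) (A *v u)"
    proof (rule matrix_eqI)
     fix x
     have "Q ((*v) A ` V) *v x = x - A *v (orth_proj V (transpose A *v x))"
      using gV orth_proj_image[OF g g' AA(1) V'] by (simp add: Q_mult space)
     also have "... = A *v (Q V *v (transpose A *v x))" by (simp add: Q_mult[OF V'] matrix_vector_mult_diff_distrib AA)
     also have "... = outer (A *v u) (A *v u) *v x" by (simp add: u(2) mv_scaleR inner_transpose)
     finally show "Q ((*v) A ` V) *v x = outer (A *v u) (A *v u) *v x" .
    qed
    thus "((%Q. A ** Q ** transpose A) \<circ> Q) V = (Q \<circ> (`) ((*v) A)) V" by (simp add: u(2) mult_outer_transpose)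
   qed
   also have "... = distr (distr \<mu> \<mu> ((`) ((*v) A))) borel Q"
    using measurable_image_grassmannian[OF g, of "CARD('n) - 1"] measurable_cong_sets[OF \<mu>(2) \<mu>(2)]
    by (intro distr_distr[OF Q, symmetric]) auto
   finally show ?thesis unfolding \<mu>(3)[OF g] \<nu>_def .
  qed
  fix K :: "(real^'n) set" assume K: "compact K"
  have eq: "2 * hausdorff_measure (CARD('n) - 1) (orth_proj V ` K) = vol (cyl (Q V) K)" if V: "V : space \<mu>" for V
  proof -
   obtain u where u: "norm u = 1" "Q V = outer u u" "V = {y. u .* y = 0}" using Q_outer[OF V] by blast
   have V': "subspace V" using V by (simp add: space)
   have op: "orth_proj V x = x - (u .* x) *: u" for x using Q_mult[OF V', of x] by (simp add: u(2) alg)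
   have "compact (orth_proj V ` K)" using bounded_linear_orth_proj[OF V'] by (intro compact_continuous_image linear_continuous_on K)
   hence "2 * hausdorff_measure (CARD('n) - 1) (orth_proj V ` K) = vol {y. y - (u .* y) *: u : orth_proj V ` K & \<bar>u .* y\<bar> < 1}"
    using orth_proj_works(1)[OF V'] u(3) by (intro hausdorff_measure_hyperplane n u) auto
   also have "{y. y - (u .* y) *: u : orth_proj V ` K & \<bar>u .* y\<bar> < 1} = cyl (Q V) K"
    unfolding cyl_def u(2) using u(1) by (auto simp: op image_iff idr alg)
   finally show ?thesis .
  qed
  have "2 * fav (CARD('n) - 1) K = 2 * (\<integral>\<^sup>+V. vol (cyl (Q V) K) / 2 \<partial>\<mu>)"
  proof -
   have "hausdorff_measure (CARD('n) - 1) (orth_proj V ` K) = vol (cyl (Q V) K) / 2" if "V : space \<mu>" for V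
    unfolding eq[OF that, symmetric] by (simp add: mult.commute[of 2] mult_divide_eq_ennreal)
   hence "fav (CARD('n) - 1) K = (\<integral>\<^sup>+V. vol (cyl (Q V) K) / 2 \<partial>\<mu>)"
    unfolding fav_def \<mu>_def[symmetric] by (intro nn_integral_cong)
   thus ?thesis by simp
  qed
  also have "... = (\<integral>\<^sup>+V. vol (cyl (Q V) K) \<partial>\<mu>)"
  proof -
   have m: "(%V. vol (cyl (Q V) K)) : borel_measurable \<mu>" by (rule mcomp[OF Q cyl_measurable(2)[OF K]])
   thus ?thesis by (subst nn_integral_cmult[symmetric]) (auto simp: ennreal_times_divide mult.commute[of 2] mult_divide_eq_ennreal)
  qed
  also have "... = (\<integral>\<^sup>+Q. vol (cyl Q K) \<partial>\<nu>)"
   unfolding \<nu>_def using cyl_measurable(2)[OF K] by (intro nn_integral_distr[OF Q, symmetric]) simp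
  finally show "2 * fav (CARD('n) - 1) K = (\<integral>\<^sup>+Q. vol (cyl Q K) \<partial>\<nu>)" .
 qed
qed

section \<open>The smoothed mean projection\<close>

text \<open>The odd profile is \<open>t / sqrt (1 + t^2)\<close>, with derivative
  \<open>damp t ^ 3\<close>. Splitting off the even factor \<open>damp\<close> allows the profile
  along the line of \<open>Q\<close> to be written with \<open>norm (Q *v p)\<close>, without
  choosing a sign for the unit vector.\<close>

definition damp :: "real => real" where
 "damp t = 1 / sqrt (1 + t\<^sup>2)"

lemma damp_pos: "0 < damp t" and damp_le_1: "damp t <= 1" by (auto simp: damp_def sum_power2_gt_zero_iff add_pos_nonneg)

lemma damp_abs [simp]: "damp \<bar>t\<bar> = damp t" by (simp add: damp_def)

lemma damp_sq: "damp t ^ 2 * (1 + t\<^sup>2) = 1"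
proof -
 have "1 + t\<^sup>2 > 0" by (simp add: add_pos_nonneg)
 thus ?thesis by (simp add: damp_def power_divide)
qed

lemma damp_continuous [continuous_intros]: "continuous_on A f ==> continuous_on A (%x. damp (f x))"
 unfolding damp_def by (intro continuous_intros) (auto simp: add_nonneg_eq_0_iff)

lemma damp_Lipschitz: "\<bar>damp s - damp t\<bar> <= \<bar>s - t\<bar>"
proof -
 let ?A = "sqrt (1 + s\<^sup>2)" and ?B = "sqrt (1 + t\<^sup>2)"
 have AB: "?A >= 1" "?B >= 1" by auto
 have "\<bar>?A - ?B\<bar> <= \<bar>s - t\<bar>" using norm_triangle_ineq3[of "(1::real, s)" "(1, t)"] by (simp add: norm_Pair)
 have "damp s - damp t = (?B - ?A) / (?A * ?B)" unfolding damp_def using AB by (subst diff_frac_eq) (auto simp: add_nonneg_eq_0_iff)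
 hence "\<bar>damp s - damp t\<bar> = \<bar>?A - ?B\<bar> / (?A * ?B)" using AB by (simp add: abs_mult abs_minus_commute)
 also have "... <= \<bar>?A - ?B\<bar> / 1" using mult_mono[OF AB] AB by (intro divide_left_mono) auto
 finally show ?thesis using \<open>\<bar>?A - ?B\<bar> <= \<bar>s - t\<bar>\<close> by simp
qed

lemma damp_cube_Lipschitz: "\<bar>damp s ^ 3 - damp t ^ 3\<bar> <= 3 * \<bar>s - t\<bar>"
proof -
 have "damp s ^ 3 - damp t ^ 3 = (damp s - damp t) * (damp s ^ 2 + damp s * damp t + damp t ^ 2)" by (simp add: alg sq_eq power3_eq_cube)
 moreover have "\<bar>damp s ^ 2 + damp s * damp t + damp t ^ 2\<bar> <= 3"
 proof -
  have "damp s ^ 2 <= 1" "damp t ^ 2 <= 1" "damp s * damp t <= 1"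
   using damp_pos damp_le_1 by (auto simp: power_le_one less_imp_le mult_le_one)
  moreover have "0 <= damp s ^ 2 + damp s * damp t + damp t ^ 2" using damp_pos[of s] damp_pos[of t] by simp
  ultimately show ?thesis by linarith
 qed
 ultimately show ?thesis using mult_mono[OF damp_Lipschitz[of s t], of "\<bar>damp s ^ 2 + damp s * damp t + damp t ^ 2\<bar>" 3]
  by (simp add: abs_mult mult.commute)
qed

definition squash :: "real => real" where
 "squash t = damp t * t"

lemma squash_derivative: "(squash has_real_derivative damp t ^ 3) (at t)"
proof -
 have p: "1 + t\<^sup>2 > 0" by (simp add: add_pos_nonneg)
 have "((%t. t / sqrt (1 + t\<^sup>2)) has_real_derivative (1 * sqrt (1 + t\<^sup>2) - t * (inverse (sqrt (1 + t\<^sup>2)) / 2 * (2 * t))) / (sqrt (1 + t\<^sup>2) * sqrt (1 + t\<^sup>2))) (at t)"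
  using p by (auto intro!: derivative_eq_intros)
 moreover have "(1 * sqrt (1 + t\<^sup>2) - t * (inverse (sqrt (1 + t\<^sup>2)) / 2 * (2 * t))) / (sqrt (1 + t\<^sup>2) * sqrt (1 + t\<^sup>2)) = damp t ^ 3"
 proof -
  define A where "A = sqrt (1 + t\<^sup>2)"
  have A: "A > 0" "A ^ 2 = 1 + t\<^sup>2" using p by (auto simp: A_def)
  have "A - t * (inverse A / 2 * (2 * t)) = 1 / A" using A by (simp add: field_simps sq_eq)
  thus ?thesis using A(1) by (simp add: damp_def A_def[symmetric] power3_eq_cube field_simps)
 qed
 moreover have "squash = (%t. t / sqrt (1 + t\<^sup>2))" by (auto simp: squash_def damp_def)
 ultimately show ?thesis by simp
qed

lemma squash_mean_value: "s < t ==> \<exists>\<xi>. s < \<xi> & \<xi> < t & squash t - squash s = (t - s) * damp \<xi> ^ 3"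
 by (rule MVT2) (auto intro: squash_derivative)

lemma squash_taylor: "\<bar>squash t - squash s - damp s ^ 3 * (t - s)\<bar> <= 3 * (t - s)\<^sup>2"
proof -
 consider "s = t" | "s < t" | "t < s" by linarith
 then obtain \<xi> where \<xi>: "\<bar>\<xi> - s\<bar> <= \<bar>t - s\<bar>" "squash t - squash s = (t - s) * damp \<xi> ^ 3"
 proof cases
  case 1 thus thesis by (intro that[of s]) auto
 next
  case 2
  then obtain \<xi> where "s < \<xi>" "\<xi> < t" "squash t - squash s = (t - s) * damp \<xi> ^ 3" using squash_mean_value by blast
  thus thesis by (intro that[of \<xi>]) auto
 next
  case 3
  then obtain \<xi> where \<xi>: "t < \<xi>" "\<xi> < s" "squash s - squash t = (s - t) * damp \<xi> ^ 3" using squash_mean_value by blast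
  hence "squash t - squash s = (t - s) * damp \<xi> ^ 3" by (simp add: alg)
  thus thesis using \<xi> by (intro that[of \<xi>]) auto
 qed
 have "squash t - squash s - damp s ^ 3 * (t - s) = (damp \<xi> ^ 3 - damp s ^ 3) * (t - s)" unfolding \<xi>(2) by (simp add: alg)
 hence "\<bar>squash t - squash s - damp s ^ 3 * (t - s)\<bar> = \<bar>damp \<xi> ^ 3 - damp s ^ 3\<bar> * \<bar>t - s\<bar>"
  by (simp add: abs_mult)
 also have "... <= (3 * \<bar>t - s\<bar>) * \<bar>t - s\<bar>"
  using damp_cube_Lipschitz[of \<xi> s] \<xi>(1) by (intro mult_right_mono) auto
 finally show ?thesis by (simp add: sq_eq flip: abs_mult)
qed

lemma squash_strict_mono: "s < t ==> squash s < squash t"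
proof -
 assume st: "s < t"
 then obtain \<xi> where "squash t - squash s = (t - s) * damp \<xi> ^ 3" using squash_mean_value by blast
 moreover have "0 < (t - s) * damp \<xi> ^ 3" using st damp_pos[of \<xi>] by (intro mult_pos_pos zero_less_power) auto
 ultimately show ?thesis by linarith
qed

lemma squash_eq_iff [simp]: "squash s = squash t \<longleftrightarrow> s = t" by (metis less_irrefl linorder_neqE squash_strict_mono)

lemma squash_less_1: "\<bar>squash t\<bar> < 1"
proof -
 have "(squash t)\<^sup>2 = 1 - damp t ^ 2" using damp_sq[of t] by (simp add: squash_def alg power_mult_distrib)
 hence "(squash t)\<^sup>2 < 1" using damp_pos[of t] by simp
 thus ?thesis by (simp add: abs_square_less_1)
qed

lemma squash_surj:
 assumes "\<bar>y\<bar> < 1"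
 obtains t where "squash t = y"
proof
 have p: "1 - y\<^sup>2 > 0" using assms by (simp add: abs_square_less_1)
 have "1 + (y / sqrt (1 - y\<^sup>2))\<^sup>2 = 1 / (1 - y\<^sup>2)" using p by (simp add: power_divide field_simps)
 thus "squash (y / sqrt (1 - y\<^sup>2)) = y" using p by (simp add: squash_def damp_def real_sqrt_divide)
qed

lemma squash_minus: "squash (- t) = - squash t" by (simp add: squash_def damp_def)

lemma squash_limit: "(squash \<longlongrightarrow> 1) at_top"
proof -
 have "((%t::real. t / sqrt (1 + t\<^sup>2)) \<longlongrightarrow> 1) at_top" by real_asymp
 thus ?thesis by (simp add: squash_def[abs_def] damp_def)
qed

lemma squash_continuous [continuous_intros]: "continuous_on A f ==> continuous_on A (%x. squash (f x))"
 unfolding squash_def by (intro continuous_intros)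

lemma continuous_on_matrix_vector [continuous_intros]:
 fixes f :: "'a::topological_space => real^'n^'m"
 shows "continuous_on S f ==> continuous_on S g ==> continuous_on S (%x. f x *v g x)"
 unfolding matrix_vector_mult_def by (intro continuous_intros)

lemma continuous_on_matrix_matrix [continuous_intros]:
 fixes f :: "'a::topological_space => real^'n^'m"
 shows "continuous_on S f ==> continuous_on S g ==> continuous_on S (%x. f x ** (g x :: real^'k^'n))"
 unfolding matrix_matrix_mult_def by (intro continuous_intros)

lemma continuous_on_det [continuous_intros]:
 fixes f :: "'a::topological_space => real^'n^'n"
 shows "continuous_on S f ==> continuous_on S (%x. det (f x))" unfolding det_def by (intro continuous_intros)

lemma bounded_linear_matrix_vector: "bounded_linear (%A :: real^'n^'m. A *v x)" unfolding linear_conv_bounded_linear[symmetric]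
 by (rule linearI) (rule mv_add, rule mv_scale[symmetric])

lemma outer_bound: obtains B where "!!u :: real^'n. norm u = 1 ==> norm (outer u u) <= B"
proof -
 have "compact ((%u :: real^'n. outer u u) ` sphere 0 1)"
  unfolding outer_def by (intro compact_continuous_image continuous_intros compact_sphere)
 from compact_imp_bounded[OF this]
 obtain B where B: "\<forall>A\<in>(%u :: real^'n. outer u u) ` sphere 0 1. norm A <= B" unfolding bounded_iff by (rule exE)
 have "norm (outer u u) <= B" if "norm u = 1" for u :: "real^'n" using that by (intro bspec[OF B] imageI) simp
 thus thesis by (rule that)
qed

lemma transpose_eqI:
 fixes A :: "real^'k^'k"
 assumes "!!x y. (A *v x) .* y = x .* (A *v y)"
 shows "transpose A = A"
proof (rule matrix_eqI)
 fix y
 have "x .* (transpose A *v y) = x .* (A *v y)" for x by (rule trans[OF inner_transpose[symmetric] assms])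
 hence "\<forall>x. x .* (transpose A *v y) = x .* (A *v y)" by (rule allI)
 thus "transpose A *v y = A *v y" by (rule vector_eq_ldot[THEN iffD1])
qed

section \<open>The averaged projection and its derivative\<close>

locale hyperplane_distribution =
 fixes \<nu> :: "(real^'n^'n) measure"
 assumes prob: "prob_space \<nu>"
  and sets_\<nu> [measurable_cong, simp]: "sets \<nu> = sets borel"
  and rank_one: "AE Q in \<nu>. \<exists>u. norm u = 1 & Q = outer u u"
  and invariant: "!!A. orthogonal_matrix A ==> distr \<nu> borel (%Q. A ** Q ** transpose A) = \<nu>"
begin

sublocale prob_space \<nu> by (rule prob)

definition S0 :: "real^'n => real^'n" where
 "S0 p = (\<integral>Q. damp (norm (Q *v p)) *: (Q *v p) \<partial>\<nu>)"

definition DS :: "real^'n => real^'n^'n" where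
 "DS p = (\<integral>Q. damp (norm (Q *v p)) ^ 3 *: Q \<partial>\<nu>)"

lemma AE_rank_one: "(!!Q u. norm u = 1 ==> Q = outer u u ==> P Q) ==> AE Q in \<nu>. P Q" using rank_one by (rule eventually_mono) blast

lemma space_\<nu> [simp]: "space \<nu> = UNIV" using sets_eq_imp_space_eq[OF sets_\<nu>] by simp

lemma measurable_\<nu>: "continuous_on UNIV f ==> f : borel_measurable \<nu>"
 using cont_borel[of f] measurable_cong_sets[OF sets_\<nu> refl] by blast

lemma integrable_S0: "integrable \<nu> (%Q. damp (norm (Q *v p)) *: (Q *v p))"
proof (rule integrable_const_bound)
 show "AE Q in \<nu>. norm (damp (norm (Q *v p)) *: (Q *v p)) <= 1"
 proof (rule AE_I2)
  fix Q :: "real^'n^'n"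
  have "norm (damp (norm (Q *v p)) *: (Q *v p)) = \<bar>squash (norm (Q *v p))\<bar>" using damp_pos by (simp add: squash_def abs_mult)
  thus "norm (damp (norm (Q *v p)) *: (Q *v p)) <= 1" using squash_less_1[of "norm (Q *v p)"] by simp
 qed
 show "(%Q. damp (norm (Q *v p)) *: (Q *v p)) : borel_measurable \<nu>" by (intro measurable_\<nu> continuous_intros)
qed

lemma integrable_DS: "integrable \<nu> (%Q. damp (norm (Q *v p)) ^ 3 *: Q)"
proof -
 obtain B where B: "!!u :: real^'n. norm u = 1 ==> norm (outer u u) <= B" by (rule outer_bound) blast
 show ?thesis
 proof (rule integrable_const_bound)
  show "AE Q in \<nu>. norm (damp (norm (Q *v p)) ^ 3 *: Q) <= B" using rank_one
  proof eventually_elim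
   fix Q :: "real^'n^'n" assume "\<exists>u. norm u = 1 & Q = outer u u"
   hence "norm Q <= B" using B by blast
   moreover have "damp (norm (Q *v p)) ^ 3 <= 1" "0 <= damp (norm (Q *v p)) ^ 3"
    using damp_pos[of "norm (Q *v p)"] damp_le_1 by (auto intro!: power_le_one)
   ultimately show "norm (damp (norm (Q *v p)) ^ 3 *: Q) <= B" using mult_right_mono[of "damp (norm (Q *v p)) ^ 3" 1 "norm Q"] by simp
  qed
  show "(%Q. damp (norm (Q *v p)) ^ 3 *: Q) : borel_measurable \<nu>" by (intro measurable_\<nu> continuous_intros)
 qed
qed

lemma DS_mult: "DS p *v x = (\<integral>Q. damp (norm (Q *v p)) ^ 3 *: (Q *v x) \<partial>\<nu>)"
 and integrable_DS_mult: "integrable \<nu> (%Q. damp (norm (Q *v p)) ^ 3 *: (Q *v x))"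
 using integral_bounded_linear[OF bounded_linear_matrix_vector[of x] integrable_DS[of p]]
  integrable_bounded_linear[OF bounded_linear_matrix_vector[of x] integrable_DS[of p]] by (simp_all add: DS_def mv_scale)

lemma norm_integral_le:
 fixes f :: "real^'n^'n => 'b::{banach, second_countable_topology}"
 assumes "integrable \<nu> f" "AE Q in \<nu>. norm (f Q) <= C"
 shows "norm (\<integral>Q. f Q \<partial>\<nu>) <= C"
proof -
 have "norm (\<integral>Q. f Q \<partial>\<nu>) <= (\<integral>Q. norm (f Q) \<partial>\<nu>)"
  by (rule Bochner_Integration.integral_norm_bound)
 also have "... <= (\<integral>Q. C \<partial>\<nu>)" using assms by (intro integral_mono_AE) auto
 finally show ?thesis by (simp add: prob_space[simplified])
qed

lemma outer_values:
 assumes "norm u = 1"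
 shows "norm (outer u u *v x) = \<bar>u .* x\<bar>" "damp (norm (outer u u *v x)) *: (outer u u *v x) = squash (u .* x) *: u"
 using assms by (simp_all add: squash_def)

text \<open>The second order estimate for \<open>squash\<close> holds uniformly in the direction, so
  it can be integrated directly and yields differentiability under the integral.\<close>

lemma S0_taylor: "norm (S0 q - S0 p - DS p *v (q - p)) <= 3 * (norm (q - p))\<^sup>2"
proof -
 let ?f = "%Q. damp (norm (Q *v q)) *: (Q *v q) - damp (norm (Q *v p)) *: (Q *v p) - damp (norm (Q *v p)) ^ 3 *: (Q *v (q - p))"
 have "S0 q - S0 p - DS p *v (q - p) = (\<integral>Q. ?f Q \<partial>\<nu>)" unfolding S0_def DS_mult
  by (simp only: Bochner_Integration.integral_diff[OF Bochner_Integration.integrable_diff[OF integrable_S0 integrable_S0] integrable_DS_mult]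
   Bochner_Integration.integral_diff[OF integrable_S0 integrable_S0])
 also have "norm ... <= 3 * (norm (q - p))\<^sup>2"
 proof (rule norm_integral_le)
  show "integrable \<nu> ?f" by (intro Bochner_Integration.integrable_diff integrable_S0 integrable_DS_mult)
  show "AE Q in \<nu>. norm (?f Q) <= 3 * (norm (q - p))\<^sup>2"
  proof (rule AE_rank_one)
   fix Q :: "real^'n^'n" and u assume u: "norm u = 1" "Q = outer u u"
   have "?f Q = (squash (u .* q) - squash (u .* p) - damp (u .* p) ^ 3 * (u .* q - u .* p)) *: u" using u(1) by (simp add: u(2) squash_def alg)
   hence "norm (?f Q) = \<bar>squash (u .* q) - squash (u .* p) - damp (u .* p) ^ 3 * (u .* q - u .* p)\<bar>" using u(1) by simp
   also have "... <= 3 * (u .* q - u .* p)\<^sup>2" by (rule squash_taylor)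
   also have "... <= 3 * (norm (q - p))\<^sup>2"
   proof -
    have "\<bar>u .* q - u .* p\<bar> <= \<bar>norm (q - p)\<bar>" using CS_ineq[of u "q - p"] u(1) by (simp add: idr)
    hence "(u .* q - u .* p)\<^sup>2 <= (norm (q - p))\<^sup>2" by (rule abs_le_square_iff[THEN iffD1])
    thus ?thesis by simp
   qed
   finally show "norm (?f Q) <= 3 * (norm (q - p))\<^sup>2" .
  qed
 qed
 finally show ?thesis .
qed

lemma S0_derivative: "(S0 has_derivative (%h. DS p *v h)) (at p within A)"
proof -
 have bl: "bounded_linear (%h. DS p *v h)" unfolding linear_conv_bounded_linear[symmetric] by (rule matrix_vector_mul_linear)
 have "(S0 has_derivative (%h. DS p *v h)) (at p)" unfolding has_derivative_at2
 proof (intro conjI bl)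
  have "((%q. 3 * norm (q - p)) \<longlongrightarrow> 3 * norm (p - p)) (at p)"
   by (intro tendsto_mult tendsto_const tendsto_norm tendsto_diff tendsto_ident_at)
  hence lim: "((%q. 3 * norm (q - p)) \<longlongrightarrow> 0) (at p)" by simp
  have bound: "norm ((1 / norm (q - p)) *: (S0 q - (S0 p + DS p *v (q - p)))) <= 3 * norm (q - p)" for q
  proof (cases "q = p")
   case False
   hence pos: "0 < norm (q - p)" by simp
   have "norm ((1 / norm (q - p)) *: (S0 q - (S0 p + DS p *v (q - p)))) = norm (S0 q - S0 p - DS p *v (q - p)) / norm (q - p)"
    by (simp add: diff_diff_eq)
   also have "... <= 3 * (norm (q - p))\<^sup>2 / norm (q - p)" by (rule divide_right_mono[OF S0_taylor]) simp
   also have "... = 3 * norm (q - p)" using pos by (simp add: sq_eq)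
   finally show ?thesis .
  qed simp
  show "((%q. (1 / norm (q - p)) *: (S0 q - (S0 p + DS p *v (q - p)))) \<longlongrightarrow> 0) (at p)"
   by (rule Lim_null_comparison[OF always_eventually[OF allI[OF bound]] lim])
 qed
 thus ?thesis by (rule der_within)
qed

lemma DS_continuous: "continuous_on UNIV DS"
proof -
 obtain B where B: "!!u :: real^'n. norm u = 1 ==> norm (outer u u) <= B" by (rule outer_bound) blast
 obtain e :: "real^'n" where "norm e = 1" using vector_choose_size[of 1] by auto
 hence B0: "0 <= B" using B[of e] norm_ge_zero order_trans by blast
 have "norm (DS q - DS p) <= 3 * B * norm (q - p)" for p q
 proof -
  have "DS q - DS p = (\<integral>Q. damp (norm (Q *v q)) ^ 3 *: Q - damp (norm (Q *v p)) ^ 3 *: Q \<partial>\<nu>)"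
   unfolding DS_def by (rule Bochner_Integration.integral_diff[OF integrable_DS integrable_DS, symmetric])
  also have "norm ... <= 3 * B * norm (q - p)"
  proof (rule norm_integral_le)
   show "AE Q in \<nu>. norm (damp (norm (Q *v q)) ^ 3 *: Q - damp (norm (Q *v p)) ^ 3 *: Q) <= 3 * B * norm (q - p)"
   proof (rule AE_rank_one)
    fix Q :: "real^'n^'n" and u assume u: "norm u = 1" "Q = outer u u"
    have "norm (damp (norm (Q *v q)) ^ 3 *: Q - damp (norm (Q *v p)) ^ 3 *: Q) = \<bar>damp (u .* q) ^ 3 - damp (u .* p) ^ 3\<bar> * norm Q"
     using u(1) by (simp add: u(2) flip: scaleR_diff_left)
    also have "... <= (3 * norm (q - p)) * B"
    proof (rule mult_mono)
     have "\<bar>u .* q - u .* p\<bar> <= norm (q - p)" using CS_ineq[of u "q - p"] u(1) by (simp add: idr)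
     hence "3 * \<bar>u .* q - u .* p\<bar> <= 3 * norm (q - p)" by simp
     thus "\<bar>damp (u .* q) ^ 3 - damp (u .* p) ^ 3\<bar> <= 3 * norm (q - p)" by (rule order_trans[OF damp_cube_Lipschitz])
    qed (use B u in auto)
    finally show "norm (damp (norm (Q *v q)) ^ 3 *: Q - damp (norm (Q *v p)) ^ 3 *: Q) <= 3 * B * norm (q - p)" by (simp add: mult_ac)
   qed
  qed (intro Bochner_Integration.integrable_diff integrable_DS)
  finally show ?thesis .
 qed
 hence "(3 * B)-lipschitz_on UNIV DS" using B0 by (intro lipschitz_onI) (auto simp: dist_norm)
 thus ?thesis by (rule lip_cont)
qed

lemma invariant_AE:
 assumes A: "orthogonal_matrix A" and P: "{Q. P Q} : sets borel" "AE Q in \<nu>. P Q"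
 shows "AE Q in \<nu>. P (A ** Q ** transpose A)"
proof -
 have m: "(%Q. A ** Q ** transpose A) : \<nu> \<rightarrow>\<^sub>M borel" by (intro measurable_\<nu> continuous_intros)
 have "AE Q in distr \<nu> borel (%Q. A ** Q ** transpose A). P Q" using P(2) unfolding invariant[OF A] .
 thus ?thesis using P(1) by (subst (asm) AE_distr_iff[OF m]) auto
qed

lemma invariant_integral:
 fixes f :: "real^'n^'n => 'b::{banach, second_countable_topology}"
 assumes A: "orthogonal_matrix A" and f: "continuous_on UNIV f"
 shows "(\<integral>Q. f (A ** Q ** transpose A) \<partial>\<nu>) = (\<integral>Q. f Q \<partial>\<nu>)"
proof -
 have m: "(%Q. A ** Q ** transpose A) : \<nu> \<rightarrow>\<^sub>M borel" by (intro measurable_\<nu> continuous_intros)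
 have "(\<integral>Q. f Q \<partial>distr \<nu> borel (%Q. A ** Q ** transpose A)) = (\<integral>Q. f (A ** Q ** transpose A) \<partial>\<nu>)"
  using f by (intro integral_distr[OF m] cont_borel)
 thus ?thesis unfolding invariant[OF A] by simp
qed

text \<open>By invariance the same would hold with \<open>x\<close> replaced by any basis vector.
  Almost every \<open>Q\<close> would then be zero, contrary to rank one.\<close>

lemma not_AE_orthogonal:
 assumes x: "x ~= 0"
 shows "~ (AE Q in \<nu>. Q *v x = 0)"
proof
 assume ae: "AE Q in \<nu>. Q *v x = 0"
 have "AE Q in \<nu>. Q *v b = 0" if b: "b : Basis" for b
 proof -
  obtain f where f: "orthogonal_transformation f" "f x = norm x *: b" using orthogonal_transformation_exists[of x "norm x *: b"] b by auto
  define A where "A = transpose (matrix f)"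
  have A: "orthogonal_matrix A" using f(1) by (simp add: A_def orth_matrix)
  have "AE Q in \<nu>. (A ** Q ** transpose A) *v x = 0"
   by (rule invariant_AE[OF A _ ae]) (intro borel_closed closed_Collect_eq continuous_intros)
  thus ?thesis
  proof eventually_elim
   fix Q :: "real^'n^'n" assume Q: "(A ** Q ** transpose A) *v x = 0"
   have "transpose A *v x = norm x *: b" using f matrix_works_real[of f x] by (simp add: A_def orth_linear)
   hence "A *v (Q *v (norm x *: b)) = 0" using Q by (simp add: mv_assoc[symmetric])
   hence "(transpose A ** A) *v (Q *v (norm x *: b)) = 0" by (simp add: mv_assoc[symmetric])
   thus "Q *v b = 0" using A x by (simp add: orthogonal_matrix_def mv_scaleR)
  qed
 qed
 hence "AE Q in \<nu>. \<forall>b\<in>Basis. Q *v b = 0" by (intro AE_finite_allI) auto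
 hence "AE Q in \<nu>. False" using rank_one
 proof eventually_elim
  fix Q :: "real^'n^'n" assume Q: "\<forall>b\<in>Basis. Q *v b = 0" "\<exists>u. norm u = 1 & Q = outer u u"
  then obtain u where u: "norm u = 1" "Q = outer u u" by blast
  hence "u .* b = 0" if "b : Basis" for b using Q(1) that by auto
  hence "u = 0" by (metis euclidean_all_zero_iff)
  thus False using u(1) by simp
 qed
 thus False by simp
qed

lemma DS_positive: "positive_matrix (DS p)" unfolding positive_matrix_def symmetric_matrix_def
proof (intro conjI allI impI)
 have in': "y .* (DS p *v x) = (\<integral>Q. y .* (damp (norm (Q *v p)) ^ 3 *: (Q *v x)) \<partial>\<nu>)" for x y
  unfolding DS_mult by (rule integral_inner_right[symmetric]) (rule integrable_DS_mult)
 have "(DS p *v x) .* y = x .* (DS p *v y)" for x y unfolding in' icomm[of "DS p *v x" y]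
 proof (rule integral_cong_AE)
  show "AE Q in \<nu>. y .* (damp (norm (Q *v p)) ^ 3 *: (Q *v x)) = x .* (damp (norm (Q *v p)) ^ 3 *: (Q *v y))" using rank_one
  proof eventually_elim
   fix Q :: "real^'n^'n" assume "\<exists>u. norm u = 1 & Q = outer u u"
   then obtain u where u: "Q = outer u u" by blast
   show "y .* (damp (norm (Q *v p)) ^ 3 *: (Q *v x)) = x .* (damp (norm (Q *v p)) ^ 3 *: (Q *v y))"
    unfolding u outer_mult_vec inner_scaleR_right icomm[of u x] icomm[of u y] by (simp only: mult_ac)
  qed
 qed (intro measurable_\<nu> continuous_intros)+
 thus "transpose (DS p) = DS p" by (rule transpose_eqI)
next
 fix x :: "real^'n" assume x: "x ~= 0"
 have i: "integrable \<nu> (%Q. x .* (damp (norm (Q *v p)) ^ 3 *: (Q *v x)))" using integrable_DS_mult by (intro integrable_inner_right) auto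
 have eq: "x .* (DS p *v x) = (\<integral>Q. x .* (damp (norm (Q *v p)) ^ 3 *: (Q *v x)) \<partial>\<nu>)"
  unfolding DS_mult by (rule integral_inner_right[symmetric]) (rule integrable_DS_mult)
 have nn: "AE Q in \<nu>. 0 <= x .* (damp (norm (Q *v p)) ^ 3 *: (Q *v x))" using rank_one
 proof eventually_elim
  fix Q :: "real^'n^'n" assume "\<exists>u. norm u = 1 & Q = outer u u"
  then obtain u where u: "Q = outer u u" by blast
  show "0 <= x .* (damp (norm (Q *v p)) ^ 3 *: (Q *v x))" unfolding u outer_mult_vec inner_scaleR_right icomm[of x u]
   using damp_pos[THEN less_imp_le] by (intro mult_nonneg_nonneg zero_le_power zero_le_square)
 qed
 have "0 <= x .* (DS p *v x)" unfolding eq by (rule integral_nonneg_AE[OF nn])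
 moreover have "x .* (DS p *v x) ~= 0"
 proof
  assume "x .* (DS p *v x) = 0"
  hence "AE Q in \<nu>. x .* (damp (norm (Q *v p)) ^ 3 *: (Q *v x)) = 0" unfolding eq integral_nonneg_eq_0_iff_AE[OF i nn] .
  hence "AE Q in \<nu>. Q *v x = 0" using rank_one
  proof eventually_elim
   fix Q :: "real^'n^'n" assume 0: "x .* (damp (norm (Q *v p)) ^ 3 *: (Q *v x)) = 0" and "\<exists>u. norm u = 1 & Q = outer u u"
   then obtain u where u: "Q = outer u u" by blast
   have "damp (norm (Q *v p)) ^ 3 * ((u .* x) * (u .* x)) = 0" using 0 unfolding u outer_mult_vec inner_scaleR_right icomm[of x u] .
   hence "u .* x = 0" using damp_pos[of "norm (Q *v p)"] by simp
   thus "Q *v x = 0" unfolding u outer_mult_vec by simp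
  qed
  thus False using not_AE_orthogonal[OF x] by blast
 qed
 ultimately show "0 < x .* (DS p *v x)" by simp
qed

lemma S0_monotone:
 assumes "p ~= q"
 shows "0 < (S0 q - S0 p) .* (q - p)"
proof -
 let ?f = "%Q. damp (norm (Q *v q)) *: (Q *v q) - damp (norm (Q *v p)) *: (Q *v p)"
 have i0: "integrable \<nu> ?f" by (intro Bochner_Integration.integrable_diff integrable_S0)
 have i: "integrable \<nu> (%Q. ?f Q .* (q - p))" by (intro integrable_inner_left) (use i0 in auto)
 have "S0 q - S0 p = (\<integral>Q. ?f Q \<partial>\<nu>)"
  unfolding S0_def by (rule Bochner_Integration.integral_diff[OF integrable_S0 integrable_S0, symmetric])
 hence eq: "(S0 q - S0 p) .* (q - p) = (\<integral>Q. ?f Q .* (q - p) \<partial>\<nu>)"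
  using integral_inner_left[of "q - p" \<nu> ?f] i0 by simp
 have val: "AE Q in \<nu>. 0 <= ?f Q .* (q - p) & (?f Q .* (q - p) = 0 --> Q *v (q - p) = 0)"
 proof (rule AE_rank_one)
  fix Q :: "real^'n^'n" and u assume u: "norm u = 1" "Q = outer u u"
  have *: "?f Q .* (q - p) = (squash (u .* q) - squash (u .* p)) * (u .* q - u .* p)" using u(1) by (simp add: u(2) squash_def alg)
  consider "u .* q = u .* p" | "u .* q < u .* p" | "u .* p < u .* q" by linarith
  thus "0 <= ?f Q .* (q - p) & (?f Q .* (q - p) = 0 --> Q *v (q - p) = 0)"
  proof cases
   case 1
   thus ?thesis unfolding * by (simp add: u idr)
  next
   case 2
   hence "0 < (squash (u .* q) - squash (u .* p)) * (u .* q - u .* p)" using squash_strict_mono[OF 2] by (intro mult_neg_neg) auto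
   thus ?thesis unfolding * using less_imp_neq by force
  next
   case 3
   hence "0 < (squash (u .* q) - squash (u .* p)) * (u .* q - u .* p)" using squash_strict_mono[OF 3] by (intro mult_pos_pos) auto
   thus ?thesis unfolding * using less_imp_neq by force
  qed
 qed
 hence nn: "AE Q in \<nu>. 0 <= ?f Q .* (q - p)" by eventually_elim simp
 have "0 <= (S0 q - S0 p) .* (q - p)" unfolding eq by (rule integral_nonneg_AE[OF nn])
 moreover have "(S0 q - S0 p) .* (q - p) ~= 0"
 proof
  assume "(S0 q - S0 p) .* (q - p) = 0"
  hence "AE Q in \<nu>. ?f Q .* (q - p) = 0" unfolding eq integral_nonneg_eq_0_iff_AE[OF i nn] .
  with val have "AE Q in \<nu>. Q *v (q - p) = 0" by eventually_elim simp
  thus False using not_AE_orthogonal[of "q - p"] assms by simp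
 qed
 ultimately show ?thesis by simp
qed

lemma S0_inj: "inj S0"
proof (rule injI)
 fix p q assume "S0 p = S0 q"
 thus "p = q" using S0_monotone[of p q] by (cases "p = q") auto
qed

lemma S0_orthogonal:
 assumes f: "orthogonal_transformation f"
 shows "S0 (f p) = f (S0 p)"
proof -
 define A where "A = matrix f"
 have A: "orthogonal_matrix A" "!!x. A *v x = f x" using f by (simp_all add: A_def orth_matrix matrix_works_real)
 have "S0 (f p) = (\<integral>Q. damp (norm ((A ** Q ** transpose A) *v f p)) *: ((A ** Q ** transpose A) *v f p) \<partial>\<nu>)"
  unfolding S0_def by (rule invariant_integral[OF A(1), symmetric]) (intro continuous_intros)
 also have "... = (\<integral>Q. f (damp (norm (Q *v p)) *: (Q *v p)) \<partial>\<nu>)"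
 proof (rule Bochner_Integration.integral_cong[OF refl])
  fix Q :: "real^'n^'n"
  have "transpose A *v (A *v p) = p" using A(1) by (simp add: mv_assoc orthogonal_matrix_def)
  hence "(A ** Q ** transpose A) *v f p = f (Q *v p)" by (simp add: mv_assoc[symmetric] A(2)[symmetric])
  thus "damp (norm ((A ** Q ** transpose A) *v f p)) *: ((A ** Q ** transpose A) *v f p) = f (damp (norm (Q *v p)) *: (Q *v p))"
   using f by (simp add: orthogonal_transformation_norm linear_scale orth_linear)
 qed
 also have "... = f (S0 p)" unfolding S0_def using orth_linear[OF f]
  by (intro integral_bounded_linear integrable_S0) (simp add: linear_linear)
 finally show ?thesis .
qed

end

lemma trace_mult_outer: "trace (A ** outer u u) = u .* (A *v u)"
proof -
 have "A ** outer u u = outer (A *v u) u" using mult_outer_transpose[of A u u "mat 1"] by simp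
 thus ?thesis by (simp add: trace_def outer_def inner_vec_def mult.commute)
qed

text \<open>With \<open>J\<close> factored out on the right, the identity plus the rank one matrix
  \<open>outer u (t *: (transpose A *v u) - u)\<close> remains. This is the common form of all
  Jacobians below of maps that treat the component along \<open>u\<close> separately.\<close>

lemma det_split_projection:
 fixes u :: "real^'n" and A J :: "real^'n^'n"
 assumes u: "norm u = 1"
 shows "det ((mat 1 - outer u u) ** J + t *: (outer u u ** (A ** J))) = det J * (t * (u .* (A *v u)))"
proof -
 have eq: "(mat 1 - outer u u) ** J + t *: (outer u u ** (A ** J)) = (mat 1 + outer u (t *: (transpose A *v u) - u)) ** J"
 proof (rule matrix_eqI)
  fix x
  have "(transpose A *v u) .* (J *v x) = u .* (A *v (J *v x))" by (simp add: inner_transpose)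
  thus "((mat 1 - outer u u) ** J + t *: (outer u u ** (A ** J))) *v x = ((mat 1 + outer u (t *: (transpose A *v u) - u)) ** J) *v x"
   by (simp add: mv_add mv_diff mv_assoc[symmetric]
    mv_scale[symmetric] idl alg)
 qed
 have "u .* (transpose A *v u) = u .* (A *v u)" using inner_transpose[of A u u] by (simp add: icomm)
 hence "1 + u .* (t *: (transpose A *v u) - u) = t * (u .* (A *v u))" using u by (simp add: idr norm_eq_1)
 thus ?thesis unfolding eq det_mul det_mat1_plus_outer by simp
qed

lemma lborel_image:
 fixes g :: "real^'n => real^'n"
 assumes "S : sets lebesgue" "!!x. x : S ==> (g has_derivative g' x) (at x within S)" "inj_on g S"
 shows "lvol (g ` S) = (\<integral>\<^sup>+x. ennreal \<bar>det (matrix (g' x))\<bar> * indicator S x \<partial>lborel)"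
 using emeasure_image[OF assms] by (simp add: nn_integral_completion)

lemma det_stretch:
 fixes u :: "real^'n"
 assumes u: "norm u = 1" and c: "c > 0"
 shows "det (c *: mat 1 + (1 - c) *: outer u u :: real^'n^'n) = c ^ (CARD('n) - 1)"
proof -
 have uu: "u .* u = 1" using u by (simp add: norm_eq_1)
 have "c *: mat 1 + (1 - c) *: outer u u = (c *: mat 1) ** (mat 1 + outer u (((1 - c) / c) *: u))"
  by (rule matrix_eqI) (use c in \<open>simp add: mv_add mv_scale[symmetric] mv_assoc[symmetric] scaleR_add_right\<close>)
 moreover have "det (c *: mat 1 :: real^'n^'n) = c ^ CARD('n)" by (subst det_diagonal) (auto simp: mat_def)
 ultimately have "det (c *: mat 1 + (1 - c) *: outer u u) = c ^ CARD('n) * (1 + u .* (((1 - c) / c) *: u))"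
  by (simp add: det_mul det_mat1_plus_outer)
 also have "... = c ^ CARD('n) / c" using c by (simp add: uu field_simps)
 also have "... = c ^ (CARD('n) - 1)" using c by (simp add: power_diff)
 finally show ?thesis .
qed

section \<open>The image of the averaged projection and the mean shadow of a ball\<close>

context hyperplane_distribution
begin

lemma trace_DS:
 "(\<integral>Q. damp (norm (Q *v p)) ^ 3 * trace (A ** Q) \<partial>\<nu>) = trace (A ** DS p)"
 "integrable \<nu> (%Q. damp (norm (Q *v p)) ^ 3 * trace (A ** Q))"
proof -
 have "linear (%Q. trace (A ** Q))"
  by (intro linearI) (simp_all add: trace_add matrix_add_ldistrib trace_def matrix_matrix_mult_def sum_distrib_left sum.distrib distrib_left mult_ac)
 hence bl: "bounded_linear (%Q. trace (A ** Q))" by (simp add: linear_conv_bounded_linear)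
 have eq: "trace (A ** (s *: Q)) = s * trace (A ** Q)" for s Q using linear_scale[OF \<open>linear (%Q. trace (A ** Q))\<close>] by simp
 show "(\<integral>Q. damp (norm (Q *v p)) ^ 3 * trace (A ** Q) \<partial>\<nu>) = trace (A ** DS p)"
  using integral_bounded_linear[OF bl integrable_DS[of p]] unfolding eq DS_def .
 show "integrable \<nu> (%Q. damp (norm (Q *v p)) ^ 3 * trace (A ** Q))"
  using integrable_bounded_linear[OF bl integrable_DS[of p]] unfolding eq .
qed

definition mass :: ennreal where
 "mass = (\<integral>\<^sup>+p. ennreal (det (DS p)) \<partial>lborel)"

text \<open>The mean of the absolute value of \<open>u .* e\<close>; by invariance every unit vector
  \<open>e\<close> gives the same number. It is the least upper bound of
  \<open>norm (S0 p)\<close>.\<close>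

definition radius :: real where
 "radius = (\<integral>Q. norm (Q *v (SOME b. b : Basis)) \<partial>\<nu>)"

lemma det_DS_pos: "0 < det (DS p)" by (rule positive_matrix_det_trace(1)[OF DS_positive])

lemma integrable_norm_mult: "integrable \<nu> (%Q. norm (Q *v x))"
proof (rule integrable_const_bound)
 show "AE Q in \<nu>. norm (norm (Q *v x)) <= norm x"
 proof (rule AE_rank_one)
  fix Q :: "real^'n^'n" and u assume u: "norm u = 1" "Q = outer u u"
  thus "norm (norm (Q *v x)) <= norm x" using CS_ineq[of u x] by simp
 qed
qed (intro measurable_\<nu> continuous_intros)

lemma radius_eq:
 assumes "norm e = 1"
 shows "(\<integral>Q. norm (Q *v e) \<partial>\<nu>) = radius"
proof -
 define b :: "real^'n" where "b = (SOME b. b : Basis)"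
 have "b : Basis" unfolding b_def by (rule someI_ex) (use nonempty_Basis in blast)
 hence "norm b = 1" by simp
 obtain f where f: "orthogonal_transformation f" "f e = b"
  using orthogonal_transformation_exists_1[OF assms \<open>norm b = 1\<close>] by blast
 define A where "A = transpose (matrix f)"
 have A: "orthogonal_matrix A" using f(1) by (simp add: A_def orth_matrix)
 have g: "orthogonal_transformation ((*v) A)" using A by (simp add: orth_matrix)
 have Ae: "transpose A *v e = b" using f by (simp add: A_def matrix_works_real orth_linear)
 have "(\<integral>Q. norm (Q *v e) \<partial>\<nu>) = (\<integral>Q. norm ((A ** Q ** transpose A) *v e) \<partial>\<nu>)"
  by (rule invariant_integral[OF A, symmetric]) (intro continuous_intros)
 also have "... = (\<integral>Q. norm (Q *v b) \<partial>\<nu>)" unfolding mv_assoc[symmetric] Ae orthogonal_transformation_norm[OF g] ..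
 finally show ?thesis unfolding radius_def b_def .
qed

lemma radius_pos: "0 < radius"
proof -
 obtain e :: "real^'n" where e: "norm e = 1" using vector_choose_size[of 1] by auto
 have "0 <= radius" unfolding radius_def by (rule integral_nonneg_AE) simp
 moreover have "radius ~= 0"
 proof
  assume "radius = 0"
  hence "(\<integral>Q. norm (Q *v e) \<partial>\<nu>) = 0" by (simp add: radius_eq[OF e])
  hence "AE Q in \<nu>. norm (Q *v e) = 0" by (subst (asm) integral_nonneg_eq_0_iff_AE[OF integrable_norm_mult]) auto
  hence "AE Q in \<nu>. Q *v e = 0" by simp
  moreover have "e ~= 0" using e by auto
  ultimately show False using not_AE_orthogonal by blast
 qed
 ultimately show ?thesis by simp
qed

lemma S0_inner: "S0 p .* e = (\<integral>Q. (damp (norm (Q *v p)) *: (Q *v p)) .* e \<partial>\<nu>)"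
 unfolding S0_def by (rule integral_inner_left[symmetric]) (rule integrable_S0)

lemma norm_S0_le: "norm (S0 p) <= radius"
proof (cases "S0 p = 0")
 case True
 thus ?thesis using radius_pos by simp
next
 case False
 define e where "e = S0 p /\<^sub>R norm (S0 p)"
 have e: "norm e = 1" using False by (simp add: e_def)
 have "norm (S0 p) = S0 p .* e" using False by (simp add: e_def norm_sq[symmetric] sq_eq)
 also have "... = (\<integral>Q. (damp (norm (Q *v p)) *: (Q *v p)) .* e \<partial>\<nu>)" by (rule S0_inner)
 also have "... <= (\<integral>Q. norm (Q *v e) \<partial>\<nu>)"
 proof (rule integral_mono_AE)
  show "integrable \<nu> (%Q. (damp (norm (Q *v p)) *: (Q *v p)) .* e)" by (rule integrable_inner_left) (rule integrable_S0)
  show "AE Q in \<nu>. (damp (norm (Q *v p)) *: (Q *v p)) .* e <= norm (Q *v e)"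
  proof (rule AE_rank_one)
   fix Q :: "real^'n^'n" and u assume u: "norm u = 1" "Q = outer u u"
   have "(damp (norm (Q *v p)) *: (Q *v p)) .* e = squash (u .* p) * (u .* e)" using u by (simp add: squash_def)
   also have "... <= \<bar>squash (u .* p)\<bar> * \<bar>u .* e\<bar>" unfolding abs_mult[symmetric] by (rule abs_ge_self)
   also have "... <= 1 * \<bar>u .* e\<bar>" using squash_less_1[of "u .* p"] by (intro mult_right_mono) auto
   finally show "(damp (norm (Q *v p)) *: (Q *v p)) .* e <= norm (Q *v e)" using u by simp
  qed
 qed (rule integrable_norm_mult)
 finally show ?thesis by (simp add: radius_eq[OF e])
qed

lemma S0_continuous: "continuous_on UNIV S0" using S0_derivative by (intro has_derivative_continuous_on) blast

lemma S0_image_measure: "S0 ` UNIV : sets lebesgue" "lvol (S0 ` UNIV) = mass"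
proof -
 show "S0 ` UNIV : sets lebesgue" by (rule image_sets_lebesgue[OF _ S0_derivative S0_inj]) simp
 show "lvol (S0 ` UNIV) = mass" unfolding lborel_image[OF _ S0_derivative S0_inj, simplified] mass_def
  using det_DS_pos by (simp add: less_imp_le)
qed

lemma mass_le: "mass <= vol (cball (0 :: real^'n) radius)"
proof -
 have "lvol (S0 ` UNIV) <= lvol (cball (0 :: real^'n) radius)" using norm_S0_le by (intro emeasure_mono) auto
 thus ?thesis by (simp add: S0_image_measure lebesgue_lborel)
qed

lemma mass_finite: "mass < top" using mass_le emeasure_lborel_cball_finite[of "0 :: real^'n" radius] by (auto intro: le_less_trans)

lemma mass_pos: "0 < mass"
proof -
 have m: "(%p. ennreal (det (DS p))) : borel_measurable lborel" using cont_borel[OF continuous_on_det[OF DS_continuous]] by simp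
 have "mass ~= 0"
 proof
  assume "mass = 0"
  hence "AE p in lborel. ennreal (det (DS p)) = 0" unfolding mass_def nn_integral_0_iff_AE[OF m] .
  hence "AE p in (lborel :: (real^'n) measure). False"
  proof eventually_elim
   fix p assume "ennreal (det (DS p)) = 0"
   thus False using det_DS_pos[of p] by (simp add: ennreal_eq_0_iff)
  qed
  thus False using AE_iff_measurable[of UNIV lborel "%p :: real^'n. False"] by (simp add: emeasure_lborel_UNIV)
 qed
 thus ?thesis by (simp add: zero_less_iff_neq_zero)
qed

text \<open>\<open>R\<close> reverses everything orthogonal to \<open>p\<close> and fixes
  \<open>p\<close>. Since \<open>S0\<close> commutes with it, \<open>S0 p\<close> is fixed as well
  and thus lies on the line of \<open>p\<close>.\<close>

lemma S0_parallel: "\<exists>k. S0 p = k *: p"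
proof (cases "p = 0")
 case True
 have "S0 p = 0" unfolding S0_def True by simp
 thus ?thesis using True by simp
next
 case False
 define R where "R y = (2 * (p .* y) / (p .* p)) *: p - y" for y
 have "linear R" by (rule linearI) (auto simp: R_def iar alg add_divide_distrib)
 moreover have "norm (R y) = norm y" for y
 proof -
  have pp: "p .* p ~= 0" using False by simp
  have "(p .* y) * (p .* y) * (p .* p) * 4 / ((p .* p) * (p .* p)) = (p .* y) * (p .* y) * 4 / (p .* p)" using pp by simp
  hence "R y .* R y = y .* y" using pp by (simp add: R_def idl idr icomm[of y p] field_simps)
  thus ?thesis by (simp add: norm_eq)
 qed
 ultimately have "orthogonal_transformation R" by (simp add: orthogonal_transformation)
 hence "S0 (R p) = R (S0 p)" by (rule S0_orthogonal)
 moreover have "R p = p" using False by (simp add: R_def scaleR_2)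
 ultimately have "2 *: S0 p = (2 * (p .* S0 p) / (p .* p)) *: p" by (simp add: R_def scaleR_2 alg)
 hence "S0 p = ((p .* S0 p) / (p .* p)) *: p"
  by (metis (no_types, opaque_lifting) scaleR_scaleR scaleR_left_imp_eq times_divide_eq_right zero_neq_numeral)
 thus ?thesis by blast
qed

text \<open>Far out in direction \<open>e\<close> the value of \<open>squash\<close> tends to the
  sign of \<open>u .* e\<close>, so the integrand tends to the absolute value of
  \<open>u .* e\<close>.\<close>

lemma S0_directional_limit:
 assumes e: "norm e = 1"
 shows "((%t. S0 (p + t *: e) .* e) \<longlongrightarrow> radius) at_top"
proof -
 have m0: "(%Q. norm (Q *v e)) : borel_measurable \<nu>" by (intro measurable_\<nu> continuous_intros)
 have m: "(%Q. (damp (norm (Q *v (p + t *: e))) *: (Q *v (p + t *: e))) .* e) : borel_measurable \<nu>" for t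
  by (intro measurable_\<nu> continuous_intros)
 have i1: "integrable \<nu> (%_. 1 :: real)" by simp
 have val: "(damp (norm (Q *v x)) *: (Q *v x)) .* e = squash (u .* x) * (u .* e)"
  if "norm u = 1" "Q = outer u u" for Q u x using that by (simp add: squash_def)
 have lim: "AE Q in \<nu>. ((%t. (damp (norm (Q *v (p + t *: e))) *: (Q *v (p + t *: e))) .* e) \<longlongrightarrow> norm (Q *v e)) at_top"
 proof (rule AE_rank_one)
  fix Q :: "real^'n^'n" and u assume u: "norm u = 1" "Q = outer u u"
  have "((%t. squash (u .* p + t * (u .* e)) * (u .* e)) \<longlongrightarrow> \<bar>u .* e\<bar>) at_top"
  proof -
   consider "u .* e = 0" | "u .* e > 0" | "u .* e < 0" by linarith
   thus ?thesis
   proof cases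
    case 1 thus ?thesis by simp
   next
    case 2
    have "filterlim (%t. u .* p + t * (u .* e)) at_top at_top" using 2 by real_asymp
    from tendsto_mult[OF filterlim_compose[OF squash_limit this] tendsto_const, of "u .* e"] 2
    show ?thesis by simp
   next
    case 3
    have "filterlim (%t. - (u .* p + t * (u .* e))) at_top at_top" using 3 by real_asymp
    from tendsto_mult[OF filterlim_compose[OF squash_limit this] tendsto_const, of "- (u .* e)"] 3
    show ?thesis by (simp only: squash_minus) simp
   qed
  qed
  thus "((%t. (damp (norm (Q *v (p + t *: e))) *: (Q *v (p + t *: e))) .* e) \<longlongrightarrow> norm (Q *v e)) at_top"
   unfolding val[OF u] using u by (simp add: iar)
 qed
 have bound: "\<forall>\<^sub>F t in at_top. AE Q in \<nu>. norm ((damp (norm (Q *v (p + t *: e))) *: (Q *v (p + t *: e))) .* e) <= 1"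
 proof (rule always_eventually, rule allI)
  fix t
  show "AE Q in \<nu>. norm ((damp (norm (Q *v (p + t *: e))) *: (Q *v (p + t *: e))) .* e) <= 1"
  proof (rule AE_rank_one)
   fix Q :: "real^'n^'n" and u assume u: "norm u = 1" "Q = outer u u"
   have "\<bar>u .* e\<bar> <= 1" using CS_ineq[of u e] u e by simp
   hence "\<bar>squash (u .* (p + t *: e))\<bar> * \<bar>u .* e\<bar> <= 1 * 1"
    using squash_less_1 by (intro mult_mono) (auto simp: less_imp_le)
   thus "norm ((damp (norm (Q *v (p + t *: e))) *: (Q *v (p + t *: e))) .* e) <= 1" unfolding val[OF u] by (simp add: abs_mult)
  qed
 qed
 show ?thesis unfolding S0_inner radius_eq[OF e, symmetric] by (rule integral_dominated_convergence_at_top[OF m0 m i1 lim bound])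
qed

text \<open>Since \<open>S0 p\<close> is parallel to \<open>p\<close>, it suffices to search in the
  plane of \<open>u\<close> and \<open>v\<close>. Along the line \<open>a *: u + t *: e\<close> the
  component in direction \<open>e\<close> grows continuously from 0 towards \<open>radius\<close>,
  and the intermediate value theorem applies.\<close>

lemma S0_hits:
 assumes u: "norm u = 1" and v: "u .* v = 0" "norm v < radius"
 obtains p where "u .* p = a" "S0 p - (u .* S0 p) *: u = v"
proof (cases "v = 0")
 case True
 obtain k where "S0 (a *: u) = k *: a *: u" using S0_parallel by blast
 thus thesis using u True by (intro that[of "a *: u"]) (auto simp: norm_eq_1)
next
 case False
 define e where "e = v /\<^sub>R norm v"
 have e: "norm e = 1" "u .* e = 0" "v = norm v *: e" using False v by (auto simp: e_def)
 have uu: "u .* u = 1" "e .* e = 1" using u e by (auto simp: norm_eq_1)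
 define h where "h t = S0 (a *: u + t *: e) .* e" for t
 have cont: "continuous_on UNIV h" unfolding h_def by (intro continuous_intros continuous_on_compose2[OF S0_continuous]) auto
 obtain k0 where "S0 (a *: u + 0 *: e) = k0 *: (a *: u + 0 *: e)" using S0_parallel by blast
 hence h0: "h 0 = 0" by (simp add: h_def e(2))
 have "\<forall>\<^sub>F t in at_top. norm v < h t"
  unfolding h_def using S0_directional_limit[OF e(1), of "a *: u"] v(2) by (rule order_tendstoD(1))
 hence "\<forall>\<^sub>F t in at_top. norm v < h t & 0 <= t" using eventually_ge_at_top[of 0] by eventually_elim simp
 then obtain t1 where t1: "norm v < h t1" "0 <= t1" using eventually_happens'[OF trivial_limit_at_top_linorder] by blast
 have "\<exists>t\<ge>0. t <= t1 & h t = norm v" using h0 t1 continuous_on_subset[OF cont subset_UNIV] by (intro IVT') auto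
 then obtain t where t: "h t = norm v" by blast
 obtain k where k: "S0 (a *: u + t *: e) = k *: (a *: u + t *: e)" using S0_parallel by blast
 have "k * t = norm v" using t by (simp add: h_def k ial uu e(2))
 hence "k *: (a *: u + t *: e) - (u .* (k *: (a *: u + t *: e))) *: u = norm v *: e" by (simp add: iar uu e(2) scaleR_add_right)
 thus thesis using uu e(2,3) by (intro that[of "a *: u + t *: e"]) (auto simp: iar k)
qed

text \<open>The derivative of the map that keeps the part of \<open>S0 p\<close> orthogonal to the
  line of \<open>Q\<close> and puts the profile of \<open>p\<close> along it.\<close>

definition shear :: "real^'n^'n => real^'n => real^'n^'n" where
 "shear Q p = (mat 1 - Q) ** DS p + damp (norm (Q *v p)) ^ 3 *: Q"

lemma matrix_inv_works:
 assumes "invertible (A :: real^'k^'k)"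
 shows "A ** matrix_inv A = mat 1" "matrix_inv A ** A = mat 1"
proof -
 have "A ** matrix_inv A = mat 1 & matrix_inv A ** A = mat 1" using assms unfolding matrix_inv_def invertible_def by (rule someI_ex)
 thus "A ** matrix_inv A = mat 1" "matrix_inv A ** A = mat 1" by auto
qed

lemma DS_inverse: "matrix_inv (DS p) ** DS p = mat 1" using det_DS_pos[of p] by (intro matrix_inv_works) (simp add: invertible_det_nz)

lemma det_shear:
 assumes "norm u = 1"
 shows "det (shear (outer u u) p) = det (DS p) * (damp (u .* p) ^ 3 * (u .* (matrix_inv (DS p) *v u)))"
 using det_split_projection[OF assms, of "DS p" "damp (u .* p) ^ 3" "matrix_inv (DS p)"] assms by (simp add: shear_def DS_inverse)

lemma det_shear_nonneg:
 assumes u: "norm u = 1"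
 shows "0 <= det (shear (outer u u) p)"
proof -
 define x where "x = matrix_inv (DS p) *v u"
 have "DS p *v x = u" using det_DS_pos[of p] matrix_inv_works(1)[of "DS p"] by (simp add: x_def mv_assoc invertible_det_nz)
 moreover have "0 <= x .* (DS p *v x)" using DS_positive[of p] unfolding positive_matrix_def by (cases "x = 0") (auto simp: less_imp_le)
 ultimately have "0 <= u .* x" by (simp add: icomm)
 thus ?thesis unfolding det_shear[OF u] x_def[symmetric] using det_DS_pos[of p] damp_pos[of "u .* p"] by (simp add: less_imp_le)
qed

text \<open>The map \<open>F\<close> is injective by strict monotonicity of \<open>S0\<close>, and
  its range covers the cylinder. Dilation by \<open>r / \<rho>\<close> with \<open>\<rho>\<close>
  below \<open>radius\<close> brings the whole closed ball within reach of
  \<open>S0_hits\<close>.\<close>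

lemma cyl_ball_le:
 assumes u: "norm u = 1" and \<rho>: "0 < \<rho>" "\<rho> < radius" and r: "r > 0"
 shows "vol (cyl (outer u u) (cball a r)) <= ennreal ((r / \<rho>) ^ (CARD('n) - 1)) * (\<integral>\<^sup>+p. ennreal \<bar>det (shear (outer u u) p)\<bar> \<partial>lborel)"
  (is "vol ?C <= _")
proof -
 have uu: "u .* u = 1" using u by (simp add: norm_eq_1)
 define c where "c = r / \<rho>"
 have c: "c > 0" using r \<rho> by (simp add: c_def)
 \<comment> \<open>Dilation by \<open>c\<close> orthogonally to \<open>u\<close> and the identity
   along \<open>u\<close>.\<close>
 let ?M = "c *: mat 1 + (1 - c) *: outer u u :: real^'n^'n"
 define F where "F p = c *: (S0 p - (u .* S0 p) *: u) + squash (u .* p) *: u + (a - (u .* a) *: u)" for p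
 have Fu: "u .* F p = squash (u .* p)" for p by (simp add: F_def iar idr uu)
 have inj: "inj F"
 proof (rule injI)
  fix p q assume eq: "F p = F q"
  hence upq: "u .* p = u .* q" using Fu[of p] Fu[of q] by simp
  hence "c *: (S0 p - (u .* S0 p) *: u) = c *: (S0 q - (u .* S0 q) *: u)" using eq by (simp add: F_def)
  hence "S0 p - (u .* S0 p) *: u = S0 q - (u .* S0 q) *: u" using c unfolding scaleR_cancel_left by simp
  hence "S0 p - S0 q = (u .* (S0 p - S0 q)) *: u" by (simp add: idr alg)
  hence "(S0 p - S0 q) .* (p - q) = (u .* (S0 p - S0 q)) * (u .* (p - q))" by (metis inner_scaleR_left)
  hence "(S0 p - S0 q) .* (p - q) = 0" using upq by (simp add: idr)
  thus "p = q" using S0_monotone[of q p] by (cases "p = q") auto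
 qed
 have der: "(F has_derivative (%h. (?M ** shear (outer u u) p) *v h)) (at p within A)" for p A
 proof -
  have "(squash has_derivative (*) (damp (u .* p) ^ 3)) (at (u .* p) within (%p. u .* p) ` A)"
   using squash_derivative[of "u .* p"] by (simp add: has_field_derivative_def der_within)
  from has_derivative_in_compose[OF has_derivative_inner_right[OF has_derivative_ident] this]
  have sq: "((%p. squash (u .* p)) has_derivative (%h. damp (u .* p) ^ 3 * (u .* h))) (at p within A)" by simp
  have "(F has_derivative (%h. c *: (DS p *v h - (u .* (DS p *v h)) *: u) + (damp (u .* p) ^ 3 * (u .* h)) *: u + 0)) (at p within A)"
   unfolding F_def
   by (intro has_derivative_add has_derivative_diff has_derivative_const S0_derivative has_derivative_scaleR_left has_derivative_scaleR_right has_derivative_inner_right sq)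
  moreover have "c *: (DS p *v h - (u .* (DS p *v h)) *: u) + (damp (u .* p) ^ 3 * (u .* h)) *: u + 0 = (?M ** shear (outer u u) p) *v h" for h
   using u by (simp add: shear_def mv_add mv_diff mv_assoc[symmetric]
    mv_scale[symmetric] iar idr uu alg)
  ultimately show ?thesis by simp
 qed
 have sub: "?C <= F ` UNIV"
 proof
  fix y assume "y : ?C"
  then obtain k where y: "\<bar>u .* y\<bar> < 1" "dist a k <= r" "y - k = (u .* (y - k)) *: u" using u by (auto simp: cyl_def)
  obtain s where s: "squash s = u .* y" using squash_surj[OF y(1)] by blast
  define w where "w = (k - a) - (u .* (k - a)) *: u"
  have w: "u .* w = 0" by (simp add: w_def idr uu)
  have "k - a = w + (u .* (k - a)) *: u" by (simp add: w_def)
  hence "(norm (k - a))\<^sup>2 = (norm w)\<^sup>2 + (norm ((u .* (k - a)) *: u))\<^sup>2"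
   using norm_add_Pythagorean[of w "(u .* (k - a)) *: u"] w by (simp add: orthogonal_def icomm)
  hence "norm w <= norm (k - a)" by (metis norm_ge_zero power2_le_imp_le le_add_same_cancel1 zero_le_power2)
  hence "norm w <= c * \<rho>" using y(2) \<rho> by (simp add: c_def dist_norm norm_minus_commute)
  hence "norm w < radius * c" using mult_strict_left_mono[OF \<rho>(2) c] by (simp add: mult.commute)
  hence nv: "norm ((1 / c) *: w) < radius" using c by (simp add: pos_divide_less_eq)
  have "u .* ((1 / c) *: w) = 0" using w by simp
  then obtain p where p: "u .* p = s" "S0 p - (u .* S0 p) *: u = (1 / c) *: w" by (rule S0_hits[OF u _ nv])
  have "F p = w + (u .* y) *: u + (a - (u .* a) *: u)" using c by (simp add: F_def p s)
  also have "... = y" using y(3) by (simp add: w_def idr alg)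
  finally show "y : F ` UNIV" by blast
 qed
 have "vol ?C = lvol ?C" by (intro lebesgue_lborel[symmetric] cyl_measurable) auto
 also have "... <= lvol (F ` UNIV)" by (intro emeasure_mono sub image_sets_lebesgue[OF _ der inj]) simp
 also have "... = (\<integral>\<^sup>+p. ennreal (c ^ (CARD('n) - 1)) * ennreal \<bar>det (shear (outer u u) p)\<bar> \<partial>lborel)"
  unfolding lborel_image[OF _ der inj, simplified] using c by (simp add: det_mul det_stretch[OF u c] abs_mult ennreal_mult)
 also have "... = ennreal (c ^ (CARD('n) - 1)) * (\<integral>\<^sup>+p. ennreal \<bar>det (shear (outer u u) p)\<bar> \<partial>lborel)"
 proof (rule nn_integral_cmult)
  have "continuous_on UNIV (%p. \<bar>det (shear (outer u u) p)\<bar>)"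
   unfolding shear_def by (intro continuous_intros continuous_on_compose2[OF DS_continuous]) auto
  from cont_borel[OF this]
  show "(%p. ennreal \<bar>det (shear (outer u u) p)\<bar>) : borel_measurable lborel" by simp
 qed
 finally show ?thesis by (simp add: c_def)
qed

text \<open>The Jacobian is linear in \<open>Q\<close> up to the factor \<open>damp\<close>, so
  averaging replaces \<open>Q\<close> by \<open>DS p\<close>. The trace of the identity then
  produces the factor \<open>CARD('n)\<close>.\<close>

lemma shear_integral: "(\<integral>\<^sup>+Q. ennreal \<bar>det (shear Q p)\<bar> \<partial>\<nu>) = of_nat CARD('n) * ennreal (det (DS p))"
proof -
 let ?g = "%Q. det (DS p) * (damp (norm (Q *v p)) ^ 3 * trace (matrix_inv (DS p) ** Q))"
 have eq: "AE Q in \<nu>. \<bar>det (shear Q p)\<bar> = ?g Q & 0 <= ?g Q"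
 proof (rule AE_rank_one)
  fix Q :: "real^'n^'n" and u assume u: "norm u = 1" "Q = outer u u"
  hence "det (shear Q p) = ?g Q" by (simp add: det_shear trace_mult_outer)
  thus "\<bar>det (shear Q p)\<bar> = ?g Q & 0 <= ?g Q" using det_shear_nonneg[OF u(1), of p] u(2) by simp
 qed
 hence nn: "AE Q in \<nu>. 0 <= ?g Q" by eventually_elim simp
 have "(\<integral>\<^sup>+Q. ennreal \<bar>det (shear Q p)\<bar> \<partial>\<nu>) = (\<integral>\<^sup>+Q. ennreal (?g Q) \<partial>\<nu>)"
  using eq by (intro nn_integral_cong_AE) (auto elim: eventually_mono)
 also have "... = ennreal (\<integral>Q. ?g Q \<partial>\<nu>)"
  by (rule nn_integral_eq_integral[OF integrable_mult_right[OF trace_DS(2)] nn])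
 also have "(\<integral>Q. ?g Q \<partial>\<nu>) = det (DS p) * trace (mat 1 :: real^'n^'n)" by (simp add: trace_DS DS_inverse)
 also have "ennreal ... = of_nat CARD('n) * ennreal (det (DS p))"
  using det_DS_pos[of p] by (simp add: trace_I mult.commute ennreal_mult ennreal_of_nat_eq_real_of_nat less_imp_le)
 finally show ?thesis .
qed

lemma inner_ball_shadow:
 assumes \<rho>: "0 < \<rho>" "\<rho> < radius" and r: "r > 0"
 shows "(\<integral>\<^sup>+Q. vol (cyl Q (cball a r)) \<partial>\<nu>) <= ennreal ((r / \<rho>) ^ (CARD('n) - 1)) * (of_nat CARD('n) * mass)"
proof -
 interpret pair_sigma_finite \<nu> "lborel :: (real^'n) measure" ..
 let ?D = "%z :: (real^'n^'n) \<times> (real^'n). ennreal \<bar>det (shear (fst z) (snd z))\<bar>"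
 have cont: "continuous_on UNIV (%z :: (real^'n^'n) \<times> (real^'n). \<bar>det (shear (fst z) (snd z))\<bar>)"
  unfolding shear_def by (intro continuous_intros continuous_on_compose2[OF DS_continuous]) auto
 have m: "?D : borel_measurable (\<nu> \<Otimes>\<^sub>M lborel)"
 proof -
  have s: "sets (\<nu> \<Otimes>\<^sub>M lborel) = sets (borel :: ((real^'n^'n) \<times> (real^'n)) measure)"
   unfolding sets_pair_measure_cong[OF sets_\<nu> sets_lborel] borel_prod ..
  have "?D : borel_measurable borel" using cont_borel[OF cont] by (rule mcomp) simp
  thus ?thesis using measurable_cong_sets[OF s refl] by blast
 qed
 have "(\<integral>\<^sup>+Q. vol (cyl Q (cball a r)) \<partial>\<nu>) <= (\<integral>\<^sup>+Q. ennreal ((r / \<rho>) ^ (CARD('n) - 1)) * (\<integral>\<^sup>+p. ?D (Q, p) \<partial>lborel) \<partial>\<nu>)"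
 proof (rule nn_integral_mono_AE)
  show "AE Q in \<nu>. vol (cyl Q (cball a r)) <= ennreal ((r / \<rho>) ^ (CARD('n) - 1)) * (\<integral>\<^sup>+p. ?D (Q, p) \<partial>lborel)"
  proof (rule AE_rank_one)
   fix Q :: "real^'n^'n" and u assume u: "norm u = 1" "Q = outer u u"
   thus "vol (cyl Q (cball a r)) <= ennreal ((r / \<rho>) ^ (CARD('n) - 1)) * (\<integral>\<^sup>+p. ?D (Q, p) \<partial>lborel)"
    using cyl_ball_le[OF u(1) \<rho> r] by simp
  qed
 qed
 also have "... = ennreal ((r / \<rho>) ^ (CARD('n) - 1)) * (\<integral>\<^sup>+Q. (\<integral>\<^sup>+p. ?D (Q, p) \<partial>lborel) \<partial>\<nu>)"
  by (intro nn_integral_cmult lborel.borel_measurable_nn_integral_fst m)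
 also have "(\<integral>\<^sup>+Q. (\<integral>\<^sup>+p. ?D (Q, p) \<partial>lborel) \<partial>\<nu>) = (\<integral>\<^sup>+p. (\<integral>\<^sup>+Q. ?D (Q, p) \<partial>\<nu>) \<partial>lborel)"
  by (rule Fubini[OF m, symmetric])
 also have "... = (\<integral>\<^sup>+p. of_nat CARD('n) * ennreal (det (DS p)) \<partial>lborel)" by (simp add: shear_integral)
 also have "... = of_nat CARD('n) * mass" unfolding mass_def using cont_borel[OF continuous_on_det[OF DS_continuous]]
  by (intro nn_integral_cmult) simp
 finally show ?thesis .
qed

text \<open>\<open>S0_hits\<close> reaches vectors of norm less than \<open>radius\<close> only; the
  sharp constant arises by letting \<open>\<rho>\<close> tend to \<open>radius\<close>.\<close>

theorem ball_shadow:
 assumes r: "r > 0"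
 shows "(\<integral>\<^sup>+Q. vol (cyl Q (cball a r)) \<partial>\<nu>) <= ennreal ((r / radius) ^ (CARD('n) - 1)) * (of_nat CARD('n) * mass)"
proof -
 let ?X = "\<integral>\<^sup>+Q. vol (cyl Q (cball a r)) \<partial>\<nu>"
 have fin: "of_nat CARD('n) * mass < top" using mass_finite by (simp add: ennreal_mult_less_top of_nat_less_top)
 have "((%\<rho>. (r / \<rho>) ^ (CARD('n) - 1)) \<longlongrightarrow> (r / radius) ^ (CARD('n) - 1)) (at_left radius)"
  using radius_pos by (intro tendsto_intros) auto
 hence "((%\<rho>. (of_nat CARD('n) * mass) * ennreal ((r / \<rho>) ^ (CARD('n) - 1))) \<longlongrightarrow> (of_nat CARD('n) * mass) * ennreal ((r / radius) ^ (CARD('n) - 1))) (at_left radius)"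
  by (intro ennreal_tendsto_cmult fin tendsto_ennrealI)
 moreover have "\<forall>\<^sub>F \<rho> in at_left radius. ?X <= (of_nat CARD('n) * mass) * ennreal ((r / \<rho>) ^ (CARD('n) - 1))"
 proof (rule eventually_at_leftI[OF _ radius_pos])
  fix \<rho> assume "\<rho> : {0<..<radius}"
  thus "?X <= (of_nat CARD('n) * mass) * ennreal ((r / \<rho>) ^ (CARD('n) - 1))"
   using inner_ball_shadow[of \<rho> r a] r by (simp add: mult.commute)
 qed
 ultimately have "?X <= (of_nat CARD('n) * mass) * ennreal ((r / radius) ^ (CARD('n) - 1))" by (rule tendsto_lowerbound) simp
 thus ?thesis by (simp add: mult.commute)
qed

end

section \<open>Proximal coordinates of a convex potential\<close>

lemma second_difference_estimate:
 fixes e :: "'a::euclidean_space => real" and X :: "'a => 'a"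
 assumes e: "!!z. (e has_derivative (%h. X z .* h)) (at z)" and J: "linear J"
  and approx: "!!h. norm h < d ==> norm (X (z + h) - X z - J h) <= eps * norm h"
  and s: "s > 0" "s * (norm a + norm b) < d" and eps: "eps >= 0"
 shows "\<bar>(e (z + s *: a + s *: b) - e (z + s *: a) - e (z + s *: b) + e z) - s\<^sup>2 * (J b .* a)\<bar> <= 2 * eps * s\<^sup>2 * (norm a + norm b) * norm a"
proof -
 \<comment> \<open>\<open>g\<close> is a first difference in direction \<open>b\<close>. The mean
   value theorem in direction \<open>a\<close> turns the second difference into a difference of two
   values of \<open>X\<close>, and both are linearized at the fixed point \<open>z\<close>.\<close>
 define g where "g t = e (z + t *: a + s *: b) - e (z + t *: a)" for t
 have g': "(g has_real_derivative (X (z + t *: a + s *: b) - X (z + t *: a)) .* a) (at t)" for t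
 proof -
  have 1: "((%t. e (z + t *: a + c)) has_derivative (%h. X (z + t *: a + c) .* (h *: a))) (at t)" for c
  proof (rule has_derivative_compose[OF _ e])
   show "((%t. z + t *: a + c) has_derivative (%h. h *: a)) (at t)" by (auto intro!: derivative_eq_intros)
  qed
  have "(g has_derivative (%h. X (z + t *: a + s *: b) .* (h *: a) - X (z + t *: a) .* (h *: a))) (at t)"
   unfolding g_def using has_derivative_diff[OF 1[of "s *: b"] 1[of 0]] by simp
  thus ?thesis unfolding has_field_derivative_def by (rule back_subst[of "%f. (g has_derivative f) (at t)"]) (auto simp: idl alg)
 qed
 obtain \<xi> where \<xi>: "0 < \<xi>" "\<xi> < s" "g s - g 0 = (s - 0) * ((X (z + \<xi> *: a + s *: b) - X (z + \<xi> *: a)) .* a)"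
  using MVT2[OF s(1), of g "%t. (X (z + t *: a + s *: b) - X (z + t *: a)) .* a"] g' by blast
 let ?h = "\<xi> *: a + s *: b"
 have n1: "norm ?h <= s * (norm a + norm b)"
 proof -
  have "norm ?h <= \<xi> * norm a + s * norm b" using \<xi> s by (intro norm_triangle_le) auto
  also have "... <= s * norm a + s * norm b" using \<xi> by (intro add_right_mono mult_right_mono) auto
  finally show ?thesis by (simp add: distrib_left)
 qed
 have n2: "norm (\<xi> *: a) <= s * (norm a + norm b)"
 proof -
  have "\<xi> * norm a <= s * norm a" using \<xi> by (intro mult_right_mono) auto
  moreover have "0 <= s * norm b" using s by simp
  ultimately show ?thesis using \<xi>(1) by (simp add: distrib_left)
 qed
 have "norm (X (z + ?h) - X z - J ?h) <= eps * (s * (norm a + norm b))"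
  using approx[of ?h] n1 s(2) mult_left_mono[OF n1 eps] by linarith
 moreover have "norm (X (z + \<xi> *: a) - X z - J (\<xi> *: a)) <= eps * (s * (norm a + norm b))"
  using approx[of "\<xi> *: a"] n2 s(2) mult_left_mono[OF n2 eps] by linarith
 moreover have split: "X (z + ?h) - X (z + \<xi> *: a) - s *: J b = (X (z + ?h) - X z - J ?h) - (X (z + \<xi> *: a) - X z - J (\<xi> *: a))"
  using J by (simp add: linear_add linear_scale)
 ultimately have "norm (X (z + ?h) - X (z + \<xi> *: a) - s *: J b) <= 2 * eps * (s * (norm a + norm b))" unfolding split
  using norm_triangle_ineq4[of "X (z + ?h) - X z - J ?h" "X (z + \<xi> *: a) - X z - J (\<xi> *: a)"] by linarith
 hence "\<bar>(X (z + ?h) - X (z + \<xi> *: a) - s *: J b) .* a\<bar> <= 2 * eps * (s * (norm a + norm b)) * norm a"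
  using CS_ineq order_trans mult_right_mono[OF _ norm_ge_zero] by blast
 hence "s * \<bar>(X (z + ?h) - X (z + \<xi> *: a) - s *: J b) .* a\<bar> <= s * (2 * eps * (s * (norm a + norm b)) * norm a)"
  using s by (intro mult_left_mono) auto
 moreover have "(e (z + s *: a + s *: b) - e (z + s *: a) - e (z + s *: b) + e z) - s\<^sup>2 * (J b .* a) = s * ((X (z + ?h) - X (z + \<xi> *: a) - s *: J b) .* a)"
  using \<xi>(3) unfolding g_def by (simp add: idl alg sq_eq)
 ultimately show ?thesis using s by (simp add: abs_mult sq_eq mult_ac)
qed

text \<open>Only the derivative at the single point \<open>z\<close> is available, not a continuous
  second derivative. The second difference of \<open>e\<close> is symmetric in \<open>a\<close> and
  \<open>b\<close> and approximates both pairings up to an arbitrarily small multiple of the squared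
  step.\<close>

lemma gradient_derivative_symmetric:
 fixes e :: "'a::euclidean_space => real" and X :: "'a => 'a"
 assumes e: "!!z. (e has_derivative (%h. X z .* h)) (at z)" and J: "(X has_derivative J) (at z)"
 shows "J b .* a = J a .* b"
proof -
 have lin: "linear J" using J by (rule has_derivative_linear)
 define C where "C = 2 * (norm a + norm b) * norm a + 2 * (norm b + norm a) * norm b"
 have C: "0 <= C" by (simp add: C_def)
 have "\<bar>J b .* a - J a .* b\<bar> <= eps * C" if eps: "eps > 0" for eps
 proof -
  obtain d where d: "d > 0" "!!y. norm (y - z) < d ==> norm (X y - X z - J (y - z)) <= eps * norm (y - z)"
   using J eps unfolding has_derivative_at_alt by blast
  have approx: "norm (X (z + h) - X z - J h) <= eps * norm h" if "norm h < d" for h using d(2)[of "z + h"] that by simp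
  define s where "s = d / (2 * (norm a + norm b + 1))"
  have pos: "norm a + norm b + 1 > 0" using norm_ge_zero[of a] norm_ge_zero[of b] by linarith
  have s: "s > 0" "s * (norm a + norm b) < d"
  proof -
   show "s > 0" using d(1) pos by (simp add: s_def)
   have "s * (norm a + norm b) < s * (2 * (norm a + norm b + 1))" using \<open>s > 0\<close> pos by (intro mult_strict_left_mono) auto
   also have "... = d" using pos by (simp add: s_def)
   finally show "s * (norm a + norm b) < d" .
  qed
  let ?D = "e (z + s *: a + s *: b) - e (z + s *: a) - e (z + s *: b) + e z"
  have 1: "\<bar>?D - s\<^sup>2 * (J b .* a)\<bar> <= 2 * eps * s\<^sup>2 * (norm a + norm b) * norm a"
   using eps by (intro second_difference_estimate[OF e lin approx s]) auto
  have 2: "\<bar>(e (z + s *: b + s *: a) - e (z + s *: b) - e (z + s *: a) + e z) - s\<^sup>2 * (J a .* b)\<bar> <= 2 * eps * s\<^sup>2 * (norm b + norm a) * norm b"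
   using eps s by (intro second_difference_estimate[OF e lin approx]) (auto simp: add.commute)
  have "z + s *: b + s *: a = z + s *: a + s *: b" by simp
  hence "\<bar>s\<^sup>2 * (J b .* a) - s\<^sup>2 * (J a .* b)\<bar> <= 2 * eps * s\<^sup>2 * (norm a + norm b) * norm a + 2 * eps * s\<^sup>2 * (norm b + norm a) * norm b"
   using 1 2[unfolded \<open>z + s *: b + s *: a = z + s *: a + s *: b\<close>] by linarith
  also have "... = s\<^sup>2 * (eps * C)" by (simp add: C_def alg)
  finally have "s\<^sup>2 * \<bar>J b .* a - J a .* b\<bar> <= s\<^sup>2 * (eps * C)" by (simp add: abs_mult flip: right_diff_distrib)
  thus ?thesis using s(1) by simp
 qed
 hence "\<bar>J b .* a - J a .* b\<bar> <= 0 + eps" if "eps > 0" for eps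
 proof -
  have "eps / (C + 1) * C <= eps" using that C by (simp add: field_simps)
  moreover have "\<bar>J b .* a - J a .* b\<bar> <= eps / (C + 1) * C"
   using \<open>!!eps. eps > 0 ==> \<bar>J b .* a - J a .* b\<bar> <= eps * C\<close>[of "eps / (C + 1)"] that C by simp
  ultimately show ?thesis by simp
 qed
 hence "\<bar>J b .* a - J a .* b\<bar> <= 0" by (rule field_le_epsilon)
 thus ?thesis by simp
qed

lemma power2_norm_add: "(norm (a + b))\<^sup>2 = (norm a)\<^sup>2 + 2 * (a .* b) + (norm b)\<^sup>2" for a b :: "'a::real_inner"
 by (simp add: norm_sq ial iar icomm)

lemma matrix_kernel_trivial:
 assumes "det (A :: real^'n^'n) ~= 0" "A *v x = 0"
 shows "x = 0" using assms by (auto simp: invertible_det_nz[symmetric] invertible_left_inverse matrix_left_invertible_ker)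

lemma difference_quotient:
 fixes f :: "real^'n => real^'n"
 assumes f: "(f has_derivative D) (at z)"
 shows "((%t. (1 / t) *: (f (z + t *: h) - f z)) \<longlongrightarrow> D h) (at 0)"
proof (rule vec_tendstoI)
 fix i
 have 1: "((%t. z + t *: h) has_derivative (%t. t *: h)) (at 0)" by (auto intro!: derivative_eq_intros)
 have 2: "(f has_derivative D) (at (z + 0 *: h))" using f by simp
 have "((%t. f (z + t *: h)) has_vector_derivative D h) (at 0)"
  using has_derivative_compose[OF 1 2] linear_scale[OF has_derivative_linear[OF f]] by (simp add: has_vector_derivative_def)
 hence "((%t. f (z + t *: h) $ i) has_real_derivative D h $ i) (at 0)" unfolding has_real_derivative_iff_has_vector_derivative
  by (rule bounded_linear.has_vector_derivative[OF bounded_linear_vec_nth])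
 thus "((%t. ((1 / t) *: (f (z + t *: h) - f z)) $ i) \<longlongrightarrow> D h $ i) (at 0)" by (simp add: has_field_derivative_iff)
qed

locale prox =
 fixes \<psi> :: "real^'n => real" and R :: real
 assumes convex: "convex_on UNIV \<psi>" and lip: "R-lipschitz_on UNIV \<psi>"
begin

lemma R: "0 <= R" "\<bar>\<psi> p - \<psi> q\<bar> <= R * norm (p - q)" using lip by (auto simp: lipschitz_on_def dist_norm)

lemma prox_exists: "\<exists>p. z - p : subdiff \<psi> p"
proof -
 define f where "f p = \<psi> p + (norm (p - z))\<^sup>2 / 2" for p
 have cont: "continuous_on UNIV f" unfolding f_def by (intro continuous_intros lip_cont[OF lip]) auto
 \<comment> \<open>Beyond distance \<open>2 * R\<close> the quadratic term outweighs the possible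
   decrease of the Lipschitz function, so a minimum over this ball is global.\<close>
 obtain p where p: "p : cball z (2 * R + 1)" "!!q. q : cball z (2 * R + 1) ==> f p <= f q"
  using continuous_attains_inf[of "cball z (2 * R + 1)" f] R(1) continuous_on_subset[OF cont] by auto
 have glob: "f p <= f q" for q
 proof (cases "q : cball z (2 * R + 1)")
  case True thus ?thesis by (rule p(2))
 next
  case False
  hence "2 * R + 1 < norm (q - z)" by (simp add: dist_norm norm_minus_commute)
  hence "R * norm (q - z) <= norm (q - z) * norm (q - z) / 2" using mult_right_mono[of "2 * R" "norm (q - z)" "norm (q - z)"] by simp
  moreover have "\<psi> z - R * norm (q - z) <= \<psi> q" using R(2)[of z q] by (simp add: norm_minus_commute)
  ultimately have "f z <= f q" by (simp add: f_def sq_eq)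
  moreover have "f p <= f z" using R(1) by (intro p(2)) simp
  ultimately show ?thesis by simp
 qed
 have "\<psi> p + (z - p) .* (r - p) <= \<psi> r" for r
 proof -
  have key: "(z - p) .* (r - p) <= \<psi> r - \<psi> p + t * ((norm (r - p))\<^sup>2 / 2)" if t: "0 < t" "t < 1" for t
  proof -
   have "f p <= f (p + t *: (r - p))" by (rule glob)
   moreover have "\<psi> (p + t *: (r - p)) <= (1 - t) * \<psi> p + t * \<psi> r" using convex_onD[OF convex, of t p r] t by (simp add: alg)
   moreover have "(norm (p + t *: (r - p) - z))\<^sup>2 = (norm (p - z))\<^sup>2 - 2 * t * ((z - p) .* (r - p)) + t\<^sup>2 * (norm (r - p))\<^sup>2"
   proof -
    have e: "p + t *: (r - p) - z = (p - z) + t *: (r - p)" "z - p = - (p - z)" by simp_all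
    show ?thesis unfolding e power2_norm_add inner_scaleR_right inner_minus_left norm_scaleR power_mult_distrib by simp
   qed
   ultimately have "t * ((z - p) .* (r - p)) <= t * (\<psi> r - \<psi> p + t * ((norm (r - p))\<^sup>2 / 2))"
    unfolding f_def by (simp add: alg sq_eq)
   thus ?thesis using t(1) by simp
  qed
  have "((%t. \<psi> r - \<psi> p + t * ((norm (r - p))\<^sup>2 / 2)) \<longlongrightarrow> \<psi> r - \<psi> p + 0 * ((norm (r - p))\<^sup>2 / 2)) (at_right 0)"
   by (intro tendsto_intros)
  moreover have "\<forall>\<^sub>F t in at_right 0. (z - p) .* (r - p) <= \<psi> r - \<psi> p + t * ((norm (r - p))\<^sup>2 / 2)"
   by (rule eventually_at_rightI[of 0 1]) (use key in auto)
  ultimately have "(z - p) .* (r - p) <= \<psi> r - \<psi> p + 0 * ((norm (r - p))\<^sup>2 / 2)" by (rule tendsto_lowerbound) simp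
  thus ?thesis by simp
 qed
 thus ?thesis unfolding subdiff_def by blast
qed

text \<open>The proximal map, that is, the resolvent of the subdifferential; by
  \<open>P_unique\<close> the choice is unique.\<close>

definition P :: "real^'n => real^'n" where
 "P z = (SOME p. z - p : subdiff \<psi> p)"

definition X :: "real^'n => real^'n" where
 "X z = z - P z"

lemma X_subdiff: "X z : subdiff \<psi> (P z)" unfolding X_def P_def by (rule someI_ex[OF prox_exists])

lemma X_plus_P: "X z + P z = z" by (simp add: X_def)

lemma subgradient: "x : subdiff \<psi> p ==> \<psi> p + x .* (r - p) <= \<psi> r" by (simp add: subdiff_def)

lemma subdiff_monotone:
 assumes "x : subdiff \<psi> p" "x' : subdiff \<psi> p'"
 shows "0 <= (x - x') .* (p - p')" using subgradient[OF assms(1), of p'] subgradient[OF assms(2), of p] by (simp add: idl idr)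

lemma monotone: "0 <= (X z - X z') .* (P z - P z')" by (rule subdiff_monotone[OF X_subdiff X_subdiff])

lemma P_unique:
 assumes "x : subdiff \<psi> p"
 shows "P (x + p) = p" "X (x + p) = x"
proof -
 have "0 <= (X (x + p) - x) .* (P (x + p) - p)" by (rule subdiff_monotone[OF X_subdiff assms])
 moreover have "X (x + p) - x = - (P (x + p) - p)" using X_plus_P[of "x + p"] by (simp add: alg)
 ultimately have "(P (x + p) - p) .* (P (x + p) - p) <= 0" by (simp only: inner_minus_left)
 hence "(P (x + p) - p) .* (P (x + p) - p) = 0" using inner_ge_zero[of "P (x + p) - p"] by linarith
 thus "P (x + p) = p" by simp
 thus "X (x + p) = x" by (simp add: X_def)
qed

lemma diff_split: "(X z - X z') + (P z - P z') = z - z'" by (simp add: X_def)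

lemma norm_diff_split: "(norm (z - z'))\<^sup>2 = (norm (X z - X z'))\<^sup>2 + 2 * ((X z - X z') .* (P z - P z')) + (norm (P z - P z'))\<^sup>2"
 unfolding diff_split[of z z', symmetric] by (rule power2_norm_add)

lemma X_lipschitz: "norm (X z - X z') <= norm (z - z')"
proof (rule power2_le_imp_le)
 show "(norm (X z - X z'))\<^sup>2 <= (norm (z - z'))\<^sup>2"
  using norm_diff_split[of z z'] monotone[of z z'] zero_le_power2[of "norm (P z - P z')"] by linarith
qed simp

lemma P_lipschitz: "norm (P z - P z') <= norm (z - z')"
proof (rule power2_le_imp_le)
 show "(norm (P z - P z'))\<^sup>2 <= (norm (z - z'))\<^sup>2"
  using norm_diff_split[of z z'] monotone[of z z'] zero_le_power2[of "norm (X z - X z')"] by linarith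
qed simp

lemma X_firm: "(norm (X z - X z'))\<^sup>2 <= (X z - X z') .* (z - z')"
proof -
 have "(X z - X z') .* (z - z') = (X z - X z') .* (X z - X z') + (X z - X z') .* (P z - P z')"
  by (simp only: diff_split[of z z', symmetric] iar)
 thus ?thesis using monotone[of z z'] by (simp add: norm_sq)
qed

lemma X_bounded: "norm (X z) <= R"
proof -
 have "\<psi> (P z) + X z .* (P z + X z - P z) <= \<psi> (P z + X z)" by (rule subgradient[OF X_subdiff])
 hence "(norm (X z))\<^sup>2 <= R * norm (X z)" using R(2)[of "P z + X z" "P z"] by (simp add: norm_sq)
 thus ?thesis using R(1) by (cases "X z = 0") (auto simp: sq_eq)
qed

lemma X_lipschitz_on: "1-lipschitz_on UNIV X" and P_lipschitz_on: "1-lipschitz_on UNIV P"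
 by (auto intro!: lipschitz_onI simp: dist_norm X_lipschitz P_lipschitz)

lemma X_continuous: "continuous_on UNIV X" and P_continuous: "continuous_on UNIV P" using X_lipschitz_on P_lipschitz_on lip_cont by blast+

text \<open>The Moreau envelope. Its gradient is \<open>X\<close>, which is the reason why the
  derivative of \<open>X\<close> is symmetric.\<close>

definition envelope :: "real^'n => real" where
 "envelope z = \<psi> (P z) + (norm (X z))\<^sup>2 / 2"

lemma envelope_upper: "envelope z' <= envelope z + X z .* (z' - z) + (norm (z' - z))\<^sup>2 / 2"
proof -
 have "\<psi> (P z') + X z' .* (P z - P z') <= \<psi> (P z)" by (rule subgradient[OF X_subdiff])
 moreover have "X z + (z' - z) = X z' + (P z' - P z)" using X_plus_P[of z] X_plus_P[of z'] by (simp add: X_def)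
 hence "(norm (X z + (z' - z)))\<^sup>2 = (norm (X z' + (P z' - P z)))\<^sup>2" by simp
 hence "(norm (X z))\<^sup>2 + 2 * (X z .* (z' - z)) + (norm (z' - z))\<^sup>2 = (norm (X z'))\<^sup>2 + 2 * (X z' .* (P z' - P z)) + (norm (P z' - P z))\<^sup>2"
  by (simp add: norm_sq ial iar icomm)
 moreover have "X z' .* (P z - P z') = - (X z' .* (P z' - P z))" by (simp add: idr)
 ultimately show ?thesis unfolding envelope_def using zero_le_power2[of "norm (P z' - P z)"] by linarith
qed

lemma envelope_derivative: "(envelope has_derivative (%h. X z .* h)) (at z)"
proof -
 have bound: "norm ((1 / norm (y - z)) *: (envelope y - (envelope z + X z .* (y - z)))) <= 2 * norm (y - z)" for y
 proof (cases "y = z")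
  case False
  hence pos: "0 < norm (y - z)" by simp
  have "envelope z <= envelope y + X y .* (z - y) + (norm (y - z))\<^sup>2 / 2" using envelope_upper[of z y] by (simp add: norm_minus_commute)
  moreover have "X y .* (z - y) = - (X y - X z) .* (y - z) - X z .* (y - z)" by (simp add: idl idr)
  moreover have "- (X y - X z) .* (y - z) <= (norm (y - z))\<^sup>2"
  proof -
   have "- (X y - X z) .* (y - z) <= norm (- (X y - X z)) * norm (y - z)" by (rule norm_cauchy_schwarz)
   also have "... <= norm (y - z) * norm (y - z)" unfolding norm_minus_cancel by (rule mult_right_mono[OF X_lipschitz]) simp
   finally show ?thesis by (simp only: sq_eq)
  qed
  moreover have "envelope y <= envelope z + X z .* (y - z) + (norm (y - z))\<^sup>2 / 2" by (rule envelope_upper)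
  ultimately have "\<bar>envelope y - (envelope z + X z .* (y - z))\<bar> <= 2 * (norm (y - z))\<^sup>2"
   using zero_le_power2[of "norm (y - z)"] by (simp only: abs_le_iff) linarith
  hence "\<bar>envelope y - (envelope z + X z .* (y - z))\<bar> / norm (y - z) <= 2 * (norm (y - z))\<^sup>2 / norm (y - z)"
   by (rule divide_right_mono) simp
  thus ?thesis using pos by (simp add: sq_eq)
 qed simp
 have "((%y. 2 * norm (y - z)) \<longlongrightarrow> 2 * norm (z - z)) (at z)"
  by (intro tendsto_mult tendsto_const tendsto_norm tendsto_diff tendsto_ident_at)
 hence lim: "((%y. 2 * norm (y - z)) \<longlongrightarrow> 0) (at z)" by simp
 show ?thesis unfolding has_derivative_at2
  by (intro conjI bounded_linear_inner_right Lim_null_comparison[OF always_eventually[OF allI[OF bound]] lim])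
qed

text \<open>A limit along a fixed sequence of step sizes: total and Borel measurable, and equal to
  the matrix of the derivative wherever that exists.\<close>

definition JX :: "real^'n => real^'n^'n" where
 "JX z = (\<chi> i j. lim (%k. real (Suc k) * (X (z + (1 / real (Suc k)) *: axis j 1) $ i - X z $ i)))"

lemma JX_measurable: "JX : borel_measurable borel"
proof -
 have "(%z. JX z $ i $ j) : borel_measurable borel" for i j
 proof -
  have c: "(%z. real (Suc k) * (X (z + (1 / real (Suc k)) *: axis j 1) $ i - X z $ i)) : borel_measurable borel" for k
   by (intro cont_borel continuous_intros continuous_on_compose2[OF X_continuous]) auto
  show ?thesis unfolding JX_def vec_lambda_beta by (rule borel_measurable_lim_metric[OF c])
 qed
 thus ?thesis by (subst borel_measurable_euclidean_space) (auto simp: Basis_vec_def inner_axis)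
qed

lemma JX_derivative:
 assumes D: "(X has_derivative D) (at z)"
 shows "D = (%h. JX z *v h)"
proof -
 have "JX z $ i $ j = D (axis j 1) $ i" for i j
 proof -
  have "filterlim (%k. 1 / real (Suc k)) (at 0) sequentially" using LIMSEQ_inverse_real_of_nat by (auto simp: filterlim_at inverse_eq_divide)
  from filterlim_compose[OF tendsto_vec_nth[OF difference_quotient[OF D]] this]
  show ?thesis unfolding JX_def by (simp add: limI)
 qed
 hence "JX z = matrix D" by (simp add: matrix_def vec_eq_iff)
 thus ?thesis using has_derivative_linear[OF D] by (simp add: matrix_works_real)
qed

lemma JX_symmetric:
 assumes J: "(X has_derivative (%h. JX z *v h)) (at z)"
 shows "symmetric_matrix (JX z)" unfolding symmetric_matrix_def
proof (rule transpose_eqI)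
 fix a b
 show "(JX z *v a) .* b = a .* (JX z *v b)" using gradient_derivative_symmetric[OF envelope_derivative J, of a b] by (simp only: icomm[of a])
qed

lemma JX_firm:
 assumes J: "(X has_derivative (%h. JX z *v h)) (at z)"
 shows "(norm (JX z *v h))\<^sup>2 <= (JX z *v h) .* h"
proof (rule tendsto_le[OF trivial_limit_at])
 let ?q = "%t. (1 / t) *: (X (z + t *: h) - X z)"
 show "((%t. (norm (?q t))\<^sup>2) \<longlongrightarrow> (norm (JX z *v h))\<^sup>2) (at 0)"
  and "((%t. ?q t .* h) \<longlongrightarrow> (JX z *v h) .* h) (at 0)" by (intro tendsto_intros difference_quotient[OF J])+
 have "(norm (?q t))\<^sup>2 <= ?q t .* h" for t
 proof (cases "t = 0")
  case False
  have "(norm (X (z + t *: h) - X z))\<^sup>2 / t\<^sup>2 <= (t * ((X (z + t *: h) - X z) .* h)) / t\<^sup>2"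
   using X_firm[of "z + t *: h" z] by (intro divide_right_mono) auto
  thus ?thesis using False by (simp add: power_mult_distrib power_divide sq_eq)
 qed simp
 thus "\<forall>\<^sub>F t in at 0. (norm (?q t))\<^sup>2 <= ?q t .* h" by simp
qed

lemma JX_nonneg:
 assumes J: "(X has_derivative (%h. JX z *v h)) (at z)"
 shows "nonneg_matrix (JX z)" "nonneg_matrix (mat 1 - JX z)"
proof -
 have "0 <= h .* (JX z *v h)" for h using JX_firm[OF J, of h] zero_le_power2[of "norm (JX z *v h)"] by (simp only: icomm[of h])
 thus "nonneg_matrix (JX z)" using JX_symmetric[OF J] by (simp add: nonneg_matrix_def)
 have "transpose (mat 1 - JX z) = mat 1 - JX z"
  using JX_symmetric[OF J] unfolding symmetric_matrix_def by (simp add: transpose_def vec_eq_iff mat_def)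
 moreover have "0 <= h .* ((mat 1 - JX z) *v h)" for h
 proof -
  have "(norm (JX z *v h))\<^sup>2 <= norm (JX z *v h) * norm h" using JX_firm[OF J, of h] norm_cauchy_schwarz[of "JX z *v h" h] by linarith
  hence "norm (JX z *v h) <= norm h" by (cases "JX z *v h = 0") (auto simp: sq_eq)
  hence "(JX z *v h) .* h <= norm h * norm h"
   using norm_cauchy_schwarz[of "JX z *v h" h] mult_right_mono[of "norm (JX z *v h)" "norm h" "norm h"] by simp
  thus ?thesis by (simp add: mv_diff idr icomm[of h] norm_sq[symmetric] sq_eq)
 qed
 ultimately show "nonneg_matrix (mat 1 - JX z)" by (simp add: nonneg_matrix_def symmetric_matrix_def)
qed

text \<open>If the monotonicity pairing vanishes, the potential is affine between \<open>P z\<close>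
  and \<open>P z'\<close> with both \<open>X z\<close> and \<open>X z'\<close> as supporting slopes.
  Convex combinations of the slopes are then subgradients at the corresponding combinations of the
  points.\<close>

lemma affine_on_segment:
 assumes eq: "(X z' - X z) .* (P z' - P z) = 0" and t: "0 <= t" "t <= 1"
 shows "X (z + t *: (z' - z)) = X z + t *: (X z' - X z)"
proof -
 let ?x = "X z" and ?x' = "X z'" and ?p = "P z" and ?p' = "P z'"
 have g: "\<psi> ?p + ?x .* (?p' - ?p) <= \<psi> ?p'" by (rule subgradient[OF X_subdiff])
 have "\<psi> ?p' + ?x' .* (?p - ?p') <= \<psi> ?p" by (rule subgradient[OF X_subdiff])
 hence g': "\<psi> ?p' <= \<psi> ?p + ?x' .* (?p' - ?p)" by (simp add: idr)
 have e1: "?x' .* (?p' - ?p) = ?x .* (?p' - ?p)" using eq by (simp add: idl)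
 hence e2: "\<psi> ?p' = \<psi> ?p + ?x .* (?p' - ?p)" using g g' by simp
 define pt where "pt = ?p + t *: (?p' - ?p)"
 define xt where "xt = ?x + t *: (?x' - ?x)"
 have pt: "\<psi> pt <= \<psi> ?p + t * (?x .* (?p' - ?p))"
 proof -
  have "\<psi> ((1 - t) *: ?p + t *: ?p') <= (1 - t) * \<psi> ?p + t * \<psi> ?p'" using convex_onD[OF convex, of t ?p ?p'] t by simp
  moreover have "(1 - t) *: ?p + t *: ?p' = pt" by (simp add: pt_def alg)
  moreover have "(1 - t) * \<psi> ?p + t * \<psi> ?p' = \<psi> ?p + t * (?x .* (?p' - ?p))" unfolding e2 by (simp add: alg)
  ultimately show ?thesis by simp
 qed
 have "xt : subdiff \<psi> pt" unfolding subdiff_def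
 proof (intro CollectI allI)
  fix r
  have a: "\<psi> pt + ?x .* (r - pt) <= \<psi> r"
  proof -
   have "\<psi> ?p + ?x .* (r - ?p) <= \<psi> r" by (rule subgradient[OF X_subdiff])
   moreover have "?x .* (r - ?p) = t * (?x .* (?p' - ?p)) + ?x .* (r - pt)" by (simp add: pt_def idr iar)
   ultimately show ?thesis using pt by linarith
  qed
  have b: "\<psi> pt + ?x' .* (r - pt) <= \<psi> r"
  proof -
   have "\<psi> ?p' + ?x' .* (r - ?p') <= \<psi> r" by (rule subgradient[OF X_subdiff])
   moreover have "?x' .* (r - ?p') = (t - 1) * (?x' .* (?p' - ?p)) + ?x' .* (r - pt)" by (simp add: pt_def idr iar alg)
   hence "?x' .* (r - ?p') = t * (?x .* (?p' - ?p)) - ?x .* (?p' - ?p) + ?x' .* (r - pt)" unfolding e1 by (simp add: left_diff_distrib)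
   ultimately show ?thesis using pt e2 by linarith
  qed
  have "\<psi> pt + xt .* (r - pt) = (1 - t) * (\<psi> pt + ?x .* (r - pt)) + t * (\<psi> pt + ?x' .* (r - pt))"
   by (simp add: xt_def ial idl alg)
  also have "... <= (1 - t) * \<psi> r + t * \<psi> r" using a b t by (intro add_mono mult_left_mono) auto
  finally show "\<psi> pt + xt .* (r - pt) <= \<psi> r" by (simp add: alg)
 qed
 hence "X (xt + pt) = xt" by (rule P_unique)
 moreover have "xt + pt = z + t *: (z' - z)" using X_plus_P[of z] X_plus_P[of z'] diff_split[of z' z] by (simp add: xt_def pt_def X_def alg)
 ultimately show ?thesis by (simp add: xt_def)
qed

text \<open>Source of all injectivity statements: a coincidence of values at an arbitrary
  \<open>z'\<close> becomes a kernel vector of a derivative at \<open>z\<close> alone.\<close>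

lemma derivative_on_segment:
 assumes J: "(X has_derivative (%h. JX z *v h)) (at z)" and eq: "(X z' - X z) .* (P z' - P z) = 0"
 shows "JX z *v (z' - z) = X z' - X z"
proof -
 have "((%t. X (z + t *: (z' - z))) has_derivative (%t. JX z *v (t *: (z' - z)))) (at 0 within {0..1})"
 proof -
  have 1: "((%t. z + t *: (z' - z)) has_derivative (%t. t *: (z' - z))) (at 0 within {0..1})" by (auto intro!: derivative_eq_intros)
  have 2: "(X has_derivative (%h. JX z *v h)) (at (z + 0 *: (z' - z)))" using J by simp
  show ?thesis by (rule has_derivative_compose[OF 1 2])
 qed
 hence 1: "((%t. X (z + t *: (z' - z))) has_vector_derivative JX z *v (z' - z)) (at 0 within {0..1})"
  by (simp add: has_vector_derivative_def mv_scaleR)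
 have "((%t. X z + t *: (X z' - X z)) has_vector_derivative X z' - X z) (at 0 within {0..1})" by (auto intro!: derivative_eq_intros)
 hence 2: "((%t. X (z + t *: (z' - z))) has_vector_derivative X z' - X z) (at 0 within {0..1})"
  by (rule has_vector_derivative_transform[rotated 2]) (auto simp: affine_on_segment[OF eq])
 show ?thesis using 1 2 by (rule vector_derivative_unique_within[rotated]) (simp add: trivial_limit_within islimpt_Icc)
qed

text \<open>Rademacher's theorem gives a Lebesgue null set; a Borel null superset keeps the later
  sets in the Borel algebra.\<close>

definition N :: "(real^'n) set" where
 "N = (SOME N. N : null_sets lborel & {z. ~ X differentiable (at z)} <= N)"

lemma N: "N : null_sets lborel" and N_derivative: "z ~: N ==> (X has_derivative (%h. JX z *v h)) (at z)"
proof -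
 have "{z. ~ X differentiable (at z)} : null_sets lebesgue" using Rademacher[OF X_lipschitz_on] by (simp add: neg_null)
 hence "\<exists>N. N : null_sets lborel & {z. ~ X differentiable (at z)} <= N" unfolding null_sets_completion_iff2 by blast
 hence *: "N : null_sets lborel & {z. ~ X differentiable (at z)} <= N" unfolding N_def by (rule someI_ex)
 thus "N : null_sets lborel" by blast
 assume "z ~: N"
 hence "X differentiable (at z)" using * by blast
 then obtain D where D: "(X has_derivative D) (at z)" unfolding differentiable_def by blast
 thus "(X has_derivative (%h. JX z *v h)) (at z)" using JX_derivative[OF D] by simp
qed

lemma P_derivative:
 assumes "(X has_derivative (%h. JX z *v h)) (at z)"
 shows "(P has_derivative (%h. (mat 1 - JX z) *v h)) (at z)"
proof -
 have "((%z. z - X z) has_derivative (%h. h - JX z *v h)) (at z)" by (intro has_derivative_diff has_derivative_ident assms)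
 moreover have "(%z. z - X z) = P" by (auto simp: X_def)
 ultimately show ?thesis by (simp add: mv_diff)
qed

lemma X_inj:
 assumes "(X has_derivative (%h. JX z *v h)) (at z)" "det (JX z) ~= 0" "X z' = X z"
 shows "z' = z"
proof -
 have "JX z *v (z' - z) = 0" using derivative_on_segment[OF assms(1), of z'] assms(3) by simp
 thus ?thesis using matrix_kernel_trivial[OF assms(2)] by force
qed

lemma P_inj:
 assumes "(X has_derivative (%h. JX z *v h)) (at z)" "det (mat 1 - JX z) ~= 0" "P z' = P z"
 shows "z' = z"
proof -
 have "JX z *v (z' - z) = X z' - X z" using derivative_on_segment[OF assms(1), of z'] assms(3) by simp
 hence "(mat 1 - JX z) *v (z' - z) = 0" using diff_split[of z' z] assms(3) by (simp add: mv_diff)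
 thus ?thesis using matrix_kernel_trivial[OF assms(2)] by force
qed

end

section \<open>The isoperimetric estimate for shadows\<close>

text \<open>Inner regularity. It extends estimates such as the transport inequality, which is known
  for compact sets only.\<close>

lemma emeasure_le_by_compact:
 fixes S K :: "'a::euclidean_space set"
 assumes S: "S : sets lebesgue" "S <= K" and K: "compact K" and c: "c >= 0"
  and bound: "!!E. compact E ==> E <= S ==> ennreal c * lvol E <= B"
 shows "ennreal c * lvol S <= B"
proof (rule ennreal_le_epsilon)
 fix e :: real assume e: "e > 0"
 hence "e / (c + 1) > 0" using c by simp
 then obtain T where T: "closed T" "T <= S" "S - T : lmeasurable" "lvol (S - T) < ennreal (e / (c + 1))"
  using sets_lebesgue_inner_closed[OF S(1)] by blast
 have "T = K Int T" using T(2) S(2) by blast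
 moreover have "compact (K Int T)" using K T(1) by (rule compact_Int_closed)
 ultimately have cT: "compact T" by simp
 have "lvol S = lvol T + lvol (S - T)" using T cT S(1) by (subst plus_emeasure) (auto simp: Un_absorb1)
 hence "ennreal c * lvol S = ennreal c * lvol T + ennreal c * lvol (S - T)" by (simp add: distrib_left)
 also have "... <= B + ennreal c * ennreal (e / (c + 1))" using T(4) by (intro add_mono bound[OF cT T(2)] mult_left_mono) auto
 also have "ennreal c * ennreal (e / (c + 1)) <= ennreal e"
 proof -
  have "c * (e / (c + 1)) <= e" using e c by (simp add: field_simps)
  thus ?thesis using c e by (simp flip: ennreal_mult)
 qed
 finally show "ennreal c * lvol S <= B + ennreal e" by (simp add: add_left_mono)
qed

lemma nonneg_matrix_nonsingular:
 assumes A: "nonneg_matrix (A :: real^'n^'n)" and det: "det A ~= 0"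
 shows "positive_matrix A" unfolding positive_matrix_def
proof (intro conjI allI impI)
 show "symmetric_matrix A" using A by (simp add: nonneg_matrix_def)
 fix x :: "real^'n" assume x: "x ~= 0"
 have "0 <= x .* (A *v x)" using A by (simp add: nonneg_matrix_def)
 moreover have "x .* (A *v x) ~= 0" using nonneg_matrix_kernel[OF A] matrix_kernel_trivial[OF det] x by blast
 ultimately show "0 < x .* (A *v x)" by simp
qed

lemma nonneg_matrix_det: "nonneg_matrix (A :: real^'n^'n) ==> 0 <= det A"
 using nonneg_matrix_nonsingular[of A] positive_matrix_det_trace(1)[of A] by (cases "det A = 0") auto

lemma negligible_Lipschitz_image:
 fixes f :: "'a::euclidean_space => 'a"
 assumes f: "L-lipschitz_on UNIV f" and N: "negligible N"
 shows "negligible (f ` N)"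
proof (rule negligible_locally_Lipschitz_image[OF order.refl N])
 fix x assume "x : N"
 show "\<exists>T B. open T & x : T & (\<forall>y\<in>N Int T. norm (f y - f x) <= B * norm (y - x))"
  using f by (intro exI[of _ UNIV] exI[of _ L]) (auto simp: lipschitz_on_def dist_norm)
qed

lemma null_sets_lborel_negligible: "N : null_sets lborel ==> negligible N" by (simp add: neg_null null_sets_completionI)

section \<open>Change of variables in proximal coordinates\<close>

locale shadow_transport =
 fixes \<nu> :: "(real^'n^'n) measure" and \<psi> :: "real^'n => real" and R :: real and K :: "(real^'n) set" and c :: real
 assumes distribution: "hyperplane_distribution \<nu>" and potential: "prox \<psi> R"
  and K: "compact K" and c: "c > 0"
  and transport: "!!E. compact E ==> E <= K ==> ennreal c * vol E \<le>
   (\<integral>\<^sup>+p. ennreal (det (hyperplane_distribution.DS \<nu> p)) * indicator {p. E Int subdiff \<psi> p ~= {}} p \<partial>lborel)"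
begin

sublocale hyperplane_distribution \<nu> by (rule distribution)
sublocale prox \<psi> R by (rule potential)

definition G :: "(real^'n) set" where
 "G = {z. z ~: N & det (JX z) ~= 0 & X z : K}"

definition bad :: "(real^'n) set" where
 "bad = N Un {z. z ~: N & det (JX z) = 0}"

lemma N_borel: "N : sets borel" using N by (auto simp: null_sets_def)

lemma X_measurable: "X : borel_measurable borel" and P_measurable: "P : borel_measurable borel"
 by (auto intro!: cont_borel X_continuous P_continuous)

lemma det_JX_measurable: "(%z. det (JX z)) : borel_measurable borel"
 by (rule mcomp[OF JX_measurable cont_borel[OF continuous_on_det[OF continuous_on_id]]])

lemma det_co_JX_measurable: "(%z. det (mat 1 - JX z)) : borel_measurable borel"
proof -
 have "continuous_on UNIV (%A :: real^'n^'n. det (mat 1 - A))" by (intro continuous_intros)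
 from mcomp[OF JX_measurable cont_borel[OF this]] show ?thesis .
qed

lemma det_DS_measurable: "(%p. det (DS p)) : borel_measurable borel" by (intro cont_borel continuous_on_det DS_continuous)

lemma det_DS_P_measurable: "(%z. det (DS (P z))) : borel_measurable borel" by (rule mcomp[OF P_measurable det_DS_measurable])

lemma borel_pred:
 assumes "f : borel_measurable borel" "A : sets borel"
 shows "{z. f z : A} : sets borel" using measurable_sets[OF assms] by (simp add: vimage_def)

lemma G_borel: "G : sets borel"
proof -
 have "G = (UNIV - N) Int {z. det (JX z) : - {0}} Int {z. X z : K}" by (auto simp: G_def)
 also have "... : sets borel" using N_borel K by (intro sets.Int borel_pred det_JX_measurable X_measurable) (auto simp: borel_compact)
 finally show ?thesis .
qed

lemma singular_borel: "{z. z ~: N & det (JX z) = 0} : sets borel"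
proof -
 have "{z. z ~: N & det (JX z) = 0} = (UNIV - N) Int {z. det (JX z) : {0}}" by auto
 also have "... : sets borel" using N_borel by (intro sets.Int borel_pred det_JX_measurable) auto
 finally show ?thesis .
qed

lemma N_negligible: "negligible N" using N by (rule null_sets_lborel_negligible)

lemma X_bad_negligible: "negligible (X ` bad)"
proof -
 have "negligible (X ` {z. z ~: N & det (JX z) = 0})"
 proof (rule negligible_image_singular)
  show "{z. z ~: N & det (JX z) = 0} : sets lebesgue" using singular_borel by simp
  show "(X has_derivative (%h. JX z *v h)) (at z within A)" if "z : {z. z ~: N & det (JX z) = 0}" for z A
   using N_derivative[of z] that by (auto intro: der_within)
 qed auto
 thus ?thesis unfolding bad_def image_Un using negligible_Lipschitz_image[OF X_lipschitz_on N_negligible] by simp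
qed

lemma det_co_nonneg: "z ~: N ==> 0 <= det (mat 1 - JX z)" and det_JX_nonneg: "z ~: N ==> 0 <= det (JX z)"
 using JX_nonneg[OF N_derivative] nonneg_matrix_det by blast+

text \<open>Where the Jacobian of \<open>P\<close> is nonzero, \<open>P\<close> is injective and the
  change of variables formula holds. The remaining part has a null image, by the theorem on singular
  values and the Lipschitz property.\<close>

lemma P_image_bound:
 assumes T: "T : sets borel"
 shows "(\<integral>\<^sup>+p. ennreal (det (DS p)) * indicator (P ` T) p \<partial>lborel) <= (\<integral>\<^sup>+z. ennreal (det (DS (P z)) * det (mat 1 - JX z)) * indicator T z \<partial>lborel)"
proof -
 define T1 where "T1 = T Int {z. z ~: N & det (mat 1 - JX z) ~= 0}"
 define T2 where "T2 = T Int {z. z ~: N & det (mat 1 - JX z) = 0}"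
 have T1: "T1 : sets borel"
 proof -
  have "T1 = T Int (UNIV - N) Int {z. det (mat 1 - JX z) : - {0}}" by (auto simp: T1_def)
  also have "... : sets borel" using N_borel T by (intro sets.Int borel_pred det_co_JX_measurable) auto
  finally show ?thesis .
 qed
 have T2: "T2 : sets borel"
 proof -
  have "T2 = T Int (UNIV - N) Int {z. det (mat 1 - JX z) : {0}}" by (auto simp: T2_def)
  also have "... : sets borel" using N_borel T by (intro sets.Int borel_pred det_co_JX_measurable) auto
  finally show ?thesis .
 qed
 have der: "(P has_derivative (%h. (mat 1 - JX z) *v h)) (at z within A)" if "z ~: N" for z A
  using P_derivative[OF N_derivative[OF that]] by (rule der_within)
 have neg: "negligible (P ` T2 Un P ` N)"
 proof (rule negligible_Un)
  show "negligible (P ` T2)"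
  proof (rule negligible_image_singular)
   show "T2 : sets lebesgue" using T2 by simp
   show "(P has_derivative (%h. (mat 1 - JX z) *v h)) (at z within T2)" if "z : T2" for z using der[of z T2] that by (simp add: T2_def)
   show "det (matrix ((*v) (mat 1 - JX z))) = 0" if "z : T2" for z using that by (simp add: T2_def)
  qed
  show "negligible (P ` N)" by (rule negligible_Lipschitz_image[OF P_lipschitz_on N_negligible])
 qed
 have inj: "inj_on P T1"
 proof (rule inj_onI)
  fix z z' assume z: "z : T1" "z' : T1" "P z = P z'"
  thus "z = z'" using P_inj[OF N_derivative[of z'], of z] by (auto simp: T1_def)
 qed
 have "(\<integral>\<^sup>+p. ennreal (det (DS p)) * indicator (P ` T) p \<partial>lborel) = (\<integral>\<^sup>+p. ennreal (det (DS p)) * indicator (P ` T) p \<partial>lebesgue)"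
  by (simp add: nn_integral_completion)
 also have "... <= (\<integral>\<^sup>+p. ennreal (det (DS p)) * indicator (P ` T1) p \<partial>lebesgue)"
 proof (rule nn_integral_mono_AE)
  have "P ` T2 Un P ` N : null_sets lebesgue" using neg by (simp add: neg_null)
  moreover have "P ` T <= P ` T1 Un (P ` T2 Un P ` N)" by (auto simp: T1_def T2_def)
  ultimately show "AE p in lebesgue. ennreal (det (DS p)) * indicator (P ` T) p <= ennreal (det (DS p)) * indicator (P ` T1) p"
   by (intro AE_I'[of "P ` T2 Un P ` N"]) (auto simp: indicator_def)
 qed
 also have "... = (\<integral>\<^sup>+z. ennreal (det (DS (P z))) * (ennreal \<bar>det (matrix (%h. (mat 1 - JX z) *v h))\<bar> * indicator T1 z) \<partial>lebesgue)"
 proof (rule nn_integral_image)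
  show "T1 : sets lebesgue" using T1 by simp
  show "(P has_derivative (%h. (mat 1 - JX z) *v h)) (at z within T1)" if "z : T1" for z using der[of z T1] that by (simp add: T1_def)
  show "(%p. ennreal (det (DS p))) : borel_measurable borel" using det_DS_measurable by (rule mcomp) simp
 qed (rule inj)
 also have "... <= (\<integral>\<^sup>+z. ennreal (det (DS (P z)) * det (mat 1 - JX z)) * indicator T z \<partial>lebesgue)"
 proof (rule nn_integral_mono)
  fix z
  show "ennreal (det (DS (P z))) * (ennreal \<bar>det (matrix (%h. (mat 1 - JX z) *v h))\<bar> * indicator T1 z) <= ennreal (det (DS (P z)) * det (mat 1 - JX z)) * indicator T z"
   using det_DS_pos[of "P z"] det_co_nonneg[of z] by (auto simp: T1_def indicator_def ennreal_mult less_imp_le)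
 qed
 finally show ?thesis by (simp add: nn_integral_completion)
qed

lemma X_image_measure:
 assumes T: "T : sets borel" "T <= G"
 shows "X ` T : sets lebesgue" "lvol (X ` T) = (\<integral>\<^sup>+z. ennreal (det (JX z)) * indicator T z \<partial>lborel)"
proof -
 have T': "T : sets lebesgue" using T by simp
 have der: "(X has_derivative (%h. JX z *v h)) (at z within T)" if "z : T" for z
  using N_derivative[of z] that T(2) by (auto simp: G_def intro: der_within)
 have inj: "inj_on X T"
 proof (rule inj_onI)
  fix z z' assume z: "z : T" "z' : T" "X z = X z'"
  thus "z = z'" using X_inj[OF N_derivative[of z'], of z] T(2) by (auto simp: G_def)
 qed
 show "X ` T : sets lebesgue" by (rule image_sets_lebesgue[OF T' der inj])
 have "lvol (X ` T) = (\<integral>\<^sup>+z. ennreal \<bar>det (matrix (%h. JX z *v h))\<bar> * indicator T z \<partial>lborel)"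
  by (rule lborel_image[OF T' der inj])
 also have "... = (\<integral>\<^sup>+z. ennreal (det (JX z)) * indicator T z \<partial>lborel)"
 proof (rule nn_integral_cong)
  fix z
  show "ennreal \<bar>det (matrix (%h. JX z *v h))\<bar> * indicator T z = ennreal (det (JX z)) * indicator T z"
   using det_JX_nonneg[of z] T(2) by (auto simp: indicator_def G_def)
 qed
 finally show "lvol (X ` T) = (\<integral>\<^sup>+z. ennreal (det (JX z)) * indicator T z \<partial>lborel)" .
qed

lemma subdiff_meets: "{p. E Int subdiff \<psi> p ~= {}} = P ` (X -` E)"
proof (intro set_eqI iffI)
 fix p assume "p : {p. E Int subdiff \<psi> p ~= {}}"
 then obtain x where "x : E" "x : subdiff \<psi> p" by blast
 thus "p : P ` (X -` E)" using P_unique[of x p] by (intro image_eqI[of _ _ "x + p"]) auto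
next
 fix p assume "p : P ` (X -` E)"
 thus "p : {p. E Int subdiff \<psi> p ~= {}}" using X_subdiff by blast
qed

lemma transport_bound:
 assumes E: "compact E" "E <= K"
 shows "ennreal c * lvol E <= (\<integral>\<^sup>+z. ennreal (det (DS (P z)) * det (mat 1 - JX z)) * indicator (X -` E) z \<partial>lborel)"
proof -
 have "X -` E : sets borel" using borel_pred[OF X_measurable borel_compact[OF E(1)]] by (simp add: vimage_def)
 from order_trans[OF transport[OF E, unfolded subdiff_meets] P_image_bound[OF this]]
 show ?thesis using E(1) by (simp add: lebesgue_lborel borel_compact)
qed

text \<open>A compact part of \<open>K\<close> that avoids the images of \<open>G\<close> and of
  \<open>bad\<close> has empty preimage under \<open>X\<close>, so \<open>transport_bound\<close>
  forces its volume to be 0.\<close>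

lemma K_minus_image_null: "lvol (K - X ` G) = 0"
proof -
 have XG: "X ` G : sets lebesgue" by (rule X_image_measure(1)[OF G_borel order.refl])
 have Xb: "X ` bad : null_sets lebesgue" using X_bad_negligible by (simp add: neg_null)
 let ?H = "K - X ` G - X ` bad"
 have H: "?H : sets lebesgue" using K XG null_setsD2[OF Xb] by (intro sets.Diff) (auto simp: borel_compact)
 have "ennreal c * lvol ?H <= 0"
 proof (rule emeasure_le_by_compact[OF H _ K])
  fix E assume E: "compact E" "E <= ?H"
  have "X -` E = {}" using E(2) by (auto simp: G_def bad_def)
  thus "ennreal c * lvol E <= 0" using transport_bound[OF E(1)] E(2) by auto
 qed (use c in auto)
 hence "lvol ?H = 0" using c by simp
 hence "?H : null_sets lebesgue" using H by auto
 hence "?H Un X ` bad : null_sets lebesgue" using Xb by (rule null_sets.Un)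
 hence "K - X ` G : null_sets lebesgue" by (rule null_sets_completion_subset[rotated]) auto
 thus ?thesis by auto
qed

lemma measure_K: "vol K = (\<integral>\<^sup>+z. ennreal (det (JX z)) * indicator G z \<partial>lborel)"
proof -
 have XG: "X ` G : sets lebesgue" by (rule X_image_measure(1)[OF G_borel order.refl])
 have sub: "X ` G <= K" by (auto simp: G_def)
 have "lvol K = lvol (X ` G) + lvol (K - X ` G)" using XG K sub by (subst plus_emeasure) (auto simp: borel_compact Un_absorb1)
 thus ?thesis using K X_image_measure(2)[OF G_borel order.refl] by (simp add: K_minus_image_null lebesgue_lborel borel_compact)
qed

lemma Monge_Ampere: "AE z in lborel. z : G --> c * det (JX z) <= det (DS (P z)) * det (mat 1 - JX z)"
proof -
 let ?f = "%z. det (DS (P z)) * det (mat 1 - JX z)" and ?g = "%z. c * det (JX z)"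
 define T where "T = {z : G. ?f z < ?g z}"
 have fm: "?f : borel_measurable borel" and gm: "?g : borel_measurable borel"
  using det_DS_P_measurable det_co_JX_measurable det_JX_measurable by (auto intro!: borel_measurable_times)
 have T: "T : sets borel"
 proof -
  have "T = G Int {z. ?f z < ?g z}" by (auto simp: T_def)
  also have "... : sets borel" using borel_measurable_less[OF fm gm] by (intro sets.Int G_borel) simp
  finally show ?thesis .
 qed
 have TG: "T <= G" by (auto simp: T_def)
 have TN: "z ~: N" if "z : T" for z using that by (auto simp: T_def G_def)
 have XT: "X ` T : sets lebesgue" by (rule X_image_measure(1)[OF T TG])
 have Xb: "X ` bad : null_sets lebesgue" using X_bad_negligible by (simp add: neg_null)
 have "ennreal c * lvol (X ` T - X ` bad) <= (\<integral>\<^sup>+z. ennreal (?f z) * indicator T z \<partial>lborel)"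
 proof (rule emeasure_le_by_compact[OF _ _ K])
  show "X ` T - X ` bad : sets lebesgue" using XT Xb by auto
  show "X ` T - X ` bad <= K" by (auto simp: T_def G_def)
  fix E assume E: "compact E" "E <= X ` T - X ` bad"
  have sub: "X -` E <= T"
  proof
   fix z assume z: "z : X -` E"
   then obtain t where t: "t : T" "X z = X t" using E(2) by auto
   hence "z = t" using X_inj[OF N_derivative[of t], of z] by (auto simp: T_def G_def)
   thus "z : T" using t by simp
  qed
  have "ennreal c * lvol E <= (\<integral>\<^sup>+z. ennreal (?f z) * indicator (X -` E) z \<partial>lborel)"
   using E by (intro transport_bound) (auto simp: T_def G_def)
  also have "... <= (\<integral>\<^sup>+z. ennreal (?f z) * indicator T z \<partial>lborel)"
   using sub by (intro nn_integral_mono mult_left_mono) (auto simp: indicator_def)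
  finally show "ennreal c * lvol E <= (\<integral>\<^sup>+z. ennreal (?f z) * indicator T z \<partial>lborel)" .
 qed (use c in auto)
 moreover have "lvol (X ` T - X ` bad) = lvol (X ` T)" by (rule emeasure_Diff_null_set[OF Xb XT])
 moreover have cX: "ennreal c * lvol (X ` T) = (\<integral>\<^sup>+z. ennreal (?g z) * indicator T z \<partial>lborel)"
 proof -
  have "ennreal c * lvol (X ` T) = (\<integral>\<^sup>+z. ennreal c * (ennreal (det (JX z)) * indicator T z) \<partial>lborel)"
   unfolding X_image_measure(2)[OF T TG] using T det_JX_measurable by (intro nn_integral_cmult[symmetric]) auto
  also have "... = (\<integral>\<^sup>+z. ennreal (?g z) * indicator T z \<partial>lborel)"
  proof (rule nn_integral_cong)
   fix z show "ennreal c * (ennreal (det (JX z)) * indicator T z) = ennreal (?g z) * indicator T z"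
    using c det_JX_nonneg[of z] TN[of z] by (auto simp: indicator_def ennreal_mult)
  qed
  finally show ?thesis .
 qed
 ultimately have le: "(\<integral>\<^sup>+z. ennreal (?g z) * indicator T z \<partial>lborel) <= (\<integral>\<^sup>+z. ennreal (?f z) * indicator T z \<partial>lborel)"
  by simp
 have fin: "(\<integral>\<^sup>+z. ennreal (?f z) * indicator T z \<partial>lborel) ~= \<infinity>"
 proof -
  have "(\<integral>\<^sup>+z. ennreal (?f z) * indicator T z \<partial>lborel) <= (\<integral>\<^sup>+z. ennreal (?g z) * indicator T z \<partial>lborel)"
   by (intro nn_integral_mono) (auto simp: indicator_def T_def intro!: ennreal_leI)
  also have "... = ennreal c * lvol (X ` T)" by (rule cX[symmetric])
  also have "... <= ennreal c * lvol K" using K by (intro mult_left_mono emeasure_mono) (auto simp: T_def G_def borel_compact)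
  also have "... < top" using emeasure_compact_finite[OF K] K by (simp add: ennreal_mult_less_top lebesgue_lborel borel_compact)
  finally show ?thesis by simp
 qed
 have "AE z in lborel. ennreal (?g z) * indicator T z <= ennreal (?f z) * indicator T z"
 proof (rule ccontr)
  assume n: "~ (AE z in lborel. ennreal (?g z) * indicator T z <= ennreal (?f z) * indicator T z)"
  have "(\<integral>\<^sup>+z. ennreal (?f z) * indicator T z \<partial>lborel) < (\<integral>\<^sup>+z. ennreal (?g z) * indicator T z \<partial>lborel)"
  proof (rule nn_integral_less[OF _ _ fin _ n])
   show "AE z in lborel. ennreal (?f z) * indicator T z <= ennreal (?g z) * indicator T z"
    by (intro AE_I2) (auto simp: indicator_def T_def intro!: ennreal_leI)
  qed (use fm gm T in auto)
  thus False using le by simp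
 qed
 thus ?thesis
 proof eventually_elim
  fix z assume h: "ennreal (?g z) * indicator T z <= ennreal (?f z) * indicator T z"
  show "z : G --> ?g z <= ?f z"
  proof (rule impI, rule ccontr)
   assume z: "z : G" "~ ?g z <= ?f z"
   hence zT: "z : T" by (simp add: T_def)
   hence "ennreal (?g z) <= ennreal (?f z)" using h by simp
   moreover have "0 <= ?f z" using det_DS_pos[of "P z"] det_co_nonneg[OF TN[OF zT]] by (simp add: less_imp_le)
   ultimately have "?g z <= ?f z" by (subst (asm) ennreal_le_iff)
   thus False using z by simp
  qed
 qed
qed

end

section \<open>The shadow map and its averaged Jacobian\<close>

context shadow_transport
begin

definition shadow_map :: "real^'n => real^'n => real^'n" where
 "shadow_map u z = X z - (u .* X z) *: u + squash (u .* P z) *: u"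

definition shadow_jac :: "real^'n^'n => real^'n => real^'n^'n" where
 "shadow_jac Q z = (mat 1 - Q) ** JX z + damp (norm (Q *v P z)) ^ 3 *: (Q ** (mat 1 - JX z))"

text \<open>The derivative of \<open>P\<close> as a function of \<open>X\<close>; formally the
  inverse of the Hessian of the potential.\<close>

definition slope :: "real^'n => real^'n^'n" where
 "slope z = (mat 1 - JX z) ** matrix_inv (JX z)"

lemma shadow_jac_measurable: "(%(Q, z). det (shadow_jac Q z)) : borel_measurable (borel \<Otimes>\<^sub>M borel)"
proof -
 define h :: "(real^'n^'n) \<times> (real^'n^'n) \<times> (real^'n) => real" where
  "h y = det ((mat 1 - fst y) ** fst (snd y) + damp (norm (fst y *v snd (snd y))) ^ 3 *: (fst y ** (mat 1 - fst (snd y))))" for y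
 have "continuous_on UNIV h" unfolding h_def by (intro continuous_intros)
 hence h: "h : borel_measurable borel" by (rule cont_borel)
 have "(%x :: (real^'n^'n) \<times> (real^'n). (fst x, JX (snd x), P (snd x))) : (borel \<Otimes>\<^sub>M borel) \<rightarrow>\<^sub>M (borel \<Otimes>\<^sub>M borel \<Otimes>\<^sub>M borel)"
  by (intro measurable_Pair measurable_fst mcomp[OF measurable_snd JX_measurable] mcomp[OF measurable_snd P_measurable])
 moreover have "borel \<Otimes>\<^sub>M borel \<Otimes>\<^sub>M borel = (borel :: ((real^'n^'n) \<times> (real^'n^'n) \<times> (real^'n)) measure)"
  by (simp only: borel_prod)
 ultimately have "(%x :: (real^'n^'n) \<times> (real^'n). (fst x, JX (snd x), P (snd x))) : (borel \<Otimes>\<^sub>M borel) \<rightarrow>\<^sub>M borel"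
  by (simp only:)
 from mcomp[OF this h] show ?thesis by (simp add: h_def shadow_jac_def case_prod_beta)
qed

lemma shadow_map_derivative:
 assumes u: "norm u = 1" and J: "(X has_derivative (%h. JX z *v h)) (at z)"
 shows "(shadow_map u has_derivative (%h. shadow_jac (outer u u) z *v h)) (at z within A)"
proof -
 have dP: "(P has_derivative (%h. (mat 1 - JX z) *v h)) (at z within A)" using P_derivative[OF J] by (rule der_within)
 have dX: "(X has_derivative (%h. JX z *v h)) (at z within A)" using J by (rule der_within)
 have sq: "((%z. squash (u .* P z)) has_derivative (%h. damp (u .* P z) ^ 3 * (u .* ((mat 1 - JX z) *v h)))) (at z within A)"
 proof -
  have "(squash has_derivative (*) (damp (u .* P z) ^ 3)) (at (u .* P z) within (%z. u .* P z) ` A)"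
   using squash_derivative[of "u .* P z"] by (simp add: has_field_derivative_def der_within)
  from has_derivative_in_compose[OF has_derivative_inner_right[OF dP] this]
  show ?thesis .
 qed
 have "(shadow_map u has_derivative (%h. JX z *v h - (u .* (JX z *v h)) *: u + (damp (u .* P z) ^ 3 * (u .* ((mat 1 - JX z) *v h))) *: u)) (at z within A)"
  unfolding shadow_map_def[abs_def]
  by (intro has_derivative_add has_derivative_diff dX has_derivative_scaleR_left has_derivative_inner_right sq)
 moreover have "JX z *v h - (u .* (JX z *v h)) *: u + (damp (u .* P z) ^ 3 * (u .* ((mat 1 - JX z) *v h))) *: u = shadow_jac (outer u u) z *v h" for h
  using u by (simp add: shadow_jac_def mv_add mv_diff mv_assoc[symmetric] mv_scale[symmetric])
 ultimately show ?thesis by simp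
qed

lemma slope_JX:
 assumes "det (JX z) ~= 0"
 shows "slope z ** JX z = mat 1 - JX z" using matrix_inv_works(2)[of "JX z"] assms
 by (simp add: slope_def matrix_mul_assoc[symmetric] invertible_det_nz)

lemma det_shadow_jac:
 assumes u: "norm u = 1" and det: "det (JX z) ~= 0"
 shows "det (shadow_jac (outer u u) z) = det (JX z) * (damp (u .* P z) ^ 3 * (u .* (slope z *v u)))"
 using det_split_projection[OF u, of "JX z" "damp (u .* P z) ^ 3" "slope z"] u by (simp add: shadow_jac_def slope_JX[OF det])

lemma shadow_map_in_cyl:
 assumes u: "norm u = 1" and "X z : K"
 shows "shadow_map u z : cyl (outer u u) K"
proof -
 have uu: "u .* u = 1" using u by (simp add: norm_eq_1)
 have 1: "u .* shadow_map u z = squash (u .* P z)" by (simp add: shadow_map_def iar idr uu)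
 hence "shadow_map u z - X z = (u .* (shadow_map u z - X z)) *: u" unfolding idr 1 by (simp add: shadow_map_def alg)
 moreover have "norm (outer u u *v shadow_map u z) < 1" using u squash_less_1[of "u .* P z"] by (simp add: 1)
 ultimately show ?thesis using assms(2) by (auto simp: cyl_def)
qed

text \<open>Equal values make the difference of the \<open>X\<close> parallel to \<open>u\<close>
  and that of the \<open>P\<close> orthogonal to \<open>u\<close>. The pairing vanishes, and
  \<open>derivative_on_segment\<close> puts \<open>z' - z\<close> into the kernel of the Jacobian.
  Nothing is assumed about \<open>z'\<close>, so points outside \<open>G\<close> are separated from
  regular ones as well.\<close>

lemma shadow_map_inj:
 assumes u: "norm u = 1" and z: "z ~: N" "det (shadow_jac (outer u u) z) ~= 0" and eq: "shadow_map u z' = shadow_map u z"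
 shows "z' = z"
proof -
 have uu: "u .* u = 1" using u by (simp add: norm_eq_1)
 have us: "u .* shadow_map u z = squash (u .* P z)" for z by (simp add: shadow_map_def iar idr uu)
 have uP: "u .* P z' = u .* P z" using us[of z] us[of z'] eq by simp
 define \<alpha> where "\<alpha> = u .* (X z' - X z)"
 have dX: "X z' - X z = \<alpha> *: u" using eq uP by (simp add: shadow_map_def \<alpha>_def idr alg)
 hence "(X z' - X z) .* (P z' - P z) = 0" using uP by (simp add: idr)
 hence J: "JX z *v (z' - z) = X z' - X z" by (rule derivative_on_segment[OF N_derivative[OF z(1)]])
 have IJ: "(mat 1 - JX z) *v (z' - z) = P z' - P z" unfolding mv_diff J matrix_vector_mul_lid by (simp add: X_def)
 have "shadow_jac (outer u u) z *v (z' - z) = X z' - X z - (u .* (X z' - X z)) *: u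
  + damp (norm (outer u u *v P z)) ^ 3 *: (u .* (P z' - P z)) *: u"
  unfolding shadow_jac_def mv_add mv_scale[symmetric] mv_assoc[symmetric] J IJ by (simp add: mv_diff)
 also have "u .* (P z' - P z) = 0" using uP by (simp add: idr)
 also have "X z' - X z - (u .* (X z' - X z)) *: u = 0" unfolding dX by (simp add: uu)
 finally have "shadow_jac (outer u u) z *v (z' - z) = 0" by simp
 hence "z' - z = 0" by (rule matrix_kernel_trivial[OF z(2)])
 thus ?thesis by simp
qed

lemma shadow_jac_slice_measurable: "(%z. det (shadow_jac Q z)) : borel_measurable borel"
 using mcomp[OF measurable_Pair1'[of Q borel borel] shadow_jac_measurable] by simp

definition regular :: "real^'n => (real^'n) set" where
 "regular u = {z : G. det (shadow_jac (outer u u) z) ~= 0}"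

lemma regular_borel: "regular u : sets borel"
proof -
 have "regular u = G Int {z. det (shadow_jac (outer u u) z) : - {0}}" by (auto simp: regular_def)
 also have "... : sets borel" by (intro sets.Int G_borel borel_pred shadow_jac_slice_measurable) auto
 finally show ?thesis .
qed

lemma shadow_image_measure:
 assumes u: "norm u = 1"
 shows "shadow_map u ` regular u : sets lebesgue" "shadow_map u ` regular u <= cyl (outer u u) K"
  "lvol (shadow_map u ` regular u) = (\<integral>\<^sup>+z. ennreal \<bar>det (shadow_jac (outer u u) z)\<bar> * indicator G z \<partial>lborel)"
proof -
 have r: "regular u : sets lebesgue" using regular_borel by simp
 have der: "(shadow_map u has_derivative (%h. shadow_jac (outer u u) z *v h)) (at z within regular u)" if "z : regular u" for z
  using that N_derivative[of z] by (intro shadow_map_derivative u) (auto simp: regular_def G_def)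
 have inj: "inj_on (shadow_map u) (regular u)"
 proof (rule inj_onI)
  fix z z' assume "z : regular u" "z' : regular u" "shadow_map u z = shadow_map u z'"
  thus "z = z'" using shadow_map_inj[OF u, of z' z] by (auto simp: regular_def G_def)
 qed
 show "shadow_map u ` regular u : sets lebesgue" by (rule image_sets_lebesgue[OF r der inj])
 show "shadow_map u ` regular u <= cyl (outer u u) K" using shadow_map_in_cyl[OF u] by (auto simp: regular_def G_def)
 have "lvol (shadow_map u ` regular u) = (\<integral>\<^sup>+z. ennreal \<bar>det (matrix (%h. shadow_jac (outer u u) z *v h))\<bar> * indicator (regular u) z \<partial>lborel)"
  by (rule lborel_image[OF r der inj])
 also have "... = (\<integral>\<^sup>+z. ennreal \<bar>det (shadow_jac (outer u u) z)\<bar> * indicator G z \<partial>lborel)"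
  by (intro nn_integral_cong) (auto simp: regular_def indicator_def)
 finally show "lvol (shadow_map u ` regular u) = (\<integral>\<^sup>+z. ennreal \<bar>det (shadow_jac (outer u u) z)\<bar> * indicator G z \<partial>lborel)" .
qed

lemma cyl_lower_bound:
 assumes u: "norm u = 1"
 shows "(\<integral>\<^sup>+z. ennreal \<bar>det (shadow_jac (outer u u) z)\<bar> * indicator G z \<partial>lborel) <= vol (cyl (outer u u) K)"
proof -
 have "lvol (shadow_map u ` regular u) <= lvol (cyl (outer u u) K)"
  using shadow_image_measure[OF u] cyl_measurable(1)[OF K] by (intro emeasure_mono) auto
 thus ?thesis using shadow_image_measure(3)[OF u] cyl_measurable(1)[OF K] by (simp add: lebesgue_lborel)
qed

text \<open>\<open>slope z\<close> is the inverse of \<open>JX z\<close> minus the identity. Firm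
  nonexpansiveness of \<open>X\<close> says exactly that this inverse dominates the
  identity.\<close>

lemma slope_nonneg:
 assumes z: "z ~: N" "det (JX z) ~= 0"
 shows "nonneg_matrix (slope z)"
proof -
 have J: "(X has_derivative (%h. JX z *v h)) (at z)" "det (JX z) ~= 0" using z N_derivative by auto
 have inv: "JX z *v (matrix_inv (JX z) *v x) = x" for x using matrix_inv_works(1)[of "JX z"] J(2) by (simp add: mv_assoc invertible_det_nz)
 have sl: "slope z *v x = matrix_inv (JX z) *v x - x" for x by (simp add: slope_def mv_assoc[symmetric] mv_diff inv)
 have sym: "symmetric_matrix (JX z)" by (rule JX_symmetric[OF J(1)])
 have "(slope z *v x) .* y = x .* (slope z *v y)" for x y
 proof -
  define a b where "a = matrix_inv (JX z) *v x" and "b = matrix_inv (JX z) *v y"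
  have "a .* (JX z *v b) = (JX z *v a) .* b" using symmetric_matrix_inner[OF sym, of a b] by simp
  hence "a .* y = x .* b" unfolding a_def b_def inv .
  thus ?thesis by (simp add: sl idl idr a_def b_def)
 qed
 hence "symmetric_matrix (slope z)" unfolding symmetric_matrix_def by (rule transpose_eqI)
 moreover have "0 <= x .* (slope z *v x)" for x
 proof -
  define a where "a = matrix_inv (JX z) *v x"
  have "(norm (JX z *v a))\<^sup>2 <= (JX z *v a) .* a" by (rule JX_firm[OF J(1)])
  hence "x .* x <= x .* a" unfolding a_def inv by (simp add: norm_sq)
  thus ?thesis by (simp add: sl idr a_def)
 qed
 ultimately show ?thesis by (simp add: nonneg_matrix_def)
qed

lemma shadow_jac_integral:
 assumes z: "z : G"
 shows "(\<integral>\<^sup>+Q. ennreal \<bar>det (shadow_jac Q z)\<bar> \<partial>\<nu>) = ennreal (det (JX z) * trace (slope z ** DS (P z)))"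
  and "0 <= trace (slope z ** DS (P z))"
proof -
 have J: "0 < det (JX z)" "z ~: N" "det (JX z) ~= 0" using z det_JX_nonneg[of z] by (auto simp: G_def)
 let ?g = "%Q. damp (norm (Q *v P z)) ^ 3 * trace (slope z ** Q)"
 have eq: "AE Q in \<nu>. \<bar>det (shadow_jac Q z)\<bar> = det (JX z) * ?g Q & 0 <= ?g Q"
 proof (rule AE_rank_one)
  fix Q :: "real^'n^'n" and u assume u: "norm u = 1" "Q = outer u u"
  have "det (shadow_jac Q z) = det (JX z) * ?g Q" using det_shadow_jac[OF u(1), of z] J u by (simp add: trace_mult_outer)
  moreover have "0 <= ?g Q"
   using slope_nonneg[OF J(2,3)] damp_pos[of "norm (Q *v P z)"] by (simp add: u(2) trace_mult_outer nonneg_matrix_def less_imp_le)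
  ultimately show "\<bar>det (shadow_jac Q z)\<bar> = det (JX z) * ?g Q & 0 <= ?g Q" using J by simp
 qed
 have nn: "AE Q in \<nu>. 0 <= ?g Q" using eq by eventually_elim simp
 have nn': "AE Q in \<nu>. 0 <= det (JX z) * ?g Q" using nn by eventually_elim (use J in simp)
 show "0 <= trace (slope z ** DS (P z))" unfolding trace_DS(1)[of "P z" "slope z", symmetric] by (rule integral_nonneg_AE[OF nn])
 have "(\<integral>\<^sup>+Q. ennreal \<bar>det (shadow_jac Q z)\<bar> \<partial>\<nu>) = (\<integral>\<^sup>+Q. ennreal (det (JX z) * ?g Q) \<partial>\<nu>)"
  using eq by (intro nn_integral_cong_AE) (auto elim: eventually_mono)
 also have "... = ennreal (\<integral>Q. det (JX z) * ?g Q \<partial>\<nu>)"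
  by (rule nn_integral_eq_integral[OF integrable_mult_right[OF trace_DS(2)] nn'])
 finally show "(\<integral>\<^sup>+Q. ennreal \<bar>det (shadow_jac Q z)\<bar> \<partial>\<nu>) = ennreal (det (JX z) * trace (slope z ** DS (P z)))"
  by (simp add: trace_DS)
qed

text \<open>The geometric mean belonging to the density \<open>c\<close>. In the equality case
  \<open>S0 (P z)\<close> and \<open>\<kappa> *: X z\<close> turn out to differ by a constant, which
  makes this number the dilation factor.\<close>

definition \<kappa> :: real where
 "\<kappa> = root CARD('n) c"

lemma \<kappa>: "0 < \<kappa>" "\<kappa> ^ CARD('n) = c" using c by (auto simp: \<kappa>_def real_root_gt_zero)

text \<open>The Monge-Ampere inequality bounds \<open>det (DS (P z)) * det (slope z)\<close> from
  below by \<open>c\<close>, and \<open>det_mult_le_trace\<close> converts this into a bound for the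
  trace. Equality in the result forces equality in both.\<close>

lemma trace_bound:
 assumes z: "z : G" and MA: "c * det (JX z) <= det (DS (P z)) * det (mat 1 - JX z)"
 shows "CARD('n) * \<kappa> <= trace (slope z ** DS (P z))"
  and "trace (slope z ** DS (P z)) = CARD('n) * \<kappa> ==> DS (P z) ** slope z = mat \<kappa>"
proof -
 have J: "0 < det (JX z)" and zN: "z ~: N" "det (JX z) ~= 0" using z det_JX_nonneg[of z] by (auto simp: G_def)
 have "det (slope z) * det (JX z) = det (mat 1 - JX z)" using slope_JX[of z] J by (simp flip: det_mul)
 hence "c * det (JX z) <= (det (DS (P z)) * det (slope z)) * det (JX z)" using MA by (simp add: mult.assoc)
 hence det: "c <= det (DS (P z)) * det (slope z)" using J by simp
 hence "det (slope z) ~= 0" using c by auto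
 hence pos: "positive_matrix (slope z)" by (rule nonneg_matrix_nonsingular[OF slope_nonneg[OF zN]])
 let ?t = "trace (DS (P z) ** slope z) / CARD('n)"
 have tr: "trace (slope z ** DS (P z)) = trace (DS (P z) ** slope z)" by (rule trace_mult_commute)
 have t0: "0 <= ?t" using shadow_jac_integral(2)[OF z] by (simp add: tr)
 have le: "det (DS (P z)) * det (slope z) <= ?t ^ CARD('n)" by (rule det_mult_le_trace(1)[OF DS_positive pos])
 hence "\<kappa> ^ CARD('n) <= ?t ^ CARD('n)" using det unfolding \<kappa>(2) by linarith
 hence "\<kappa> <= ?t" using t0 power_strict_mono[of ?t \<kappa> "CARD('n)"] by (meson linorder_not_le zero_less_card_finite)
 thus "CARD('n) * \<kappa> <= trace (slope z ** DS (P z))" by (simp add: tr field_simps)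
 assume "trace (slope z ** DS (P z)) = CARD('n) * \<kappa>"
 hence "?t = \<kappa>" by (simp add: tr)
 hence "det (DS (P z)) * det (slope z) = ?t ^ CARD('n)" using le det \<kappa>(2) by simp
 hence "DS (P z) ** slope z = mat ?t" by (rule det_mult_le_trace(2)[OF DS_positive pos])
 thus "DS (P z) ** slope z = mat \<kappa>" using \<open>?t = \<kappa>\<close> by simp
qed

lemma shadow_jac_product_measurable: "(%(Q, z). ennreal \<bar>det (shadow_jac Q z)\<bar> * indicator G z) : borel_measurable (\<nu> \<Otimes>\<^sub>M lborel)"
proof -
 have s: "sets (\<nu> \<Otimes>\<^sub>M lborel) = sets (borel \<Otimes>\<^sub>M (borel :: (real^'n) measure))"
  by (rule sets_pair_measure_cong[OF sets_\<nu> sets_lborel])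
 have G': "(%x :: (real^'n^'n) \<times> (real^'n). indicator G (snd x) :: ennreal) : borel_measurable (borel \<Otimes>\<^sub>M borel)"
  using G_borel by (intro mcomp[OF measurable_snd borel_measurable_indicator]) auto
 have "(%x. ennreal \<bar>det (shadow_jac (fst x) (snd x))\<bar>) : borel_measurable (borel \<Otimes>\<^sub>M borel)"
  using shadow_jac_measurable unfolding case_prod_beta by measurable
 from borel_measurable_times_ennreal[OF this G'] show ?thesis unfolding case_prod_beta measurable_cong_sets[OF s refl] .
qed

lemma total_shadow_jac:
 "(\<integral>\<^sup>+Q. (\<integral>\<^sup>+z. ennreal \<bar>det (shadow_jac Q z)\<bar> * indicator G z \<partial>lborel) \<partial>\<nu>) = (\<integral>\<^sup>+z. ennreal (det (JX z) * trace (slope z ** DS (P z))) * indicator G z \<partial>lborel)"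
proof -
 interpret pair_sigma_finite \<nu> "lborel :: (real^'n) measure" ..
 have "(\<integral>\<^sup>+Q. (\<integral>\<^sup>+z. ennreal \<bar>det (shadow_jac Q z)\<bar> * indicator G z \<partial>lborel) \<partial>\<nu>) = (\<integral>\<^sup>+z. (\<integral>\<^sup>+Q. ennreal \<bar>det (shadow_jac Q z)\<bar> * indicator G z \<partial>\<nu>) \<partial>lborel)"
  using Fubini[OF shadow_jac_product_measurable] by simp
 also have "... = (\<integral>\<^sup>+z. ennreal (det (JX z) * trace (slope z ** DS (P z))) * indicator G z \<partial>lborel)"
  using shadow_jac_integral(1) by (intro nn_integral_cong) (auto simp: indicator_def)
 finally show ?thesis .
qed

lemma total_shadow_bound:
 "ennreal (CARD('n) * \<kappa>) * vol K <= (\<integral>\<^sup>+z. ennreal (det (JX z) * trace (slope z ** DS (P z))) * indicator G z \<partial>lborel)"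
proof -
 have "ennreal (CARD('n) * \<kappa>) * vol K = (\<integral>\<^sup>+z. ennreal (CARD('n) * \<kappa>) * (ennreal (det (JX z)) * indicator G z) \<partial>lborel)"
  unfolding measure_K using G_borel det_JX_measurable by (intro nn_integral_cmult[symmetric]) auto
 also have "... <= (\<integral>\<^sup>+z. ennreal (det (JX z) * trace (slope z ** DS (P z))) * indicator G z \<partial>lborel)"
 proof (rule nn_integral_mono_AE)
  show "AE z in lborel. ennreal (CARD('n) * \<kappa>) * (ennreal (det (JX z)) * indicator G z) <= ennreal (det (JX z) * trace (slope z ** DS (P z))) * indicator G z"
   using Monge_Ampere
  proof eventually_elim
   fix z assume MA: "z : G --> c * det (JX z) <= det (DS (P z)) * det (mat 1 - JX z)"
   show "ennreal (CARD('n) * \<kappa>) * (ennreal (det (JX z)) * indicator G z) <= ennreal (det (JX z) * trace (slope z ** DS (P z))) * indicator G z"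
   proof (cases "z : G")
    case True
    hence J: "0 <= det (JX z)" using det_JX_nonneg[of z] by (simp add: G_def)
    have "CARD('n) * \<kappa> * det (JX z) <= trace (slope z ** DS (P z)) * det (JX z)"
     using trace_bound(1)[OF True] MA True J by (intro mult_right_mono) auto
    thus ?thesis using True J \<kappa>(1) by (simp add: ennreal_mult[symmetric] mult.commute ennreal_leI)
   qed simp
  qed
 qed
 finally show ?thesis .
qed

theorem shadow_bound: "ennreal (CARD('n) * \<kappa>) * vol K <= (\<integral>\<^sup>+Q. vol (cyl Q K) \<partial>\<nu>)"
proof -
 have "ennreal (CARD('n) * \<kappa>) * vol K <= (\<integral>\<^sup>+Q. (\<integral>\<^sup>+z. ennreal \<bar>det (shadow_jac Q z)\<bar> * indicator G z \<partial>lborel) \<partial>\<nu>)"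
  unfolding total_shadow_jac by (rule total_shadow_bound)
 also have "... <= (\<integral>\<^sup>+Q. vol (cyl Q K) \<partial>\<nu>)"
 proof (rule nn_integral_mono_AE)
  show "AE Q in \<nu>. (\<integral>\<^sup>+z. ennreal \<bar>det (shadow_jac Q z)\<bar> * indicator G z \<partial>lborel) <= vol (cyl Q K)"
   using rank_one
  proof eventually_elim
   fix Q :: "real^'n^'n" assume "\<exists>u. norm u = 1 & Q = outer u u"
   thus "(\<integral>\<^sup>+z. ennreal \<bar>det (shadow_jac Q z)\<bar> * indicator G z \<partial>lborel) <= vol (cyl Q K)"
    using cyl_lower_bound by blast
  qed
 qed
 finally show ?thesis .
qed

end

section \<open>The equality case\<close>

definition tube :: "real^'n => real^'n => real => real => (real^'n) set" where
 "tube u q \<delta> l = {y. norm ((y - q) - (u .* (y - q)) *: u) <= \<delta> & 0 <= u .* (y - q) & u .* (y - q) <= l}"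

lemma closed_tube: "closed (tube u q \<delta> l)" unfolding tube_def by (intro closed_Collect_conj closed_Collect_le continuous_intros)

lemma tube_dist:
 assumes u: "norm u = 1" and y: "y : tube u q \<delta> l"
 shows "norm (y - q) <= \<delta> + l"
proof -
 have "norm (y - q) <= norm ((y - q) - (u .* (y - q)) *: u) + norm ((u .* (y - q)) *: u)"
  using norm_triangle_ineq[of "(y - q) - (u .* (y - q)) *: u" "(u .* (y - q)) *: u"] by simp
 thus ?thesis using y u by (auto simp: tube_def)
qed

lemma emeasure_tube_finite:
 assumes u: "norm u = 1"
 shows "vol (tube u q \<delta> l) < top"
proof -
 have "tube u q \<delta> l <= cball q (\<delta> + l)" using tube_dist[OF u] by (auto simp: dist_norm norm_minus_commute)
 hence "bounded (tube u q \<delta> l)" by (rule bounded_subset[OF bounded_cball])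
 thus ?thesis using emeasure_bounded_finite by simp
qed

lemma emeasure_tube_pos:
 assumes u: "norm u = 1" and \<delta>: "\<delta> > 0"
 shows "0 < vol (tube u q \<delta> 1)"
proof -
 have uu: "u .* u = 1" using u by (simp add: norm_eq_1)
 define \<rho> where "\<rho> = min (1/2) (\<delta> / 2)"
 have \<rho>: "\<rho> > 0" "\<rho> <= 1/2" "2 * \<rho> <= \<delta>" using \<delta> by (auto simp: \<rho>_def)
 have "ball (q + (1/2) *: u) \<rho> <= tube u q \<delta> 1"
 proof
  fix y assume "y : ball (q + (1/2) *: u) \<rho>"
  hence w: "norm (y - q - (1/2) *: u) < \<rho>" by (simp add: dist_norm norm_minus_commute alg)
  define w where "w = y - q - (1/2) *: u"
  have yq: "y - q = w + (1/2) *: u" by (simp add: w_def)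
  have uw: "\<bar>u .* w\<bar> <= \<rho>" using CS_ineq[of u w] u w by (simp add: w_def)
  have "norm ((y - q) - (u .* (y - q)) *: u) = norm (w - (u .* w) *: u)" unfolding yq by (simp add: iar uu alg)
  also have "... <= norm w + norm ((u .* w) *: u)" by (rule norm_triangle_ineq4)
  also have "... <= \<delta>" using uw u w \<rho> by (simp add: w_def)
  finally show "y : tube u q \<delta> 1" using uw \<rho> unfolding tube_def by (simp add: yq iar uu abs_le_iff)
 qed
 hence "vol (ball (q + (1/2) *: u) \<rho>) <= vol (tube u q \<delta> 1)" by (intro emeasure_mono) (simp_all add: borel_closed closed_tube)
 moreover have "0 < vol (ball (q + (1/2) *: u) \<rho>)"
  using content_ball_pos[OF \<rho>(1), of "q + (1/2) *: u"] by (simp add: measure_def enn2real_positive_iff)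
 ultimately show ?thesis by (rule less_le_trans[rotated])
qed

text \<open>Only proportionality to the length matters, so the volume of the base is never computed:
  a stretch along \<open>u\<close> has determinant \<open>l\<close>.\<close>

lemma emeasure_tube:
 assumes u: "norm u = 1" and l: "l > 0"
 shows "vol (tube u q \<delta> l) = ennreal l * vol (tube u 0 \<delta> 1)"
proof -
 have uu: "u .* u = 1" using u by (simp add: norm_eq_1)
 define T where "T y = q + (y + ((l - 1) * (u .* y)) *: u)" for y
 let ?M = "mat 1 + outer u ((l - 1) *: u)"
 have M: "?M *v y = y + ((l - 1) * (u .* y)) *: u" for y by (simp add: mv_add)
 have uT: "u .* (T y - q) = l * (u .* y)" for y by (simp add: T_def iar uu alg)
 have pT: "(T y - q) - (u .* (T y - q)) *: u = y - (u .* y) *: u" for y unfolding uT by (simp add: T_def alg)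
 have img: "T ` tube u 0 \<delta> 1 = tube u q \<delta> l"
 proof (intro set_eqI iffI)
  fix y assume "y : T ` tube u 0 \<delta> 1"
  then obtain x where x: "x : tube u 0 \<delta> 1" "y = T x" by blast
  hence "l * (u .* x) <= l * 1" using l by (intro mult_left_mono) (auto simp: tube_def)
  thus "y : tube u q \<delta> l" using x l unfolding tube_def mem_Collect_eq x(2) uT pT[unfolded uT] by simp
 next
  fix y assume y: "y : tube u q \<delta> l"
  define x where "x = (y - q) + ((1 / l - 1) * (u .* (y - q))) *: u"
  have ux: "u .* x = (u .* (y - q)) / l" unfolding x_def iar inner_scaleR_right uu by (simp add: left_diff_distrib)
  have Tx: "T x = y" unfolding T_def ux unfolding x_def using l by (simp add: alg diff_divide_distrib flip: scaleR_add_left)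
  have "x - (u .* x) *: u = (y - q) - (u .* (y - q)) *: u" using pT[of x] unfolding Tx by simp
  hence "x : tube u 0 \<delta> 1" using y l unfolding tube_def by (simp add: ux divide_le_eq)
  thus "y : T ` tube u 0 \<delta> 1" using Tx by blast
 qed
 have der: "(T has_derivative (%y. ?M *v y)) (at x within A)" for x A unfolding T_def M by (auto intro!: derivative_eq_intros)
 have inj: "inj_on T A" for A
 proof (rule inj_onI)
  fix x y assume "T x = T y"
  hence "x - (u .* x) *: u = y - (u .* y) *: u" "l * (u .* x) = l * (u .* y)" using pT[of x] pT[of y] uT[of x] uT[of y] by metis+
  thus "x = y" using l by simp
 qed
 have det: "det ?M = l" unfolding det_mat1_plus_outer by (simp add: uu)
 have leb: "tube u 0 \<delta> 1 : sets lebesgue" using borel_closed[OF closed_tube, of u 0 \<delta> 1] by simp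
 have "vol (tube u q \<delta> l) = lvol (T ` tube u 0 \<delta> 1)"
  unfolding img by (rule lebesgue_lborel[OF borel_closed[OF closed_tube], symmetric])
 also have "... = (\<integral>\<^sup>+x. ennreal l * indicator (tube u 0 \<delta> 1) x \<partial>lborel)"
  unfolding lborel_image[OF leb der inj] matrix_of_matrix_vector_mul det using l by simp
 also have "... = ennreal l * vol (tube u 0 \<delta> 1)" using borel_closed[OF closed_tube] by (intro nn_integral_cmult_indicator) simp
 finally show ?thesis .
qed

context shadow_transport
begin

text \<open>Equality in the inequality of the means, written without the inverse of
  \<open>JX z\<close>.\<close>

definition aligned :: "(real^'n) set" where
 "aligned = {z : G. DS (P z) ** (mat 1 - JX z) = \<kappa> *: JX z}"

lemma aligned_G: "z : aligned ==> z : G" by (simp add: aligned_def)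

lemma aligned_N: "z : aligned ==> z ~: N" by (simp add: aligned_def G_def)

lemma aligned_borel: "aligned : sets borel"
proof -
 have c: "continuous_on UNIV (%y :: (real^'n^'n) \<times> (real^'n). DS (snd y) ** (mat 1 - fst y) - \<kappa> *: fst y)"
  by (intro continuous_intros continuous_on_compose2[OF DS_continuous]) auto
 have "(%z. (JX z, P z)) : borel \<rightarrow>\<^sub>M borel"
  unfolding borel_prod[symmetric] by (intro measurable_Pair JX_measurable P_measurable)
 from mcomp[OF this cont_borel[OF c]]
 have "(%z. DS (P z) ** (mat 1 - JX z) - \<kappa> *: JX z) : borel_measurable borel" by simp
 hence "{z. DS (P z) ** (mat 1 - JX z) - \<kappa> *: JX z : {0}} : sets borel" by (rule borel_pred) simp
 moreover have "aligned = G Int {z. DS (P z) ** (mat 1 - JX z) - \<kappa> *: JX z : {0}}" by (auto simp: aligned_def)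
 ultimately show ?thesis using G_borel by auto
qed

lemma aligned_det:
 assumes "z : aligned"
 shows "det (DS (P z)) * det (mat 1 - JX z) = c * det (JX z)" "0 < det (mat 1 - JX z)"
proof -
 have "det (DS (P z) ** (mat 1 - JX z)) = det (\<kappa> *: JX z)" using assms by (simp add: aligned_def)
 also have "\<kappa> *: JX z = (\<kappa> *: mat 1) ** JX z" by (rule matrix_eqI) (simp add: mv_assoc[symmetric] mv_scale[symmetric])
 also have "det ... = c * det (JX z)"
 proof -
  have "det (\<kappa> *: mat 1 :: real^'n^'n) = \<kappa> ^ CARD('n)" by (subst det_diagonal) (auto simp: mat_def)
  thus ?thesis by (simp add: det_mul \<kappa>(2))
 qed
 finally show 1: "det (DS (P z)) * det (mat 1 - JX z) = c * det (JX z)" by (simp add: det_mul)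
 have "0 < det (JX z)" using det_JX_nonneg[OF aligned_N[OF assms]] assms by (auto simp: aligned_def G_def)
 hence "0 < det (DS (P z)) * det (mat 1 - JX z)" unfolding 1 using c by simp
 thus "0 < det (mat 1 - JX z)" using det_DS_pos[of "P z"] by (simp add: zero_less_mult_iff)
qed

end

section \<open>Equality on the preimage of K\<close>

locale shadow_equality =
 fixes \<nu> :: "(real^'n^'n) measure" and \<psi> :: "real^'n => real" and R :: real and K :: "(real^'n) set" and c :: real
 assumes estimate: "shadow_transport \<nu> \<psi> R K c"
  and total: "ennreal c * vol K = hyperplane_distribution.mass \<nu>"
  and shadow_le: "(\<integral>\<^sup>+Q. vol (cyl Q K) \<partial>\<nu>) <= ennreal (CARD('n) * root CARD('n) c) * vol K"
begin

sublocale shadow_transport \<nu> \<psi> R K c by (rule estimate)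

lemma eq: "(\<integral>\<^sup>+Q. vol (cyl Q K) \<partial>\<nu>) <= ennreal (CARD('n) * \<kappa>) * vol K"
 using shadow_le by (simp add: \<kappa>_def)

lemma K_finite: "vol K < top" using emeasure_compact_finite[OF K] by simp

text \<open>The pointwise trace bound has the same finite integral on both sides, so equality holds
  almost everywhere on \<open>G\<close>.\<close>

lemma AE_aligned: "AE z in lborel. z : G --> z : aligned"
proof -
 let ?f = "%z. ennreal (CARD('n) * \<kappa>) * (ennreal (det (JX z)) * indicator G z)"
 let ?g = "%z. ennreal (det (JX z) * trace (slope z ** DS (P z))) * indicator G z"
 have fm: "?f : borel_measurable lborel" using G_borel det_JX_measurable by auto
 have gm: "?g : borel_measurable lborel"
 proof -
  have "(%z. \<integral>\<^sup>+Q. ennreal \<bar>det (shadow_jac Q z)\<bar> * indicator G z \<partial>\<nu>) : borel_measurable lborel"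
  proof -
   have "(%(z, Q). ennreal \<bar>det (shadow_jac Q z)\<bar> * indicator G z) : borel_measurable (lborel \<Otimes>\<^sub>M \<nu>)"
    using measurable_pair_swap[OF shadow_jac_product_measurable] by simp
   thus ?thesis by (rule borel_measurable_nn_integral)
  qed
  moreover have "(\<integral>\<^sup>+Q. ennreal \<bar>det (shadow_jac Q z)\<bar> * indicator G z \<partial>\<nu>) = ?g z" for z
   using shadow_jac_integral(1) by (auto simp: indicator_def)
  ultimately show ?thesis by simp
 qed
 have If: "(\<integral>\<^sup>+z. ?f z \<partial>lborel) = ennreal (CARD('n) * \<kappa>) * vol K"
  unfolding measure_K using G_borel det_JX_measurable by (intro nn_integral_cmult) auto
 have "(\<integral>\<^sup>+z. ?g z \<partial>lborel) <= (\<integral>\<^sup>+Q. vol (cyl Q K) \<partial>\<nu>)"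
  unfolding total_shadow_jac[symmetric]
 proof (rule nn_integral_mono_AE)
  show "AE Q in \<nu>. (\<integral>\<^sup>+z. ennreal \<bar>det (shadow_jac Q z)\<bar> * indicator G z \<partial>lborel) <= vol (cyl Q K)"
   using rank_one
  proof eventually_elim
   fix Q :: "real^'n^'n" assume "\<exists>u. norm u = 1 & Q = outer u u"
   thus "(\<integral>\<^sup>+z. ennreal \<bar>det (shadow_jac Q z)\<bar> * indicator G z \<partial>lborel) <= vol (cyl Q K)"
    using cyl_lower_bound by blast
  qed
 qed
 hence le: "(\<integral>\<^sup>+z. ?g z \<partial>lborel) <= (\<integral>\<^sup>+z. ?f z \<partial>lborel)" unfolding If using eq by (rule order_trans)
 have fin: "(\<integral>\<^sup>+z. ?f z \<partial>lborel) ~= \<infinity>"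
  unfolding If using K_finite by (simp add: ennreal_mult_eq_top_iff less_top)
 have fg: "AE z in lborel. ?f z <= ?g z" using Monge_Ampere
 proof eventually_elim
  fix z assume MA: "z : G --> c * det (JX z) <= det (DS (P z)) * det (mat 1 - JX z)"
  show "?f z <= ?g z"
  proof (cases "z : G")
   case True
   hence J: "0 <= det (JX z)" using det_JX_nonneg[of z] by (simp add: G_def)
   have "CARD('n) * \<kappa> * det (JX z) <= trace (slope z ** DS (P z)) * det (JX z)"
    using trace_bound(1)[OF True] MA True J by (intro mult_right_mono) auto
   thus ?thesis using True J \<kappa>(1) by (simp add: ennreal_mult[symmetric] mult.commute ennreal_leI)
  qed simp
 qed
 have "AE z in lborel. ?g z <= ?f z"
 proof (rule ccontr)
  assume "~ (AE z in lborel. ?g z <= ?f z)"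
  from nn_integral_less[OF fm gm fin fg this] le show False by simp
 qed
 with Monge_Ampere show ?thesis
 proof eventually_elim
  fix z assume MA: "z : G --> c * det (JX z) <= det (DS (P z)) * det (mat 1 - JX z)" and gf: "?g z <= ?f z"
  show "z : G --> z : aligned"
  proof
   assume z: "z : G"
   hence J: "0 < det (JX z)" using det_JX_nonneg[of z] by (auto simp: G_def)
   have "ennreal (det (JX z) * trace (slope z ** DS (P z))) <= ennreal (CARD('n) * \<kappa> * det (JX z))"
    using gf z J \<kappa>(1) by (simp add: ennreal_mult)
   hence "det (JX z) * trace (slope z ** DS (P z)) <= CARD('n) * \<kappa> * det (JX z)"
    using J \<kappa>(1) by (subst (asm) ennreal_le_iff) auto
   hence "trace (slope z ** DS (P z)) <= CARD('n) * \<kappa>" using J by (simp add: mult.commute)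
   hence "trace (slope z ** DS (P z)) = CARD('n) * \<kappa>" using trace_bound(1)[OF z] MA z by simp
   hence "DS (P z) ** slope z = mat \<kappa>" using trace_bound(2)[OF z] MA z by blast
   hence "DS (P z) ** (slope z ** JX z) = mat \<kappa> ** JX z" by (simp add: matrix_mul_assoc)
   moreover have "mat \<kappa> ** JX z = \<kappa> *: JX z"
    by (simp add: mat_def matrix_matrix_mult_def vec_eq_iff if_distrib[of "%x. x * _"] sum.delta cong: if_cong)
   ultimately show "z : aligned" using z J by (simp add: aligned_def slope_JX)
  qed
 qed
qed

lemma P_aligned_conull: "negligible (UNIV - P ` aligned)" and P_aligned_sets: "P ` aligned : sets lebesgue"
proof -
 have al: "aligned : sets lebesgue" using aligned_borel by simp
 have der: "(P has_derivative (%h. (mat 1 - JX z) *v h)) (at z within aligned)" if "z : aligned" for z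
  using P_derivative[OF N_derivative[OF aligned_N[OF that]]] by (rule der_within)
 have inj: "inj_on P aligned"
 proof (rule inj_onI)
  fix z z' assume "z : aligned" "z' : aligned" "P z = P z'"
  thus "z = z'" using P_inj[OF N_derivative[OF aligned_N[of z']], of z] aligned_det(2)[of z'] by auto
 qed
 show im: "P ` aligned : sets lebesgue" by (rule image_sets_lebesgue[OF al der inj])
 let ?w = "%p. ennreal (det (DS p))"
 have wm: "?w : borel_measurable borel" using det_DS_measurable by (rule mcomp) simp
 have "(\<integral>\<^sup>+p. ?w p * indicator (P ` aligned) p \<partial>lebesgue) = (\<integral>\<^sup>+z. ?w (P z) * (ennreal \<bar>det (matrix (%h. (mat 1 - JX z) *v h))\<bar> * indicator aligned z) \<partial>lebesgue)"
  by (rule nn_integral_image[OF al der inj wm])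
 also have "... = (\<integral>\<^sup>+z. ennreal c * (ennreal (det (JX z)) * indicator aligned z) \<partial>lebesgue)"
 proof (rule nn_integral_cong)
  fix z
  show "?w (P z) * (ennreal \<bar>det (matrix (%h. (mat 1 - JX z) *v h))\<bar> * indicator aligned z) = ennreal c * (ennreal (det (JX z)) * indicator aligned z)"
  proof (cases "z : aligned")
   case True
   thus ?thesis using aligned_det[OF True] det_DS_pos[of "P z"] det_JX_nonneg[OF aligned_N[OF True]] c
    by (simp add: ennreal_mult[symmetric] less_imp_le)
  qed simp
 qed
 also have "... = (\<integral>\<^sup>+z. ennreal c * (ennreal (det (JX z)) * indicator aligned z) \<partial>lborel)"
  by (simp add: nn_integral_completion)
 also have "... = (\<integral>\<^sup>+z. ennreal c * (ennreal (det (JX z)) * indicator G z) \<partial>lborel)"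
 proof (rule nn_integral_cong_AE)
  show "AE z in lborel. ennreal c * (ennreal (det (JX z)) * indicator aligned z) = ennreal c * (ennreal (det (JX z)) * indicator G z)"
   using AE_aligned
  proof eventually_elim
   fix z assume "z : G --> z : aligned"
   hence "z : aligned \<longleftrightarrow> z : G" using aligned_G by blast
   thus "ennreal c * (ennreal (det (JX z)) * indicator aligned z) = ennreal c * (ennreal (det (JX z)) * indicator G z)"
    by (simp add: indicator_def)
  qed
 qed
 also have "... = ennreal c * vol K" unfolding measure_K using G_borel det_JX_measurable by (intro nn_integral_cmult) auto
 finally have I1: "(\<integral>\<^sup>+p. ?w p * indicator (P ` aligned) p \<partial>lebesgue) = mass" by (simp add: total)
 have cm: "UNIV - P ` aligned : sets lebesgue" using im by (metis sets.compl_sets space_borel space_completion space_lborel)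
 have wm': "?w : borel_measurable lebesgue" using wm by (simp add: measurable_completion)
 have "mass = (\<integral>\<^sup>+p. ?w p \<partial>lebesgue)" by (simp add: mass_def nn_integral_completion)
 also have "... = (\<integral>\<^sup>+p. ?w p * indicator (P ` aligned) p + ?w p * indicator (UNIV - P ` aligned) p \<partial>lebesgue)"
  by (intro nn_integral_cong) (auto simp: indicator_def)
 also have "... = mass + (\<integral>\<^sup>+p. ?w p * indicator (UNIV - P ` aligned) p \<partial>lebesgue)"
  using wm' im cm by (subst nn_integral_add) (auto simp: I1)
 finally have "(\<integral>\<^sup>+p. ?w p * indicator (UNIV - P ` aligned) p \<partial>lebesgue) = 0"
  using mass_finite by (cases "mass" rule: ennreal_cases; cases "\<integral>\<^sup>+p. ?w p * indicator (UNIV - P ` aligned) p \<partial>lebesgue" rule: ennreal_cases)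
   (auto simp flip: ennreal_plus)
 hence "AE p in lebesgue. ?w p * indicator (UNIV - P ` aligned) p = 0" using wm' cm by (subst (asm) nn_integral_0_iff_AE) auto
 hence "AE p in lebesgue. p ~: UNIV - P ` aligned"
 proof eventually_elim
  fix p assume "?w p * indicator (UNIV - P ` aligned) p = 0"
  thus "p ~: UNIV - P ` aligned" using det_DS_pos[of p] by (auto simp: indicator_def ennreal_eq_0_iff split: if_splits)
 qed
 thus "negligible (UNIV - P ` aligned)" using cm by (simp add: neg_null AE_iff_null_sets)
qed

text \<open>The growth of \<open>X\<close> along a segment cannot be obtained by integrating a
  derivative that is known almost everywhere only; volumes of thin tubes are compared instead.
  Replacing the component of \<open>P z\<close> along \<open>u\<close> by that of \<open>X z\<close>
  multiplies the Jacobian of \<open>P\<close> by at least \<open>m\<close>. Almost all of the tube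
  of length \<open>l\<close> is covered by \<open>P\<close>, and the new image fits into a tube of
  length \<open>l'\<close> with the same base.\<close>

lemma volume_comparison:
 assumes u: "norm u = 1" and l: "l > 0" and l': "l' > 0" and \<delta>: "\<delta> > 0" and m: "m > 0"
  and lower: "!!q. q : tube u q0 \<delta> l ==> \<kappa> * m <= u .* (DS q *v u)"
  and range: "!!z. P z : tube u q0 \<delta> l ==> a <= u .* X z & u .* X z <= a + l'"
 shows "m * l <= l'"
proof -
 have uu: "u .* u = 1" using u by (simp add: norm_eq_1)
 define F where "F z = P z - (u .* P z) *: u + (u .* X z) *: u" for z
 \<comment> \<open>Written in the shape of \<open>det_split_projection\<close>. On \<open>S\<close>
   the inner product \<open>(1 / \<kappa>) *: DS (P z) ** (mat 1 - JX z)\<close> is just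
   \<open>JX z\<close>, so this is the derivative of \<open>F\<close>.\<close>
 define DF where "DF z = (mat 1 - outer u u) ** (mat 1 - JX z) + 1 *: (outer u u ** ((1 / \<kappa>) *: DS (P z) ** (mat 1 - JX z)))" for z
 define S where "S = aligned Int {z. P z : tube u q0 \<delta> l}"
 have tb: "tube u q \<delta> l : sets borel" for q l by (rule borel_closed[OF closed_tube])
 have S: "S : sets borel" unfolding S_def by (intro sets.Int aligned_borel borel_pred P_measurable tb)
 have SL: "S : sets lebesgue" using S by simp
 have Sal: "z : aligned" if "z : S" for z using that by (simp add: S_def)
 have AJ: "(1 / \<kappa>) *: DS (P z) ** (mat 1 - JX z) = JX z" if "z : S" for z
 proof -
  have "(1 / \<kappa>) *: DS (P z) ** (mat 1 - JX z) = (1 / \<kappa>) *: (DS (P z) ** (mat 1 - JX z))"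
   by (rule matrix_eqI) (simp add: mv_assoc[symmetric] mv_scale[symmetric])
  thus ?thesis using Sal[OF that] \<kappa>(1) by (simp add: aligned_def)
 qed
 have DFv: "DF z *v h = (mat 1 - JX z) *v h - (u .* ((mat 1 - JX z) *v h)) *: u + (u .* (JX z *v h)) *: u" if "z : S" for z h
  unfolding DF_def AJ[OF that] by (simp add: mv_add mv_diff[of "mat 1"] mv_assoc[symmetric])
 have detDF: "det (DF z) = det (mat 1 - JX z) * ((1 / \<kappa>) * (u .* (DS (P z) *v u)))" for z
  unfolding DF_def det_split_projection[OF u] by (simp add: mv_scale[symmetric])
 have detDF_ge: "det (mat 1 - JX z) * m <= det (DF z)" if "z : S" for z
 proof -
  have "m <= (1 / \<kappa>) * (u .* (DS (P z) *v u))" using lower[of "P z"] that \<kappa>(1) by (simp add: S_def field_simps)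
  thus ?thesis unfolding detDF using aligned_det(2)[OF Sal[OF that]] by (intro mult_left_mono) auto
 qed
 have detDF_pos: "0 < det (DF z)" if "z : S" for z
  using detDF_ge[OF that] aligned_det(2)[OF Sal[OF that]] m by (meson less_le_trans mult_pos_pos)
 have der: "(F has_derivative (%h. DF z *v h)) (at z within A)" if "z : S" for z A
 proof -
  have dX: "(X has_derivative (%h. JX z *v h)) (at z within A)" using N_derivative[OF aligned_N[OF Sal[OF that]]] by (rule der_within)
  have dP: "(P has_derivative (%h. (mat 1 - JX z) *v h)) (at z within A)"
   using P_derivative[OF N_derivative[OF aligned_N[OF Sal[OF that]]]] by (rule der_within)
  show ?thesis unfolding F_def DFv[OF that]
   by (intro has_derivative_add has_derivative_diff dX dP has_derivative_scaleR_left has_derivative_inner_right)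
 qed
 have uF: "u .* F z = u .* X z" for z by (simp add: F_def iar idr uu)
 have inj: "inj_on F S"
 proof (rule inj_onI)
  fix z z' assume z: "z : S" "z' : S" "F z = F z'"
  have uX: "u .* X z' = u .* X z" using uF[of z] uF[of z'] z(3) by simp
  define \<alpha> where "\<alpha> = u .* (P z' - P z)"
  have dP: "P z' - P z = \<alpha> *: u" using z(3) uX by (simp add: F_def \<alpha>_def idr alg)
  have "(X z' - X z) .* (P z' - P z) = 0" unfolding dP using uX by (simp add: idl idr icomm[of _ u])
  hence J: "JX z *v (z' - z) = X z' - X z" by (rule derivative_on_segment[OF N_derivative[OF aligned_N[OF Sal[OF z(1)]]]])
  have IJ: "(mat 1 - JX z) *v (z' - z) = P z' - P z" unfolding mv_diff J matrix_vector_mul_lid by (simp add: X_def)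
  have "DF z *v (z' - z) = 0"
  proof -
   have "DF z *v (z' - z) = \<alpha> *: u - (u .* (\<alpha> *: u)) *: u + (u .* (X z' - X z)) *: u" unfolding DFv[OF z(1)] J IJ dP ..
   also have "u .* (X z' - X z) = 0" using uX by (simp add: idr)
   finally show ?thesis by (simp add: uu)
  qed
  moreover have "det (DF z) ~= 0" using detDF_pos[OF z(1)] by (rule less_imp_neq[symmetric])
  ultimately have "z' - z = 0" by (rule matrix_kernel_trivial[rotated])
  thus "z = z'" by simp
 qed
 have injP: "inj_on P S"
 proof (rule inj_onI)
  fix z z' assume "z : S" "z' : S" "P z = P z'"
  thus "z = z'" using P_inj[OF N_derivative[OF aligned_N[of z']], of z] aligned_det(2)[of z'] by (auto simp: S_def)
 qed
 have derP: "(P has_derivative (%h. (mat 1 - JX z) *v h)) (at z within S)" if "z : S" for z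
  using P_derivative[OF N_derivative[OF aligned_N[OF Sal[OF that]]]] by (rule der_within)
 let ?D = "vol (tube u 0 \<delta> 1)"
 have "ennreal m * (ennreal l * ?D) = ennreal m * lvol (tube u q0 \<delta> l)" using emeasure_tube[OF u l] tb by (simp add: lebesgue_lborel)
 also have "lvol (tube u q0 \<delta> l) <= lvol (P ` S Un (UNIV - P ` aligned))"
 proof (rule emeasure_mono)
  show "tube u q0 \<delta> l <= P ` S Un (UNIV - P ` aligned)" by (auto simp: S_def)
  show "P ` S Un (UNIV - P ` aligned) : sets lebesgue"
   using image_sets_lebesgue[OF SL derP injP] P_aligned_conull by (auto dest: negligible_imp_sets)
 qed
 also have "... = lvol (P ` S)" using image_sets_lebesgue[OF SL derP injP] P_aligned_conull
  by (intro emeasure_Un_null_set) (auto simp: neg_null)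
 also have "... = (\<integral>\<^sup>+z. ennreal \<bar>det (matrix (%h. (mat 1 - JX z) *v h))\<bar> * indicator S z \<partial>lborel)"
  by (rule lborel_image[OF SL derP injP])
 also have "ennreal m * ... = (\<integral>\<^sup>+z. ennreal m * (ennreal \<bar>det (mat 1 - JX z)\<bar> * indicator S z) \<partial>lborel)"
  using S det_co_JX_measurable by (subst nn_integral_cmult) auto
 also have "... <= (\<integral>\<^sup>+z. ennreal \<bar>det (matrix (%h. DF z *v h))\<bar> * indicator S z \<partial>lborel)"
 proof (rule nn_integral_mono)
  fix z
  show "ennreal m * (ennreal \<bar>det (mat 1 - JX z)\<bar> * indicator S z) <= ennreal \<bar>det (matrix (%h. DF z *v h))\<bar> * indicator S z"
  proof (cases "z : S")
   case True
   thus ?thesis using detDF_ge[OF True] detDF_pos[OF True] aligned_det(2)[OF Sal[OF True]] m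
    by (simp add: ennreal_mult[symmetric] mult.commute ennreal_leI)
  qed simp
 qed
 also have "... = lvol (F ` S)" by (rule lborel_image[OF SL der inj, symmetric])
 also have "... <= lvol (tube u (q0 - (u .* q0) *: u + a *: u) \<delta> l')"
 proof (rule emeasure_mono)
  show "F ` S <= tube u (q0 - (u .* q0) *: u + a *: u) \<delta> l'"
  proof
   fix y assume "y : F ` S"
   then obtain z where z: "z : S" "y = F z" by blast
   let ?q = "q0 - (u .* q0) *: u + a *: u"
   have 1: "u .* (F z - ?q) = u .* X z - a" by (simp add: idr uF iar uu)
   have 2: "(F z - ?q) - (u .* (F z - ?q)) *: u = (P z - q0) - (u .* (P z - q0)) *: u" unfolding 1 by (simp add: F_def idr alg)
   have Pz: "P z : tube u q0 \<delta> l" using z(1) by (simp add: S_def)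
   have "norm ((F z - ?q) - (u .* (F z - ?q)) *: u) <= \<delta>" unfolding 2 using Pz by (simp add: tube_def)
   moreover have "0 <= u .* (F z - ?q) & u .* (F z - ?q) <= l'" unfolding 1 using range[OF Pz] by simp
   ultimately show "y : tube u ?q \<delta> l'" unfolding z(2) tube_def by blast
  qed
  show "tube u (q0 - (u .* q0) *: u + a *: u) \<delta> l' : sets lebesgue" using tb by simp
 qed
 also have "... = ennreal l' * ?D" using emeasure_tube[OF u l'] tb by (simp add: lebesgue_lborel)
 finally have "ennreal m * (ennreal l * ?D) <= ennreal l' * ?D" by (simp add: mult_left_mono)
 hence *: "ennreal (m * l) * ?D <= ennreal l' * ?D" using m l by (simp add: ennreal_mult mult.assoc)
 obtain d where d: "?D = ennreal d" "0 <= d" using emeasure_tube_finite[OF u, of 0 \<delta> 1] by (cases ?D rule: ennreal_cases) auto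
 have "0 < d" using emeasure_tube_pos[OF u \<delta>, of 0] d by simp
 have "m * l * d <= l' * d" using * d l' m l by (simp add: ennreal_mult[symmetric])
 thus ?thesis using \<open>0 < d\<close> by simp
qed

end

section \<open>Strong monotonicity and nondegeneracy\<close>

context shadow_equality
begin

text \<open>A thin tube is laid around the segment from \<open>P z0\<close> to \<open>P z\<close>.
  Monotonicity against the two end points confines the component of \<open>X\<close> on the tube to
  nearly the interval between the end values, and \<open>volume_comparison\<close> bounds that
  interval from below.\<close>

lemma strong_monotone:
 obtains m where "m > 0" "!!z. norm (P z - P z0) <= 1 ==> m * norm (P z - P z0) <= norm (X z - X z0)"
proof -
 \<comment> \<open>Radius 2 contains all tubes used, since the segment has length at most 1 and the
   tube radius is at most 1.\<close>
 let ?C = "cball (P z0) 2 \<times> sphere (0 :: real^'n) 1" and ?f = "%y. snd y .* (DS (fst y) *v snd y)"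
 have c1: "compact ?C" by (intro compact_Times) auto
 have c2: "?C ~= {}"
 proof -
  obtain e :: "real^'n" where "norm e = 1" using vector_choose_size[of 1] by auto
  hence "(P z0, e) : ?C" by simp
  thus ?thesis by blast
 qed
 have c3: "continuous_on ?C ?f" by (intro continuous_intros continuous_on_compose2[OF DS_continuous]) auto
 from continuous_attains_inf[OF c1 c2 c3] obtain y where yC: "y : ?C" and y: "\<forall>x\<in>?C. ?f y <= ?f x" by (rule bexE)
 define m where "m = (snd y .* (DS (fst y) *v snd y)) / \<kappa>"
 have "snd y ~= 0" using yC by (cases y) auto
 hence m: "m > 0" using DS_positive[of "fst y"] \<kappa>(1) by (simp add: m_def positive_matrix_def)
 have lower: "\<kappa> * m <= u .* (DS q *v u)" if "q : cball (P z0) 2" "norm u = 1" for q u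
 proof -
  have "(q, u) : ?C" using that by simp
  with y have "?f y <= ?f (q, u)" by (rule bspec)
  thus ?thesis using \<kappa>(1) by (simp add: m_def)
 qed
 show thesis
 proof
  show "m > 0" by fact
  fix z assume h1: "norm (P z - P z0) <= 1"
  show "m * norm (P z - P z0) <= norm (X z - X z0)"
  proof (cases "P z = P z0")
   case False
   define h where "h = norm (P z - P z0)"
   have h: "0 < h" "h <= 1" using False h1 by (auto simp: h_def)
   define u where "u = (P z - P z0) /\<^sub>R h"
   have u: "norm u = 1" using h(1) by (simp add: u_def h_def)
   have uu: "u .* u = 1" using u by (simp add: norm_eq_1)
   have Pz: "P z = P z0 + h *: u" using h(1) by (simp add: u_def)
   have est: "m * (h - 2 * eps) <= u .* (X z - X z0) + 4 * (R + 1) * eps" if eps: "0 < eps" "2 * eps < h" for eps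
   proof -
    \<comment> \<open>The transversal error is of order \<open>R * \<delta>\<close> and gets divided
      by the distance from an end point, which is at least \<open>eps\<close>. A radius of
      \<open>eps^2\<close> keeps the quotient of order \<open>R * eps\<close>.\<close>
    define \<delta> where "\<delta> = eps\<^sup>2"
    have \<delta>: "\<delta> > 0" "\<delta> <= 1" using eps h by (auto simp: \<delta>_def power_le_one)
    let ?q = "P z0 + eps *: u"
    have decomp: "\<exists>s v. q - P z0 = s *: u + v & eps <= s & s <= h - eps & norm v <= \<delta>" if "q : tube u ?q \<delta> (h - 2 * eps)" for q
    proof -
     have "q - P z0 = (eps + u .* (q - ?q)) *: u + ((q - ?q) - (u .* (q - ?q)) *: u)" by (simp add: scaleR_add_left)
     moreover have "eps <= eps + u .* (q - ?q)" "eps + u .* (q - ?q) <= h - eps" "norm ((q - ?q) - (u .* (q - ?q)) *: u) <= \<delta>"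
      using that unfolding tube_def by auto
     ultimately show ?thesis by blast
    qed
    have XR: "\<bar>(X y - X y') .* v\<bar> <= 2 * R * \<delta>" if "norm v <= \<delta>" for y y' v
    proof -
     have "norm (X y - X y') <= 2 * R" using norm_triangle_ineq4[of "X y" "X y'"] X_bounded[of y] X_bounded[of y'] by linarith
     hence "norm (X y - X y') * norm v <= 2 * R * \<delta>" using that R(1) by (intro mult_mono) auto
     thus ?thesis using CS_ineq[of "X y - X y'" v] by linarith
    qed
    have bound: "t >= - (2 * R * eps)" if "s * t >= - (2 * R * \<delta>)" "eps <= s" for s t
    proof (cases "t >= 0")
     case True
     have "0 <= 2 * R * eps" using R(1) eps(1) by simp
     thus ?thesis using True by linarith
    next
     case False
     hence "s * t <= eps * t" using that(2) by (intro mult_right_mono_neg) auto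
     hence "eps * (- (2 * R * eps)) <= eps * t" using that(1) by (simp add: \<delta>_def sq_eq alg)
     thus ?thesis using eps(1) by (simp only: mult_le_cancel_left_pos)
    qed
    have "m * (h - 2 * eps) <= u .* (X z - X z0) + 4 * (R + 1) * eps"
    \<comment> \<open>The interval allows an error \<open>2 * R * eps\<close> at both ends; the
      additional \<open>4 * eps\<close> makes its length positive even when \<open>X z\<close> has
      the same component as \<open>X z0\<close>.\<close>
    proof (rule volume_comparison[OF u _ _ \<delta>(1) m, where ?q0.0 = ?q and a = "u .* X z0 - 2 * R * eps"])
     show "h - 2 * eps > 0" using eps by simp
     have "0 <= (X z - X z0) .* (P z - P z0)" by (rule monotone)
     hence "0 <= h * (u .* (X z - X z0))" by (simp add: Pz icomm)
     hence "0 <= u .* (X z - X z0)" using h(1) by (simp add: zero_le_mult_iff)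
     moreover have "0 < 4 * (R + 1) * eps" using R(1) eps(1) by simp
     ultimately show "0 < u .* (X z - X z0) + 4 * (R + 1) * eps" by simp
    next
     fix q assume q: "q : tube u ?q \<delta> (h - 2 * eps)"
     then obtain s v where sv: "q - P z0 = s *: u + v" "eps <= s" "s <= h - eps" "norm v <= \<delta>" using decomp by blast
     have "norm (q - P z0) <= norm (s *: u) + norm v" unfolding sv(1) by (rule norm_triangle_ineq)
     hence "norm (q - P z0) <= 2" using sv u eps h \<delta> by simp
     thus "\<kappa> * m <= u .* (DS q *v u)" using u by (intro lower) (auto simp: dist_norm norm_minus_commute)
    next
     fix y assume y: "P y : tube u ?q \<delta> (h - 2 * eps)"
     then obtain s v where sv: "P y - P z0 = s *: u + v" "eps <= s" "s <= h - eps" "norm v <= \<delta>" using decomp by blast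
     have "0 <= (X y - X z0) .* (s *: u + v)" using monotone[of y z0] unfolding sv(1) .
     hence "- (2 * R * \<delta>) <= s * ((X y - X z0) .* u)" using XR[OF sv(4), of y z0] by (simp add: iar)
     hence 1: "- (2 * R * eps) <= (X y - X z0) .* u" by (rule bound[OF _ sv(2)])
     have "P z - P y = (h - s) *: u - v" using sv(1) Pz by (simp add: alg)
     hence "0 <= (X z - X y) .* ((h - s) *: u - v)" using monotone[of z y] by simp
     hence "- (2 * R * \<delta>) <= (h - s) * ((X z - X y) .* u)" using XR[OF sv(4), of z y] by (simp add: idr)
     hence 2: "- (2 * R * eps) <= (X z - X y) .* u" by (rule bound) (use sv(3) in simp)
     have R0: "0 <= 4 * eps" using eps(1) by simp
     show "u .* X z0 - 2 * R * eps <= u .* X y & u .* X y <= u .* X z0 - 2 * R * eps + (u .* (X z - X z0) + 4 * (R + 1) * eps)"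
      using 1 2 R0 by (simp add: idl idr icomm[of _ u] alg)
    qed
    thus ?thesis .
   qed
   have "((%eps. m * (h - 2 * eps)) \<longlongrightarrow> m * (h - 2 * 0)) (at_right 0)"
    and "((%eps. u .* (X z - X z0) + 4 * (R + 1) * eps) \<longlongrightarrow> u .* (X z - X z0) + 4 * (R + 1) * 0) (at_right 0)"
    by (intro tendsto_intros)+
   moreover have "\<forall>\<^sub>F eps in at_right 0. m * (h - 2 * eps) <= u .* (X z - X z0) + 4 * (R + 1) * eps"
    by (rule eventually_at_rightI[of 0 "h / 2"]) (use est h in auto)
   ultimately have "m * (h - 2 * 0) <= u .* (X z - X z0) + 4 * (R + 1) * 0" by (intro tendsto_le[OF trivial_limit_at_right_real]) auto
   also have "... <= norm (X z - X z0)" using norm_cauchy_schwarz[of u "X z - X z0"] u by simp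
   finally show ?thesis by (simp add: h_def)
  qed simp
 qed
qed

text \<open>Along a kernel direction \<open>X\<close> would change by less than first order. As
  \<open>X\<close> and \<open>P\<close> add up to the identity, \<open>P\<close> would then change
  at full rate, contrary to \<open>strong_monotone\<close>.\<close>

lemma det_JX_nonzero:
 assumes z: "z ~: N"
 shows "det (JX z) ~= 0"
proof
 assume "det (JX z) = 0"
 hence "~ (\<forall>x. JX z *v x = 0 --> x = 0)" by (metis invertible_det_nz invertible_left_inverse matrix_left_invertible_ker)
 then obtain e0 where e0: "JX z *v e0 = 0" "e0 ~= 0" by blast
 define e where "e = e0 /\<^sub>R norm e0"
 have e: "norm e = 1" "JX z *v e = 0" using e0 by (auto simp: e_def mv_scaleR)
 obtain m where m: "m > 0" "!!y. norm (P y - P z) <= 1 ==> m * norm (P y - P z) <= norm (X y - X z)" using strong_monotone[of z] by blast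
 \<comment> \<open>The two estimates below combine to \<open>m * t <= \<eta> * (m + 1) * t\<close>;
   this value makes the factor on the right \<open>m / 2\<close>.\<close>
 define \<eta> where "\<eta> = (m / 2) / (m + 1)"
 have \<eta>: "0 < \<eta>" "\<eta> < 1" "\<eta> * (m + 1) < m"
 proof -
  have "m + 1 ~= 0" using m(1) by simp
  from nonzero_eq_divide_eq[THEN iffD1, OF this \<eta>_def] have "\<eta> * (m + 1) = m / 2" .
  thus "\<eta> * (m + 1) < m" using m(1) by simp
  show "0 < \<eta>" "\<eta> < 1" using m(1) by (auto simp: \<eta>_def)
 qed
 obtain d where d: "d > 0" "!!y. norm (y - z) < d ==> norm (X y - X z - JX z *v (y - z)) <= \<eta> * norm (y - z)"
  using N_derivative[OF z] \<eta>(1) unfolding has_derivative_at_alt by blast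
 define t where "t = min (d / 2) 1"
 have t: "0 < t" "t < d" "t <= 1" using d(1) by (auto simp: t_def)
 let ?y = "z + t *: e"
 have X: "norm (X ?y - X z) <= \<eta> * t" using d(2)[of ?y] t e by (simp add: mv_scaleR)
 have "norm (P ?y - P z) <= norm (?y - z)" by (rule P_lipschitz)
 hence "norm (P ?y - P z) <= 1" using t e by simp
 hence "m * norm (P ?y - P z) <= \<eta> * t" using m(2) X by fastforce
 moreover have "t <= norm (X ?y - X z) + norm (P ?y - P z)"
  using norm_triangle_ineq[of "X ?y - X z" "P ?y - P z"] unfolding diff_split using t e by simp
 hence "m * t <= m * (\<eta> * t + norm (P ?y - P z))" using X m(1) by (intro mult_left_mono) auto
 ultimately have "m * t <= (\<eta> * (m + 1)) * t" by (simp add: alg)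
 thus False using \<eta>(3) t(1) by simp
qed

end

section \<open>Directions that meet a set of positive volume\<close>

definition reflect :: "real^'n => real^'n^'n" where
 "reflect y = mat 1 - (2 / (y .* y)) *: outer y y"

lemma reflect_mult: "reflect y *v x = x - (2 * (y .* x) / (y .* y)) *: y" by (simp add: reflect_def mv_diff mv_scale[symmetric])

text \<open>Division by zero yields zero, so the formula is the identity at 0 and
  \<open>reflect y\<close> is orthogonal for every \<open>y\<close>.\<close>

lemma reflect_zero: "reflect 0 = mat 1" by (simp add: reflect_def)

lemma reflect_transpose: "transpose (reflect y) = reflect y" by (rule transpose_eqI) (simp add: reflect_mult idl idr icomm)

lemma reflect_orthogonal: "orthogonal_matrix (reflect y)"
proof (cases "y = 0")
 case False
 hence "y .* y ~= 0" by simp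
 have "reflect y *v (reflect y *v x) = x" for x
 proof -
  define c where "c = 2 * (y .* x) / (y .* y)"
  have "2 * (y .* (x - c *: y)) / (y .* y) = - c"
   using \<open>y .* y ~= 0\<close> by (simp add: c_def idr diff_divide_distrib right_diff_distrib)
  thus ?thesis unfolding reflect_mult c_def[symmetric] by simp
 qed
 hence "reflect y ** reflect y = mat 1" by (intro matrix_eqI) (simp add: mv_assoc[symmetric])
 thus ?thesis by (simp add: orthogonal_matrix reflect_transpose)
qed (simp add: reflect_zero orthogonal_matrix_id)

lemma reflect_swap:
 assumes n: "norm a = norm b"
 shows "reflect (b - a) *v a = b"
proof (cases "a = b")
 case False
 have ab: "a .* a = b .* b" using n by (simp add: norm_eq)
 have "(b - a) .* (b - a) ~= 0" using False by simp
 moreover have "2 * ((b - a) .* a) = - ((b - a) .* (b - a))" using ab by (simp add: idl idr icomm)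
 ultimately have "2 * ((b - a) .* a) / ((b - a) .* (b - a)) = - 1" by simp
 thus ?thesis by (simp add: reflect_mult)
qed (simp add: reflect_zero)

lemma reflect_measurable: "(reflect :: real^'n => _) : borel_measurable borel"
proof -
 have "continuous_on (- {0}) (reflect :: real^'n => _)" unfolding reflect_def[abs_def] outer_def by (intro continuous_intros) auto
 hence "(%y :: real^'n. if y : {0} then reflect y else reflect y) : borel_measurable borel" by (intro borel_measurable_continuous_on_if) auto
 thus ?thesis by simp
qed

text \<open>The shifted point is the vector whose reflection takes \<open>norm k *: u\<close> to
  \<open>k\<close>. Off the ray of \<open>u\<close> the shift is injective with Jacobian determinant
  \<open>1 - u .* sgn k\<close>, which vanishes only on that ray.\<close>

lemma emeasure_radial_shift_pos:
 fixes u :: "real^'n"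
 assumes u: "norm u = 1" and S: "S : sets borel" "0 < vol S" and ray: "!!k. k : S ==> k ~= norm k *: u"
 shows "~ negligible ((%k. k - norm k *: u) ` S)"
proof
 let ?F = "%k. k - norm k *: u"
 let ?DF = "%k. mat 1 + outer u (- sgn k)"
 assume neg: "negligible (?F ` S)"
 have uu: "u .* u = 1" using u by (simp add: norm_eq_1)
 have k0: "k ~= 0" if "k : S" for k using ray[OF that] by auto
 have SL: "S : sets lebesgue" using S by simp
 have der: "(?F has_derivative (%h. ?DF k *v h)) (at k within S)" if "k : S" for k
 proof -
  have "(?F has_derivative (%h. h - (h .* sgn k) *: u)) (at k within S)"
   by (intro has_derivative_diff has_derivative_ident has_derivative_scaleR_left der_within[OF has_derivative_norm[OF k0[OF that]]])
  moreover have "h - (h .* sgn k) *: u = ?DF k *v h" for h by (simp add: mv_add icomm)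
  ultimately show ?thesis by simp
 qed
 have inj: "inj_on ?F S"
 proof (rule inj_onI)
  fix k k' assume k: "k : S" "k' : S" "?F k = ?F k'"
  \<comment> \<open>The quotient of the squared length of \<open>?F x\<close> by its component along
    \<open>u\<close> determines \<open>norm x\<close>, and then \<open>x\<close> itself.\<close>
  have e: "?F x .* ?F x = 2 * norm x * (norm x - u .* x)" for x by (simp add: idl idr uu icomm[of x u] norm_sq[of x, symmetric] sq_eq alg)
  have e2: "u .* ?F x = - (norm x - u .* x)" for x by (simp add: idr uu)
  have "norm k - u .* k = norm k' - u .* k'" using e2[of k] e2[of k'] k(3) by simp
  moreover have "norm k - u .* k ~= 0"
  proof
   assume "norm k - u .* k = 0"
   hence "?F k .* ?F k = 0" unfolding e by simp
   thus False using ray[OF k(1)] by simp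
  qed
  moreover have "2 * norm k * (norm k - u .* k) = 2 * norm k' * (norm k' - u .* k')" using e[of k] e[of k'] k(3) by simp
  ultimately have "norm k = norm k'" by simp
  thus "k = k'" using k(3) by simp
 qed
 have det: "det (?DF k) ~= 0" if "k : S" for k
 proof
  assume "det (?DF k) = 0"
  hence "u .* sgn k = 1" by (simp add: det_mat1_plus_outer)
  hence "u .* k = norm k" using k0[OF that] by (simp add: sgn_div_norm field_simps)
  hence "norm u *: k = norm k *: u" using norm_cauchy_schwarz_eq[of u k] u by simp
  thus False using ray[OF that] u by simp
 qed
 have "lvol (?F ` S) = 0" using neg by (simp add: neg_null null_setsD1)
 hence 0: "(\<integral>\<^sup>+k. ennreal \<bar>det (matrix (%h. ?DF k *v h))\<bar> * indicator S k \<partial>lebesgue) = 0"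
  using emeasure_image[OF SL der inj] by simp
 have "AE k in lebesgue. ennreal \<bar>det (matrix (%h. ?DF k *v h))\<bar> * indicator S k = 0"
  using 0 by (subst (asm) nn_integral_0_iff_AE[OF borel_measurable_det_derivative[OF SL der]]) auto
 hence "AE k in lebesgue. k ~: S"
 proof eventually_elim
  fix k assume "ennreal \<bar>det (matrix (%h. ?DF k *v h))\<bar> * indicator S k = 0"
  thus "k ~: S" using det[of k] by (auto simp: indicator_def ennreal_eq_0_iff split: if_splits)
 qed
 hence "lvol S = 0" using SL by (subst (asm) AE_iff_measurable[OF SL]) auto
 thus False using S by (simp add: lebesgue_lborel)
qed

lemma line_negligible:
 fixes u :: "real^'n"
 assumes "CARD('n) >= 2"
 shows "negligible {k. \<exists>t. k = t *: u}"
proof -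
 have "dim {u} < DIM(real^'n)" using assms dim_le_card'[of "{u}"] by simp
 then obtain v where v: "v ~= 0" "!!y. y : span {u} ==> orthogonal v y" using orthogonal_to_subspace_exists[of "{u}"] by blast
 have "v .* u = 0" using v(2)[of u] by (simp add: span_base orthogonal_def)
 hence "{k. \<exists>t. k = t *: u} <= {k. v .* k = 0}" by auto
 moreover have "negligible {k. v .* k = 0}" using v(1) by (intro negligible_hyperplane) simp
 ultimately show ?thesis by (rule negligible_subset[rotated])
qed

lemma closed_line_meets:
 fixes S :: "(real^'n) set"
 assumes "compact S"
 shows "closed {z :: (real^'n^'n) \<times> (real^'n). \<exists>k\<in>S. k - snd z = fst z *v (k - snd z)}"
proof -
 have "closed {w :: (real^'n) \<times> (real^'n^'n) \<times> (real^'n). fst w - snd (snd w) = fst (snd w) *v (fst w - snd (snd w))}"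
  by (intro closed_Collect_eq continuous_intros)
 from closed_compact_projection[OF assms this] show ?thesis by (rule back_subst[of closed]) auto
qed

context hyperplane_distribution
begin

text \<open>The distribution is only known to be invariant. Averaging over reflections turns the set of reflection vectors carrying a fixed
 direction into a direction of \<open>S\<close> into a set of positive Lebesgue measure.\<close>

lemma directions_hit:
 fixes S :: "(real^'n) set"
 assumes n: "CARD('n) >= 2" and S: "compact S" "0 < vol S"
 shows "~ (AE Q in \<nu>. \<forall>k\<in>S. k ~= Q *v k)"
proof
 assume ae: "AE Q in \<nu>. \<forall>k\<in>S. k ~= Q *v k"
 let ?A = "%Q :: real^'n^'n. \<forall>k\<in>S. k ~= Q *v k"
 have A: "{Q. ?A Q} : sets borel"
 proof -
  have "closed {w :: (real^'n) \<times> (real^'n^'n). fst w = snd w *v fst w}" by (intro closed_Collect_eq continuous_intros)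
  from closed_compact_projection[OF S(1) this]
  have "closed {Q :: real^'n^'n. \<exists>k\<in>S. k = Q *v k}" by (rule back_subst[of closed]) auto
  hence "UNIV - {Q :: real^'n^'n. \<exists>k\<in>S. k = Q *v k} : sets borel" by auto
  thus ?thesis by (rule back_subst[of "%A. A : sets borel"]) auto
 qed
 let ?P = "%Q y. ?A (reflect y ** Q ** transpose (reflect y))"
 interpret pair_sigma_finite \<nu> "lborel :: (real^'n) measure" ..
 have "AE Q in \<nu>. AE y in lborel. ?P Q y"
 proof (subst AE_commute)
  show "AE y in lborel. AE Q in \<nu>. ?P Q y" using invariant_AE[OF reflect_orthogonal A ae] by simp
  define h :: "(real^'n^'n) \<times> (real^'n^'n) => real^'n^'n" where "h w = fst w ** snd w ** transpose (fst w)" for w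
  have "continuous_on UNIV h" unfolding h_def transpose_def by (intro continuous_intros)
  hence h: "h : borel_measurable borel" by (rule cont_borel)
  have "(%x. (reflect (snd x), fst x)) : (borel \<Otimes>\<^sub>M borel) \<rightarrow>\<^sub>M (borel :: ((real^'n^'n) \<times> (real^'n^'n)) measure)"
   unfolding borel_prod[where 'a = "real^'n^'n" and 'b = "real^'n^'n", symmetric]
   by (intro measurable_Pair measurable_fst mcomp[OF measurable_snd reflect_measurable])
  from mcomp[OF this h] have m: "(%x. h (reflect (snd x), fst x)) : borel_measurable (borel \<Otimes>\<^sub>M (borel :: (real^'n) measure))" .
  have s: "sets (\<nu> \<Otimes>\<^sub>M lborel) = sets (borel \<Otimes>\<^sub>M (borel :: (real^'n) measure))"
   by (rule sets_pair_measure_cong[OF sets_\<nu> sets_lborel])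
  have sp: "space (\<nu> \<Otimes>\<^sub>M (lborel :: (real^'n) measure)) = UNIV" by (simp add: space_pair_measure)
  from measurable_sets[OF m A]
  have "{x. ?P (fst x) (snd x)} : sets (borel \<Otimes>\<^sub>M (borel :: (real^'n) measure))"
   by (simp add: h_def vimage_def space_pair_measure)
  thus "{x : space (\<nu> \<Otimes>\<^sub>M lborel). ?P (fst x) (snd x)} : sets (\<nu> \<Otimes>\<^sub>M lborel)" unfolding s sp by simp
 qed
 hence "AE Q in \<nu>. False" using rank_one
 proof eventually_elim
  fix Q :: "real^'n^'n" assume P: "AE y in lborel. ?P Q y" and "\<exists>u. norm u = 1 & Q = outer u u"
  then obtain u where u: "norm u = 1" "Q = outer u u" by blast
  \<comment> \<open>On the ray of \<open>u\<close> the reflection vector degenerates to 0. The ray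
    lies on a line, which is null because the dimension is at least 2.\<close>
  define S1 where "S1 = S - {k. k = norm k *: u}"
  have cl: "closed {k. k = norm k *: u}" by (intro closed_Collect_eq continuous_intros)
  have S1: "S1 : sets borel" unfolding S1_def using S(1) cl by (intro sets.Diff) (auto simp: borel_compact)
  have "negligible {k. k = norm k *: u}" by (rule negligible_subset[OF line_negligible[OF n, of u]]) blast
  hence "{k. k = norm k *: u} : null_sets lborel" using cl by (auto simp: neg_null null_sets_def lebesgue_lborel)
  hence "vol S1 = vol S" unfolding S1_def using S(1) by (intro emeasure_Diff_null_set) (auto simp: borel_compact)
  hence pos: "0 < vol S1" using S(2) by simp
  have "~ ?P Q (k - norm k *: u)" if k: "k : S1" for k
  proof -
   let ?y = "k - norm k *: u"
   have R: "reflect ?y *v (norm k *: u) = k" using u by (intro reflect_swap) simp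
   have k0: "k ~= 0" using k by (auto simp: S1_def)
   hence Ru: "reflect ?y *v u = (1 / norm k) *: k"
   proof -
    have "(1 / norm k) *: (norm k *: (reflect ?y *v u)) = (1 / norm k) *: k" using R by (simp only: mv_scaleR)
    thus ?thesis using k0 by simp
   qed
   have "(reflect ?y ** Q ** transpose (reflect ?y)) *v k = k"
    unfolding u(2) mult_outer_transpose Ru using k0 by (simp add: norm_sq[symmetric] sq_eq)
   thus ?thesis using k by (metis DiffD1 S1_def)
  qed
  hence sub: "(%k. k - norm k *: u) ` S1 <= {y. ~ ?P Q y}" by blast
  obtain M where M: "{y : space lborel. ~ ?P Q y} <= M" "M : null_sets lborel" using P unfolding eventually_ae_filter by blast
  hence "negligible M" by (intro null_sets_lborel_negligible)
  moreover have "(%k. k - norm k *: u) ` S1 <= M" using sub M(1) by auto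
  ultimately have "negligible ((%k. k - norm k *: u) ` S1)" by (rule negligible_subset)
  moreover have "~ negligible ((%k. k - norm k *: u) ` S1)" by (rule emeasure_radial_shift_pos[OF u(1) S1 pos]) (simp add: S1_def)
  ultimately show False by blast
 qed
 thus False by simp
qed

end

lemma emeasure_cyl_finite:
 fixes K :: "(real^'n) set"
 assumes u: "norm u = 1" and K: "compact K"
 shows "vol (cyl (outer u u) K) < top"
proof -
 obtain B where B: "!!k. k : K ==> norm k <= B" using compact_imp_bounded[OF K] unfolding bounded_iff by blast
 have "norm y <= 1 + 2 * B" if "y : cyl (outer u u) K" for y
 proof -
  obtain k where k: "k : K" "y - k = (u .* (y - k)) *: u" and y: "norm ((u .* y) *: u) < 1"
   using \<open>y : cyl (outer u u) K\<close> by (auto simp: cyl_def)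
  have "y = (u .* y) *: u + (k - (u .* k) *: u)" using k(2) by (simp add: idr alg)
  hence "norm y <= norm ((u .* y) *: u) + norm (k - (u .* k) *: u)" by (metis norm_triangle_ineq)
  also have "norm (k - (u .* k) *: u) <= norm k + norm ((u .* k) *: u)" by (rule norm_triangle_ineq4)
  also have "norm ((u .* k) *: u) <= norm k" using CS_ineq[of u k] u by simp
  finally show ?thesis using y B[OF k(1)] by linarith
 qed
 hence "bounded (cyl (outer u u) K)" unfolding bounded_iff by blast
 thus ?thesis using emeasure_bounded_finite by simp
qed

lemma matrix_kernel_negligible:
 fixes A :: "real^'n^'n"
 assumes "A ~= 0"
 shows "negligible {k. A *v (k - x) = 0}"
proof -
 obtain i where i: "A $ i ~= 0" using assms by (auto simp: vec_eq_iff)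
 have "negligible {k. (A $ i) .* k = (A $ i) .* x}" using i by (intro negligible_hyperplane) simp
 moreover have "{k. A *v (k - x) = 0} <= {k. (A $ i) .* k = (A $ i) .* x}" by (auto simp: vec_eq_iff matrix_vector_mul_component idr)
 ultimately show ?thesis by (rule negligible_subset)
qed

section \<open>Points outside K whose lines meet K\<close>

context shadow_transport
begin

definition passing :: "real^'n^'n => (real^'n) set" where
 "passing Q = {z. z ~: N & X z ~: K & (\<exists>k\<in>K. k - X z = Q *v (k - X z)) & det (shadow_jac Q z) ~= 0}"

lemma passing_product_measurable: "{w. snd w : passing (fst w)} : sets (borel \<Otimes>\<^sub>M borel)"
proof -
 define L where "L = {z :: (real^'n^'n) \<times> (real^'n). \<exists>k\<in>K. k - snd z = fst z *v (k - snd z)}"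
 have L: "L : sets borel" unfolding L_def by (rule borel_closed[OF closed_line_meets[OF K]])
 let ?B = "borel \<Otimes>\<^sub>M borel :: ((real^'n^'n) \<times> (real^'n)) measure"
 have sp: "space ?B = UNIV" by (simp add: space_pair_measure)
 have f: "(%w. (fst w, X (snd w))) : ?B \<rightarrow>\<^sub>M (borel :: ((real^'n^'n) \<times> (real^'n)) measure)"
  unfolding borel_prod[where 'a = "real^'n^'n" and 'b = "real^'n", symmetric]
  by (intro measurable_Pair measurable_fst mcomp[OF measurable_snd X_measurable])
 have "{w. (fst w, X (snd w)) : L} : sets ?B" using measurable_sets[OF f L] by (simp add: vimage_def sp)
 moreover have snd: "{w. snd w : A} : sets ?B" if "A : sets borel" for A
  using measurable_sets[OF measurable_snd[of "borel :: (real^'n^'n) measure" borel] that] by (simp add: vimage_def sp)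
 moreover have "- N : sets borel" using N_borel by simp
 moreover have "{z. X z : - K} : sets borel" using K by (intro borel_pred X_measurable) (intro borel_comp borel_compact)
 moreover have "{w. (%(Q, z). det (shadow_jac Q z)) w : - {0}} : sets ?B"
  using measurable_sets[OF shadow_jac_measurable, of "- {0}"] by (simp add: vimage_def sp)
 ultimately have "{w. snd w : - N} Int {w. snd w : {z. X z : - K}} Int {w. (fst w, X (snd w)) : L} Int {w. (%(Q, z). det (shadow_jac Q z)) w : - {0}} : sets ?B"
  by (intro sets.Int snd)
 moreover have "{w. snd w : - N} Int {w. snd w : {z. X z : - K}} Int {w. (fst w, X (snd w)) : L} Int {w. (%(Q, z). det (shadow_jac Q z)) w : - {0}} = {w. snd w : passing (fst w)}"
  by (auto simp: passing_def L_def case_prod_beta)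
 ultimately show ?thesis by simp
qed

lemma passing_borel: "passing Q : sets borel" using sets_Pair1[OF passing_product_measurable, of Q] by (simp add: vimage_def)

text \<open>The image of the passing points lies in the cylinder and is disjoint from the image of
  the regular points, which already has the full finite volume. So it is null, and the nonzero
  Jacobian makes the set itself null.\<close>

lemma passing_null:
 assumes u: "norm u = 1"
  and le: "vol (cyl (outer u u) K) <= (\<integral>\<^sup>+z. ennreal \<bar>det (shadow_jac (outer u u) z)\<bar> * indicator G z \<partial>lborel)"
 shows "AE z in lborel. z ~: passing (outer u u)"
proof -
 let ?H = "passing (outer u u)"
 have uu: "u .* u = 1" using u by (simp add: norm_eq_1)
 have HL: "?H : sets lebesgue" using passing_borel by simp
 have der: "(shadow_map u has_derivative (%h. shadow_jac (outer u u) z *v h)) (at z within ?H)" if "z : ?H" for z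
  using that N_derivative[of z] by (intro shadow_map_derivative u) (auto simp: passing_def)
 have inj: "inj_on (shadow_map u) ?H"
 proof (rule inj_onI)
  fix z z' assume "z : ?H" "z' : ?H" "shadow_map u z = shadow_map u z'"
  thus "z = z'" using shadow_map_inj[OF u, of z' z] by (auto simp: passing_def)
 qed
 have im: "shadow_map u ` ?H : sets lebesgue" by (rule image_sets_lebesgue[OF HL der inj])
 have sub: "shadow_map u ` ?H <= cyl (outer u u) K"
 proof (rule image_subsetI)
  fix z assume "z : ?H"
  then obtain k where k: "k : K" "k - X z = outer u u *v (k - X z)" unfolding passing_def by blast
  have 1: "u .* shadow_map u z = squash (u .* P z)" by (simp add: shadow_map_def iar idr uu)
  have "k = X z + (u .* (k - X z)) *: u" using k(2) by (simp add: alg)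
  hence "shadow_map u z - k = (squash (u .* P z) - u .* k) *: u" unfolding shadow_map_def by (simp add: idr alg)
  hence "shadow_map u z - k = (u .* (shadow_map u z - k)) *: u" by (simp add: idr 1 uu)
  moreover have "norm (outer u u *v shadow_map u z) < 1" using u squash_less_1[of "u .* P z"] by (simp add: 1)
  ultimately show "shadow_map u z : cyl (outer u u) K" using k(1) by (auto simp: cyl_def)
 qed
 have dis: "shadow_map u ` ?H Int shadow_map u ` regular u = {}"
 proof (rule ccontr)
  assume "shadow_map u ` ?H Int shadow_map u ` regular u ~= {}"
  then obtain z z' where z: "z : ?H" "z' : regular u" "shadow_map u z = shadow_map u z'" by (elim ex_in_conv[THEN iffD2, THEN exE] IntE imageE) metis
  hence "z = z'" using shadow_map_inj[OF u, of z' z] by (auto simp: regular_def G_def)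
  thus False using z by (auto simp: passing_def regular_def G_def)
 qed
 let ?a = "lvol (shadow_map u ` ?H)" and ?b = "lvol (shadow_map u ` regular u)"
 have "?a + ?b = lvol (shadow_map u ` ?H Un shadow_map u ` regular u)" by (rule plus_emeasure[OF im shadow_image_measure(1)[OF u] dis])
 also have "... <= lvol (cyl (outer u u) K)" using sub shadow_image_measure(2)[OF u] cyl_measurable(1)[OF K] by (intro emeasure_mono) auto
 also have "... = vol (cyl (outer u u) K)" using cyl_measurable(1)[OF K] by (rule lebesgue_lborel)
 also have "... <= ?b" using le shadow_image_measure(3)[OF u] by simp
 finally have ab: "?a + ?b <= ?b" .
 have "?b < top" using cyl_lower_bound[OF u] emeasure_cyl_finite[OF u K] shadow_image_measure(3)[OF u] by simp
 hence "?a = 0" using ab by (cases ?a rule: ennreal_cases; cases ?b rule: ennreal_cases) (auto simp: top_unique simp flip: ennreal_plus)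
 hence 0: "(\<integral>\<^sup>+z. ennreal \<bar>det (matrix (%h. shadow_jac (outer u u) z *v h))\<bar> * indicator ?H z \<partial>lborel) = 0"
  using lborel_image[OF HL der inj] by simp
 have "AE z in lborel. ennreal \<bar>det (shadow_jac (outer u u) z)\<bar> * indicator ?H z = 0"
 proof (subst nn_integral_0_iff_AE[symmetric])
  show "(%z. ennreal \<bar>det (shadow_jac (outer u u) z)\<bar> * indicator ?H z) : borel_measurable lborel"
   using shadow_jac_slice_measurable passing_borel by auto
 qed (use 0 in simp)
 thus ?thesis
 proof eventually_elim
  fix z assume "ennreal \<bar>det (shadow_jac (outer u u) z)\<bar> * indicator ?H z = 0"
  thus "z ~: ?H" by (auto simp: indicator_def ennreal_eq_0_iff passing_def split: if_splits)
 qed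
qed

end

context shadow_equality
begin

text \<open>The averages of both sides are caught between equal finite bounds, so the pointwise
  estimate \<open>cyl_lower_bound\<close> cannot be strict with positive probability.\<close>

lemma AE_cyl_le:
 "AE Q in \<nu>. vol (cyl Q K) <= (\<integral>\<^sup>+z. ennreal \<bar>det (shadow_jac Q z)\<bar> * indicator G z \<partial>lborel)"
  (is "AE Q in \<nu>. ?g Q <= ?f Q")
proof (rule ccontr)
 assume n: "~ (AE Q in \<nu>. ?g Q <= ?f Q)"
 have fm: "?f : borel_measurable \<nu>" using lborel.borel_measurable_nn_integral[OF shadow_jac_product_measurable] .
 have gm: "?g : borel_measurable \<nu>" using cyl_measurable(2)[OF K] measurable_cong_sets[OF sets_\<nu> refl] by blast
 have fg: "AE Q in \<nu>. ?f Q <= ?g Q" using rank_one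
 proof eventually_elim
  fix Q :: "real^'n^'n" assume "\<exists>u. norm u = 1 & Q = outer u u"
  thus "?f Q <= ?g Q" using cyl_lower_bound by blast
 qed
 have "(\<integral>\<^sup>+Q. ?f Q \<partial>\<nu>) <= (\<integral>\<^sup>+Q. ?g Q \<partial>\<nu>)" using fg by (rule nn_integral_mono_AE)
 also have "... <= ennreal (CARD('n) * \<kappa>) * vol K" by (rule eq)
 also have "... < \<infinity>" using K_finite by (simp add: ennreal_mult_less_top)
 finally have "(\<integral>\<^sup>+Q. ?f Q \<partial>\<nu>) ~= \<infinity>" by simp
 from nn_integral_less[OF fm gm this fg n] have "(\<integral>\<^sup>+Q. ?f Q \<partial>\<nu>) < (\<integral>\<^sup>+Q. ?g Q \<partial>\<nu>)" .
 also have "... <= ennreal (CARD('n) * \<kappa>) * vol K" by (rule eq)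
 also have "... <= (\<integral>\<^sup>+Q. ?f Q \<partial>\<nu>)" unfolding total_shadow_jac by (rule total_shadow_bound)
 finally show False by simp
qed

lemma AE_passing: "AE z in lborel. AE Q in \<nu>. z ~: passing Q"
proof -
 interpret pair_sigma_finite \<nu> "lborel :: (real^'n) measure" ..
 have s: "sets (\<nu> \<Otimes>\<^sub>M lborel) = sets (borel \<Otimes>\<^sub>M (borel :: (real^'n) measure))"
  by (rule sets_pair_measure_cong[OF sets_\<nu> sets_lborel])
 have sp: "space (\<nu> \<Otimes>\<^sub>M (lborel :: (real^'n) measure)) = UNIV"
  using sets_eq_imp_space_eq[OF s] by (simp add: space_pair_measure)
 have "UNIV - {w. snd w : passing (fst w)} : sets (\<nu> \<Otimes>\<^sub>M lborel)"
  using sets.compl_sets[of "{w. snd w : passing (fst w)}" "\<nu> \<Otimes>\<^sub>M lborel"] passing_product_measurable unfolding s sp by simp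
 hence m: "{w : space (\<nu> \<Otimes>\<^sub>M lborel). snd w ~: passing (fst w)} : sets (\<nu> \<Otimes>\<^sub>M lborel)"
  unfolding sp by (simp add: set_diff_eq)
 have "AE Q in \<nu>. AE z in lborel. z ~: passing Q" using AE_cyl_le rank_one
 proof eventually_elim
  fix Q :: "real^'n^'n"
  assume "vol (cyl Q K) <= (\<integral>\<^sup>+z. ennreal \<bar>det (shadow_jac Q z)\<bar> * indicator G z \<partial>lborel)"
   and "\<exists>u. norm u = 1 & Q = outer u u"
  thus "AE z in lborel. z ~: passing Q" using passing_null by blast
 qed
 thus ?thesis using AE_commute[of "%Q z. z ~: passing Q"] m by simp
qed

lemma K_positive: "0 < vol K"
proof -
 have "ennreal c * vol K ~= 0" using total mass_pos by simp
 thus ?thesis by (auto simp: zero_less_iff_neq_zero)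
qed

text \<open>If \<open>slope z\<close> is nonzero, the part of \<open>K\<close> outside the
  translated kernel has positive volume, and by \<open>directions_hit\<close> the lines through
  \<open>X z\<close> reach it with positive probability. As \<open>z\<close> is almost never
  passing, the Jacobian vanishes for such a direction \<open>u\<close>; then \<open>u\<close> is in
  the kernel of \<open>slope z\<close>, contradicting the choice of the part. Hence
  \<open>slope z = 0\<close>.\<close>

lemma AE_off_G:
 assumes n: "CARD('n) >= 2"
 shows "AE z in lborel. z ~: N --> z ~: G --> JX z = mat 1" using AE_passing
proof eventually_elim
 fix z :: "real^'n"
 assume pass: "AE Q in \<nu>. z ~: passing Q"
 show "z ~: N --> z ~: G --> JX z = mat 1"
 proof (intro impI)
  assume z: "z ~: N" "z ~: G"
  have det: "det (JX z) ~= 0" by (rule det_JX_nonzero[OF z(1)])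
  have XK: "X z ~: K" using z det by (simp add: G_def)
  have nn: "nonneg_matrix (slope z)" by (rule slope_nonneg[OF z(1) det])
  have "slope z = 0"
  proof (rule ccontr)
   assume nz: "slope z ~= 0"
   let ?Z = "{k. slope z *v (k - X z) = 0}"
   have cl: "closed ?Z" by (intro closed_Collect_eq continuous_intros)
   have Z: "?Z : null_sets lborel" using matrix_kernel_negligible[OF nz, of "X z"] cl by (auto simp: neg_null null_sets_def lebesgue_lborel)
   have "vol (K - ?Z) = vol K" using Z K by (intro emeasure_Diff_null_set) (auto simp: borel_compact)
   hence pos: "0 < lvol (K - ?Z)" using K_positive cl K by (subst lebesgue_lborel) (auto simp: borel_compact)
   \<comment> \<open>Inner regularity, used backwards: it provides a compact subset of positive
     volume, as \<open>directions_hit\<close> asks for.\<close>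
   have hit: "~ (\<forall>E. compact E --> E <= K - ?Z --> ennreal 1 * lvol E <= 0)"
   proof
    assume h: "\<forall>E. compact E --> E <= K - ?Z --> ennreal 1 * lvol E <= 0"
    have "ennreal 1 * lvol (K - ?Z) <= 0"
    proof (rule emeasure_le_by_compact[OF _ _ K])
     show "K - ?Z : sets lebesgue" using K cl by (auto simp: borel_compact)
    qed (use h in auto)
    thus False using pos by simp
   qed
   then obtain E where E: "compact E" "E <= K - ?Z" "0 < lvol E" by (auto simp: not_le zero_less_iff_neq_zero)
   define S where "S = (%k. k + - X z) ` E"
   have S: "compact S" unfolding S_def by (intro compact_continuous_image continuous_intros E)
   have "lvol S = lvol E" using emeasure_lebesgue_affine[of 1 "- X z" E] by (simp add: S_def add.commute)
   hence Spos: "0 < vol S" using E(3) borel_compact[OF S] by (simp add: lebesgue_lborel)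
   have "AE Q in \<nu>. \<forall>k\<in>S. k ~= Q *v k" using pass rank_one
   proof eventually_elim
    fix Q :: "real^'n^'n" assume np: "z ~: passing Q" and "\<exists>u. norm u = 1 & Q = outer u u"
    then obtain u where u: "norm u = 1" "Q = outer u u" by blast
    show "\<forall>k\<in>S. k ~= Q *v k"
    proof (rule ballI, rule notI)
     fix k assume k: "k : S" "k = Q *v k"
     then obtain x where x: "x : E" "k = x - X z" by (auto simp: S_def)
     hence "x : K" "slope z *v k ~= 0" using E(2) by auto
     moreover have "x - X z = Q *v (x - X z)" using k(2) x(2) by simp
     ultimately have "det (shadow_jac Q z) = 0" using np z(1) XK by (auto simp: passing_def)
     hence "u .* (slope z *v u) = 0" using det_shadow_jac[OF u(1) det] damp_pos[of "u .* P z"] det unfolding u(2) by simp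
     hence "slope z *v u = 0" by (rule nonneg_matrix_kernel[OF nn])
     hence "slope z *v ((u .* k) *: u) = 0" by (simp add: mv_scaleR)
     moreover have "k = (u .* k) *: u" using k(2) unfolding u(2) by simp
     ultimately show False using \<open>slope z *v k ~= 0\<close> by simp
    qed
   qed
   thus False using directions_hit[OF n S Spos] by blast
  qed
  thus "JX z = mat 1" using slope_JX[OF det] by simp
 qed
qed

end

lemma squash_lipschitz: "\<bar>squash s - squash t\<bar> <= \<bar>s - t\<bar>"
proof -
 have main: "\<bar>squash t - squash s\<bar> <= t - s" if st: "s < t" for s t
 proof -
  obtain \<xi> where \<xi>: "squash t - squash s = (t - s) * damp \<xi> ^ 3" using squash_mean_value[OF st] by blast
  have "0 <= damp \<xi> ^ 3" "damp \<xi> ^ 3 <= 1" using damp_pos[of \<xi>] damp_le_1[of \<xi>] by (auto intro!: power_le_one)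
  thus ?thesis using st unfolding \<xi> by (simp add: abs_mult mult_le_cancel_left1)
 qed
 show ?thesis using main[of s t] main[of t s] by (cases s t rule: linorder_cases) auto
qed

lemma AE_lborel_translate:
 fixes v :: "'a::euclidean_space"
 assumes M: "M : null_sets lborel"
 shows "AE z in lborel. z + v ~: M"
proof -
 have "AE z in distr lborel borel ((+) v). z ~: M" unfolding lborel_distr_plus using M by (simp add: AE_not_in)
 thus ?thesis using M by (subst (asm) AE_distr_iff) (auto simp: add.commute null_sets_def)
qed

lemma AE_continuous_eq:
 fixes f g :: "'a::euclidean_space => real"
 assumes f: "continuous_on UNIV f" and g: "continuous_on UNIV g" and ae: "AE x in lborel. f x = g x"
 shows "f x = g x"
proof (rule ccontr)
 assume "f x ~= g x"
 hence ne: "{x. f x ~= g x} ~= {}" by blast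
 have "open {x. f x ~= g x}" by (intro open_Collect_neq f g)
 hence "~ negligible {x. f x ~= g x}" using ne by (rule open_not_negligible)
 moreover obtain M where "{x : space lborel. f x ~= g x} <= M" "M : null_sets lborel" using ae unfolding eventually_ae_filter by blast
 hence "negligible {x. f x ~= g x}" using negligible_subset[OF null_sets_lborel_negligible] by simp
 ultimately show False by blast
qed

text \<open>If every chord of the image is parallel to the chord of the arguments, then the chord from \<open>z\<close> to \<open>z'\<close> is stretched by the
 same factor as the chord from \<open>z'\<close> to any third point off the line, which contradicts boundedness.\<close>

lemma parallel_chords_constant:
 fixes Y :: "real^'n => real^'n"
 assumes n: "CARD('n) >= 2" and bounded: "!!z. norm (Y z) <= C"
  and chord: "!!z v. \<exists>s. Y (z + v) = Y z + s *: v"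
 shows "Y z = Y z'"
proof (rule ccontr)
 assume ne: "Y z ~= Y z'"
 define e where "e = z' - z"
 obtain s where s: "Y z' = Y z + s *: e" using chord[of z e] by (auto simp: e_def)
 have s0: "s ~= 0" and e0: "e ~= 0" using ne s by auto
 have "dim {e} < DIM(real^'n)" using n dim_le_card'[of "{e}"] by simp
 then obtain v0 where v0: "v0 ~= 0" "!!y. y : span {e} ==> orthogonal v0 y" using orthogonal_to_subspace_exists[of "{e}"] by blast
 define v where "v = v0 /\<^sub>R norm v0"
 have v: "norm v = 1" "v .* e = 0" using v0(1) v0(2)[of e] by (auto simp: v_def span_base orthogonal_def)
 \<comment> \<open>With this length the product of \<open>T\<close> and \<open>s\<close> exceeds in
   absolute value the largest possible oscillation \<open>2 * C\<close>.\<close>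
 define T where "T = (2 * C + 1) / \<bar>s\<bar>"
 obtain a where a: "Y (z + T *: v) = Y z + a *: T *: v" using chord[of z "T *: v"] by blast
 obtain b where b: "Y (z' + (T *: v - e)) = Y z' + b *: (T *: v - e)" using chord[of z' "T *: v - e"] by blast
 have "z' + (T *: v - e) = z + T *: v" by (simp add: e_def)
 hence "Y z + a *: T *: v = Y z + s *: e + b *: (T *: v - e)" by (metis a b s)
 hence "e .* (a *: T *: v) = e .* (s *: e + b *: (T *: v - e))" by (simp add: add.assoc)
 hence "(s - b) * (e .* e) = 0" using v(2) by (auto simp: iar idr icomm[of e v] alg)
 hence "b = s" using e0 by auto
 have "v .* (Y (z' + (T *: v - e)) - Y z') = s * T" unfolding b \<open>b = s\<close> using v by (simp add: idr norm_eq_1)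
 moreover have "\<bar>v .* (Y (z' + (T *: v - e)) - Y z')\<bar> <= norm (Y (z' + (T *: v - e)) - Y z')"
  using CS_ineq[of v "Y (z' + (T *: v - e)) - Y z'"] v(1) by simp
 moreover have "norm (Y (z' + (T *: v - e)) - Y z') <= 2 * C"
  using norm_triangle_ineq4[of "Y (z' + (T *: v - e))" "Y z'"] bounded[of "z' + (T *: v - e)"] bounded[of z'] by linarith
 moreover have "\<bar>s * T\<bar> = \<bar>2 * C + 1\<bar>" using s0 by (simp add: T_def abs_mult)
 ultimately show False by linarith
qed

context hyperplane_distribution
begin

lemma S0_lipschitz: "norm (S0 q - S0 p) <= norm (q - p)"
proof -
 let ?f = "%Q. damp (norm (Q *v q)) *: (Q *v q) - damp (norm (Q *v p)) *: (Q *v p)"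
 have "S0 q - S0 p = (\<integral>Q. ?f Q \<partial>\<nu>)"
  unfolding S0_def by (rule Bochner_Integration.integral_diff[OF integrable_S0 integrable_S0, symmetric])
 also have "norm ... <= norm (q - p)"
 proof (rule norm_integral_le)
  show "integrable \<nu> ?f" by (intro Bochner_Integration.integrable_diff integrable_S0)
  show "AE Q in \<nu>. norm (?f Q) <= norm (q - p)"
  proof (rule AE_rank_one)
   fix Q :: "real^'n^'n" and u assume u: "norm u = 1" "Q = outer u u"
   have "norm (?f Q) = \<bar>squash (u .* q) - squash (u .* p)\<bar>"
    unfolding u(2) outer_values(2)[OF u(1)] using u(1) by (simp flip: scaleR_diff_left)
   also have "... <= \<bar>u .* q - u .* p\<bar>" by (rule squash_lipschitz)
   also have "... <= norm (q - p)" using CS_ineq[of u "q - p"] u(1) by (simp add: idr)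
   finally show "norm (?f Q) <= norm (q - p)" .
  qed
 qed
 finally show ?thesis .
qed

end

section \<open>Constancy of the difference of \<open>S0 (P z)\<close> and
  \<open>\<kappa> *: X z\<close>\<close>

context shadow_equality
begin

definition Y :: "real^'n => real^'n" where
 "Y z = S0 (P z) - \<kappa> *: X z"

lemma Y_lipschitz: "norm (Y z - Y z') <= (1 + \<kappa>) * norm (z - z')"
proof -
 have "norm (Y z - Y z') = norm ((S0 (P z) - S0 (P z')) - \<kappa> *: (X z - X z'))" by (simp add: Y_def alg)
 also have "... <= norm (S0 (P z) - S0 (P z')) + norm (\<kappa> *: (X z - X z'))" by (rule norm_triangle_ineq4)
 also have "... <= norm (z - z') + \<kappa> * norm (z - z')"
  using order_trans[OF S0_lipschitz[of "P z" "P z'"] P_lipschitz[of z z']] X_lipschitz[of z z'] \<kappa>(1) by (intro add_mono) auto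
 finally show ?thesis by (simp add: alg)
qed

lemma Y_continuous: "continuous_on A Y"
 by (rule lip_cont[of "1 + \<kappa>"], rule lipschitz_onI) (use Y_lipschitz \<kappa>(1) in \<open>auto simp: dist_norm\<close>)

text \<open>A scalar multiple of the identity in both cases, with factor 0 on \<open>aligned\<close>
  and \<open>- \<kappa>\<close> where \<open>JX z = mat 1\<close>.\<close>

lemma Y_derivative:
 assumes z: "z ~: N" and al: "z : aligned \<or> JX z = mat 1"
 obtains a where "(Y has_derivative (%h. a *: h)) (at z)"
proof -
 have dX: "(X has_derivative (%h. JX z *v h)) (at z)" by (rule N_derivative[OF z])
 have dS: "((%z. S0 (P z)) has_derivative (%h. DS (P z) *v ((mat 1 - JX z) *v h))) (at z)"
  using has_derivative_in_compose[OF P_derivative[OF dX] S0_derivative] .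
 have dY: "(Y has_derivative (%h. DS (P z) *v ((mat 1 - JX z) *v h) - \<kappa> *: (JX z *v h))) (at z)"
  unfolding Y_def[abs_def] by (intro has_derivative_diff dS has_derivative_scaleR_right dX)
 from al show thesis
 proof
  assume "z : aligned"
  hence "(DS (P z) ** (mat 1 - JX z)) *v h = (\<kappa> *: JX z) *v h" for h by (simp add: aligned_def)
  hence "(%h. DS (P z) *v ((mat 1 - JX z) *v h) - \<kappa> *: (JX z *v h)) = (%h. 0 *: h)" by (simp add: mv_assoc mv_scale)
  thus thesis using dY that by metis
 next
  assume "JX z = mat 1"
  hence "(%h. DS (P z) *v ((mat 1 - JX z) *v h) - \<kappa> *: (JX z *v h)) = (%h. (- \<kappa>) *: h)" by simp
  thus thesis using dY that by metis
 qed
qed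

text \<open>The factor in the derivative may jump between its two values, so integrating the whole
  derivative gives nothing. Its component orthogonal to the direction of motion is 0 in either case.
  By Fubini this holds almost everywhere on almost every line, the Lipschitz property gives
  constancy there, and continuity reaches the remaining lines.\<close>

lemma Y_orthogonal_constant:
 assumes n: "CARD('n) >= 2" and wv: "w .* v = 0"
 shows "w .* Y (z + v) = w .* Y z"
proof -
 have "AE z in lborel. z ~: N" using N by (rule AE_not_in)
 hence "AE z in lborel. z ~: N & (z : aligned \<or> JX z = mat 1)" using AE_aligned AE_off_G[OF n] by eventually_elim blast
 then obtain M where M: "{z : space lborel. ~ (z ~: N & (z : aligned \<or> JX z = mat 1))} <= M" "M : null_sets lborel"
  unfolding eventually_ae_filter by blast
 have good: "z ~: N & (z : aligned \<or> JX z = mat 1)" if "z ~: M" for z using M(1) that by auto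
 have "AE z in lborel. AE t in (lborel :: real measure). z + t *: v ~: M"
 proof (subst lborel_pair.AE_commute)
  show "AE t in lborel. AE z in (lborel :: (real^'n) measure). z + t *: v ~: M" using AE_lborel_translate[OF M(2)] by simp
  have "continuous_on UNIV (%y :: (real^'n) \<times> real. fst y + snd y *: v)" by (intro continuous_intros)
  hence "(%y :: (real^'n) \<times> real. fst y + snd y *: v) : borel \<rightarrow>\<^sub>M borel" by (rule cont_borel)
  moreover have "- M : sets borel" using M(2) by auto
  ultimately have "(%y :: (real^'n) \<times> real. fst y + snd y *: v) -` (- M) Int space borel : sets borel" by (rule measurable_sets)
  thus "{y : space (lborel \<Otimes>\<^sub>M lborel). fst y + snd y *: v ~: M} : sets (lborel \<Otimes>\<^sub>M lborel)"
   unfolding lborel_prod by (simp add: vimage_def)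
 qed
 hence "AE z in lborel. w .* Y (z + v) = w .* Y z"
 proof eventually_elim
  fix z :: "real^'n"
  assume t: "AE t in (lborel :: real measure). z + t *: v ~: M"
  then obtain T where T: "{t : space lborel. ~ z + t *: v ~: M} <= T" "T : null_sets lborel" unfolding eventually_ae_filter by blast
  let ?g = "%t. w .* Y (z + t *: v)"
  have "?g 1 = ?g 0"
  proof (rule Lipschitz_zero_derivative_constant[where g = ?g and a = 1 and b = 0])
   show "negligible T" using T(2) by (rule null_sets_lborel_negligible)
   show "(norm w * (1 + \<kappa>) * norm v)-lipschitz_on UNIV ?g"
   proof (rule lipschitz_onI)
    fix s t :: real
    have "dist (?g s) (?g t) = \<bar>w .* (Y (z + s *: v) - Y (z + t *: v))\<bar>" by (simp add: dist_real_def idr)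
    also have "... <= norm w * norm (Y (z + s *: v) - Y (z + t *: v))" by (rule CS_ineq)
    also have "... <= norm w * ((1 + \<kappa>) * norm ((z + s *: v) - (z + t *: v)))" by (intro mult_left_mono Y_lipschitz) simp
    also have "(z + s *: v) - (z + t *: v) = (s - t) *: v" by (simp add: alg)
    finally show "dist (?g s) (?g t) <= norm w * (1 + \<kappa>) * norm v * dist s t" by (simp add: dist_real_def mult_ac)
   qed (use \<kappa>(1) in simp)
   fix t assume "t ~: T"
   hence "z + t *: v ~: M" using T(1) by auto
   from good[OF this] obtain a where a: "(Y has_derivative (%h. a *: h)) (at (z + t *: v))" using Y_derivative by blast
   have l: "((%t. z + t *: v) has_derivative (%h. h *: v)) (at t)" by (auto intro!: derivative_eq_intros)
   have "((%t. Y (z + t *: v)) has_derivative (%h. a *: (h *: v))) (at t)" by (rule has_derivative_compose[OF l a])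
   from has_derivative_inner_right[OF this, of w]
   show "(?g has_real_derivative 0) (at t)" by (simp add: has_field_derivative_def wv lambda_zero)
  qed
  thus "w .* Y (z + v) = w .* Y z" by simp
 qed
 thus ?thesis by (intro AE_continuous_eq continuous_intros continuous_on_compose2[OF Y_continuous[of UNIV]]) auto
qed

lemma X_in_ball:
 assumes n: "CARD('n) >= 2"
 obtains a where "!!z. X z : cball a (radius / \<kappa>)"
proof
 have const: "Y z = Y 0" for z
 proof (rule parallel_chords_constant[OF n, where Y = Y and C = "radius + \<kappa> * R"])
  fix z
  have "norm (Y z) <= norm (S0 (P z)) + norm (\<kappa> *: X z)" unfolding Y_def by (rule norm_triangle_ineq4)
  also have "... <= radius + \<kappa> * R" using norm_S0_le[of "P z"] X_bounded[of z] \<kappa>(1) by (intro add_mono) auto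
  finally show "norm (Y z) <= radius + \<kappa> * R" .
 next
  fix z v
  show "\<exists>s. Y (z + v) = Y z + s *: v"
  proof (cases "v = 0")
   case False
   define d where "d = Y (z + v) - Y z"
   \<comment> \<open>Removing the part of \<open>d\<close> along \<open>v\<close> leaves a vector
     orthogonal to \<open>v\<close> and, by \<open>Y_orthogonal_constant\<close>, also to
     \<open>d\<close>; hence it is 0.\<close>
   define s where "s = (d .* v) / (v .* v)"
   have "(d - s *: v) .* v = 0" using False by (simp add: idl s_def)
   moreover from Y_orthogonal_constant[OF n this, of z] have "(d - s *: v) .* d = 0" by (simp add: d_def idr)
   ultimately have "(d - s *: v) .* (d - s *: v) = 0" unfolding idr[of "d - s *: v" d] by simp
   hence "d = s *: v" by simp
   thus ?thesis by (auto simp: d_def alg)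
  qed simp
 qed
 fix z
 have "S0 (P z) - \<kappa> *: X z = Y 0" using const[of z] by (simp add: Y_def)
 hence "\<kappa> *: X z = S0 (P z) - Y 0" by (simp add: alg)
 hence "inverse \<kappa> *: \<kappa> *: X z = inverse \<kappa> *: (S0 (P z) - Y 0)" by (simp only:)
 hence "X z = inverse \<kappa> *: (S0 (P z) - Y 0)" using \<kappa>(1) by simp
 hence "norm (X z - - (inverse \<kappa> *: Y 0)) = norm (S0 (P z)) / \<kappa>"
  using \<kappa>(1) by (simp add: scaleR_diff_right divide_inverse)
 also have "... <= radius / \<kappa>" using norm_S0_le \<kappa>(1) by (intro divide_right_mono) auto
 finally show "X z : cball (- (inverse \<kappa> *: Y 0)) (radius / \<kappa>)" by (simp add: dist_norm norm_minus_commute)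
qed

end

section \<open>Comparison with the ball\<close>

context hyperplane_distribution
begin

lemma shadow_transport_exists:
 assumes K: "compact K" "0 < measure lborel K"
 obtains \<psi> R where "shadow_transport \<nu> \<psi> R K (enn2real mass / measure lborel K)"
proof -
 define c where "c = enn2real mass / measure lborel K"
 define \<omega> where "\<omega> = density lborel (%p. ennreal (det (DS p)))"
 have dm: "(%p. ennreal (det (DS p))) : borel_measurable lborel" using cont_borel[OF continuous_on_det[OF DS_continuous]] by simp
 have em: "emeasure \<omega> A = (\<integral>\<^sup>+p. ennreal (det (DS p)) * indicator A p \<partial>lborel)" if "A : sets borel" for A
  unfolding \<omega>_def using that dm by (simp add: emeasure_density)
 have tot: "emeasure \<omega> UNIV = mass" using em[of UNIV] by (simp add: mass_def)
 have "space \<omega> = UNIV" by (simp add: \<omega>_def)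
 interpret \<omega>: finite_measure \<omega>
  by (rule finite_measureI) (use mass_finite in \<open>simp add: \<open>space \<omega> = UNIV\<close> tot\<close>)
 interpret \<omega>: transport_source \<omega>
 proof
  show "sets \<omega> = sets borel" by (simp add: \<omega>_def)
  show "M : null_sets \<omega>" if "M : null_sets lborel" for M
   using that dm AE_not_in[OF that] unfolding \<omega>_def by (subst null_sets_density_iff) auto
 qed
 have W: "0 < enn2real mass" using mass_pos mass_finite by (simp add: enn2real_positive_iff)
 have c: "c > 0" "c * measure lborel K = measure \<omega> UNIV" using W K(2) by (auto simp: c_def measure_def tot)
 obtain \<psi> R where \<psi>: "convex_on UNIV \<psi>" "R-lipschitz_on UNIV \<psi>"
  "!!E. compact E ==> E <= K ==> {p. E Int subdiff \<psi> p ~= {}} : sets borel &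
   c * measure lborel E <= measure \<omega> {p. E Int subdiff \<psi> p ~= {}}"
  using \<omega>.transport_potential_exists[OF K(1) c K(2)] by blast
 have "shadow_transport \<nu> \<psi> R K c"
 proof (rule shadow_transport.intro)
  show "hyperplane_distribution \<nu>" by (rule hyperplane_distribution_axioms)
  show "prox \<psi> R" using \<psi>(1,2) by unfold_locales
  fix E assume E: "compact E" "E <= K"
  have "ennreal c * vol E = ennreal (c * measure lborel E)"
   using c(1) emeasure_compact_finite[OF E(1)] by (simp add: ennreal_mult emeasure_eq_ennreal_measure)
  also have "... <= emeasure \<omega> {p. E Int subdiff \<psi> p ~= {}}"
   using \<psi>(3)[OF E] by (simp add: \<omega>.emeasure_eq_measure ennreal_leI)
  also have "... = (\<integral>\<^sup>+p. ennreal (det (DS p)) * indicator {p. E Int subdiff \<psi> p ~= {}} p \<partial>lborel)"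
   using \<psi>(3)[OF E] by (intro em) simp
  finally show "ennreal c * vol E <= (\<integral>\<^sup>+p. ennreal (det (DS p)) * indicator {p. E Int subdiff \<psi> p ~= {}} p \<partial>lborel)" .
 qed (use K(1) c(1) in auto)
 thus thesis unfolding c_def by (rule that)
qed

text \<open>With \<open>W = \<kappa> ^ CARD('n) * k\<close> the lower bound for the shadow of
  \<open>K\<close> and the upper bound for the ball combine to
  \<open>radius <= \<kappa> * r\<close>. As the image of \<open>S0\<close> lies in the ball of this
  radius, \<open>W\<close> is at most the volume of that ball, and dividing by the power of
  \<open>\<kappa>\<close> gives the inequality.\<close>

theorem shadow_isoperimetric:
 assumes n: "CARD('n) >= 2" and cpt: "compact K" and vol: "0 < measure lborel K" and r: "r > 0"
  and le: "(\<integral>\<^sup>+Q. vol (cyl Q K) \<partial>\<nu>) <= (\<integral>\<^sup>+Q. vol (cyl Q (cball a r)) \<partial>\<nu>)"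
 shows "measure lborel K <= measure lborel (cball a r)"
  and "measure lborel K = measure lborel (cball a r) ==> \<exists>a'. cball a' r <= K & vol (K - cball a' r) = 0"
proof -
 define k W c where "k = measure lborel K" and "W = enn2real mass" and "c = W / k"
 obtain \<psi> R where T: "shadow_transport \<nu> \<psi> R K c" using shadow_transport_exists[OF cpt vol] unfolding c_def W_def k_def .
 interpret shadow_transport \<nu> \<psi> R K c by (rule T)
 have k: "0 < k" "vol K = ennreal k" using vol emeasure_compact_finite[OF cpt] by (simp_all add: k_def emeasure_eq_ennreal_measure)
 have W: "mass = ennreal W" "0 < W" using mass_pos mass_finite by (auto simp: W_def enn2real_positive_iff)
 have Wk: "W = \<kappa> ^ CARD('n) * k" using k unfolding \<kappa>(2) by (simp add: c_def)
 let ?n = "CARD('n)" and ?s = "(r / radius) ^ (CARD('n) - 1)"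
 have pos: "0 < radius" "0 < r" "0 < \<kappa>" "0 < k" "0 < W" using radius_pos r \<kappa>(1) k(1) W(2) by auto
 have split: "x ^ ?n = x ^ (?n - 1) * x" for x :: real using power_minus_mult[of ?n x] by simp
 have upper: "(\<integral>\<^sup>+Q. vol (cyl Q K) \<partial>\<nu>) <= ennreal (?s * (?n * W))"
  using order_trans[OF le ball_shadow[OF r]] pos by (simp add: W(1) ennreal_mult ennreal_of_nat_eq_real_of_nat)
 have "ennreal (?n * \<kappa> * k) <= ennreal (?s * (?n * W))" using order_trans[OF shadow_bound upper] pos by (simp add: k(2) ennreal_mult)
 hence "?n * \<kappa> * k <= ?s * (?n * W)" using pos by (subst (asm) ennreal_le_iff) auto
 hence "?n * (\<kappa> * k) * 1 <= ?n * (\<kappa> * k) * (r * \<kappa> / radius) ^ (?n - 1)"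
  unfolding Wk split[of \<kappa>] by (simp add: power_mult_distrib power_divide mult_ac)
 hence "1 ^ (?n - 1) <= (r * \<kappa> / radius) ^ (?n - 1)" using pos by (subst (asm) mult_le_cancel_left_pos) auto
 moreover have "(r * \<kappa> / radius) ^ (?n - 1) < 1 ^ (?n - 1)" if "r * \<kappa> / radius < 1"
  using that n pos by (intro power_strict_mono) auto
 ultimately have "1 <= r * \<kappa> / radius" by (meson linorder_not_le)
 hence kr: "radius <= \<kappa> * r" using pos by (simp add: field_simps)
 let ?v = "unit_ball_vol (real ?n)"
 have ball: "measure lborel (cball b s) = ?v * s ^ ?n" if "0 <= s" for b :: "real^'n" and s using content_cball[OF that, of b] by simp
 have v: "0 < ?v" by (rule unit_ball_vol_pos) simp
 have Wb: "W <= ?v * radius ^ ?n"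
 proof -
  have "ennreal W <= vol (cball (0 :: real^'n) radius)" using mass_le unfolding W(1) .
  also have "... = ennreal (?v * radius ^ ?n)"
   using emeasure_lborel_cball_finite[of "0 :: real^'n" radius] ball[of radius 0] pos by (simp add: emeasure_eq_ennreal_measure)
  finally show ?thesis using pos v by (subst (asm) ennreal_le_iff) auto
 qed
 have "radius ^ ?n <= (\<kappa> * r) ^ ?n" using kr pos by (intro power_mono) auto
 hence "\<kappa> ^ ?n * k <= ?v * (\<kappa> * r) ^ ?n" using Wb v unfolding Wk[symmetric] by (meson mult_left_mono less_imp_le order_trans)
 hence "\<kappa> ^ ?n * k <= \<kappa> ^ ?n * (?v * r ^ ?n)" by (simp add: power_mult_distrib mult_ac)
 hence "k <= ?v * r ^ ?n" using pos by (subst (asm) mult_le_cancel_left_pos) auto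
 thus "measure lborel K <= measure lborel (cball a r)" using r ball[of r a] by (simp add: k_def)

 assume "measure lborel K = measure lborel (cball a r)"
 \<comment> \<open>Equal volumes reverse the last estimate and give
   \<open>radius = \<kappa> * r\<close>. Then the upper bound for the shadow coincides with the
   lower one, which is the hypothesis of the equality case.\<close>
 hence kv: "k = ?v * r ^ ?n" using r ball[of r a] by (simp add: k_def)
 hence "?v * (\<kappa> * r) ^ ?n <= ?v * radius ^ ?n" using Wb unfolding Wk by (simp add: power_mult_distrib mult_ac)
 hence "(\<kappa> * r) ^ ?n <= radius ^ ?n" using v by (subst (asm) mult_le_cancel_left_pos) auto
 hence "\<kappa> * r <= radius" using pos by (subst (asm) power_mono_iff) auto
 hence \<kappa>r: "radius = \<kappa> * r" using kr by simp
 hence rr: "radius / \<kappa> = r" "r / radius = 1 / \<kappa>" using pos by auto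
 have "shadow_equality \<nu> \<psi> R K c"
 proof (rule shadow_equality.intro)
  show "shadow_transport \<nu> \<psi> R K c" by (rule T)
  show "ennreal c * vol K = mass" using k W by (simp add: c_def flip: ennreal_mult)
  have "?s * (?n * W) = ?n * \<kappa> * k" unfolding rr Wk split[of \<kappa>] using pos by (simp add: power_divide)
  moreover have "ennreal (?n * \<kappa> * k) = ennreal (?n * root ?n c) * vol K" using pos by (simp add: k(2) ennreal_mult \<kappa>_def)
  ultimately show "(\<integral>\<^sup>+Q. vol (cyl Q K) \<partial>\<nu>) <= ennreal (?n * root ?n c) * vol K" using upper by (simp only:)
 qed
 then interpret E: shadow_equality \<nu> \<psi> R K c .
 obtain a' where a': "!!z. X z : cball a' r" using E.X_in_ball[OF n] unfolding rr by blast
 let ?B = "cball a' r"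
 have KB: "K : sets borel" using cpt by (rule borel_compact)
 have null: "vol (K - ?B) = 0"
 proof -
  have "K - ?B <= K - X ` G" using a' by auto
  moreover have "K - X ` G : null_sets lebesgue"
   using K_minus_image_null KB X_image_measure(1)[OF G_borel order.refl] by (intro null_setsI sets.Diff) auto
  ultimately have "K - ?B : null_sets lebesgue" by (rule null_sets_completion_subset)
  thus ?thesis using KB by (simp add: null_sets_def lebesgue_lborel)
 qed
 have eq: "vol K = vol ?B"
  unfolding k(2) using emeasure_lborel_cball_finite[of a' r] ball[of r a'] r by (simp add: kv emeasure_eq_ennreal_measure)
 have "K - ?B : null_sets lborel" using null KB by (simp add: null_sets_def)
 hence "vol ((K Int ?B) Un (K - ?B)) = vol (K Int ?B)" using KB by (intro emeasure_Un_null_set) auto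
 hence "vol (K Int ?B) = vol ?B" by (simp add: Int_Diff_Un eq)
 moreover have "?B - K = ?B - K Int ?B" by blast
 ultimately have 0: "vol (?B - K) = 0" using emeasure_Diff[of lborel "K Int ?B" ?B] KB emeasure_lborel_cball_finite[of a' r] by simp
 \<comment> \<open>An open null set is empty. Since \<open>K\<close> is closed, it contains the
   closed ball too.\<close>
 have "ball a' r - K = {}"
 proof (rule ccontr)
  assume "ball a' r - K ~= {}"
  moreover have "open (ball a' r - K)" using cpt by (intro open_Diff) (auto simp: compact_imp_closed)
  ultimately have "~ negligible (ball a' r - K)" using open_not_negligible by blast
  moreover have "?B - K : null_sets lborel" using 0 KB by (auto simp: null_sets_def)
  hence "negligible (ball a' r - K)" by (rule negligible_subset[OF null_sets_lborel_negligible]) auto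
  ultimately show False by blast
 qed
 hence "closure (ball a' r) <= K" using cpt by (intro closure_minimal) (auto simp: compact_imp_closed)
 thus "\<exists>a'. cball a' r <= K & vol (K - cball a' r) = 0" using null r by (auto simp: closure_ball)
qed

end

theorem theorem1p1:
  fixes K B :: "(real ^ 'n) set" and a :: "real ^ 'n" and r :: real
  assumes "CARD('n) \<ge> 2"
    and "compact K"
    and "r > 0" and "B = cball a r"
    and "fav (CARD('n) - 1) K = fav (CARD('n) - 1) B"
  shows "hausdorff_measure (CARD('n)) K \<le> hausdorff_measure (CARD('n)) B \<and>
    (hausdorff_measure (CARD('n)) K = hausdorff_measure (CARD('n)) B \<longrightarrow>
       (\<exists>B'. B' \<subseteq> K \<and> congruent_sets B' B \<and> hausdorff_measure (CARD('n)) (K - B') = 0))"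
proof -
 obtain \<nu> :: "(real^'n^'n) measure" where \<nu>: "hyperplane_distribution \<nu>"
  and cyl: "!!K. compact K ==> 2 * fav (CARD('n) - 1) K = (\<integral>\<^sup>+Q. vol (cyl Q K) \<partial>\<nu>)"
  by (rule fav_cylinders[OF assms(1)]) (rule that, rule hyperplane_distribution.intro)
 interpret hyperplane_distribution \<nu> by (rule \<nu>)
 have B: "compact B" using assms(4) by simp
 have hausdorff: "hausdorff_measure CARD('n) E = ennreal (measure lborel E)" if "compact E" for E :: "(real^'n) set"
  using hausdorff_measure_compact[OF that] emeasure_compact_finite[OF that] by (simp add: emeasure_eq_ennreal_measure)
 have shadows: "(\<integral>\<^sup>+Q. vol (cyl Q K) \<partial>\<nu>) <= (\<integral>\<^sup>+Q. vol (cyl Q (cball a r)) \<partial>\<nu>)"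
  using cyl[OF assms(2)] cyl[OF B] assms(4,5) by simp
 have posB: "0 < measure lborel B" using content_cball_pos[OF assms(3), of a] assms(4) by simp
 show ?thesis
 proof (cases "measure lborel K = 0")
  \<comment> \<open>The transport needs a target of positive volume. Here the inequality is trivial,
    and equality is impossible because the ball has positive volume.\<close>
  case True
  thus ?thesis using posB by (simp add: hausdorff assms(2) B)
 next
  case False
  hence "0 < measure lborel K" by (simp add: zero_less_measure_iff)
  note iso = shadow_isoperimetric[OF assms(1,2) this assms(3) shadows, folded assms(4)]
  have "\<exists>B'. B' <= K & congruent_sets B' B & hausdorff_measure (CARD('n)) (K - B') = 0"
   if "hausdorff_measure CARD('n) K = hausdorff_measure CARD('n) B"
  proof -
   from that have "measure lborel K = measure lborel B" by (simp add: hausdorff assms(2) B)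
   then obtain a' where a': "cball a' r <= K" "vol (K - cball a' r) = 0" using iso(2) by blast
   have "(+) (a - a') ` cball a' r = B" unfolding cball_translation[symmetric] by (simp add: assms(4))
   hence "congruent_sets (cball a' r) B" unfolding congruent_sets_def by (intro exI[of _ "(+) (a - a')"]) simp
   thus ?thesis using a' hausdorff_measure_diff_null[OF assms(2) closed_cball a'(2)] by auto
  qed
  thus ?thesis using iso(1) by (simp add: hausdorff assms(2) B ennreal_leI)
 qed
qed

end
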